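(* Suppose $U$ is a finite range translation-invariant interaction on $\mathbb{Z}^d$, $d\ge2$. Then there exists $\beta_1>0$ such that for every $0<\beta\le\beta_1$ there exists a unique Gibbs measure $\mathbb{P}_\beta$ with interaction $\beta U$, and, provided that the map $q\mapsto P((1-q)\beta U)$ is $C^1$ on $[-1,\infty)$, the following holds. For all $u\ge0$, $$\lim_{n\to\infty}\frac{1}{n^d}\log\,(\mathbb{P}_\beta\times\mathbb{P}_\beta)\left(\frac{\log\mathbf{w}_n^d}{n^d}\ge s(\mathbb{P}_\beta)+u\right)=\inf_{q>-1}\left\{-(s(\mathbb{P}_\beta)+u)q+\mathcal{W}(q)\right\},$$ and for all $u\in(0,u_0)$, where $u_0=\left|\lim_{q\downarrow-1}\mathcal{W}'(q)-s(\mathbb{P}_\beta)\right|$, $$\lim_{n\to\infty}\frac{1}{n^d}\log\,(\mathbb{P}_\beta\times\mathbb{P}_\beta)\left(\frac{\log\mathbf{w}_n^d}{n^d}\le s(\mathbb{P}_\beta)-u\right)=\inf_{q>-1}\left\{-(s(\mathbb{P}_\beta)-u)q+\mathcal{W}(q)\right\}.$$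
   Context: Setting. $\mathcal{A}$ is a finite set, $\Omega=\mathcal{A}^{\mathbb{Z}^d}$ with the product topology and its Borel sigma-field, $\mathcal{S}$ is the set of (nonempty) finite subsets of $\mathbb{Z}^d$, $|\mathbf{x}|=\sum_i|x_i|$, $\sigma_V$ is the restriction of $\sigma$ to $V$, $\Omega_V=\mathcal{A}^V$, $(\tau_{\mathbf{x}}\sigma)(\mathbf{y})=\sigma(\mathbf{x}+\mathbf{y})$, $C_n=[0,n]^d\cap\mathbb{Z}^d$, and $\mathcal{C}(A_n)=\{\sigma:\sigma_{C_n}=A_n\}$ for $A_n\in\Omega_{C_n}$. Waiting time: for $\xi,\sigma\in\Omega$, $\mathbf{w}_n(\xi,\sigma)$ is the minimal $k\in\mathbb{N}$ such that there is $\mathbf{x}\in\mathbb{Z}_+^d$ with $|\mathbf{x}|>0$, $0\le x_i\le k$ for all $i$, and $(\tau_{\mathbf{x}}\sigma)_{C_n}=\xi_{C_n}$. Here $(\xi,\sigma)$ is distributed according to $\mathbb{P}_\beta\times\mathbb{P}_\beta$. Interactions and Gibbs measures. A translation-invariant interaction is $U:\mathcal{S}\times\Omega\to\mathbb{R}$ such that $U(A,\sigma)$ depends only on $\sigma_A$, $U(A+\mathbf{x},\tau_{-\mathbf{x}}\sigma)=U(A,\sigma)$, and $\sum_{A\ni 0}\sup_\sigma|U(A,\sigma)|<\infty$. It is finite range if there is $R>0$ with $U(A,\cdot)=0$ whenever $\mathrm{diam}(A)>R$. Put $H^\zeta_\Lambda(\sigma)=\sum_{A\cap\Lambda\ne\emptyset}U(A,\sigma_\Lambda\zeta_{\Lambda^c})$.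 A Gibbs measure with interaction $U$ is a translation-invariant probability measure $\mathbb{P}$ on $\Omega$ such that for every $\Lambda\in\mathcal{S}$ the conditional distribution of $\sigma_\Lambda$ given $\sigma_{\Lambda^c}=\zeta_{\Lambda^c}$ is, for $\mathbb{P}$-a.e. $\zeta$, proportional to $e^{-H^\zeta_\Lambda(\sigma)}$. Entropy, pressure and $\mathcal{W}$. $s(\mathbb{P})=\lim_{n\to\infty}-\frac{1}{n^d}\sum_{A_n\in\Omega_{C_n}}\mathbb{P}(\mathcal{C}(A_n))\log\mathbb{P}(\mathcal{C}(A_n))$; $P(U)=\lim_{n\to\infty}\frac{1}{n^d}\log\sum_{\sigma_{C_n}\in\Omega_{C_n}}\exp\left(-\sum_{A\subset C_n}U(A,\sigma)\right)$; and $\mathcal{W}(q)=\lim_{n\to\infty}\frac{1}{n^d}\log\int\mathbf{w}_n^{qd}\,d(\mathbb{P}_\beta\times\mathbb{P}_\beta)$, which for $q\ge-1$ equals $P((1-q)\beta U)+(q-1)P(\beta U)$. *)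

theory Defs
  imports "HOL-Probability.Probability"
begin

text \<open>The dimension is \<open>d = CARD('d)\<close>, the lattice is \<open>int ^ 'd\<close>, and the alphabet is the universe
  of a (nonempty) finite type \<open>'a\<close>.\<close>

type_synonym ('d, 'a) config = "int ^ 'd \<Rightarrow> 'a"

type_synonym ('d, 'a) interaction = "(int ^ 'd) set \<Rightarrow> ('d, 'a) config \<Rightarrow> real"

definition config_space :: "('d::finite, 'a::finite) config measure" where
  "config_space =
     sigma UNIV {S. openin (product_topology (\<lambda>_. discrete_topology UNIV) UNIV) S}"

definition finite_subsets :: "(int ^ 'd::finite) set set" where
  "finite_subsets = {A. finite A \<and> A \<noteq> {}}"

definition norm1 :: "int ^ 'd::finite \<Rightarrow> int" where
  "norm1 x = (\<Sum>i\<in>UNIV. \<bar>x $ i\<bar>)"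

definition diam :: "(int ^ 'd::finite) set \<Rightarrow> int" where
  "diam A = Max {norm1 (x - y) | x y. x \<in> A \<and> y \<in> A}"

definition shift :: "int ^ 'd::finite \<Rightarrow> ('d, 'a) config \<Rightarrow> ('d, 'a) config" where
  "shift x \<sigma> = (\<lambda>y. \<sigma> (x + y))"

definition cube :: "nat \<Rightarrow> (int ^ 'd::finite) set" where
  "cube n = {x. \<forall>i. 0 \<le> x $ i \<and> x $ i \<le> int n}"

text \<open>Patterns on \<open>V\<close> are extensional functions; since these are total functions, an interaction
  can be evaluated on them directly.\<close>

definition patterns :: "(int ^ 'd::finite) set \<Rightarrow> ('d, 'a::finite) config set" where
  "patterns V = (V \<rightarrow>\<^sub>E UNIV)"

definition cylinder :: "(int ^ 'd::finite) set \<Rightarrow> ('d, 'a::finite) config \<Rightarrow> ('d, 'a) config set" where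
  "cylinder V \<eta> = {\<sigma>. restrict \<sigma> V = \<eta>}"

text \<open>The value \<open>\<infinity>\<close> is taken when the pattern of \<open>\<xi>\<close> on the cube does not occur in \<open>\<sigma>\<close>.\<close>

definition waiting_time ::
    "nat \<Rightarrow> ('d::finite, 'a::finite) config \<Rightarrow> ('d, 'a) config \<Rightarrow> enat" where
  "waiting_time n \<xi> \<sigma> = Inf {enat k | k. \<exists>x. norm1 x > 0 \<and> (\<forall>i. 0 \<le> x $ i \<and> x $ i \<le> int k) \<and>
     restrict (shift x \<sigma>) (cube n) = restrict \<xi> (cube n)}"

definition interaction :: "('d::finite, 'a::finite) interaction \<Rightarrow> bool" where
  "interaction U \<longleftrightarrow>
     (\<forall>A\<in>finite_subsets. \<forall>\<sigma> \<sigma>'. restrict \<sigma> A = restrict \<sigma>' A \<longrightarrow> U A \<sigma> = U A \<sigma>') \<and>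
     (\<forall>A\<in>finite_subsets. \<forall>x \<sigma>. U ((\<lambda>a. a + x) ` A) (shift (- x) \<sigma>) = U A \<sigma>) \<and>
     (\<lambda>A. SUP \<sigma>. \<bar>U A \<sigma>\<bar>) summable_on {A \<in> finite_subsets. 0 \<in> A}"

definition finite_range :: "('d::finite, 'a::finite) interaction \<Rightarrow> bool" where
  "finite_range U \<longleftrightarrow>
     (\<exists>R::real. R > 0 \<and> (\<forall>A\<in>finite_subsets. real_of_int (diam A) > R \<longrightarrow> (\<forall>\<sigma>. U A \<sigma> = 0)))"

definition scale_interaction :: "real \<Rightarrow> ('d::finite, 'a::finite) interaction \<Rightarrow> ('d, 'a) interaction" where
  "scale_interaction \<beta> U = (\<lambda>A \<sigma>. \<beta> * U A \<sigma>)"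

definition hamiltonian ::
    "('d::finite, 'a::finite) interaction \<Rightarrow> (int ^ 'd) set \<Rightarrow> ('d, 'a) config \<Rightarrow> ('d, 'a) config \<Rightarrow> real"
  where
  "hamiltonian U \<Lambda> \<zeta> \<sigma> =
     (\<Sum>\<^sub>\<infinity>A\<in>{A \<in> finite_subsets. A \<inter> \<Lambda> \<noteq> {}}. U A (override_on \<zeta> \<sigma> \<Lambda>))"

text \<open>The sigma-field generated by \<open>\<sigma> \<mapsto> \<sigma>\<^bsub>V\<^esub>\<close>.\<close>

definition field_on :: "(int ^ 'd::finite) set \<Rightarrow> ('d, 'a::finite) config measure" where
  "field_on V = sigma UNIV {{\<sigma>. \<sigma> x = a} | x a. x \<in> V}"

definition gibbs_measure ::
    "('d::finite, 'a::finite) interaction \<Rightarrow> ('d, 'a) config measure \<Rightarrow> bool" where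
  "gibbs_measure U M \<longleftrightarrow>
     prob_space M \<and> sets M = sets config_space \<and>
     (\<forall>x. distr M M (shift x) = M) \<and>
     (\<forall>\<Lambda>\<in>finite_subsets. \<forall>\<eta>\<in>patterns \<Lambda>. AE \<zeta> in M.
        real_cond_exp M (field_on (- \<Lambda>)) (indicator (cylinder \<Lambda> \<eta>)) \<zeta> =
        exp (- hamiltonian U \<Lambda> \<zeta> \<eta>) / (\<Sum>\<eta>'\<in>patterns \<Lambda>. exp (- hamiltonian U \<Lambda> \<zeta> \<eta>')))"

definition specific_entropy :: "('d::finite, 'a::finite) config measure \<Rightarrow> real" where
  "specific_entropy M = lim (\<lambda>n. - (1 / real n ^ CARD('d)) *
     (\<Sum>\<eta>\<in>patterns (cube n).
        measure M (cylinder (cube n) \<eta>) * ln (measure M (cylinder (cube n) \<eta>))))"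

definition pressure :: "('d::finite, 'a::finite) interaction \<Rightarrow> real" where
  "pressure U = lim (\<lambda>n. 1 / real n ^ CARD('d) *
     ln (\<Sum>\<eta>\<in>patterns (cube n). exp (- (\<Sum>A\<in>{A \<in> finite_subsets. A \<subseteq> cube n}. U A \<eta>))))"

text \<open>Logarithm on \<open>[0, \<infinity>]\<close>, with \<open>log 0 = -\<infinity>\<close> and \<open>log \<infinity> = \<infinity>\<close>.\<close>

definition elog :: "ereal \<Rightarrow> ereal" where
  "elog x = (if x \<le> 0 then - \<infinity> else if x = \<infinity> then \<infinity> else ereal (ln (real_of_ereal x)))"

definition enat_powr :: "enat \<Rightarrow> real \<Rightarrow> ennreal" where
  "enat_powr w p = (case w of enat k \<Rightarrow> ennreal (real k powr p)
     | \<infinity> \<Rightarrow> (if p > 0 then \<infinity> else if p = 0 then 1 else 0))"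

definition waiting_pressure :: "('d::finite, 'a::finite) config measure \<Rightarrow> real \<Rightarrow> ereal" where
  "waiting_pressure M q = lim (\<lambda>n. ereal (1 / real n ^ CARD('d)) *
     elog (enn2ereal
       (\<integral>\<^sup>+ (\<xi>, \<sigma>). enat_powr (waiting_time n \<xi> \<sigma>) (q * real CARD('d)) \<partial>(M \<Otimes>\<^sub>M M))))"

definition log_waiting_rate ::
    "nat \<Rightarrow> ('d::finite, 'a::finite) config \<Rightarrow> ('d, 'a) config \<Rightarrow> ereal" where
  "log_waiting_rate n \<xi> \<sigma> =
     elog (ereal_of_enat (waiting_time n \<xi> \<sigma>) ^ CARD('d)) / ereal (real n ^ CARD('d))"

definition u_zero :: "('d::finite, 'a::finite) config measure \<Rightarrow> real" where
  "u_zero M =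
     \<bar>Lim (at_right (- 1)) (deriv (\<lambda>q. real_of_ereal (waiting_pressure M q))) - specific_entropy M\<bar>"

text \<open>Continuous differentiability on a set, with derivatives taken within the set (so one-sided at
  an endpoint), unlike the library's \<open>C1_differentiable_on\<close>.\<close>

definition C1_within :: "(real \<Rightarrow> real) \<Rightarrow> real set \<Rightarrow> bool" where
  "C1_within f S \<longleftrightarrow>
     (\<exists>f'. (\<forall>x\<in>S. (f has_real_derivative f' x) (at x within S)) \<and> continuous_on S f')"

end

theory Submission
  imports Defs "HOL-Real_Asymp.Real_Asymp"
begin

text \<open>At small \<open>\<beta>\<close> the conditional probability of a symbol given all other sites depends only weakly on
  those sites. A Dobrushin contraction for this dependence yields a unique finite-volume limit, hence
  existence, uniqueness and translation invariance.

  The log-likelihood of a pattern \<open>\<eta>\<close> on the cube equals \<open>\<beta>\<close> times its energy plus volume times pressure,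
  up to a surface term, so the moments of \<open>1/P(\<eta>)\<close> grow at rate
  \<open>\<W>(q) = P((1-q)\<beta>U) + (q-1)P(\<beta>U)\<close>. Given \<open>\<xi>\<close>, the waiting time satisfies
  \<open>P(w \<le> k) \<le> (k+1)^d P(\<eta>)\<close> and, trying disjoint translates one after the other,
  \<open>P(w > k) \<le> 3 exp(- c P(\<eta>) k^d)\<close> with \<open>- ln c\<close> of surface order; hence \<open>w^d\<close> is exponentially equivalent
  to \<open>1/P(\<eta>)\<close> in all moments with \<open>q > -1\<close>.

  The upper bounds are Markov's inequality; the lower bounds tilt the pattern distribution at points
  where \<open>\<W>'\<close> lies slightly beyond the level. In the upper tail the level may exceed or equal
  \<open>sup \<W>'\<close>; above it both sides are \<open>-\<infinity>\<close>, and at it a block argument counts the patterns of almost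
  maximal energy.\<close>

section \<open>The lattice\<close>

text \<open>Every comparison carries an error of surface order \<open>n ^ (d - 1)\<close>, and its
  constants are tracked because at one level this order decides. The statement divides by
  \<open>n ^ d\<close>, whereas \<open>cube n\<close> has \<open>(n + 1) ^ d\<close> sites. At the
  level v = sup W' no pattern carries more information than \<open>vol * v\<close> plus a boundary
  term, and the event is reached only because the surplus of at least
  \<open>(n + 1) ^ (d - 1)\<close> sites contributes at least ln 2 each. This beats the boundary
  terms once \<open>24 * \<beta> * surface_const \<le> ln 2\<close>, a second smallness condition on
  \<beta> beside the one for uniqueness. Dimension at least 2 makes logarithmic factors, such as the
  volume lost in the waiting-time estimate, at most of surface order in the exponent. The
  contraction is formulated for abstract functionals, since it serves twice: for two Gibbs measures,
  which are invariant under resampling at every site, and for two finite-volume means, which are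
  invariant only away from the boundary, so that the number of contraction steps is limited by the
  depth of a site in the box.\<close>

lemma norm1_nonneg: "norm1 x \<ge> 0"
  by (simp add: norm1_def sum_nonneg)

lemma norm1_0 [simp]: "norm1 0 = 0"
  by (simp add: norm1_def)

lemma norm1_triangle: "norm1 (x + y) \<le> norm1 x + norm1 y"
  unfolding norm1_def by (simp add: sum.distrib[symmetric] sum_mono abs_triangle_ineq)

lemma abs_component_le_norm1: "\<bar>x $ i\<bar> \<le> norm1 x"
  unfolding norm1_def by (rule member_le_sum) auto

lemma norm1_pos_iff: "norm1 x > 0 \<longleftrightarrow> x \<noteq> 0"
proof
  assume "x \<noteq> 0"
  then obtain i where "x $ i \<noteq> 0" by (auto simp: vec_eq_iff)
  then show "norm1 x > 0" using abs_component_le_norm1[of x i] by linarith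
qed auto

lemma vec_set_eq_image_PiE: "{x :: 'b ^ 'd::finite. \<forall>i. x $ i \<in> A i} = vec_lambda ` PiE UNIV A"
proof safe
  fix x :: "'b ^ 'd" assume "\<forall>i. x $ i \<in> A i"
  then have "vec_nth x \<in> PiE UNIV A" by auto
  then show "x \<in> vec_lambda ` PiE UNIV A" by (intro image_eqI[of _ _ "vec_nth x"]) auto
qed (auto simp: PiE_iff)

lemma finite_vec_set:
  assumes "\<And>i. finite (A i)"
  shows "finite {x :: 'b ^ 'd::finite. \<forall>i. x $ i \<in> A i}"
  unfolding vec_set_eq_image_PiE by (intro finite_imageI finite_PiE assms) auto

lemma card_vec_set: "card {x :: 'b ^ 'd::finite. \<forall>i. x $ i \<in> A} = card A ^ CARD('d)"
proof -
  have "inj_on vec_lambda (PiE UNIV (\<lambda>_::'d. A))"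
    by (auto simp: inj_on_def vec_lambda_inject)
  then show ?thesis
    using vec_set_eq_image_PiE[of "\<lambda>_::'d. A"] by (simp add: card_image card_PiE)
qed

lemma finite_cube [simp]: "finite (cube n :: (int ^ 'd::finite) set)"
proof -
  have *: "cube n = {x :: int ^ 'd. \<forall>i. x $ i \<in> {0..int n}}" by (auto simp: cube_def)
  show ?thesis unfolding * by (rule finite_vec_set) simp
qed

lemma card_cube: "card (cube n :: (int ^ 'd::finite) set) = (n + 1) ^ CARD('d)"
proof -
  have *: "cube n = {x :: int ^ 'd. \<forall>i. x $ i \<in> {0..int n}}" by (auto simp: cube_def)
  show ?thesis unfolding * card_vec_set by (simp add: nat_add_distrib)
qed

lemma zero_in_cube [simp]: "0 \<in> cube n"
  by (simp add: cube_def)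

definition nbhd :: "int \<Rightarrow> (int ^ 'd::finite) set \<Rightarrow> (int ^ 'd) set" where
  "nbhd r S = {y. \<exists>x\<in>S. norm1 (y - x) \<le> r}"

text \<open>With \<open>r\<close> the range, a nonzero interaction term that joins \<open>S\<close>
  to its complement must contain one of these sites, so all boundary errors are multiples of the
  cardinality of this set.\<close>

definition inner_boundary :: "int \<Rightarrow> (int ^ 'd::finite) set \<Rightarrow> (int ^ 'd) set" where
  "inner_boundary r S = {x\<in>S. \<exists>y. y \<notin> S \<and> norm1 (y - x) \<le> r}"

lemma nbhd_Un: "nbhd r (S \<union> T) = nbhd r S \<union> nbhd r T"
  by (auto simp: nbhd_def)

lemma subset_nbhd:
  assumes "0 \<le> r"
  shows "S \<subseteq> nbhd r S"
proof
  fix x assume "x \<in> S"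
  then show "x \<in> nbhd r S" using assms by (auto simp: nbhd_def intro: bexI[of _ x])
qed

lemma finite_norm1_ball [simp]: "finite {y :: int ^ 'd::finite. norm1 y \<le> r}"
proof (rule finite_subset)
  show "{y :: int ^ 'd. norm1 y \<le> r} \<subseteq> {y. \<forall>i. y $ i \<in> {-r..r}}"
  proof (clarsimp)
    fix y :: "int ^ 'd" and i assume "norm1 y \<le> r"
    then show "- r \<le> y $ i \<and> y $ i \<le> r" using abs_component_le_norm1[of y i] by linarith
  qed
qed (rule finite_vec_set, simp)

lemma nbhd_singleton: "nbhd r {x} = (+) x ` {y. norm1 y \<le> r}"
proof safe
  fix y assume "y \<in> nbhd r {x}"
  then show "y \<in> (+) x ` {y. norm1 y \<le> r}"
    by (intro image_eqI[of _ _ "y - x"]) (auto simp: nbhd_def)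
qed (auto simp: nbhd_def)

lemma card_nbhd_singleton: "card (nbhd r {x :: int ^ 'd}) = card {y :: int ^ 'd::finite. norm1 y \<le> r}"
  by (simp add: nbhd_singleton card_image)

lemma finite_nbhd [simp]:
  assumes "finite S"
  shows "finite (nbhd r S)"
proof -
  have "nbhd r S = (\<Union>x\<in>S. nbhd r {x})" by (auto simp: nbhd_def)
  then show ?thesis using assms by (simp add: nbhd_singleton)
qed

lemma inner_boundary_subset: "inner_boundary r S \<subseteq> S"
  by (auto simp: inner_boundary_def)

lemma finite_inner_boundary [simp]: "finite S \<Longrightarrow> finite (inner_boundary r S)"
  using inner_boundary_subset finite_subset by blast

lemma inner_boundary_translate: "inner_boundary r ((+) x ` S) = (+) x ` inner_boundary r S"
proof -
  have *: "y \<in> (+) x ` S \<longleftrightarrow> y - x \<in> S" for y S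
    by (auto intro: image_eqI[of _ _ "y - x"])
  have "(\<exists>y. y - x \<notin> S \<and> norm1 (y - z) \<le> r) \<longleftrightarrow> (\<exists>y. y \<notin> S \<and> norm1 (y - (z - x)) \<le> r)" for z
  proof safe
    fix y assume "y - x \<notin> S" "norm1 (y - z) \<le> r"
    then show "\<exists>y. y \<notin> S \<and> norm1 (y - (z - x)) \<le> r" by (intro exI[of _ "y - x"]) auto
  next
    fix y assume "y \<notin> S" "norm1 (y - (z - x)) \<le> r"
    then show "\<exists>y. y - x \<notin> S \<and> norm1 (y - z) \<le> r"
      by (intro exI[of _ "y + x"]) (auto simp: algebra_simps)
  qed
  then show ?thesis by (auto simp: inner_boundary_def *)
qed

text \<open>Bernoulli's inequality for \<open>1 - j / N\<close>, multiplied by \<open>N ^ d\<close>.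
  It turns the removal of a margin from a cube into a surface term, both for inner boundaries and
  for the remainder of a tiling.\<close>

lemma power_diff_le_boundary:
  fixes N j :: real
  assumes "0 \<le> j" "0 < N" "j \<le> N"
  shows "N ^ d - (N - j) ^ d \<le> real d * j * N ^ (d - 1)"
proof (cases d)
  case (Suc m)
  have "1 - real d * (j / N) \<le> (1 - j / N) ^ d"
    using Bernoulli_inequality[of "- (j / N)" d] assms by (simp add: field_simps)
  then have "N ^ d * (1 - real d * (j / N)) \<le> N ^ d * (1 - j / N) ^ d"
    using assms by (intro mult_left_mono) auto
  also have "\<dots> = (N - j) ^ d"
    using assms by (simp add: power_mult_distrib[symmetric] field_simps)
  finally have "N ^ d - (N - j) ^ d \<le> N ^ d * (real d * (j / N))" by (simp add: algebra_simps)
  also have "\<dots> = real d * j * N ^ (d - 1)" using assms Suc by simp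
  finally show ?thesis .
qed simp

text \<open>Sites at coordinate distance at least \<open>r\<close> from every face cannot reach the
  complement, so the inner boundary is contained in a cube minus a concentric cube whose side is
  shorter by \<open>2 * r\<close>.\<close>

lemma card_inner_boundary_cube:
  assumes "0 \<le> r"
  shows "real (card (inner_boundary r (cube n :: (int ^ 'd::finite) set)))
    \<le> 2 * real_of_int r * real CARD('d) * real (n + 1) ^ (CARD('d) - 1)"
proof (cases "2 * r \<le> int n + 1")
  case True
  define I where "I = {x :: int ^ 'd. \<forall>i. x $ i \<in> {r..int n - r}}"
  have I: "finite I" "I \<subseteq> cube n"
  proof -
    show "finite I" unfolding I_def by (rule finite_vec_set) simp
    show "I \<subseteq> cube n"
    proof
      fix x assume "x \<in> I"
      then have "0 \<le> x $ i \<and> x $ i \<le> int n" for i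
        using assms by (auto simp: I_def dest!: spec[of _ i])
      then show "x \<in> cube n" by (simp add: cube_def)
    qed
  qed
  have "real (card I) = (real (n + 1) - 2 * real_of_int r) ^ CARD('d)"
    using True assms unfolding I_def card_vec_set by (simp add: of_nat_diff) (auto simp: nat_add_distrib algebra_simps)
  moreover have "inner_boundary r (cube n) \<subseteq> cube n - I"
  proof safe
    fix x :: "int ^ 'd" assume "x \<in> inner_boundary r (cube n)" "x \<in> I"
    then obtain y where y: "y \<notin> cube n" "norm1 (y - x) \<le> r" by (auto simp: inner_boundary_def)
    have "0 \<le> y $ i \<and> y $ i \<le> int n" for i
      using abs_component_le_norm1[of "y - x" i] y(2) \<open>x \<in> I\<close>
      by (auto simp: I_def dest!: spec[of _ i])
    then show False using y(1) by (auto simp: cube_def)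
  qed (auto simp: inner_boundary_def)
  then have "card (inner_boundary r (cube n :: (int ^ 'd) set)) \<le> card (cube n - I)"
    by (intro card_mono) auto
  then have "real (card (inner_boundary r (cube n :: (int ^ 'd) set))) \<le> real (card (cube n :: (int ^ 'd) set)) - real (card I)"
    using I card_mono[OF finite_cube I(2)] by (simp add: card_Diff_subset of_nat_diff)
  ultimately have "real (card (inner_boundary r (cube n :: (int ^ 'd) set)))
      \<le> real (n + 1) ^ CARD('d) - (real (n + 1) - 2 * real_of_int r) ^ CARD('d)"
    by (simp add: card_cube add.commute)
  also have "\<dots> \<le> real CARD('d) * (2 * real_of_int r) * real (n + 1) ^ (CARD('d) - 1)"
    using True assms by (intro power_diff_le_boundary) linarith+
  finally show ?thesis by (simp add: mult_ac)
next
  \<comment> \<open>The cube is narrower than \<open>2 * r\<close>, and the trivial bound by its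
    whole volume already has the required order.\<close>
  case False
  have "card (inner_boundary r (cube n :: (int ^ 'd) set)) \<le> card (cube n :: (int ^ 'd) set)"
    by (intro card_mono inner_boundary_subset) auto
  also have "\<dots> = (n + 1) * (n + 1) ^ (CARD('d) - 1)"
    unfolding card_cube using power_eq_if[of "n + 1" "CARD('d)"] by simp
  finally have "real (card (inner_boundary r (cube n :: (int ^ 'd) set))) \<le> real (n + 1) * real (n + 1) ^ (CARD('d) - 1)"
    by (metis of_nat_le_iff of_nat_mult of_nat_power)
  also have "\<dots> \<le> (2 * real_of_int r * real CARD('d)) * real (n + 1) ^ (CARD('d) - 1)"
  proof (intro mult_right_mono)
    have "real (n + 1) \<le> 2 * real_of_int r" using False by linarith
    also have "\<dots> \<le> 2 * real_of_int r * real CARD('d)"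
      using assms by (intro mult_le_cancel_left1[THEN iffD2]) (auto simp: Suc_le_eq)
    finally show "real (n + 1) \<le> 2 * real_of_int r * real CARD('d)" .
  qed auto
  finally show ?thesis .
qed

section \<open>Patterns and energies\<close>

lemma patterns_finite [simp]: "finite S \<Longrightarrow> finite (patterns S :: ('d::finite, 'a::finite) config set)"
  by (auto simp: patterns_def intro!: finite_PiE)

lemma patterns_nonempty [simp]: "patterns S \<noteq> {}"
  by (simp add: patterns_def PiE_eq_empty_iff)

lemma card_patterns:
  "finite S \<Longrightarrow> card (patterns S :: ('d::finite, 'a::finite) config set) = CARD('a) ^ card S"
  by (simp add: patterns_def card_PiE)

lemma restrict_in_patterns [simp]: "restrict \<sigma> S \<in> patterns S"
  by (simp add: patterns_def)

lemma patterns_eqI: "\<eta> \<in> patterns S \<Longrightarrow> \<theta> \<in> patterns S \<Longrightarrow> (\<And>y. y \<in> S \<Longrightarrow> \<eta> y = \<theta> y) \<Longrightarrow> \<eta> = \<theta>"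
  unfolding patterns_def by (rule PiE_ext)

text \<open>The finite Fubini identity behind every argument that varies the pattern in one region
  while freezing it elsewhere.\<close>

lemma sum_patterns_Un:
  fixes f :: "('d::finite, 'a::finite) config \<Rightarrow> real"
  assumes "finite S" "finite T" "S \<inter> T = {}"
  shows "(\<Sum>\<omega>\<in>patterns (S \<union> T). f \<omega>) = (\<Sum>\<theta>\<in>patterns T. \<Sum>\<eta>\<in>patterns S. f (override_on \<theta> \<eta> S))"
proof -
  have ov: "override_on \<theta> \<eta> S \<in> patterns (S \<union> T)"
    "restrict (override_on \<theta> \<eta> S) T = \<theta>" "restrict (override_on \<theta> \<eta> S) S = \<eta>"
    if "\<theta> \<in> patterns T" "\<eta> \<in> patterns S" for \<theta> \<eta> :: "('d, 'a) config"
  proof -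
    show "override_on \<theta> \<eta> S \<in> patterns (S \<union> T)"
      using that by (simp add: patterns_def PiE_iff extensional_def override_on_def)
    show "restrict (override_on \<theta> \<eta> S) T = \<theta>"
      by (rule patterns_eqI[of _ T]) (use that assms(3) in \<open>auto simp: override_on_def\<close>)
    show "restrict (override_on \<theta> \<eta> S) S = \<eta>"
      by (rule patterns_eqI[of _ S]) (use that in auto)
  qed
  have re: "override_on (restrict \<omega> T) (restrict \<omega> S) S = \<omega>" if "\<omega> \<in> patterns (S \<union> T)"
    for \<omega> :: "('d, 'a) config"
  proof (rule patterns_eqI[of _ "S \<union> T"])
    show "override_on (restrict \<omega> T) (restrict \<omega> S) S \<in> patterns (S \<union> T)" by (rule ov(1)) auto
  qed (use that in \<open>auto simp: override_on_def\<close>)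
  have "(\<Sum>\<theta>\<in>patterns T. \<Sum>\<eta>\<in>patterns S. f (override_on \<theta> \<eta> S))
      = (\<Sum>(\<theta>, \<eta>)\<in>patterns T \<times> patterns S. f (override_on \<theta> \<eta> S))"
    by (simp add: sum.cartesian_product)
  also have "\<dots> = (\<Sum>\<omega>\<in>patterns (S \<union> T). f \<omega>)"
    by (rule sum.reindex_bij_witness[where i = "\<lambda>\<omega>. (restrict \<omega> T, restrict \<omega> S)"
        and j = "\<lambda>(\<theta>, \<eta>). override_on \<theta> \<eta> S"]) (auto simp: ov re)
  finally show ?thesis by simp
qed

lemma patterns_translate_bij:
  "bij_betw (shift (- x)) (patterns S) (patterns ((+) x ` S))"
proof (rule bij_betwI[where g = "shift x"])
  have "- x + y \<notin> S" if "y \<notin> (+) x ` S" for y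
    using that by (auto intro: image_eqI[of _ _ "- x + y"])
  then show "shift (- x) \<in> patterns S \<rightarrow> patterns ((+) x ` S)"
    by (auto simp: patterns_def PiE_iff extensional_def shift_def)
  have "x + y \<notin> (+) x ` S" if "y \<notin> S" for y
    using that by auto
  then show "shift x \<in> patterns ((+) x ` S) \<rightarrow> patterns S"
    by (auto simp: patterns_def PiE_iff extensional_def shift_def simp del: image_iff)
qed (auto simp: shift_def fun_eq_iff add.assoc[symmetric])

text \<open>The working form of the hypotheses: an integer range in the \<open>norm1\<close>
  distance, and one constant \<open>K\<close> for the total interaction through any site. The
  summability is kept only for finite families.\<close>

locale finite_range_interaction =
  fixes U :: "('d::finite, 'a::finite) interaction" and r :: int and K :: real
  assumes r_nonneg: "0 \<le> r" and K_nonneg: "0 \<le> K"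
    and dep: "finite A \<Longrightarrow> A \<noteq> {} \<Longrightarrow> (\<And>y. y \<in> A \<Longrightarrow> \<sigma> y = \<tau> y) \<Longrightarrow> U A \<sigma> = U A \<tau>"
    and translation: "finite A \<Longrightarrow> A \<noteq> {} \<Longrightarrow> U ((+) x ` A) (shift (- x) \<sigma>) = U A \<sigma>"
    and range: "finite A \<Longrightarrow> x \<in> A \<Longrightarrow> y \<in> A \<Longrightarrow> r < norm1 (y - x) \<Longrightarrow> U A \<sigma> = 0"
    and sum_le: "finite F \<Longrightarrow> (\<And>A. A \<in> F \<Longrightarrow> finite A \<and> x \<in> A) \<Longrightarrow> (\<Sum>A\<in>F. \<bar>U A \<sigma>\<bar>) \<le> K"

text \<open>\<open>K\<close> is the infinite sum over the sets through the origin; translation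
  invariance carries families through another site to the origin.\<close>

lemma finite_range_interaction_exists:
  fixes U :: "('d::finite, 'a::finite) interaction"
  assumes "interaction U" "finite_range U"
  shows "\<exists>r K. finite_range_interaction U r K"
proof -
  obtain R :: real where R: "R > 0"
    "\<And>A \<sigma>. A \<in> finite_subsets \<Longrightarrow> real_of_int (diam A) > R \<Longrightarrow> U A \<sigma> = 0"
    using assms(2) unfolding finite_range_def by blast
  note int = assms(1)[unfolded interaction_def]
  have dep: "U A \<sigma> = U A \<tau>" if "finite A" "A \<noteq> {}" "\<And>y. y \<in> A \<Longrightarrow> \<sigma> y = \<tau> y" for A \<sigma> \<tau>
  proof -
    have "restrict \<sigma> A = restrict \<tau> A" using that(3) by (rule restrict_ext)
    moreover have "A \<in> finite_subsets" using that by (simp add: finite_subsets_def)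
    ultimately show ?thesis using int by blast
  qed
  have trans: "U ((+) x ` A) (shift (- x) \<sigma>) = U A \<sigma>" if "finite A" "A \<noteq> {}" for A x \<sigma>
  proof -
    have "A \<in> finite_subsets" using that by (simp add: finite_subsets_def)
    moreover have "(+) x = (\<lambda>a. a + x)" by (simp add: fun_eq_iff)
    ultimately show ?thesis using int[THEN conjunct2, THEN conjunct1, THEN bspec, of A] by simp
  qed
  have summ: "(\<lambda>A. SUP \<sigma>. \<bar>U A \<sigma>\<bar>) summable_on {A \<in> finite_subsets. 0 \<in> A}"
    using int by blast
  define K where "K = (\<Sum>\<^sub>\<infinity>A\<in>{A \<in> finite_subsets. 0 \<in> A}. SUP \<sigma>. \<bar>U A \<sigma>\<bar>)"
  have le_SUP: "\<bar>U A \<sigma>\<bar> \<le> (SUP \<sigma>. \<bar>U A \<sigma>\<bar>)" if "finite A" "A \<noteq> {}" for A \<sigma>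
  proof (rule cSUP_upper)
    \<comment> \<open>The supremum is over an infinite configuration space, but \<open>U A\<close>
      sees only the finitely many patterns on \<open>A\<close>; this gives boundedness, without
      which \<open>SUP\<close> would be meaningless.\<close>
    have "range (\<lambda>\<sigma>. \<bar>U A \<sigma>\<bar>) \<subseteq> (\<lambda>\<sigma>. \<bar>U A \<sigma>\<bar>) ` patterns A"
    proof safe
      fix \<sigma> show "\<bar>U A \<sigma>\<bar> \<in> (\<lambda>\<sigma>. \<bar>U A \<sigma>\<bar>) ` patterns A"
        using dep[OF that, of \<sigma> "restrict \<sigma> A"] by (intro image_eqI[of _ _ "restrict \<sigma> A"]) auto
    qed
    then have "finite (range (\<lambda>\<sigma>. \<bar>U A \<sigma>\<bar>))"
      by (rule finite_subset) (simp add: that)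
    then show "bdd_above (range (\<lambda>\<sigma>. \<bar>U A \<sigma>\<bar>))" by (rule bdd_above_finite)
  qed simp
  have SUP_nonneg: "0 \<le> (SUP \<sigma>. \<bar>U A \<sigma>\<bar>)" if "finite A" "A \<noteq> {}" for A
    using le_SUP[OF that, of undefined] by linarith
  have K0: "0 \<le> K" unfolding K_def
    by (rule infsum_nonneg) (auto simp: finite_subsets_def intro: SUP_nonneg)
  have "finite_range_interaction U (nat \<lceil>R\<rceil>) K"
  proof
    fix A :: "(int ^ 'd) set" and x y \<sigma>
    assume A: "finite A" "x \<in> A" "y \<in> A" "int (nat \<lceil>R\<rceil>) < norm1 (y - x)"
    have "{norm1 (x - y) |x y. x \<in> A \<and> y \<in> A} = (\<lambda>(x, y). norm1 (x - y)) ` (A \<times> A)" by auto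
    then have "finite {norm1 (x - y) |x y. x \<in> A \<and> y \<in> A}" using A(1) by simp
    then have "norm1 (y - x) \<le> diam A" unfolding diam_def using A by (intro Max_ge) auto
    then have "R < real_of_int (diam A)" using A(4) R(1) by linarith
    then show "U A \<sigma> = 0" using A by (intro R(2)) (auto simp: finite_subsets_def)
  next
    fix F :: "(int ^ 'd) set set" and x \<sigma>
    assume F: "finite F" "\<And>A. A \<in> F \<Longrightarrow> finite A \<and> x \<in> A"
    \<comment> \<open>The family is moved by \<open>- x\<close>, so that all its members contain the
      origin and the sum is a partial sum of \<open>K\<close>.\<close>
    define G where "G = (`) ((+) (- x)) ` F"
    have inj: "inj_on ((`) ((+) (- x))) F"
      by (intro inj_onI) (simp add: inj_image_eq_iff)
    have "(\<Sum>A\<in>F. \<bar>U A \<sigma>\<bar>) = (\<Sum>A\<in>F. \<bar>U ((+) (- x) ` A) (shift x \<sigma>)\<bar>)"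
    proof (intro sum.cong refl)
      fix A assume "A \<in> F"
      then have "finite A" "A \<noteq> {}" using F(2) by auto
      from trans[OF this, of "- x" \<sigma>] show "\<bar>U A \<sigma>\<bar> = \<bar>U ((+) (- x) ` A) (shift x \<sigma>)\<bar>" by simp
    qed
    also have "\<dots> = (\<Sum>A\<in>G. \<bar>U A (shift x \<sigma>)\<bar>)"
      unfolding G_def by (subst sum.reindex[OF inj]) simp
    also have "\<dots> \<le> (\<Sum>A\<in>G. SUP \<sigma>. \<bar>U A \<sigma>\<bar>)"
      using F(2) by (intro sum_mono le_SUP) (auto simp: G_def)
    also have "\<dots> \<le> K" unfolding K_def
    proof (rule finite_sum_le_infsum[OF summ])
      show "finite G" using F(1) by (simp add: G_def)
      show "G \<subseteq> {A \<in> finite_subsets. 0 \<in> A}"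
        using F(2) by (auto simp: G_def finite_subsets_def intro!: image_eqI[of _ _ x])
    qed (auto simp: finite_subsets_def intro: SUP_nonneg)
    finally show "(\<Sum>A\<in>F. \<bar>U A \<sigma>\<bar>) \<le> K" .
  qed (simp, fact K0, rule dep, assumption+, rule trans)
  then show ?thesis by blast
qed

context finite_range_interaction
begin

text \<open>Free boundary condition: only sets inside \<open>S\<close> count. The empty set is
  removed because the hypotheses on \<open>U\<close> concern nonempty sets only.\<close>

definition energy :: "(int ^ 'd) set \<Rightarrow> ('d, 'a) config \<Rightarrow> real" where
  "energy S \<sigma> = (\<Sum>A\<in>Pow S - {{}}. U A \<sigma>)"

text \<open>The parameter may be negative: it will be \<open>(1 - q) * \<beta>\<close> with q of
  either side of 1, and for large q the sum is dominated by patterns of maximal energy.\<close>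

definition partition_sum :: "real \<Rightarrow> (int ^ 'd) set \<Rightarrow> real" where
  "partition_sum t S = (\<Sum>\<eta>\<in>patterns S. exp (- (t * energy S \<eta>)))"

lemma energy_cong:
  assumes "finite S" "\<And>y. y \<in> S \<Longrightarrow> \<sigma> y = \<tau> y"
  shows "energy S \<sigma> = energy S \<tau>"
  unfolding energy_def
proof (intro sum.cong refl)
  fix A assume "A \<in> Pow S - {{}}"
  then show "U A \<sigma> = U A \<tau>" using assms finite_subset[of A S] by (intro dep) auto
qed

lemma energy_restrict: "finite S \<Longrightarrow> energy S (restrict \<sigma> S) = energy S \<sigma>"
  by (rule energy_cong) auto

lemma energy_translate:
  assumes "finite S"
  shows "energy ((+) x ` S) (shift (- x) \<sigma>) = energy S \<sigma>"
proof -
  have bij: "bij_betw ((`) ((+) x)) (Pow S - {{}}) (Pow ((+) x ` S) - {{}})"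
    unfolding bij_betw_def
  proof
    show "inj_on ((`) ((+) x)) (Pow S - {{}})"
      by (intro inj_onI) (simp add: inj_image_eq_iff)
    have "(`) ((+) x) ` Pow S = Pow ((+) x ` S)" by (rule image_Pow_surj) simp
    moreover have "(`) ((+) x) ` (Pow S - {{}}) = (`) ((+) x) ` Pow S - {{}}" by auto
    ultimately show "(`) ((+) x) ` (Pow S - {{}}) = Pow ((+) x ` S) - {{}}" by simp
  qed
  have "energy ((+) x ` S) (shift (- x) \<sigma>) = (\<Sum>A\<in>Pow S - {{}}. U ((+) x ` A) (shift (- x) \<sigma>))"
    unfolding energy_def by (rule sum.reindex_bij_betw[OF bij, symmetric])
  also have "\<dots> = energy S \<sigma>" unfolding energy_def
    using assms by (intro sum.cong translation) (auto intro: finite_subset)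
  finally show ?thesis .
qed

text \<open>Each nonvanishing term is charged to a site of \<open>S\<close> that it contains, and
  every site is charged at most \<open>K\<close>.\<close>

lemma sum_abs_le_card:
  assumes "finite S" "finite F" "\<And>A. A \<in> F \<Longrightarrow> finite A"
    and "\<And>A. A \<in> F \<Longrightarrow> U A \<sigma> \<noteq> 0 \<Longrightarrow> A \<inter> S \<noteq> {}"
  shows "(\<Sum>A\<in>F. \<bar>U A \<sigma>\<bar>) \<le> K * real (card S)"
proof -
  have "(\<Sum>A\<in>F. \<bar>U A \<sigma>\<bar>) \<le> (\<Sum>A\<in>F. \<Sum>x\<in>S. if x \<in> A then \<bar>U A \<sigma>\<bar> else 0)"
  proof (rule sum_mono)
    fix A assume A: "A \<in> F"
    show "\<bar>U A \<sigma>\<bar> \<le> (\<Sum>x\<in>S. if x \<in> A then \<bar>U A \<sigma>\<bar> else 0)"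
    proof (cases "U A \<sigma> = 0")
      case False
      then obtain z where z: "z \<in> A" "z \<in> S" using assms(4)[OF A] by auto
      then have "\<bar>U A \<sigma>\<bar> = (if z \<in> A then \<bar>U A \<sigma>\<bar> else 0)" by simp
      also have "\<dots> \<le> (\<Sum>x\<in>S. if x \<in> A then \<bar>U A \<sigma>\<bar> else 0)"
        by (rule member_le_sum) (use z assms in auto)
      finally show ?thesis .
    qed (auto intro: sum_nonneg)
  qed
  also have "\<dots> = (\<Sum>x\<in>S. \<Sum>A\<in>{A\<in>F. x \<in> A}. \<bar>U A \<sigma>\<bar>)"
    by (subst sum.swap) (simp add: sum.inter_filter[OF assms(2)])
  also have "\<dots> \<le> (\<Sum>x\<in>S. K)"
    using assms by (intro sum_mono sum_le) auto
  finally show ?thesis by (simp add: mult.commute)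
qed

lemma abs_energy_le:
  assumes "finite S"
  shows "\<bar>energy S \<sigma>\<bar> \<le> K * real (card S)"
proof -
  have "\<bar>energy S \<sigma>\<bar> \<le> (\<Sum>A\<in>Pow S - {{}}. \<bar>U A \<sigma>\<bar>)" unfolding energy_def by (rule sum_abs)
  also have "\<dots> \<le> K * real (card S)"
    using assms by (intro sum_abs_le_card) (auto intro: finite_subset)
  finally show ?thesis .
qed

text \<open>Only sets meeting both regions are missed. Such a set, if its term is nonzero, has a
  point of \<open>S\<close> within distance \<open>r\<close> of a point outside \<open>S\<close>,
  hence meets the inner boundary and can be charged to it.\<close>

lemma energy_Un:
  assumes "finite S" "finite T" "S \<inter> T = {}"
  shows "\<bar>energy (S \<union> T) \<sigma> - energy S \<sigma> - energy T \<sigma>\<bar> \<le> K * real (card (inner_boundary r S))"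
proof -
  define Mix where "Mix = {A. A \<subseteq> S \<union> T \<and> A \<inter> S \<noteq> {} \<and> A \<inter> T \<noteq> {}}"
  have Mix: "finite Mix" by (rule finite_subset[of _ "Pow (S \<union> T)"]) (use assms in \<open>auto simp: Mix_def\<close>)
  have split: "Pow (S \<union> T) - {{}} = ((Pow S - {{}}) \<union> (Pow T - {{}})) \<union> Mix"
    by (auto simp: Mix_def)
  have disj: "((Pow S - {{}}) \<union> (Pow T - {{}})) \<inter> Mix = {}" "(Pow S - {{}}) \<inter> (Pow T - {{}}) = {}"
    using assms(3) unfolding Mix_def by blast+
  have "energy (S \<union> T) \<sigma> = (\<Sum>A\<in>(Pow S - {{}}) \<union> (Pow T - {{}}). U A \<sigma>) + (\<Sum>A\<in>Mix. U A \<sigma>)"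
    unfolding energy_def split using assms(1,2) Mix disj(1) by (intro sum.union_disjoint) simp_all
  also have "(\<Sum>A\<in>(Pow S - {{}}) \<union> (Pow T - {{}}). U A \<sigma>) = energy S \<sigma> + energy T \<sigma>"
    unfolding energy_def using assms(1,2) disj(2) by (intro sum.union_disjoint) simp_all
  finally have "\<bar>energy (S \<union> T) \<sigma> - energy S \<sigma> - energy T \<sigma>\<bar> = \<bar>\<Sum>A\<in>Mix. U A \<sigma>\<bar>" by simp
  also have "\<dots> \<le> (\<Sum>A\<in>Mix. \<bar>U A \<sigma>\<bar>)" by (rule sum_abs)
  also have "\<dots> \<le> K * real (card (inner_boundary r S))"
  proof (rule sum_abs_le_card)
    fix A assume A: "A \<in> Mix"
    then show fin: "finite A" using assms by (auto simp: Mix_def intro: finite_subset)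
    assume nz: "U A \<sigma> \<noteq> 0"
    obtain x y where xy: "x \<in> A" "x \<in> S" "y \<in> A" "y \<in> T" using A by (auto simp: Mix_def)
    then have "norm1 (y - x) \<le> r" using range[OF fin xy(1,3)] nz by force
    then have "x \<in> inner_boundary r S" using xy assms(3) by (auto simp: inner_boundary_def)
    then show "A \<inter> inner_boundary r S \<noteq> {}" using xy by auto
  qed (use assms Mix in auto)
  finally show ?thesis .
qed

text \<open>By finite range, nonzero terms meeting \<Lambda> lie inside \<open>S\<close>, so the
  infinite sum is finite: all subsets of \<open>S\<close> minus those avoiding \<Lambda>. The
  subtracted energy is independent of \<sigma> and will cancel in conditional probabilities.\<close>

lemma hamiltonian_eq:
  assumes "finite \<Lambda>" "finite S" "nbhd r \<Lambda> \<subseteq> S"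
  shows "hamiltonian (scale_interaction \<beta> U) \<Lambda> \<zeta> \<sigma>
    = \<beta> * (energy S (override_on \<zeta> \<sigma> \<Lambda>) - energy (S - \<Lambda>) \<zeta>)"
proof -
  let ?\<omega> = "override_on \<zeta> \<sigma> \<Lambda>"
  have \<Lambda>S: "\<Lambda> \<subseteq> S" using subset_nbhd[OF r_nonneg] assms(3) by blast
  have fin: "finite (Pow S)" using assms by simp
  have "hamiltonian (scale_interaction \<beta> U) \<Lambda> \<zeta> \<sigma>
      = (\<Sum>\<^sub>\<infinity>A\<in>{A. A \<subseteq> S \<and> A \<inter> \<Lambda> \<noteq> {}}. \<beta> * U A ?\<omega>)"
    unfolding hamiltonian_def scale_interaction_def
  proof (rule infsum_cong_neutral)
    fix A assume A: "A \<in> {A \<in> finite_subsets. A \<inter> \<Lambda> \<noteq> {}} - {A. A \<subseteq> S \<and> A \<inter> \<Lambda> \<noteq> {}}"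
    then obtain x y where xy: "x \<in> A" "x \<in> \<Lambda>" "y \<in> A" "y \<notin> S" by auto
    then have "r < norm1 (y - x)" using assms(3) by (force simp: nbhd_def)
    then show "\<beta> * U A ?\<omega> = 0" using A xy range[of A x y] by (auto simp: finite_subsets_def)
  qed (use assms in \<open>auto simp: finite_subsets_def intro: finite_subset\<close>)
  also have "\<dots> = (\<Sum>A\<in>{A. A \<subseteq> S \<and> A \<inter> \<Lambda> \<noteq> {}}. \<beta> * U A ?\<omega>)"
    by (rule infsum_finite) (rule finite_subset[OF _ fin], auto)
  also have "\<dots> = \<beta> * (\<Sum>A\<in>(Pow S - {{}}) - (Pow (S - \<Lambda>) - {{}}). U A ?\<omega>)"
    unfolding sum_distrib_left by (rule sum.cong) auto
  also have "(\<Sum>A\<in>(Pow S - {{}}) - (Pow (S - \<Lambda>) - {{}}). U A ?\<omega>)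
      = energy S ?\<omega> - energy (S - \<Lambda>) ?\<omega>"
    unfolding energy_def by (rule sum_diff) (use assms in auto)
  also have "energy (S - \<Lambda>) ?\<omega> = energy (S - \<Lambda>) \<zeta>"
    by (rule energy_cong) (use assms in auto)
  finally show ?thesis .
qed

lemma pressure_eq:
  "pressure (scale_interaction t U)
    = lim (\<lambda>n. 1 / real n ^ CARD('d) * ln (partition_sum t (cube n)))"
proof -
  have "{A \<in> finite_subsets. A \<subseteq> cube n} = Pow (cube n :: (int ^ 'd) set) - {{}}" for n
    by (auto simp: finite_subsets_def intro: finite_subset)
  then show ?thesis
    unfolding pressure_def partition_sum_def energy_def scale_interaction_def sum_distrib_left
    by (simp only:)
qed

lemma partition_sum_pos: "finite S \<Longrightarrow> 0 < partition_sum t S"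
  unfolding partition_sum_def by (intro sum_pos) auto

lemma partition_sum_translate:
  assumes "finite S"
  shows "partition_sum t ((+) x ` S) = partition_sum t S"
proof -
  have "partition_sum t ((+) x ` S)
      = (\<Sum>\<eta>\<in>patterns S. exp (- (t * energy ((+) x ` S) (shift (- x) \<eta>))))"
    unfolding partition_sum_def by (rule sum.reindex_bij_betw[OF patterns_translate_bij, symmetric])
  then show ?thesis using assms by (simp add: partition_sum_def energy_translate)
qed

text \<open>Counting patterns and inserting the extreme energies suffices here; the bound is used
  for the untiled remainder of a cube, which is small.\<close>

lemma abs_ln_partition_sum_le:
  assumes "finite S"
  shows "\<bar>ln (partition_sum t S)\<bar> \<le> (ln (real CARD('a)) + \<bar>t\<bar> * K) * real (card S)"
proof -
  have b: "\<bar>t * energy S \<eta>\<bar> \<le> \<bar>t\<bar> * K * real (card S)" for \<eta>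
    using mult_left_mono[OF abs_energy_le[OF assms, of \<eta>] abs_ge_zero[of t]] by (simp add: abs_mult mult_ac)
  have a: "1 \<le> real CARD('a)" by (simp add: Suc_le_eq)
  have ca: "ln (real CARD('a) ^ card S) = ln (real CARD('a)) * real (card S)"
    using a by (simp add: ln_realpow)
  have "partition_sum t S \<le> (\<Sum>\<eta>\<in>(patterns S :: ('d, 'a) config set). exp (\<bar>t\<bar> * K * real (card S)))"
    unfolding partition_sum_def
  proof (rule sum_mono)
    fix \<eta> show "exp (- (t * energy S \<eta>)) \<le> exp (\<bar>t\<bar> * K * real (card S))"
      using b[of \<eta>] by auto
  qed
  also have "\<dots> = real CARD('a) ^ card S * exp (\<bar>t\<bar> * K * real (card S))"
    using assms by (simp add: card_patterns)
  finally have "ln (partition_sum t S) \<le> ln (real CARD('a) ^ card S * exp (\<bar>t\<bar> * K * real (card S)))"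
    using partition_sum_pos[OF assms, of t] by (intro ln_mono) auto
  also have "\<dots> = (ln (real CARD('a)) + \<bar>t\<bar> * K) * real (card S)"
    using a by (subst ln_mult) (auto simp: ca algebra_simps)
  finally have up: "ln (partition_sum t S) \<le> (ln (real CARD('a)) + \<bar>t\<bar> * K) * real (card S)" .
  have "(\<Sum>\<eta>\<in>(patterns S :: ('d, 'a) config set). exp (- (\<bar>t\<bar> * K * real (card S)))) \<le> partition_sum t S"
    unfolding partition_sum_def
  proof (rule sum_mono)
    fix \<eta> show "exp (- (\<bar>t\<bar> * K * real (card S))) \<le> exp (- (t * energy S \<eta>))"
      using b[of \<eta>] by auto
  qed
  then have "real CARD('a) ^ card S * exp (- (\<bar>t\<bar> * K * real (card S))) \<le> partition_sum t S"
    using assms by (simp add: card_patterns)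
  then have "ln (real CARD('a) ^ card S * exp (- (\<bar>t\<bar> * K * real (card S)))) \<le> ln (partition_sum t S)"
    using a by (intro ln_mono) auto
  then have "ln (real CARD('a)) * real (card S) - \<bar>t\<bar> * K * real (card S) \<le> ln (partition_sum t S)"
    using a by (subst (asm) ln_mult) (auto simp: ca)
  moreover have "0 \<le> ln (real CARD('a)) * real (card S)" using a by simp
  ultimately show ?thesis using up unfolding abs_le_iff distrib_right by linarith
qed

text \<open>The two-sided energy estimate for a disjoint union, applied term by term. Almost
  additivity in both directions is what later yields the pressure with an explicit error.\<close>

lemma ln_partition_sum_Un:
  assumes "finite S" "finite T" "S \<inter> T = {}"
  shows "\<bar>ln (partition_sum t (S \<union> T)) - ln (partition_sum t S) - ln (partition_sum t T)\<bar>
    \<le> \<bar>t\<bar> * K * real (card (inner_boundary r S))" (is "_ \<le> ?D")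
proof -
  have b: "\<bar>t * energy (S \<union> T) (override_on \<theta> \<eta> S) - t * energy S \<eta> - t * energy T \<theta>\<bar> \<le> ?D" for \<eta> \<theta>
  proof -
    have "energy S (override_on \<theta> \<eta> S) = energy S \<eta>" "energy T (override_on \<theta> \<eta> S) = energy T \<theta>"
      using assms by (auto intro!: energy_cong simp: override_on_def)
    then have "\<bar>energy (S \<union> T) (override_on \<theta> \<eta> S) - energy S \<eta> - energy T \<theta>\<bar> \<le> K * real (card (inner_boundary r S))"
      using energy_Un[OF assms, of "override_on \<theta> \<eta> S"] by simp
    from mult_left_mono[OF this abs_ge_zero[of t]] show ?thesis
      by (simp add: abs_mult[symmetric] right_diff_distrib mult_ac)
  qed
  have pr: "partition_sum t S * partition_sum t T
      = (\<Sum>\<theta>\<in>patterns T. \<Sum>\<eta>\<in>patterns S. exp (- (t * energy S \<eta>)) * exp (- (t * energy T \<theta>)))"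
    unfolding partition_sum_def sum_product by (rule sum.swap)
  have un: "partition_sum t (S \<union> T)
      = (\<Sum>\<theta>\<in>patterns T. \<Sum>\<eta>\<in>patterns S. exp (- (t * energy (S \<union> T) (override_on \<theta> \<eta> S))))"
    unfolding partition_sum_def by (rule sum_patterns_Un[OF assms])
  have pos: "0 < partition_sum t S * partition_sum t T" "0 < partition_sum t (S \<union> T)"
    using assms by (auto intro!: partition_sum_pos mult_pos_pos)
  have l: "ln (partition_sum t S * partition_sum t T) = ln (partition_sum t S) + ln (partition_sum t T)"
    using partition_sum_pos[OF assms(1), of t] partition_sum_pos[OF assms(2), of t] by (simp add: ln_mult)
  have "partition_sum t (S \<union> T) \<le> exp ?D * (partition_sum t S * partition_sum t T)"
    unfolding un pr sum_distrib_left
  proof (intro sum_mono)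
    fix \<theta> \<eta> :: "('d, 'a) config"
    show "exp (- (t * energy (S \<union> T) (override_on \<theta> \<eta> S))) \<le> exp ?D * (exp (- (t * energy S \<eta>)) * exp (- (t * energy T \<theta>)))"
      unfolding exp_add[symmetric] using b[of \<theta> \<eta>] by (subst exp_le_cancel_iff) linarith
  qed
  then have "ln (partition_sum t (S \<union> T)) \<le> ln (exp ?D * (partition_sum t S * partition_sum t T))"
    using pos by (intro ln_mono) auto
  also have "\<dots> = ?D + ln (partition_sum t S) + ln (partition_sum t T)"
    using pos l by (subst ln_mult) auto
  finally have 1: "ln (partition_sum t (S \<union> T)) \<le> ?D + ln (partition_sum t S) + ln (partition_sum t T)" .
  have "partition_sum t S * partition_sum t T \<le> exp ?D * partition_sum t (S \<union> T)"
    unfolding un pr sum_distrib_left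
  proof (intro sum_mono)
    fix \<theta> \<eta> :: "('d, 'a) config"
    show "exp (- (t * energy S \<eta>)) * exp (- (t * energy T \<theta>)) \<le> exp ?D * exp (- (t * energy (S \<union> T) (override_on \<theta> \<eta> S)))"
      unfolding exp_add[symmetric] using b[of \<theta> \<eta>] by (subst exp_le_cancel_iff) linarith
  qed
  then have "ln (partition_sum t S * partition_sum t T) \<le> ln (exp ?D * partition_sum t (S \<union> T))"
    using pos by (intro ln_mono) auto
  also have "\<dots> = ?D + ln (partition_sum t (S \<union> T))"
    using pos by (subst ln_mult) auto
  finally show ?thesis using 1 l by linarith
qed

end

section \<open>Cylinder sets and local functions\<close>

text \<open>Unlike in \<open>cylinder\<close>, the reference may be any configuration and not only
  an extensional pattern, so shifts and one-site updates need no renormalization.\<close>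

definition cyl :: "(int ^ 'd::finite) set \<Rightarrow> ('d, 'a::finite) config \<Rightarrow> ('d, 'a) config set" where
  "cyl S \<sigma> = {\<tau>. \<forall>y\<in>S. \<tau> y = \<sigma> y}"

definition local_on :: "(int ^ 'd::finite) set \<Rightarrow> (('d, 'a::finite) config \<Rightarrow> 'b) \<Rightarrow> bool" where
  "local_on S h \<longleftrightarrow> (\<forall>\<sigma> \<tau>. (\<forall>y\<in>S. \<sigma> y = \<tau> y) \<longrightarrow> h \<sigma> = h \<tau>)"

lemma local_onI: "(\<And>\<sigma> \<tau>. (\<And>y. y \<in> S \<Longrightarrow> \<sigma> y = \<tau> y) \<Longrightarrow> h \<sigma> = h \<tau>) \<Longrightarrow> local_on S h"
  unfolding local_on_def by blast

lemma local_onD: "local_on S h \<Longrightarrow> (\<And>y. y \<in> S \<Longrightarrow> \<sigma> y = \<tau> y) \<Longrightarrow> h \<sigma> = h \<tau>"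
  unfolding local_on_def by blast

lemma local_on_mono: "local_on S h \<Longrightarrow> S \<subseteq> T \<Longrightarrow> local_on T h"
  unfolding local_on_def by blast

lemma cyl_self [simp]: "\<sigma> \<in> cyl S \<sigma>"
  by (simp add: cyl_def)

lemma cyl_empty [simp]: "cyl {} \<sigma> = UNIV"
  by (simp add: cyl_def)

lemma cyl_cong: "(\<And>y. y \<in> S \<Longrightarrow> \<sigma> y = \<tau> y) \<Longrightarrow> cyl S \<sigma> = cyl S \<tau>"
  by (auto simp: cyl_def)

lemma cyl_restrict [simp]: "cyl S (restrict \<sigma> S) = cyl S \<sigma>"
  by (rule cyl_cong) simp

lemma cylinder_eq_cyl:
  assumes "\<eta> \<in> patterns V"
  shows "cylinder V \<eta> = cyl V \<eta>"
proof -
  have "restrict \<tau> V = \<eta> \<longleftrightarrow> (\<forall>y\<in>V. \<tau> y = \<eta> y)" for \<tau>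
  proof
    assume "\<forall>y\<in>V. \<tau> y = \<eta> y"
    then show "restrict \<tau> V = \<eta>" using assms by (intro patterns_eqI[of _ V]) auto
  qed auto
  then show ?thesis by (simp add: cylinder_def cyl_def)
qed

lemma cyl_Int:
  assumes "\<rho> \<in> cyl S \<sigma> \<inter> cyl T \<tau>"
  shows "cyl S \<sigma> \<inter> cyl T \<tau> = cyl (S \<union> T) \<rho>"
  using assms by (auto simp: cyl_def)

lemma local_on_indicator_cyl: "local_on S (indicator (cyl S \<sigma>))"
  by (rule local_onI) (auto simp: cyl_def indicator_def)

lemma local_expand:
  fixes h :: "('d::finite, 'a::finite) config \<Rightarrow> real"
  assumes "finite S" "local_on S h"
  shows "h \<zeta> = (\<Sum>\<theta>\<in>patterns S. h \<theta> * indicator (cyl S \<theta>) \<zeta>)"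
proof -
  have "(\<Sum>\<theta>\<in>patterns S. h \<theta> * indicator (cyl S \<theta>) \<zeta>)
      = (\<Sum>\<theta>\<in>patterns S. if \<theta> = restrict \<zeta> S then h \<theta> else 0)"
  proof (rule sum.cong[OF refl])
    fix \<theta> :: "('d, 'a) config" assume \<theta>: "\<theta> \<in> patterns S"
    have "\<zeta> \<in> cyl S \<theta> \<longleftrightarrow> \<theta> = restrict \<zeta> S"
      using cylinder_eq_cyl[OF \<theta>] by (auto simp: cylinder_def)
    then show "h \<theta> * indicator (cyl S \<theta>) \<zeta> = (if \<theta> = restrict \<zeta> S then h \<theta> else 0)" by simp
  qed
  also have "\<dots> = h (restrict \<zeta> S)" using assms(1) by simp
  also have "\<dots> = h \<zeta>" by (rule local_onD[OF assms(2)]) simp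
  finally show ?thesis by simp
qed

lemma cyl_image_patterns: "(\<Union>\<sigma>. {cyl S \<sigma>}) = cyl S ` patterns S"
proof safe
  fix \<sigma> show "cyl S \<sigma> \<in> cyl S ` patterns S"
    by (rule image_eqI[of _ _ "restrict \<sigma> S"]) auto
qed auto

lemma countable_cyls: "countable {cyl S \<sigma> :: ('d::finite, 'a::finite) config set | S \<sigma>. finite S}"
proof -
  have "{cyl S \<sigma> :: ('d, 'a) config set | S \<sigma>. finite S} = (\<Union>S\<in>Collect finite. \<Union>\<sigma>. {cyl S \<sigma>})" by auto
  then show ?thesis
    unfolding cyl_image_patterns
    by (simp only:) (intro countable_UN countable_Collect_finite countable_image countable_finite patterns_finite, simp)
qed

lemma space_config_space [simp]: "space config_space = UNIV"
  by (simp add: config_space_def space_measure_of_conv)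

lemma openin_cyl:
  fixes \<sigma> :: "('d::finite, 'a::finite) config"
  assumes "finite S"
  shows "openin (product_topology (\<lambda>_. discrete_topology UNIV) UNIV) (cyl S \<sigma>)"
  unfolding openin_product_topology_alt
proof (intro conjI ballI)
  fix \<tau> assume \<tau>: "\<tau> \<in> cyl S \<sigma>"
  define W where "W y = (if y \<in> S then {\<sigma> y} else UNIV)" for y
  have "{y. W y \<noteq> UNIV} \<subseteq> S" by (auto simp: W_def)
  then have "finite {y \<in> UNIV. W y \<noteq> topspace (discrete_topology UNIV)}"
    using assms finite_subset by simp
  moreover have "\<tau> \<in> PiE UNIV W" using \<tau> by (auto simp: W_def cyl_def)
  moreover have "PiE UNIV W \<subseteq> cyl S \<sigma>"
  proof
    fix \<rho> assume "\<rho> \<in> PiE UNIV W"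
    then have "\<rho> y \<in> W y" for y by (simp add: PiE_iff)
    then have "\<rho> y = \<sigma> y" if "y \<in> S" for y using that by (auto simp: W_def dest: meta_spec[of _ y])
    then show "\<rho> \<in> cyl S \<sigma>" by (simp add: cyl_def)
  qed
  ultimately show "\<exists>W. finite {y \<in> UNIV. W y \<noteq> topspace (discrete_topology UNIV)} \<and>
      (\<forall>y\<in>UNIV. openin (discrete_topology UNIV) (W y)) \<and> \<tau> \<in> PiE UNIV W \<and> PiE UNIV W \<subseteq> cyl S \<sigma>"
    by auto
qed

text \<open>Around each of its points an open set contains a cylinder, so it is the union of the
  cylinders inside it; as there are only countably many cylinders over finite sets, the union is
  countable.\<close>

lemma sets_config_space:
  "sets (config_space :: ('d::finite, 'a::finite) config measure)
    = sigma_sets UNIV {cyl S \<sigma> | S \<sigma>. finite S}" (is "_ = sigma_sets UNIV ?C")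
proof -
  let ?O = "{S. openin (product_topology (\<lambda>_. discrete_topology UNIV) UNIV) S} :: ('d, 'a) config set set"
  have "sigma_sets UNIV ?O = sigma_sets UNIV ?C"
  proof (rule sigma_sets_eqI)
    fix G assume "G \<in> ?O"
    then have G: "openin (product_topology (\<lambda>_. discrete_topology UNIV) UNIV) G" by simp
    define D where "D = {c \<in> ?C. c \<subseteq> G}"
    have "\<exists>c\<in>D. \<tau> \<in> c" if \<tau>G: "\<tau> \<in> G" for \<tau>
    proof -
      obtain W where W: "finite {y \<in> UNIV. W y \<noteq> topspace (discrete_topology UNIV)}"
        "\<tau> \<in> PiE UNIV W" "PiE UNIV W \<subseteq> G"
        using bspec[OF G[unfolded openin_product_topology_alt] \<tau>G] by (elim exE conjE) (rule that)
      define S where "S = {y. W y \<noteq> UNIV}"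
      have "finite S" using W(1) by (simp add: S_def)
      moreover have "cyl S \<tau> \<subseteq> PiE UNIV W"
      proof
        fix \<rho> assume \<rho>: "\<rho> \<in> cyl S \<tau>"
        have "\<rho> y \<in> W y" for y
          using \<rho> W(2) by (cases "y \<in> S") (auto simp: cyl_def S_def PiE_iff)
        then show "\<rho> \<in> PiE UNIV W" by auto
      qed
      ultimately have "cyl S \<tau> \<in> D" using W(3) by (auto simp: D_def)
      then show ?thesis by (intro bexI[of _ "cyl S \<tau>"]) auto
    qed
    then have "G = \<Union>D" by (auto simp: D_def)
    moreover have "countable D"
      by (rule countable_subset[OF _ countable_cyls]) (auto simp: D_def)
    ultimately show "G \<in> sigma_sets UNIV ?C"
      by (simp only:) (rule sigma_sets_UNION, auto simp: D_def intro: sigma_sets.Basic)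
  next
    fix c assume "c \<in> ?C"
    then show "c \<in> sigma_sets UNIV ?O" using openin_cyl by (auto intro!: sigma_sets.Basic)
  qed
  then show ?thesis by (simp add: config_space_def sets_measure_of_conv)
qed

text \<open>Two cylinders with a common point intersect in the cylinder through that point over the
  union of their bases. Otherwise they are disjoint, which is why the empty set is adjoined.\<close>

lemma Int_stable_cyls: "Int_stable (insert {} {cyl S \<sigma> | S \<sigma>. finite S \<and> S \<subseteq> V})"
proof (rule Int_stableI)
  fix a b :: "('a, 'b) config set"
  assume ab: "a \<in> insert {} {cyl S \<sigma> | S \<sigma>. finite S \<and> S \<subseteq> V}" "b \<in> insert {} {cyl S \<sigma> | S \<sigma>. finite S \<and> S \<subseteq> V}"
  show "a \<inter> b \<in> insert {} {cyl S \<sigma> | S \<sigma>. finite S \<and> S \<subseteq> V}"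
  proof (cases "a \<inter> b = {}")
    case False
    then obtain \<rho> where \<rho>: "\<rho> \<in> a \<inter> b" by auto
    with ab obtain S \<sigma> T \<tau> where *: "a = cyl S \<sigma>" "b = cyl T \<tau>" "finite S" "finite T" "S \<subseteq> V" "T \<subseteq> V" by auto
    have "a \<inter> b = cyl (S \<union> T) \<rho>" using cyl_Int \<rho> * by blast
    moreover have "finite (S \<union> T)" "S \<union> T \<subseteq> V" using * by auto
    ultimately show ?thesis by blast
  qed simp
qed

locale config_prob = prob_space M for M :: "('d::finite, 'a::finite) config measure" +
  assumes sets_M: "sets M = sets config_space"
begin

lemma space_M [simp]: "space M = UNIV"
  using sets_eq_imp_space_eq[OF sets_M] by simp

lemma cyl_sets [measurable]: "finite S \<Longrightarrow> cyl S \<sigma> \<in> sets M"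
  unfolding sets_M sets_config_space by (rule sigma_sets.Basic) auto

lemma integral_local:
  fixes h :: "('d, 'a) config \<Rightarrow> real"
  assumes "finite S" "local_on S h"
  shows "integrable M h" "(\<integral>\<zeta>. h \<zeta> \<partial>M) = (\<Sum>\<theta>\<in>patterns S. h \<theta> * measure M (cyl S \<theta>))"
proof -
  have h: "h = (\<lambda>\<zeta>. \<Sum>\<theta>\<in>patterns S. h \<theta> * indicator (cyl S \<theta>) \<zeta>)"
    using local_expand[OF assms] by blast
  have i: "integrable M (\<lambda>\<zeta>. h \<theta> * indicator (cyl S \<theta>) \<zeta>)" for \<theta>
    using assms(1) by (auto intro!: integrable_real_indicator simp: less_top[symmetric])
  show "integrable M h" by (subst h) (intro Bochner_Integration.integrable_sum i)
  have "(\<integral>\<zeta>. h \<zeta> \<partial>M) = (\<integral>\<zeta>. (\<Sum>\<theta>\<in>patterns S. h \<theta> * indicator (cyl S \<theta>) \<zeta>) \<partial>M)"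
    by (subst h) simp
  also have "\<dots> = (\<Sum>\<theta>\<in>patterns S. \<integral>\<zeta>. h \<theta> * indicator (cyl S \<theta>) \<zeta> \<partial>M)"
    by (intro Bochner_Integration.integral_sum i)
  also have "\<dots> = (\<Sum>\<theta>\<in>patterns S. h \<theta> * measure M (cyl S \<theta>))"
    using assms(1) by (intro sum.cong refl) simp
  finally show "(\<integral>\<zeta>. h \<zeta> \<partial>M) = (\<Sum>\<theta>\<in>patterns S. h \<theta> * measure M (cyl S \<theta>))" .
qed

lemma local_sets:
  assumes "finite S" "local_on S (\<lambda>\<sigma>. \<sigma> \<in> B)"
  shows "B \<in> sets M"
proof -
  have "B = (\<Union>\<theta>\<in>patterns S \<inter> B. cyl S \<theta>)"
  proof safe
    fix \<sigma> assume "\<sigma> \<in> B"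
    moreover have "(restrict \<sigma> S \<in> B) = (\<sigma> \<in> B)" by (rule local_onD[OF assms(2)]) simp
    ultimately show "\<sigma> \<in> (\<Union>\<theta>\<in>patterns S \<inter> B. cyl S \<theta>)"
      by (intro UN_I[of "restrict \<sigma> S"]) auto
  next
    fix \<sigma> \<theta> assume "\<sigma> \<in> cyl S \<theta>" "\<theta> \<in> B"
    then show "\<sigma> \<in> B" using local_onD[OF assms(2), of \<sigma> \<theta>] by (simp add: cyl_def)
  qed
  moreover have "(\<Union>\<theta>\<in>patterns S \<inter> B. cyl S \<theta>) \<in> sets M"
    using assms(1) by (intro sets.finite_UN) auto
  ultimately show ?thesis by simp
qed

lemma measure_local:
  assumes "finite S" "local_on S (\<lambda>\<sigma>. \<sigma> \<in> B)"
  shows "measure M B = (\<Sum>\<theta>\<in>patterns S. indicator B \<theta> * measure M (cyl S \<theta>))"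
proof -
  have "local_on S (indicator B :: _ \<Rightarrow> real)"
  proof (rule local_onI)
    fix \<sigma> \<tau> :: "('d, 'a) config" assume "\<And>y. y \<in> S \<Longrightarrow> \<sigma> y = \<tau> y"
    then show "indicator B \<sigma> = (indicator B \<tau> :: real)"
      using local_onD[OF assms(2), of \<sigma> \<tau>] by (simp add: indicator_def)
  qed
  from integral_local(2)[OF assms(1) this] show ?thesis
    using local_sets[OF assms] by simp
qed

lemma measure_cyl_Int_local:
  assumes "finite S" "finite T" "S \<inter> T = {}" "local_on T (\<lambda>\<sigma>. \<sigma> \<in> B)"
  shows "measure M (cyl S \<sigma> \<inter> B)
    = (\<Sum>\<theta>\<in>patterns T. indicator B \<theta> * measure M (cyl (S \<union> T) (override_on \<theta> \<sigma> S)))"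
proof -
  have l: "local_on (S \<union> T) (\<lambda>\<tau>. \<tau> \<in> cyl S \<sigma> \<inter> B)"
  proof (rule local_onI)
    fix \<rho> \<tau> :: "('d, 'a) config" assume e: "\<And>y. y \<in> S \<union> T \<Longrightarrow> \<rho> y = \<tau> y"
    then have "(\<rho> \<in> B) = (\<tau> \<in> B)" by (intro local_onD[OF assms(4)]) simp
    then show "(\<rho> \<in> cyl S \<sigma> \<inter> B) = (\<tau> \<in> cyl S \<sigma> \<inter> B)" using e by (auto simp: cyl_def)
  qed
  have "measure M (cyl S \<sigma> \<inter> B) = (\<Sum>\<omega>\<in>patterns (S \<union> T). indicator (cyl S \<sigma> \<inter> B) \<omega> * measure M (cyl (S \<union> T) \<omega>))"
    by (rule measure_local[OF _ l]) (use assms in simp)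
  also have "\<dots> = (\<Sum>\<theta>\<in>patterns T. \<Sum>\<eta>\<in>patterns S.
      indicator (cyl S \<sigma> \<inter> B) (override_on \<theta> \<eta> S) * measure M (cyl (S \<union> T) (override_on \<theta> \<eta> S)))"
    by (rule sum_patterns_Un[OF assms(1-3)])
  also have "\<dots> = (\<Sum>\<theta>\<in>patterns T. indicator B \<theta> * measure M (cyl (S \<union> T) (override_on \<theta> \<sigma> S)))"
  proof (rule sum.cong[OF refl])
    fix \<theta> :: "('d, 'a) config" assume "\<theta> \<in> patterns T"
    have "indicator (cyl S \<sigma> \<inter> B) (override_on \<theta> \<eta> S) * measure M (cyl (S \<union> T) (override_on \<theta> \<eta> S))
      = (if \<eta> = restrict \<sigma> S then indicator B \<theta> * measure M (cyl (S \<union> T) (override_on \<theta> \<sigma> S)) else 0)"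
      if \<eta>: "\<eta> \<in> patterns S" for \<eta> :: "('d, 'a) config"
    proof -
      have B: "override_on \<theta> \<eta> S \<in> B \<longleftrightarrow> \<theta> \<in> B"
        using assms(3) by (intro local_onD[OF assms(4)]) (auto simp: override_on_def)
      have c: "override_on \<theta> \<eta> S \<in> cyl S \<sigma> \<longleftrightarrow> \<eta> = restrict \<sigma> S"
        using \<eta> by (auto simp: cyl_def intro: patterns_eqI[of _ S])
      have e: "override_on \<theta> (restrict \<sigma> S) S = override_on \<theta> \<sigma> S"
        by (auto simp: override_on_def)
      show ?thesis using B c e by (auto simp: indicator_def)
    qed
    then have "(\<Sum>\<eta>\<in>patterns S. indicator (cyl S \<sigma> \<inter> B) (override_on \<theta> \<eta> S) * measure M (cyl (S \<union> T) (override_on \<theta> \<eta> S)))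
      = (\<Sum>\<eta>\<in>patterns S. if \<eta> = restrict \<sigma> S then indicator B \<theta> * measure M (cyl (S \<union> T) (override_on \<theta> \<sigma> S)) else 0)"
      by (rule sum.cong[OF refl])
    then show "(\<Sum>\<eta>\<in>patterns S. indicator (cyl S \<sigma> \<inter> B) (override_on \<theta> \<eta> S) * measure M (cyl (S \<union> T) (override_on \<theta> \<eta> S)))
      = indicator B \<theta> * measure M (cyl (S \<union> T) (override_on \<theta> \<sigma> S))"
      using assms(1) by simp
  qed
  finally show ?thesis .
qed

lemma sum_measure_cyl_Int:
  assumes "finite S" "B \<in> sets M"
  shows "(\<Sum>\<eta>\<in>patterns S. measure M (cyl S \<eta> \<inter> B)) = measure M B"
proof -
  have "(\<Sum>\<eta>\<in>patterns S. measure M (cyl S \<eta> \<inter> B)) = measure M (\<Union>\<eta>\<in>patterns S. cyl S \<eta> \<inter> B)"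
  proof (rule finite_measure_finite_Union[symmetric])
    show "disjoint_family_on (\<lambda>\<eta>. cyl S \<eta> \<inter> B) (patterns S)"
      unfolding disjoint_family_on_def
    proof (intro ballI impI)
      fix \<eta> \<theta> :: "('d, 'a) config" assume "\<eta> \<in> patterns S" "\<theta> \<in> patterns S" "\<eta> \<noteq> \<theta>"
      then show "cyl S \<eta> \<inter> B \<inter> (cyl S \<theta> \<inter> B) = {}"
        using cylinder_eq_cyl[of \<eta> S] cylinder_eq_cyl[of \<theta> S] by (auto simp: cylinder_def)
    qed
  qed (use assms in auto)
  also have "(\<Union>\<eta>\<in>patterns S. cyl S \<eta> \<inter> B) = B"
  proof safe
    fix \<sigma> assume "\<sigma> \<in> B"
    then show "\<sigma> \<in> (\<Union>\<eta>\<in>patterns S. cyl S \<eta> \<inter> B)"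
      by (intro UN_I[of "restrict \<sigma> S"]) auto
  qed
  finally show ?thesis .
qed

end

lemma config_measure_eqI:
  fixes M N :: "('d::finite, 'a::finite) config measure"
  assumes "config_prob M" "config_prob N"
    and "\<And>S \<sigma>. finite S \<Longrightarrow> measure M (cyl S \<sigma>) = measure N (cyl S \<sigma>)"
  shows "M = N"
proof -
  interpret M: config_prob M by fact
  interpret N: config_prob N by fact
  let ?C = "insert {} {cyl S \<sigma> | S \<sigma>. finite S \<and> S \<subseteq> UNIV} :: ('d, 'a) config set set"
  have C: "sigma_sets UNIV ?C = sigma_sets UNIV {cyl S \<sigma> | S \<sigma>. finite S}"
    by (intro sigma_sets_eqI) (auto intro: sigma_sets.Basic sigma_sets.Empty)
  show ?thesis
  proof (rule measure_eqI_generator_eq[where E = ?C and \<Omega> = UNIV and A = "\<lambda>_. UNIV"])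
    show "Int_stable ?C" by (rule Int_stable_cyls)
    show "emeasure M X = emeasure N X" if "X \<in> ?C" for X
      using that assms(3) by (auto simp: M.emeasure_eq_measure N.emeasure_eq_measure)
    show "sets M = sigma_sets UNIV ?C" unfolding C M.sets_M sets_config_space ..
    show "sets N = sigma_sets UNIV ?C" unfolding C N.sets_M sets_config_space ..
    have "UNIV \<in> ?C"
      by (intro insertI2 CollectI exI[of _ "{}"] exI[of _ undefined]) simp
    then show "range (\<lambda>_::nat. UNIV) \<subseteq> ?C" unfolding image_subset_iff by (rule ballI)
  qed (auto simp: M.emeasure_eq_measure)
qed

section \<open>The DLR equations in terms of cylinder probabilities\<close>

lemma sets_field_on:
  "sets (field_on V :: ('d::finite, 'a::finite) config measure)
    = sigma_sets UNIV (insert {} {cyl S \<sigma> | S \<sigma>. finite S \<and> S \<subseteq> V})" (is "_ = sigma_sets UNIV ?C")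
proof -
  let ?G = "{{\<sigma> :: ('d, 'a) config. \<sigma> x = a} | x a. x \<in> V}"
  interpret G: sigma_algebra UNIV "sigma_sets UNIV ?G" by (rule sigma_algebra_sigma_sets) simp
  have "sigma_sets UNIV ?G = sigma_sets UNIV ?C"
  proof (rule sigma_sets_eqI)
    fix g assume "g \<in> ?G"
    then obtain x a where g: "g = {\<sigma>. \<sigma> x = a}" "x \<in> V" by blast
    then have "g = cyl {x} (\<lambda>_. a)" by (auto simp: cyl_def)
    then have "g \<in> ?C" using g(2) by blast
    then show "g \<in> sigma_sets UNIV ?C" by (rule sigma_sets.Basic)
  next
    fix c assume c: "c \<in> ?C"
    show "c \<in> sigma_sets UNIV ?G"
    proof (cases "c = {}")
      case False
      with c obtain S \<sigma> where S: "c = cyl S \<sigma>" "finite S" "S \<subseteq> V" by blast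
      have "(\<Inter>x\<in>S. {\<tau>. \<tau> x = \<sigma> x}) \<in> sigma_sets UNIV ?G" if "S \<noteq> {}"
        by (rule G.finite_INT) (use S that in \<open>auto intro!: sigma_sets.Basic\<close>)
      moreover have "c = (\<Inter>x\<in>S. {\<tau>. \<tau> x = \<sigma> x})" using S by (auto simp: cyl_def)
      ultimately show ?thesis using G.top S by (cases "S = {}") auto
    qed (simp add: sigma_sets.Empty)
  qed
  then show ?thesis by (simp add: field_on_def sets_measure_of_conv)
qed

lemma space_field_on [simp]: "space (field_on V) = UNIV"
  by (simp add: field_on_def space_measure_of_conv)

lemma (in config_prob) field_on_subalgebra: "finite_measure_subalgebra M (field_on V)"
proof
  have "sets (field_on V) \<subseteq> sets M"
    unfolding sets_field_on sets_M sets_config_space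
    by (rule sigma_sets_mono) (auto intro: sigma_sets.Basic sigma_sets.Empty)
  then show "subalgebra M (field_on V)" by (simp add: subalgebra_def)
qed

lemma local_on_measurable_field_on:
  fixes h :: "('d::finite, 'a::finite) config \<Rightarrow> real"
  assumes "finite S" "S \<subseteq> V" "local_on S h"
  shows "h \<in> borel_measurable (field_on V)"
proof -
  have [measurable]: "cyl S \<theta> \<in> sets (field_on V)" for \<theta>
    unfolding sets_field_on using assms by (intro sigma_sets.Basic) blast
  have h: "h = (\<lambda>\<zeta>. \<Sum>\<theta>\<in>patterns S. h \<theta> * indicator (cyl S \<theta>) \<zeta>)"
    using local_expand[OF assms(1,3)] by blast
  show ?thesis by (subst h) measurable
qed

context finite_range_interaction
begin

text \<open>The one-site DLR equation in product form: probability times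
  \<open>exp (\<beta> * energy)\<close> does not change when one symbol is changed well inside
  \<open>S\<close>. This needs neither conditional expectations nor positive probabilities, and it
  is stable under limits of cylinder probabilities.\<close>

definition dlr :: "real \<Rightarrow> ('d, 'a) config measure \<Rightarrow> bool" where
  "dlr \<beta> M \<longleftrightarrow> (\<forall>S x \<sigma> a. finite S \<longrightarrow> nbhd r {x} \<subseteq> S \<longrightarrow>
     measure M (cyl S (\<sigma>(x := a))) * exp (\<beta> * energy S (\<sigma>(x := a)))
       = measure M (cyl S \<sigma>) * exp (\<beta> * energy S \<sigma>))"

text \<open>The sites of \<Lambda> are changed one at a time, each change preserving the product of
  probability and Boltzmann factor.\<close>

lemma dlr_many_sites:
  assumes "dlr \<beta> M" "finite \<Lambda>" "finite S" "nbhd r \<Lambda> \<subseteq> S" "\<And>y. y \<notin> \<Lambda> \<Longrightarrow> \<sigma> y = \<tau> y"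
  shows "measure M (cyl S \<sigma>) * exp (\<beta> * energy S \<sigma>) = measure M (cyl S \<tau>) * exp (\<beta> * energy S \<tau>)"
  using assms(2,4,5)
proof (induction \<Lambda> arbitrary: \<sigma>)
  case empty
  then have "\<sigma> = \<tau>" by auto
  then show ?case by simp
next
  case (insert x \<Lambda>)
  have n: "nbhd r {x} \<subseteq> S" "nbhd r \<Lambda> \<subseteq> S"
    using insert.prems(1) nbhd_Un[of r "{x}" \<Lambda>] by auto
  have "measure M (cyl S (\<sigma>(x := \<tau> x))) * exp (\<beta> * energy S (\<sigma>(x := \<tau> x)))
      = measure M (cyl S \<sigma>) * exp (\<beta> * energy S \<sigma>)"
    using assms(1,3) n(1) unfolding dlr_def by blast
  moreover have "measure M (cyl S (\<sigma>(x := \<tau> x))) * exp (\<beta> * energy S (\<sigma>(x := \<tau> x)))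
      = measure M (cyl S \<tau>) * exp (\<beta> * energy S \<tau>)"
    by (rule insert.IH) (use n insert.prems(2) in auto)
  ultimately show ?case by simp
qed

lemma config_prob_gibbs: "gibbs_measure V M \<Longrightarrow> config_prob M"
  by (simp add: gibbs_measure_def config_prob_def config_prob_axioms_def)

text \<open>On the event that the configuration agrees with \<sigma> on \<open>S - {x}\<close> the
  one-site kernel is constant, so integrating the conditional expectation over that event gives an
  exact formula. The normalizer and the probability of the event are the same for both symbols and
  cancel.\<close>

lemma gibbs_imp_dlr:
  assumes "gibbs_measure (scale_interaction \<beta> U) M"
  shows "dlr \<beta> M"
  unfolding dlr_def
proof (intro allI impI)
  fix S :: "(int ^ 'd) set" and x and \<sigma> :: "('d, 'a) config" and a
  assume S: "finite S" "nbhd r {x} \<subseteq> S"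
  interpret config_prob M using assms by (rule config_prob_gibbs)
  interpret F: finite_measure_subalgebra M "field_on (- {x})" by (rule field_on_subalgebra)
  have xS: "x \<in> S" using S(2) subset_nbhd[OF r_nonneg, of "{x}"] by auto
  define B where "B = cyl (S - {x}) \<sigma>"
  define Z where "Z = (\<Sum>\<eta>'\<in>patterns {x}. exp (- hamiltonian (scale_interaction \<beta> U) {x} \<sigma> \<eta>'))"
  have Z: "Z > 0" unfolding Z_def by (intro sum_pos) auto
  have B: "B \<in> sets (field_on (- {x}))" unfolding sets_field_on B_def
    using S(1) by (intro sigma_sets.Basic) blast
  \<comment> \<open>On \<open>B\<close> all sites of \<open>S\<close> other than \<open>x\<close>
    are frozen and \<open>S\<close> contains the whole interaction neighbourhood of
    \<open>x\<close>, so the Hamiltonian does not depend on the choice of \<zeta>.\<close>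
  have ham: "hamiltonian (scale_interaction \<beta> U) {x} \<zeta> \<eta>
      = \<beta> * (energy S (\<sigma>(x := \<eta> x)) - energy (S - {x}) \<sigma>)" if "\<zeta> \<in> B" for \<zeta> \<eta>
  proof -
    have e: "\<zeta> y = \<sigma> y" if "y \<in> S" "y \<noteq> x" for y using that \<open>\<zeta> \<in> B\<close> by (auto simp: B_def cyl_def)
    have "energy S (override_on \<zeta> \<eta> {x}) = energy S (\<sigma>(x := \<eta> x))"
      "energy (S - {x}) \<zeta> = energy (S - {x}) \<sigma>"
      using S(1) e by (auto intro!: energy_cong simp: override_on_def)
    then show ?thesis using hamiltonian_eq[of "{x}" S \<beta> \<zeta> \<eta>] S by simp
  qed
  have main: "measure M (cyl S (\<sigma>(x := b))) * exp (\<beta> * energy S (\<sigma>(x := b)))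
      = exp (\<beta> * energy (S - {x}) \<sigma>) / Z * measure M B" for b
  proof -
    define \<eta> where "\<eta> = restrict (\<sigma>(x := b)) {x}"
    have \<eta>: "\<eta> \<in> patterns {x}" "\<eta> x = b" by (auto simp: \<eta>_def)
    let ?C = "cylinder {x} \<eta>"
    have [measurable]: "?C \<in> sets M" using cylinder_eq_cyl[OF \<eta>(1)] by simp
    have BM [measurable]: "B \<in> sets M" using S(1) by (simp add: B_def)
    have "AE \<zeta> in M. real_cond_exp M (field_on (- {x})) (indicator ?C) \<zeta> =
        exp (- hamiltonian (scale_interaction \<beta> U) {x} \<zeta> \<eta>) /
        (\<Sum>\<eta>'\<in>patterns {x}. exp (- hamiltonian (scale_interaction \<beta> U) {x} \<zeta> \<eta>'))"
      using assms \<eta>(1) unfolding gibbs_measure_def finite_subsets_def by auto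
    then have ae: "AE \<zeta> in M. indicator B \<zeta> *\<^sub>R real_cond_exp M (field_on (- {x})) (indicator ?C) \<zeta>
        = indicator B \<zeta> * (exp (- (\<beta> * (energy S (\<sigma>(x := b)) - energy (S - {x}) \<sigma>))) / Z)"
    proof eventually_elim
      case (elim \<zeta>)
      show ?case
      proof (cases "\<zeta> \<in> B")
        case True
        have "\<sigma> \<in> B" by (simp add: B_def)
        then show ?thesis using True by (simp add: elim ham \<eta>(2) Z_def)
      qed simp
    qed
    have int: "integrable M (indicator ?C :: _ \<Rightarrow> real)"
      by (rule integrable_real_indicator) (auto simp: less_top[symmetric])
    have "measure M (?C \<inter> B) = (\<integral>\<zeta>\<in>B. indicator ?C \<zeta> \<partial>M)"
    proof -
      have "(\<lambda>\<zeta>. indicator B \<zeta> *\<^sub>R (indicator ?C \<zeta> :: real)) = indicator (?C \<inter> B)"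
        by (auto simp: fun_eq_iff indicator_def)
      then show ?thesis unfolding set_lebesgue_integral_def by simp
    qed
    also have "\<dots> = (\<integral>\<zeta>\<in>B. real_cond_exp M (field_on (- {x})) (indicator ?C) \<zeta> \<partial>M)"
      by (rule F.real_cond_exp_intA[OF int B])
    also have "\<dots> = (\<integral>\<zeta>. indicator B \<zeta> * (exp (- (\<beta> * (energy S (\<sigma>(x := b)) - energy (S - {x}) \<sigma>))) / Z) \<partial>M)"
      unfolding set_lebesgue_integral_def
      by (rule integral_cong_AE) (use ae in simp_all)
    also have "\<dots> = measure M B * (exp (- (\<beta> * (energy S (\<sigma>(x := b)) - energy (S - {x}) \<sigma>))) / Z)"
      by simp
    also have "?C \<inter> B = cyl S (\<sigma>(x := b))"
      unfolding cylinder_eq_cyl[OF \<eta>(1)] B_def using xS by (auto simp: cyl_def \<eta>(2))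
    finally have "measure M (cyl S (\<sigma>(x := b)))
        = measure M B * (exp (- (\<beta> * (energy S (\<sigma>(x := b)) - energy (S - {x}) \<sigma>))) / Z)" .
    moreover have "exp (- (\<beta> * (e - c))) * exp (\<beta> * e) = exp (\<beta> * c)" for e c
      by (simp add: exp_add[symmetric] algebra_simps)
    ultimately show ?thesis by (simp add: mult.assoc)
  qed
  show "measure M (cyl S (\<sigma>(x := a))) * exp (\<beta> * energy S (\<sigma>(x := a)))
      = measure M (cyl S \<sigma>) * exp (\<beta> * energy S \<sigma>)"
    using main[of a] main[of "\<sigma> x"] by simp
qed

text \<open>The Gibbs kernel \<open>g\<close> is a local function of the configuration outside
  \<Lambda>. That it is a version of the conditional probability is checked on cylinders off
  \<Lambda>, where it is finite algebra, and extended to their sigma-field.\<close>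

lemma dlr_imp_gibbs:
  assumes "config_prob M" "dlr \<beta> M" "\<And>x. distr M M (shift x) = M"
  shows "gibbs_measure (scale_interaction \<beta> U) M"
proof -
  interpret config_prob M by fact
  have "AE \<zeta> in M. real_cond_exp M (field_on (- \<Lambda>)) (indicator (cylinder \<Lambda> \<eta>)) \<zeta> =
        exp (- hamiltonian (scale_interaction \<beta> U) \<Lambda> \<zeta> \<eta>) /
        (\<Sum>\<eta>'\<in>patterns \<Lambda>. exp (- hamiltonian (scale_interaction \<beta> U) \<Lambda> \<zeta> \<eta>'))"
    if \<Lambda>: "\<Lambda> \<in> finite_subsets" and \<eta>: "\<eta> \<in> patterns \<Lambda>" for \<Lambda> \<eta>
  proof -
    interpret F: finite_measure_subalgebra M "field_on (- \<Lambda>)" by (rule field_on_subalgebra)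
    have fin: "finite \<Lambda>" using \<Lambda> by (simp add: finite_subsets_def)
    let ?h = "hamiltonian (scale_interaction \<beta> U) \<Lambda>"
    define g where "g \<zeta> = exp (- ?h \<zeta> \<eta>) / (\<Sum>\<eta>'\<in>patterns \<Lambda>. exp (- ?h \<zeta> \<eta>'))" for \<zeta>
    have \<Lambda>n: "\<Lambda> \<subseteq> nbhd r \<Lambda>" by (rule subset_nbhd[OF r_nonneg])
    have hloc: "?h \<zeta> \<theta> = ?h \<zeta>' \<theta>" if "\<And>y. y \<in> nbhd r \<Lambda> - \<Lambda> \<Longrightarrow> \<zeta> y = \<zeta>' y" for \<zeta> \<zeta>' \<theta>
    proof -
      have "energy (nbhd r \<Lambda>) (override_on \<zeta> \<theta> \<Lambda>) = energy (nbhd r \<Lambda>) (override_on \<zeta>' \<theta> \<Lambda>)"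
        "energy (nbhd r \<Lambda> - \<Lambda>) \<zeta> = energy (nbhd r \<Lambda> - \<Lambda>) \<zeta>'"
        using fin that by (auto intro!: energy_cong simp: override_on_def)
      then show ?thesis using hamiltonian_eq[OF fin finite_nbhd[OF fin] order_refl] by simp
    qed
    have gloc: "local_on (nbhd r \<Lambda> - \<Lambda>) g"
    proof (rule local_onI)
      fix \<zeta> \<zeta>' :: "('d, 'a) config" assume "\<And>y. y \<in> nbhd r \<Lambda> - \<Lambda> \<Longrightarrow> \<zeta> y = \<zeta>' y"
      then have "?h \<zeta> \<theta> = ?h \<zeta>' \<theta>" for \<theta> by (rule hloc)
      then show "g \<zeta> = g \<zeta>'" by (simp add: g_def)
    qed
    have gM: "integrable M g" using gloc fin by (intro integral_local(1)) auto
    have gF: "g \<in> borel_measurable (field_on (- \<Lambda>))"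
      using gloc fin by (intro local_on_measurable_field_on) auto
    let ?C = "cylinder \<Lambda> \<eta>"
    have C: "?C = cyl \<Lambda> \<eta>" by (rule cylinder_eq_cyl[OF \<eta>])
    have CM [measurable]: "?C \<in> sets M" using C fin by simp
    have int: "integrable M (indicator ?C :: _ \<Rightarrow> real)"
      by (rule integrable_real_indicator) (auto simp: less_top[symmetric])
    have on_cyl: "(\<integral>\<zeta>\<in>cyl T \<sigma>. indicator ?C \<zeta> \<partial>M) = (\<integral>\<zeta>\<in>cyl T \<sigma>. g \<zeta> \<partial>M)"
      if T: "finite T" "T \<subseteq> - \<Lambda>" for T \<sigma>
    proof -
      \<comment> \<open>Both the cylinder over \<open>T\<close> and the kernel are determined by the
        pattern on \<open>R\<close>, and \<open>R\<close> surrounds \<Lambda>, so the DLR equation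
        can be applied on the union of \<Lambda> and \<open>R\<close>.\<close>
      define R where "R = (nbhd r \<Lambda> - \<Lambda>) \<union> T"
      have R: "finite R" "\<Lambda> \<inter> R = {}" "T \<subseteq> R" "nbhd r \<Lambda> \<subseteq> \<Lambda> \<union> R"
        using fin T by (auto simp: R_def)
      have lT: "local_on R (\<lambda>\<tau>. \<tau> \<in> cyl T \<sigma>)"
      proof (rule local_onI)
        fix \<rho> \<tau> :: "('d, 'a) config" assume "\<And>y. y \<in> R \<Longrightarrow> \<rho> y = \<tau> y"
        then have "\<rho> y = \<tau> y" if "y \<in> T" for y using R(3) that by blast
        then show "(\<rho> \<in> cyl T \<sigma>) = (\<tau> \<in> cyl T \<sigma>)" by (simp add: cyl_def)
      qed
      have lg: "local_on R (\<lambda>\<zeta>. indicator (cyl T \<sigma>) \<zeta> * g \<zeta>)"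
      proof (rule local_onI)
        fix \<zeta> \<zeta>' :: "('d, 'a) config" assume e: "\<And>y. y \<in> R \<Longrightarrow> \<zeta> y = \<zeta>' y"
        then have "g \<zeta> = g \<zeta>'" by (intro local_onD[OF gloc]) (auto simp: R_def)
        moreover have "\<zeta> \<in> cyl T \<sigma> \<longleftrightarrow> \<zeta>' \<in> cyl T \<sigma>" by (rule local_onD[OF lT e])
        ultimately show "indicator (cyl T \<sigma>) \<zeta> * g \<zeta> = indicator (cyl T \<sigma>) \<zeta>' * g \<zeta>'"
          by (simp add: indicator_def)
      qed
      \<comment> \<open>The DLR equation expresses all probabilities with the same surroundings
        through one of them; summing over the patterns of \<Lambda> produces the normalizer of
        \<open>g\<close>.\<close>
      have key: "measure M (cyl (\<Lambda> \<union> R) (override_on \<theta> \<eta> \<Lambda>)) = g \<theta> * measure M (cyl R \<theta>)" for \<theta>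
      proof -
        let ?p = "\<lambda>\<eta>'. measure M (cyl (\<Lambda> \<union> R) (override_on \<theta> \<eta>' \<Lambda>))"
        let ?e = "\<lambda>\<eta>'. \<beta> * energy (\<Lambda> \<union> R) (override_on \<theta> \<eta>' \<Lambda>)"
        have d: "?p \<eta>' = ?p \<eta> * exp (?e \<eta>) * exp (- ?e \<eta>')" for \<eta>'
        proof -
          have "?p \<eta>' * exp (?e \<eta>') = ?p \<eta> * exp (?e \<eta>)"
            by (rule dlr_many_sites[OF assms(2) fin]) (use fin R in \<open>auto simp: override_on_def\<close>)
          then show ?thesis by (simp add: exp_minus field_simps)
        qed
        have "measure M (cyl R \<theta>) = (\<Sum>\<eta>'\<in>patterns \<Lambda>. measure M (cyl \<Lambda> \<eta>' \<inter> cyl R \<theta>))"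
          by (rule sum_measure_cyl_Int[symmetric]) (use fin R in auto)
        also have "\<dots> = (\<Sum>\<eta>'\<in>patterns \<Lambda>. ?p \<eta>')"
        proof (intro sum.cong refl arg_cong[of _ _ "measure M"])
          fix \<eta>' :: "('d, 'a) config"
          show "cyl \<Lambda> \<eta>' \<inter> cyl R \<theta> = cyl (\<Lambda> \<union> R) (override_on \<theta> \<eta>' \<Lambda>)"
            by (rule cyl_Int) (use R(2) in \<open>auto simp: cyl_def override_on_def\<close>)
        qed
        also have "\<dots> = ?p \<eta> * exp (?e \<eta>) * (\<Sum>\<eta>'\<in>patterns \<Lambda>. exp (- ?e \<eta>'))"
          unfolding sum_distrib_left by (intro sum.cong refl d)
        finally have m: "measure M (cyl R \<theta>) = ?p \<eta> * exp (?e \<eta>) * (\<Sum>\<eta>'\<in>patterns \<Lambda>. exp (- ?e \<eta>'))" .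
        define c where "c = \<beta> * energy ((\<Lambda> \<union> R) - \<Lambda>) \<theta>"
        have h: "exp (- ?h \<theta> \<eta>') = exp c * exp (- ?e \<eta>')" for \<eta>'
          using hamiltonian_eq[OF fin, of "\<Lambda> \<union> R" \<beta> \<theta> \<eta>'] fin R
          by (simp add: c_def right_diff_distrib exp_add[symmetric])
        have "0 < (\<Sum>\<eta>'\<in>patterns \<Lambda>. exp (- ?e \<eta>'))" using fin by (intro sum_pos) auto
        then show ?thesis
          unfolding m g_def h sum_distrib_left[symmetric] by (simp add: exp_minus field_simps)
      qed
      have "(\<integral>\<zeta>\<in>cyl T \<sigma>. indicator ?C \<zeta> \<partial>M) = measure M (cyl \<Lambda> \<eta> \<inter> cyl T \<sigma>)"
      proof -
        have "(\<lambda>\<zeta>. indicator (cyl T \<sigma>) \<zeta> *\<^sub>R (indicator ?C \<zeta> :: real)) = indicator (cyl \<Lambda> \<eta> \<inter> cyl T \<sigma>)"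
          by (auto simp: fun_eq_iff indicator_def C)
        then show ?thesis unfolding set_lebesgue_integral_def by simp
      qed
      also have "\<dots> = (\<Sum>\<theta>\<in>patterns R. indicator (cyl T \<sigma>) \<theta> * measure M (cyl (\<Lambda> \<union> R) (override_on \<theta> \<eta> \<Lambda>)))"
        by (rule measure_cyl_Int_local[OF fin R(1,2) lT])
      also have "\<dots> = (\<Sum>\<theta>\<in>patterns R. indicator (cyl T \<sigma>) \<theta> * g \<theta> * measure M (cyl R \<theta>))"
        by (simp add: key mult.assoc)
      also have "\<dots> = (\<integral>\<zeta>. indicator (cyl T \<sigma>) \<zeta> * g \<zeta> \<partial>M)"
        by (rule integral_local(2)[OF R(1) lg, symmetric])
      finally show ?thesis by (simp add: set_lebesgue_integral_def)
    qed
    have all: "(\<integral>\<zeta>\<in>A. indicator ?C \<zeta> \<partial>M) = (\<integral>\<zeta>\<in>A. g \<zeta> \<partial>M)" if "A \<in> sets (field_on (- \<Lambda>))" for A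
    proof -
      let ?G = "insert {} {cyl S \<sigma> | S \<sigma>. finite S \<and> S \<subseteq> - \<Lambda>} :: ('d, 'a) config set set"
      have inM: "A \<in> sets M" if "A \<in> sigma_sets UNIV ?G" for A
        using F.subalg that unfolding subalgebra_def sets_field_on by auto
      have si: "set_integrable M A f" if "integrable M f" "A \<in> sigma_sets UNIV ?G" for A and f :: "_ \<Rightarrow> real"
        unfolding set_integrable_def using inM[OF that(2)] that(1) by (rule integrable_mult_indicator)
      have U: "(\<integral>\<zeta>\<in>UNIV. indicator ?C \<zeta> \<partial>M) = (\<integral>\<zeta>\<in>UNIV. g \<zeta> \<partial>M)"
        using on_cyl[of "{}" undefined] by simp
      have A: "A \<in> sigma_sets UNIV ?G" using that by (simp add: sets_field_on)
      have G: "?G \<subseteq> Pow UNIV" by simp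
      \<comment> \<open>The sets on which both integrals agree are closed under complements and
        countable disjoint unions, and they contain the intersection-stable class of
        cylinders.\<close>
      from Int_stable_cyls[of "- \<Lambda>"] G A show ?thesis
      proof (induction rule: sigma_sets_induct_disjoint)
        case (basic A)
        then show ?case using on_cyl by (auto simp: set_lebesgue_integral_def)
      next
        case (compl A)
        have "(\<integral>\<zeta>\<in>UNIV - A. f \<zeta> \<partial>M) = (\<integral>\<zeta>\<in>UNIV. f \<zeta> \<partial>M) - (\<integral>\<zeta>\<in>A. f \<zeta> \<partial>M)"
          if f: "integrable M f" for f :: "_ \<Rightarrow> real"
        proof -
          have "(\<integral>\<zeta>\<in>A \<union> (UNIV - A). f \<zeta> \<partial>M) = (\<integral>\<zeta>\<in>A. f \<zeta> \<partial>M) + (\<integral>\<zeta>\<in>UNIV - A. f \<zeta> \<partial>M)"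
            using compl(1) by (intro set_integral_Un si[OF f] sigma_sets.Compl) auto
          moreover have "A \<union> (UNIV - A) = UNIV" by auto
          ultimately show ?thesis by simp
        qed
        then show ?case using U compl int gM by simp
      next
        case (union A)
        have "(\<integral>\<zeta>\<in>(\<Union>i. A i). f \<zeta> \<partial>M) = (\<Sum>i. \<integral>\<zeta>\<in>A i. f \<zeta> \<partial>M)" if f: "integrable M f" for f :: "_ \<Rightarrow> real"
        proof (rule lebesgue_integral_countable_add)
          show "\<And>i. A i \<in> sets M" using union(2) by (intro inM) auto
          show "\<And>i j. i \<noteq> j \<Longrightarrow> A i \<inter> A j = {}" using union(1) by (auto simp: disjoint_family_on_def)
          show "set_integrable M (\<Union>i. A i) f" using union(2) by (intro si[OF f] sigma_sets.Union) auto
        qed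
        then show ?case using union(3) int gM by simp
      qed (simp add: set_lebesgue_integral_def)
    qed
    show ?thesis
      using F.real_cond_exp_charact[OF all int gM gF] by (simp add: g_def)
  qed
  then show ?thesis
    using assms(3) by (simp add: gibbs_measure_def prob_space_axioms sets_M)
qed

end

section \<open>Dobrushin's contraction argument\<close>

definition osc_bound :: "(('d::finite, 'a::finite) config \<Rightarrow> real) \<Rightarrow> (int ^ 'd \<Rightarrow> real) \<Rightarrow> bool" where
  "osc_bound f D \<longleftrightarrow> (\<forall>\<sigma> x a. \<bar>f (\<sigma>(x := a)) - f \<sigma>\<bar> \<le> D x)"

text \<open>Dobrushin's estimate: \<open>c\<close> weights the one-site oscillations of the test
  function. The expectations are arbitrary functionals, so that integrals and finite-volume means
  are treated alike.\<close>

definition comparable ::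
  "((('d::finite, 'a::finite) config \<Rightarrow> real) \<Rightarrow> real) \<Rightarrow> ((('d, 'a) config \<Rightarrow> real) \<Rightarrow> real) \<Rightarrow> (int ^ 'd \<Rightarrow> real) \<Rightarrow> bool" where
  "comparable E E' c \<longleftrightarrow> (\<forall>S f D. finite S \<longrightarrow> local_on S f \<longrightarrow> osc_bound f D \<longrightarrow>
     \<bar>E f - E' f\<bar> \<le> (\<Sum>x\<in>S. c x * D x))"

text \<open>The property of an expectation that yields the initial, crude comparison: an average
  stays within any interval that contains all values.\<close>

definition mean_like :: "((('d::finite, 'a::finite) config \<Rightarrow> real) \<Rightarrow> real) \<Rightarrow> bool" where
  "mean_like E \<longleftrightarrow> (\<forall>S f c b. finite S \<longrightarrow> local_on S f \<longrightarrow> (\<forall>\<sigma>. \<bar>f \<sigma> - c\<bar> \<le> b) \<longrightarrow> \<bar>E f - c\<bar> \<le> b)"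

lemma osc_bound_nonneg: "osc_bound f D \<Longrightarrow> 0 \<le> D x"
  unfolding osc_bound_def by (metis abs_ge_zero order_trans)

text \<open>Telescoping: the second configuration is turned into the first by changing the sites of
  \<open>S\<close> one by one.\<close>

lemma osc_bound_sum:
  fixes f :: "('d::finite, 'a::finite) config \<Rightarrow> real"
  assumes "finite S" "local_on S f" "osc_bound f D"
  shows "\<bar>f \<sigma> - f \<tau>\<bar> \<le> (\<Sum>x\<in>S. D x)"
proof -
  have "\<bar>f (override_on \<tau> \<sigma> T) - f \<tau>\<bar> \<le> (\<Sum>x\<in>T. D x)" if "finite T" for T
    using that
  proof (induction T rule: finite_induct)
    case (insert x T)
    have e: "override_on \<tau> \<sigma> (insert x T) = (override_on \<tau> \<sigma> T)(x := \<sigma> x)"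
      by (auto simp: override_on_def)
    have "\<bar>f ((override_on \<tau> \<sigma> T)(x := \<sigma> x)) - f (override_on \<tau> \<sigma> T)\<bar> \<le> D x"
      using assms(3) unfolding osc_bound_def by blast
    moreover have "(\<Sum>y\<in>insert x T. D y) = D x + (\<Sum>y\<in>T. D y)" using insert.hyps by simp
    ultimately show ?case using insert.IH unfolding e by linarith
  qed simp
  moreover have "f (override_on \<tau> \<sigma> S) = f \<sigma>" by (rule local_onD[OF assms(2)]) simp
  ultimately show ?thesis using assms(1) by metis
qed

lemma osc_bound_exists:
  fixes f :: "('d::finite, 'a::finite) config \<Rightarrow> real"
  assumes "finite S" "local_on S f"
  obtains D where "osc_bound f D"
proof -
  define c where "c = (\<Sum>\<theta>\<in>patterns S. \<bar>f \<theta>\<bar>)"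
  have "\<bar>f \<sigma>\<bar> \<le> c" for \<sigma>
  proof -
    have "f \<sigma> = f (restrict \<sigma> S)" by (rule local_onD[OF assms(2)]) simp
    moreover have "\<bar>f (restrict \<sigma> S)\<bar> \<le> c"
      unfolding c_def
      by (rule member_le_sum[where f = "\<lambda>\<theta>. \<bar>f \<theta>\<bar>"]) (simp_all only: restrict_in_patterns patterns_finite assms(1) abs_ge_zero)
    ultimately show ?thesis by simp
  qed
  note c = this
  have "\<bar>f (\<sigma>(x := a)) - f \<sigma>\<bar> \<le> 2 * c" for \<sigma> x a
    using c[of \<sigma>] c[of "\<sigma>(x := a)"] by linarith
  then have "osc_bound f (\<lambda>_. 2 * c)" by (simp add: osc_bound_def)
  then show ?thesis by (rule that)
qed

lemma comparable_mono:
  fixes E E' :: "(('d::finite, 'a::finite) config \<Rightarrow> real) \<Rightarrow> real"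
  assumes "comparable E E' c" "\<And>x. c x \<le> c' x"
  shows "comparable E E' c'"
  unfolding comparable_def
proof (intro allI impI)
  fix S :: "(int ^ 'd) set" and f :: "('d, 'a) config \<Rightarrow> real" and D
  assume *: "finite S" "local_on S f" "osc_bound f D"
  then have "\<bar>E f - E' f\<bar> \<le> (\<Sum>x\<in>S. c x * D x)" using assms(1) unfolding comparable_def by blast
  also have "\<dots> \<le> (\<Sum>x\<in>S. c' x * D x)"
    using assms(2) osc_bound_nonneg[OF *(3)] by (intro sum_mono mult_right_mono)
  finally show "\<bar>E f - E' f\<bar> \<le> (\<Sum>x\<in>S. c' x * D x)" .
qed

lemma comparable_2:
  fixes E E' :: "(('d::finite, 'a::finite) config \<Rightarrow> real) \<Rightarrow> real"
  assumes "mean_like E" "mean_like E'"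
  shows "comparable E E' (\<lambda>_. 2)"
  unfolding comparable_def
proof (intro allI impI)
  fix S :: "(int ^ 'd) set" and f :: "('d, 'a) config \<Rightarrow> real" and D
  assume *: "finite S" "local_on S f" "osc_bound f D"
  define \<tau> :: "('d, 'a) config" where "\<tau> = undefined"
  have b: "\<forall>\<sigma>. \<bar>f \<sigma> - f \<tau>\<bar> \<le> (\<Sum>x\<in>S. D x)" using osc_bound_sum[OF *] by blast
  have "\<bar>E f - f \<tau>\<bar> \<le> (\<Sum>x\<in>S. D x)" "\<bar>E' f - f \<tau>\<bar> \<le> (\<Sum>x\<in>S. D x)"
    using assms *(1,2) b unfolding mean_like_def by blast+
  then show "\<bar>E f - E' f\<bar> \<le> (\<Sum>x\<in>S. 2 * D x)" unfolding sum_distrib_left[symmetric] by linarith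
qed

section \<open>Single-site conditional laws, heat-bath updates and their contraction\<close>

context finite_range_interaction
begin

definition site_energy :: "int ^ 'd \<Rightarrow> ('d, 'a) config \<Rightarrow> real" where
  "site_energy x \<sigma> = energy (nbhd r {x}) \<sigma> - energy (nbhd r {x} - {x}) \<sigma>"

definition site_prob :: "real \<Rightarrow> int ^ 'd \<Rightarrow> 'a \<Rightarrow> ('d, 'a) config \<Rightarrow> real" where
  "site_prob \<beta> x a \<sigma> = exp (- (\<beta> * site_energy x (\<sigma>(x := a)))) / (\<Sum>b\<in>UNIV. exp (- (\<beta> * site_energy x (\<sigma>(x := b)))))"

text \<open>The heat-bath (Gibbs sampler) operator: the symbol at \<open>x\<close> is redrawn from
  its conditional law given the rest.\<close>

definition resample :: "real \<Rightarrow> int ^ 'd \<Rightarrow> (('d, 'a) config \<Rightarrow> real) \<Rightarrow> ('d, 'a) config \<Rightarrow> real" where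
  "resample \<beta> x f \<sigma> = (\<Sum>a\<in>UNIV. site_prob \<beta> x a \<sigma> * f (\<sigma>(x := a)))"

definition invariant_at :: "real \<Rightarrow> int ^ 'd \<Rightarrow> ((('d, 'a) config \<Rightarrow> real) \<Rightarrow> real) \<Rightarrow> bool" where
  "invariant_at \<beta> x E \<longleftrightarrow> (\<forall>S f. finite S \<longrightarrow> local_on S f \<longrightarrow> E (resample \<beta> x f) = E f)"

lemma self_in_nbhd [simp]: "x \<in> nbhd r {x}"
  using subset_nbhd[OF r_nonneg, of "{x}"] by simp

lemma site_energy_eq:
  assumes "finite S" "nbhd r {x} \<subseteq> S"
  shows "energy S \<sigma> - energy (S - {x}) \<sigma> = site_energy x \<sigma>"
proof -
  have "override_on \<sigma> \<sigma> {x} = \<sigma>" by (simp add: override_on_def)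
  then show ?thesis
    using hamiltonian_eq[of "{x}" S 1 \<sigma> \<sigma>] hamiltonian_eq[of "{x}" "nbhd r {x}" 1 \<sigma> \<sigma>] assms
    by (simp add: site_energy_def)
qed

lemma abs_site_energy_le: "\<bar>site_energy x \<sigma>\<bar> \<le> K"
proof -
  let ?N = "nbhd r {x}"
  have "site_energy x \<sigma> = (\<Sum>A\<in>(Pow ?N - {{}}) - (Pow (?N - {x}) - {{}}). U A \<sigma>)"
    unfolding site_energy_def energy_def by (rule sum_diff[symmetric]) auto
  also have "\<bar>\<dots>\<bar> \<le> (\<Sum>A\<in>(Pow ?N - {{}}) - (Pow (?N - {x}) - {{}}). \<bar>U A \<sigma>\<bar>)" by (rule sum_abs)
  also have "\<dots> \<le> K"
    by (rule sum_le[of _ x]) (auto intro: finite_subset[OF _ finite_nbhd])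
  finally show ?thesis .
qed

lemma site_energy_cong: "(\<And>y. y \<in> nbhd r {x} \<Longrightarrow> \<sigma> y = \<tau> y) \<Longrightarrow> site_energy x \<sigma> = site_energy x \<tau>"
  unfolding site_energy_def by (intro arg_cong2[of _ _ _ _ minus] energy_cong) auto

lemma site_prob_cong:
  assumes "\<And>y. y \<in> nbhd r {x} - {x} \<Longrightarrow> \<sigma> y = \<tau> y"
  shows "site_prob \<beta> x a \<sigma> = site_prob \<beta> x a \<tau>"
proof -
  have "site_energy x (\<sigma>(x := b)) = site_energy x (\<tau>(x := b))" for b
    using assms by (intro site_energy_cong) auto
  then show ?thesis by (simp add: site_prob_def)
qed

lemma site_prob_nonneg: "0 \<le> site_prob \<beta> x a \<sigma>"
  unfolding site_prob_def by (intro divide_nonneg_nonneg sum_nonneg) auto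

lemma sum_exp_pos: "0 < (\<Sum>b\<in>(UNIV :: 'a set). exp (h b :: real))"
  by (intro sum_pos) auto

lemma sum_site_prob: "(\<Sum>a\<in>UNIV. site_prob \<beta> x a \<sigma>) = 1"
  unfolding site_prob_def sum_divide_distrib[symmetric]
  using sum_exp_pos[of "\<lambda>b. - (\<beta> * site_energy x (\<sigma>(x := b)))"] by simp

text \<open>Since a site energy lies between \<open>- K\<close> and \<open>K\<close>, changing the
  surroundings alters the Boltzmann factor and the normalizer each by at most
  \<open>exp (2 * \<beta> * K)\<close>.\<close>

lemma site_prob_le:
  assumes "0 \<le> \<beta>"
  shows "site_prob \<beta> x a \<sigma> \<le> exp (4 * \<beta> * K) * site_prob \<beta> x a \<tau>"
proof -
  have b: "- (\<beta> * site_energy x \<rho>) \<le> 2 * \<beta> * K + - (\<beta> * site_energy x \<rho>')" for \<rho> \<rho>'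
  proof -
    have "site_energy x \<rho>' - site_energy x \<rho> \<le> 2 * K"
      using abs_site_energy_le[of x \<rho>] abs_site_energy_le[of x \<rho>'] by linarith
    from mult_left_mono[OF this assms] show ?thesis by (simp add: algebra_simps)
  qed
  have e: "exp (- (\<beta> * site_energy x \<rho>)) \<le> exp (2 * \<beta> * K) * exp (- (\<beta> * site_energy x \<rho>'))" for \<rho> \<rho>'
    unfolding exp_add[symmetric] using b by simp
  let ?Z = "\<lambda>\<rho>. \<Sum>b\<in>UNIV. exp (- (\<beta> * site_energy x (\<rho>(x := b))))"
  have "?Z \<tau> \<le> exp (2 * \<beta> * K) * ?Z \<sigma>" unfolding sum_distrib_left by (intro sum_mono e)
  then have "inverse (?Z \<sigma>) \<le> exp (2 * \<beta> * K) * inverse (?Z \<tau>)"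
    using sum_exp_pos by (simp add: field_simps)
  then have "exp (- (\<beta> * site_energy x (\<sigma>(x := a)))) * inverse (?Z \<sigma>)
      \<le> (exp (2 * \<beta> * K) * exp (- (\<beta> * site_energy x (\<tau>(x := a))))) * (exp (2 * \<beta> * K) * inverse (?Z \<tau>))"
    by (intro mult_mono e) (auto intro!: sum_nonneg)
  moreover have "exp (4 * \<beta> * K) = exp (2 * \<beta> * K) * exp (2 * \<beta> * K)"
    by (simp add: exp_add[symmetric])
  ultimately show ?thesis by (simp add: site_prob_def divide_inverse mult_ac)
qed

text \<open>A ratio bound \<open>c\<close> in both directions gives the pointwise bound
  \<open>(c - 1)\<close> times the second probability, and these probabilities sum to 1. The result
  measures the influence of the surroundings and tends to 0 with \<beta>.\<close>

lemma sum_abs_site_prob_diff: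
  assumes "0 \<le> \<beta>"
  shows "(\<Sum>a\<in>UNIV. \<bar>site_prob \<beta> x a \<sigma> - site_prob \<beta> x a \<tau>\<bar>) \<le> exp (4 * \<beta> * K) - 1"
proof -
  have c: "1 \<le> exp (4 * \<beta> * K)" using assms K_nonneg by simp
  have "\<bar>site_prob \<beta> x a \<sigma> - site_prob \<beta> x a \<tau>\<bar> \<le> (exp (4 * \<beta> * K) - 1) * site_prob \<beta> x a \<tau>" for a
  proof -
    let ?p = "site_prob \<beta> x a \<sigma>" and ?q = "site_prob \<beta> x a \<tau>" and ?c = "exp (4 * \<beta> * K)"
    have pq: "?p \<le> ?c * ?q" "?q \<le> ?c * ?p" "0 \<le> ?p" "0 \<le> ?q"
      using site_prob_le[OF assms] site_prob_nonneg by auto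
    have "?q - ?p \<le> (?c - 1) * ?q"
    proof (cases "?p \<le> ?q")
      case True
      have "?q - ?p \<le> (?c - 1) * ?p" using pq by (simp add: algebra_simps)
      also have "\<dots> \<le> (?c - 1) * ?q" using True c by (intro mult_left_mono) auto
      finally show ?thesis .
    next
      case False
      have "0 \<le> (?c - 1) * ?q" using c pq by simp
      with False show ?thesis by linarith
    qed
    moreover have "?p - ?q \<le> (?c - 1) * ?q" using pq by (simp add: algebra_simps)
    ultimately show ?thesis by linarith
  qed
  then have "(\<Sum>a\<in>UNIV. \<bar>site_prob \<beta> x a \<sigma> - site_prob \<beta> x a \<tau>\<bar>)
      \<le> (\<Sum>a\<in>UNIV. (exp (4 * \<beta> * K) - 1) * site_prob \<beta> x a \<tau>)" by (rule sum_mono)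
  also have "\<dots> = exp (4 * \<beta> * K) - 1" by (simp add: sum_distrib_left[symmetric] sum_site_prob)
  finally show ?thesis .
qed

lemma local_on_resample:
  assumes "local_on S f"
  shows "local_on (S \<union> nbhd r {x}) (resample \<beta> x f)"
proof (rule local_onI)
  fix \<sigma> \<tau> :: "('d, 'a) config" assume e: "\<And>y. y \<in> S \<union> nbhd r {x} \<Longrightarrow> \<sigma> y = \<tau> y"
  have "site_prob \<beta> x a \<sigma> = site_prob \<beta> x a \<tau>" for a by (rule site_prob_cong) (use e in auto)
  moreover have "f (\<sigma>(x := a)) = f (\<tau>(x := a))" for a by (rule local_onD[OF assms]) (use e in auto)
  ultimately show "resample \<beta> x f \<sigma> = resample \<beta> x f \<tau>" by (simp add: resample_def)
qed

text \<open>Resampling removes the dependence on \<open>x\<close> and passes it on to the neighbours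
  through the conditional law: each inherits the old oscillation at \<open>x\<close>, multiplied by
  the influence bound.\<close>

lemma osc_bound_resample:
  assumes "0 \<le> \<beta>" "osc_bound f D"
  shows "osc_bound (resample \<beta> x f)
    (\<lambda>y. if y = x then 0 else D y + (if y \<in> nbhd r {x} then (exp (4 * \<beta> * K) - 1) * D x else 0))"
  unfolding osc_bound_def
proof (intro allI)
  fix \<sigma> y and b :: 'a
  show "\<bar>resample \<beta> x f (\<sigma>(y := b)) - resample \<beta> x f \<sigma>\<bar>
    \<le> (if y = x then 0 else D y + (if y \<in> nbhd r {x} then (exp (4 * \<beta> * K) - 1) * D x else 0))"
  proof (cases "y = x")
    case True
    have "site_prob \<beta> x a (\<sigma>(x := b)) = site_prob \<beta> x a \<sigma>" for a by (rule site_prob_cong) auto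
    then show ?thesis using True by (simp add: resample_def)
  next
    case False
    let ?p = "\<lambda>a. site_prob \<beta> x a (\<sigma>(y := b))" and ?q = "\<lambda>a. site_prob \<beta> x a \<sigma>"
    have Dx: "0 \<le> D x" by (rule osc_bound_nonneg[OF assms(2)])
    have d1: "\<bar>f (\<sigma>(y := b, x := a)) - f (\<sigma>(x := a))\<bar> \<le> D y" for a
    proof -
      have "\<sigma>(y := b, x := a) = (\<sigma>(x := a))(y := b)" using False by auto
      then show ?thesis using assms(2) unfolding osc_bound_def by metis
    qed
    have d2: "\<bar>f (\<sigma>(x := a)) - f \<sigma>\<bar> \<le> D x" for a using assms(2) unfolding osc_bound_def by blast
    \<comment> \<open>Both laws have total mass 1, so \<open>f \<sigma>\<close> may be subtracted
      under the difference of the two. Only the oscillation at \<open>x\<close> then multiplies the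
      change of the law.\<close>
    have s0: "(\<Sum>a\<in>UNIV. (?p a - ?q a) * f \<sigma>) = 0"
      by (simp add: sum_distrib_right[symmetric] sum_subtractf sum_site_prob)
    have eq: "resample \<beta> x f (\<sigma>(y := b)) - resample \<beta> x f \<sigma>
      = (\<Sum>a\<in>UNIV. ?p a * (f (\<sigma>(y := b, x := a)) - f (\<sigma>(x := a)))) + (\<Sum>a\<in>UNIV. (?p a - ?q a) * (f (\<sigma>(x := a)) - f \<sigma>))"
      unfolding resample_def using s0 by (simp add: algebra_simps sum.distrib sum_subtractf)
    have "\<bar>resample \<beta> x f (\<sigma>(y := b)) - resample \<beta> x f \<sigma>\<bar> \<le> (\<Sum>a\<in>UNIV. \<bar>?p a * (f (\<sigma>(y := b, x := a)) - f (\<sigma>(x := a)))\<bar>) + (\<Sum>a\<in>UNIV. \<bar>(?p a - ?q a) * (f (\<sigma>(x := a)) - f \<sigma>)\<bar>)"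
      unfolding eq by (rule order_trans[OF abs_triangle_ineq add_mono[OF sum_abs sum_abs]])
    also have "\<dots> \<le> (\<Sum>a\<in>UNIV. ?p a * D y) + (\<Sum>a\<in>UNIV. \<bar>?p a - ?q a\<bar> * D x)"
    proof (intro add_mono sum_mono)
      fix a
      show "\<bar>?p a * (f (\<sigma>(y := b, x := a)) - f (\<sigma>(x := a)))\<bar> \<le> ?p a * D y"
        unfolding abs_mult abs_of_nonneg[OF site_prob_nonneg] by (rule mult_left_mono[OF d1 site_prob_nonneg])
      show "\<bar>(?p a - ?q a) * (f (\<sigma>(x := a)) - f \<sigma>)\<bar> \<le> \<bar>?p a - ?q a\<bar> * D x"
        unfolding abs_mult by (rule mult_left_mono[OF d2]) simp
    qed
    also have "\<dots> = D y + (\<Sum>a\<in>UNIV. \<bar>?p a - ?q a\<bar>) * D x"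
      by (simp add: sum_distrib_right[symmetric] sum_site_prob)
    also have "(\<Sum>a\<in>UNIV. \<bar>?p a - ?q a\<bar>) * D x \<le> (if y \<in> nbhd r {x} then (exp (4 * \<beta> * K) - 1) * D x else 0)"
    proof (cases "y \<in> nbhd r {x}")
      case True
      then show ?thesis using sum_abs_site_prob_diff[OF assms(1)] Dx by (auto intro: mult_right_mono)
    next
      case False
      then have "?p a = ?q a" for a by (intro site_prob_cong) auto
      then show ?thesis using False by simp
    qed
    finally show ?thesis using False by simp
  qed
qed

text \<open>Both functionals are unchanged if \<open>f\<close> is first resampled at
  \<open>x\<close>. Applying the known estimate to the resampled function and collecting what now
  multiplies \<open>D x\<close> gives the new weight at \<open>x\<close>.\<close>

lemma comparable_step:
  fixes E E' :: "(('d, 'a) config \<Rightarrow> real) \<Rightarrow> real"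
  assumes "0 \<le> \<beta>" "comparable E E' c" "\<And>y. 0 \<le> c y" "invariant_at \<beta> x E" "invariant_at \<beta> x E'"
  shows "comparable E E' (c(x := (exp (4 * \<beta> * K) - 1) * (\<Sum>y\<in>nbhd r {x}. c y)))"
  unfolding comparable_def
proof (intro allI impI)
  fix S and f :: "('d, 'a) config \<Rightarrow> real" and D
  assume *: "finite S" "local_on S f" "osc_bound f D"
  define \<kappa> where "\<kappa> = exp (4 * \<beta> * K) - 1"
  let ?N = "nbhd r {x}"
  let ?c = "c(x := \<kappa> * (\<Sum>y\<in>?N. c y))"
  have "\<bar>E f - E' f\<bar> \<le> (\<Sum>y\<in>S. ?c y * D y)"
  proof (cases "x \<in> S")
    case False
    have "\<bar>E f - E' f\<bar> \<le> (\<Sum>y\<in>S. c y * D y)" using assms(2) * unfolding comparable_def by blast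
    also have "\<dots> = (\<Sum>y\<in>S. ?c y * D y)" using False by (intro sum.cong) auto
    finally show ?thesis .
  next
    case True
    \<comment> \<open>The resampled function lives on a larger set. Setting the oscillation to 0 off
      \<open>S\<close> prevents the added sites from contributing anything but the part inherited
      from \<open>x\<close>.\<close>
    define D0 where "D0 y = (if y \<in> S then D y else 0)" for y
    have \<kappa>: "0 \<le> \<kappa>" using assms(1) K_nonneg by (simp add: \<kappa>_def)
    have D0: "osc_bound f D0" unfolding osc_bound_def
    proof (intro allI)
      fix \<sigma> y a
      show "\<bar>f (\<sigma>(y := a)) - f \<sigma>\<bar> \<le> D0 y"
      proof (cases "y \<in> S")
        case True
        then show ?thesis using *(3) by (simp add: D0_def osc_bound_def)
      next
        case False
        then have "f (\<sigma>(y := a)) = f \<sigma>" by (intro local_onD[OF *(2)]) auto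
        then show ?thesis by (simp add: D0_def False)
      qed
    qed
    let ?D = "\<lambda>y. if y = x then 0 else D0 y + (if y \<in> ?N then \<kappa> * D0 x else 0)"
    have fin: "finite (S \<union> ?N)" using *(1) by simp
    have "\<bar>E f - E' f\<bar> = \<bar>E (resample \<beta> x f) - E' (resample \<beta> x f)\<bar>"
      using assms(4,5) * unfolding invariant_at_def by simp
    also have "\<dots> \<le> (\<Sum>y\<in>S \<union> ?N. c y * ?D y)"
      using assms(2) fin local_on_resample[OF *(2)] osc_bound_resample[OF assms(1) D0, of x, folded \<kappa>_def]
      unfolding comparable_def by blast
    also have "\<dots> \<le> (\<Sum>y\<in>S \<union> ?N. (if y = x then 0 else c y * D0 y) + (if y \<in> ?N then \<kappa> * D0 x * c y else 0))"
    proof (rule sum_mono)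
      fix y
      have "0 \<le> \<kappa> * D0 x * c y" using assms(3) \<kappa> osc_bound_nonneg[OF D0] by simp
      then show "c y * ?D y \<le> (if y = x then 0 else c y * D0 y) + (if y \<in> ?N then \<kappa> * D0 x * c y else 0)"
        by (cases "y = x") (simp_all add: algebra_simps)
    qed
    also have "\<dots> = (\<Sum>y\<in>S \<union> ?N. if y = x then 0 else c y * D0 y) + (\<Sum>y\<in>S \<union> ?N. if y \<in> ?N then \<kappa> * D0 x * c y else 0)"
      by (rule sum.distrib)
    also have "(\<Sum>y\<in>S \<union> ?N. if y = x then 0 else c y * D0 y) = (\<Sum>y\<in>S - {x}. c y * D y)"
      by (rule sum.mono_neutral_cong_right[OF fin]) (auto simp: D0_def)
    also have "(\<Sum>y\<in>S \<union> ?N. if y \<in> ?N then \<kappa> * D0 x * c y else 0) = (\<Sum>y\<in>?N. \<kappa> * D0 x * c y)"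
      by (rule sum.mono_neutral_cong_right[OF fin]) auto
    also have "\<dots> = ?c x * D x" using True by (simp add: D0_def sum_distrib_left[symmetric] mult_ac)
    also have "(\<Sum>y\<in>S - {x}. c y * D y) = (\<Sum>y\<in>S - {x}. ?c y * D y)" by (intro sum.cong) auto
    finally show ?thesis using sum.remove[OF *(1) True, of "\<lambda>y. ?c y * D y"] by linarith
  qed
  then show "\<bar>E f - E' f\<bar> \<le> (\<Sum>y\<in>S. (c(x := (exp (4 * \<beta> * K) - 1) * (\<Sum>y\<in>nbhd r {x}. c y))) y * D y)"
    by (simp only: \<kappa>_def)
qed

text \<open>Depth \<open>k\<close> demands invariance at all sites reachable from \<open>x\<close>
  by fewer than \<open>k\<close> steps of length at most \<open>r\<close>. This is what
  \<open>k\<close> rounds of contraction at \<open>x\<close> consume.\<close>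

primrec deep :: "real \<Rightarrow> ((('d, 'a) config \<Rightarrow> real) \<Rightarrow> real) \<Rightarrow> ((('d, 'a) config \<Rightarrow> real) \<Rightarrow> real) \<Rightarrow> nat \<Rightarrow> int ^ 'd \<Rightarrow> bool" where
  "deep \<beta> E E' 0 x \<longleftrightarrow> True"
| "deep \<beta> E E' (Suc k) x \<longleftrightarrow> invariant_at \<beta> x E \<and> invariant_at \<beta> x E' \<and> (\<forall>y\<in>nbhd r {x}. deep \<beta> E E' k y)"

text \<open>Dobrushin's condition with contraction factor 1/2: the ball counts the sites, including
  the centre, from which a single update collects weight.\<close>

definition high_temperature :: "real \<Rightarrow> bool" where
  "high_temperature \<beta> \<longleftrightarrow> 0 \<le> \<beta> \<and> (exp (4 * \<beta> * K) - 1) * real (card {y :: int ^ 'd. norm1 y \<le> r}) \<le> 1 / 2"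

text \<open>Induction on the depth. Neighbours of \<open>T\<close> have depth \<open>k\<close> and
  weight \<open>2 / 2 ^ k\<close>; updating every site of \<open>T\<close> once replaces its weight
  by at most half of that.\<close>

lemma comparable_deep:
  fixes E E' :: "(('d, 'a) config \<Rightarrow> real) \<Rightarrow> real"
  assumes "high_temperature \<beta>" "mean_like E" "mean_like E'"
  shows "finite T \<Longrightarrow> (\<And>x. x \<in> T \<Longrightarrow> deep \<beta> E E' k x) \<Longrightarrow> comparable E E' (\<lambda>x. if x \<in> T then 2 / 2 ^ k else 2)"
proof (induction k arbitrary: T)
  case 0
  have "(\<lambda>x. if x \<in> T then 2 / 2 ^ 0 else 2) = (\<lambda>_. 2 :: real)" by (simp add: fun_eq_iff)
  then show ?case using comparable_2[OF assms(2,3)] by (simp only:)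
next
  case (Suc k)
  have \<beta>: "0 \<le> \<beta>" "(exp (4 * \<beta> * K) - 1) * real (card (nbhd r {x})) \<le> 1 / 2" for x :: "int ^ 'd"
    using assms(1) by (auto simp: high_temperature_def card_nbhd_singleton)
  define T' where "T' = nbhd r T"
  have T': "finite T'" "\<And>x. x \<in> T' \<Longrightarrow> deep \<beta> E E' k x"
  proof -
    show "finite T'" using Suc.prems(1) by (simp add: T'_def)
    show "deep \<beta> E E' k x" if "x \<in> T'" for x
      using that Suc.prems(2) unfolding T'_def by (auto simp: nbhd_def)
  qed
  \<comment> \<open>Weights after the sites of \<open>F\<close> have been updated. The inner
    induction enlarges \<open>F\<close> one site at a time up to \<open>T\<close>; already updated
    neighbours only have smaller weights.\<close>
  define c where "c F x = (if x \<in> F then 2 / 2 ^ Suc k else if x \<in> T' then 2 / 2 ^ k else 2 :: real)" for F x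
  have "comparable E E' (c F)" if "F \<subseteq> T" for F
    using finite_subset[OF that Suc.prems(1)] that
  proof (induction F rule: finite_induct)
    case empty
    show ?case using Suc.IH[OF T'] by (simp add: c_def[abs_def])
  next
    case (insert x F)
    then have x: "x \<in> T" and IH: "comparable E E' (c F)" by auto
    have inv: "invariant_at \<beta> x E" "invariant_at \<beta> x E'" using Suc.prems(2)[OF x] by auto
    have c0: "0 \<le> c F y" for y by (simp add: c_def)
    have "comparable E E' ((c F)(x := (exp (4 * \<beta> * K) - 1) * (\<Sum>y\<in>nbhd r {x}. c F y)))"
      by (rule comparable_step[OF \<beta>(1) IH c0 inv])
    then show ?case
    proof (rule comparable_mono)
      fix z
      have "(\<Sum>y\<in>nbhd r {x}. c F y) \<le> (\<Sum>y\<in>nbhd r {x}. 2 / 2 ^ k)"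
      proof (rule sum_mono)
        fix y assume "y \<in> nbhd r {x}"
        then have "y \<in> T'" using x by (auto simp: T'_def nbhd_def)
        then show "c F y \<le> 2 / 2 ^ k" by (simp add: c_def field_simps)
      qed
      then have "(exp (4 * \<beta> * K) - 1) * (\<Sum>y\<in>nbhd r {x}. c F y)
          \<le> (exp (4 * \<beta> * K) - 1) * (real (card (nbhd r {x})) * (2 / 2 ^ k))"
        using \<beta>(1) K_nonneg by (intro mult_left_mono) auto
      also have "\<dots> = ((exp (4 * \<beta> * K) - 1) * real (card (nbhd r {x}))) * (2 / 2 ^ k)" by simp
      also have "\<dots> \<le> (1 / 2) * (2 / 2 ^ k)" by (rule mult_right_mono[OF \<beta>(2)]) simp
      finally have "(exp (4 * \<beta> * K) - 1) * (\<Sum>y\<in>nbhd r {x}. c F y) \<le> 2 / 2 ^ Suc k" by simp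
      then show "((c F)(x := (exp (4 * \<beta> * K) - 1) * (\<Sum>y\<in>nbhd r {x}. c F y))) z \<le> c (insert x F) z"
        by (auto simp: c_def)
    qed
  qed
  from this[of T] show ?case
    by (rule comparable_mono) (auto simp: c_def field_simps)
qed

text \<open>Detailed balance: resampling one site leaves weights satisfying the DLR equation at that site invariant.\<close>

lemma sum_resample_weights:
  fixes f p :: "('d, 'a) config \<Rightarrow> real"
  assumes "finite S" "nbhd r {x} \<subseteq> S"
    and P: "\<And>\<rho> a. p (\<rho>(x := a)) * exp (\<beta> * energy S (\<rho>(x := a))) = p \<rho> * exp (\<beta> * energy S \<rho>)"
  shows "(\<Sum>\<rho>\<in>patterns S. resample \<beta> x f \<rho> * p \<rho>) = (\<Sum>\<rho>\<in>patterns S. f \<rho> * p \<rho>)"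
proof -
  have x: "x \<in> S" using assms(2) self_in_nbhd by blast
  have pat: "\<rho>(x := a) \<in> patterns S" if "\<rho> \<in> patterns S" for \<rho> :: "('d, 'a) config" and a
    using that x by (auto simp: patterns_def PiE_iff extensional_def)
  have bal: "site_prob \<beta> x a \<rho> * p \<rho> = site_prob \<beta> x (\<rho> x) (\<rho>(x := a)) * p (\<rho>(x := a))" for \<rho> a
  proof -
    have en: "energy S \<sigma> = site_energy x \<sigma> + energy (S - {x}) \<sigma>" for \<sigma>
      using site_energy_eq[OF assms(1,2), of \<sigma>] by simp
    have c: "energy (S - {x}) (\<rho>(x := a)) = energy (S - {x}) \<rho>"
      using assms(1) by (intro energy_cong) auto
    have "p (\<rho>(x := a)) * exp (\<beta> * site_energy x (\<rho>(x := a))) = p \<rho> * exp (\<beta> * site_energy x \<rho>)"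
      using P[of \<rho> a] unfolding en c by (simp add: distrib_left exp_add)
    then have "exp (- (\<beta> * site_energy x (\<rho>(x := a)))) * p \<rho> = exp (- (\<beta> * site_energy x \<rho>)) * p (\<rho>(x := a))"
      by (simp add: exp_minus field_simps)
    then show ?thesis by (simp add: site_prob_def)
  qed
  have "(\<Sum>\<rho>\<in>patterns S. resample \<beta> x f \<rho> * p \<rho>)
      = (\<Sum>\<rho>\<in>patterns S. \<Sum>a\<in>UNIV. site_prob \<beta> x a \<rho> * f (\<rho>(x := a)) * p \<rho>)"
    by (simp add: resample_def sum_distrib_right)
  also have "\<dots> = (\<Sum>(\<rho>, a)\<in>patterns S \<times> UNIV. site_prob \<beta> x a \<rho> * f (\<rho>(x := a)) * p \<rho>)"
    by (rule sum.cartesian_product)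
  also have "\<dots> = (\<Sum>(\<rho>, a)\<in>patterns S \<times> UNIV. site_prob \<beta> x a \<rho> * f \<rho> * p \<rho>)"
  \<comment> \<open>The bijection exchanges the present symbol at \<open>x\<close> with the proposed
    one; being an involution, it serves as its own inverse.\<close>
  proof (rule sum.reindex_bij_witness[where i = "\<lambda>(\<rho>, a). (\<rho>(x := a), \<rho> x)" and j = "\<lambda>(\<rho>, a). (\<rho>(x := a), \<rho> x)"])
    fix q :: "('d, 'a) config \<times> 'a" assume "q \<in> patterns S \<times> UNIV"
    obtain \<rho> a where q: "q = (\<rho>, a)" by (cases q)
    show "(case (case q of (\<rho>, a) \<Rightarrow> (\<rho>(x := a), \<rho> x)) of (\<rho>, a) \<Rightarrow> site_prob \<beta> x a \<rho> * f \<rho> * p \<rho>)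
      = (case q of (\<rho>, a) \<Rightarrow> site_prob \<beta> x a \<rho> * f (\<rho>(x := a)) * p \<rho>)"
      using bal[of a \<rho>] by (simp add: q mult_ac)
  qed (auto simp: pat)
  also have "\<dots> = (\<Sum>\<rho>\<in>patterns S. \<Sum>a\<in>UNIV. site_prob \<beta> x a \<rho> * (f \<rho> * p \<rho>))"
    by (simp add: sum.cartesian_product mult.assoc)
  also have "\<dots> = (\<Sum>\<rho>\<in>patterns S. f \<rho> * p \<rho>)"
    by (simp add: sum_distrib_right[symmetric] sum_site_prob)
  finally show ?thesis .
qed

lemma dlr_invariant_at:
  assumes "config_prob M" "dlr \<beta> M"
  shows "invariant_at \<beta> x (\<lambda>f. \<integral>\<sigma>. f \<sigma> \<partial>M)"
  unfolding invariant_at_def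
proof (intro allI impI)
  interpret config_prob M by fact
  fix S and f :: "('d, 'a) config \<Rightarrow> real" assume S: "finite S" "local_on S f"
  let ?S = "S \<union> nbhd r {x}"
  have fin: "finite ?S" using S by simp
  have "(\<integral>\<sigma>. resample \<beta> x f \<sigma> \<partial>M) = (\<Sum>\<omega>\<in>patterns ?S. resample \<beta> x f \<omega> * measure M (cyl ?S \<omega>))"
    by (rule integral_local(2)[OF fin local_on_resample[OF S(2)]])
  also have "\<dots> = (\<Sum>\<omega>\<in>patterns ?S. f \<omega> * measure M (cyl ?S \<omega>))"
    by (rule sum_resample_weights[OF fin]) (use assms(2) fin in \<open>auto simp: dlr_def\<close>)
  also have "\<dots> = (\<integral>\<sigma>. f \<sigma> \<partial>M)"
    by (rule integral_local(2)[OF fin local_on_mono[OF S(2)], symmetric]) simp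
  finally show "(\<integral>\<sigma>. resample \<beta> x f \<sigma> \<partial>M) = (\<integral>\<sigma>. f \<sigma> \<partial>M)" .
qed

end

lemma (in config_prob) mean_like_integral: "mean_like (\<lambda>f. \<integral>\<sigma>. f \<sigma> \<partial>M)"
  unfolding mean_like_def
proof (intro allI impI)
  fix S and f :: "('d, 'a) config \<Rightarrow> real" and c b
  assume f: "finite S" "local_on S f" "\<forall>\<sigma>. \<bar>f \<sigma> - c\<bar> \<le> b"
  have i: "integrable M f" by (rule integral_local(1)[OF f(1,2)])
  have "f \<sigma> \<le> c + b \<and> c - b \<le> f \<sigma>" for \<sigma> using spec[OF f(3), of \<sigma>] by linarith
  then have "(\<integral>\<sigma>. f \<sigma> \<partial>M) \<le> c + b" "c - b \<le> (\<integral>\<sigma>. f \<sigma> \<partial>M)"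
    using i by (auto intro!: integral_le_const integral_ge_const)
  then show "\<bar>(\<integral>\<sigma>. f \<sigma> \<partial>M) - c\<bar> \<le> b" by linarith
qed

text \<open>A measure with the DLR property is invariant under resampling everywhere, so every site
  has every depth and the two cylinder probabilities differ by an arbitrarily small power of
  1/2.\<close>

lemma (in finite_range_interaction) dlr_unique:
  assumes "high_temperature \<beta>" "config_prob M" "config_prob N" "dlr \<beta> M" "dlr \<beta> N"
  shows "M = N"
proof (rule config_measure_eqI[OF assms(2,3)])
  interpret M: config_prob M by fact
  interpret N: config_prob N by fact
  fix S :: "(int ^ 'd) set" and \<sigma> :: "('d, 'a) config" assume S: "finite S"
  let ?E = "\<lambda>f :: ('d, 'a) config \<Rightarrow> real. \<integral>\<sigma>. f \<sigma> \<partial>M" and ?E' = "\<lambda>f :: ('d, 'a) config \<Rightarrow> real. \<integral>\<sigma>. f \<sigma> \<partial>N"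
  let ?f = "indicator (cyl S \<sigma>) :: ('d, 'a) config \<Rightarrow> real"
  have deep: "deep \<beta> ?E ?E' k x" for k x
    by (induction k arbitrary: x) (use assms dlr_invariant_at in auto)
  obtain D where D: "osc_bound ?f D" by (rule osc_bound_exists[OF S local_on_indicator_cyl])
  have "\<bar>?E ?f - ?E' ?f\<bar> \<le> (\<Sum>x\<in>S. (if x \<in> S then 2 / 2 ^ k else 2) * D x)" for k
    using comparable_deep[OF assms(1) M.mean_like_integral N.mean_like_integral S deep]
      S local_on_indicator_cyl[of S \<sigma>] D
    unfolding comparable_def by blast
  also have "(\<Sum>x\<in>S. (if x \<in> S then 2 / 2 ^ k else 2) * D x) = (2 * (\<Sum>x\<in>S. D x)) * (1 / 2) ^ k" for k
    by (simp add: sum_distrib_left sum_divide_distrib power_one_over)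
  finally have "\<bar>?E ?f - ?E' ?f\<bar> \<le> (2 * (\<Sum>x\<in>S. D x)) * (1 / 2) ^ k" for k .
  moreover have "(\<lambda>k. (2 * (\<Sum>x\<in>S. D x)) * (1 / 2) ^ k) \<longlonglongrightarrow> (2 * (\<Sum>x\<in>S. D x)) * 0"
    by (intro tendsto_intros LIMSEQ_power_zero) simp
  ultimately have "\<bar>?E ?f - ?E' ?f\<bar> \<le> 0"
    by (intro LIMSEQ_le_const[of "\<lambda>k. (2 * (\<Sum>x\<in>S. D x)) * (1 / 2) ^ k"]) auto
  then show "measure M (cyl S \<sigma>) = measure N (cyl S \<sigma>)" using S by simp
qed

section \<open>Existence of the Gibbs measure\<close>

text \<open>A normalized positive linear functional on local functions, the form in which the
  infinite-volume limit arises; countable additivity is supplied afterwards by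
  \<open>representing_measure\<close>.\<close>

locale local_functional =
  fixes L :: "(('d::finite, 'a::finite) config \<Rightarrow> real) \<Rightarrow> real"
  assumes add: "finite S \<Longrightarrow> local_on S f \<Longrightarrow> local_on S g \<Longrightarrow> L (\<lambda>\<sigma>. f \<sigma> + g \<sigma>) = L f + L g"
    and scale: "finite S \<Longrightarrow> local_on S f \<Longrightarrow> L (\<lambda>\<sigma>. c * f \<sigma>) = c * L f"
    and nonneg: "finite S \<Longrightarrow> local_on S f \<Longrightarrow> (\<And>\<sigma>. 0 \<le> f \<sigma>) \<Longrightarrow> 0 \<le> L f"
    and one: "L (\<lambda>_. 1) = 1"
begin

lemma local_on_const: "local_on S (\<lambda>_. c)"
  by (rule local_onI) simp

lemma expand:
  assumes "finite S" "local_on S f"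
  shows "L f = (\<Sum>\<theta>\<in>patterns S. f \<theta> * L (indicator (cyl S \<theta>)))"
proof -
  have "L (\<lambda>\<sigma>. \<Sum>\<theta>\<in>F. f \<theta> * indicator (cyl S \<theta>) \<sigma>) = (\<Sum>\<theta>\<in>F. f \<theta> * L (indicator (cyl S \<theta>)))
     \<and> local_on S (\<lambda>\<sigma>. \<Sum>\<theta>\<in>F. f \<theta> * indicator (cyl S \<theta>) \<sigma>)"
    if "finite F" for F
    using that
  proof (induction F rule: finite_induct)
    case empty
    show ?case using scale[OF assms(1) local_on_const, of 0 0] by (simp add: local_on_const)
  next
    case (insert \<theta> F)
    have l: "local_on S (indicator (cyl S \<theta>) :: _ \<Rightarrow> real)" by (rule local_on_indicator_cyl)
    have l': "local_on S (\<lambda>\<sigma>. f \<theta> * indicator (cyl S \<theta>) \<sigma>)"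
    proof (rule local_onI)
      fix \<sigma> \<tau> :: "('d, 'a) config" assume "\<And>y. y \<in> S \<Longrightarrow> \<sigma> y = \<tau> y"
      then show "f \<theta> * indicator (cyl S \<theta>) \<sigma> = f \<theta> * indicator (cyl S \<theta>) \<tau>"
        by (simp add: local_onD[OF l, of \<sigma> \<tau>])
    qed
    have l'': "local_on S (\<lambda>\<sigma>. f \<theta> * indicator (cyl S \<theta>) \<sigma> + (\<Sum>\<theta>\<in>F. f \<theta> * indicator (cyl S \<theta>) \<sigma>))"
    proof (rule local_onI)
      fix \<sigma> \<tau> :: "('d, 'a) config" assume e: "\<And>y. y \<in> S \<Longrightarrow> \<sigma> y = \<tau> y"
      show "f \<theta> * indicator (cyl S \<theta>) \<sigma> + (\<Sum>\<theta>\<in>F. f \<theta> * indicator (cyl S \<theta>) \<sigma>)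
          = f \<theta> * indicator (cyl S \<theta>) \<tau> + (\<Sum>\<theta>\<in>F. f \<theta> * indicator (cyl S \<theta>) \<tau>)"
        using local_onD[OF l' e] local_onD[OF conjunct2[OF insert.IH] e] by (simp only:)
    qed
    show ?case
      unfolding sum.insert[OF insert.hyps]
      using l'' conjunct1[OF insert.IH] add[OF assms(1) l' conjunct2[OF insert.IH]] scale[OF assms(1) l, of "f \<theta>"]
      by (simp only:)
  qed
  from this[of "patterns S"] have "L (\<lambda>\<sigma>. \<Sum>\<theta>\<in>patterns S. f \<theta> * indicator (cyl S \<theta>) \<sigma>)
      = (\<Sum>\<theta>\<in>patterns S. f \<theta> * L (indicator (cyl S \<theta>)))" using assms(1) by simp
  moreover have "f = (\<lambda>\<sigma>. \<Sum>\<theta>\<in>patterns S. f \<theta> * indicator (cyl S \<theta>) \<sigma>)"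
    using local_expand[OF assms] by blast
  ultimately show ?thesis by simp
qed

lemma cyl_nonneg: "finite S \<Longrightarrow> 0 \<le> L (indicator (cyl S \<theta>))"
  by (rule nonneg[OF _ local_on_indicator_cyl]) auto

lemma mean_like: "mean_like L"
  unfolding mean_like_def
proof (intro allI impI)
  fix S and f :: "('d, 'a) config \<Rightarrow> real" and c b
  assume f: "finite S" "local_on S f" "\<forall>\<sigma>. \<bar>f \<sigma> - c\<bar> \<le> b"
  have s1: "(\<Sum>\<theta>\<in>patterns S. L (indicator (cyl S \<theta>))) = 1"
    using expand[OF f(1) local_on_const[of _ 1]] one by simp
  have "L f - c = (\<Sum>\<theta>\<in>patterns S. (f \<theta> - c) * L (indicator (cyl S \<theta>)))"
    unfolding left_diff_distrib sum_subtractf sum_distrib_left[symmetric] s1 expand[OF f(1,2)] by simp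
  also have "\<bar>\<dots>\<bar> \<le> (\<Sum>\<theta>\<in>patterns S. \<bar>(f \<theta> - c) * L (indicator (cyl S \<theta>))\<bar>)" by (rule sum_abs)
  also have "\<dots> \<le> (\<Sum>\<theta>\<in>patterns S. b * L (indicator (cyl S \<theta>)))"
    unfolding abs_mult using f(3) cyl_nonneg[OF f(1)] by (intro sum_mono mult_mono) (auto simp: order_trans[OF abs_ge_zero])
  also have "\<dots> = b" by (simp add: sum_distrib_left[symmetric] s1)
  finally show "\<bar>L f - c\<bar> \<le> b" .
qed

text \<open>Kolmogorov extension, carried out on \<open>int ^ 'd \<Rightarrow> real\<close> after embedding the alphabet into the reals.\<close>

lemma representing_measure:
  "\<exists>M. config_prob M \<and> (\<forall>S \<sigma>. finite S \<longrightarrow> measure M (cyl S \<sigma>) = L (indicator (cyl S \<sigma>)))"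
proof -
  define p where "p J \<theta> = L (indicator (cyl J \<theta>))" for J \<theta>
  have p0: "0 \<le> p J \<theta>" if "finite J" for J \<theta> using cyl_nonneg[OF that] by (simp add: p_def)
  obtain e :: "'a \<Rightarrow> real" where e: "inj e"
  proof -
    obtain f :: "'a \<Rightarrow> nat" where "inj f" using finite_imp_inj_to_nat_seg[of "UNIV :: 'a set"] by auto
    then have "inj (\<lambda>a. real (f a))" by (auto simp: inj_on_def)
    then show ?thesis by (rule that)
  qed
  define a0 :: 'a where "a0 = undefined"
  \<comment> \<open>The left inverse of the embedding, extended to all reals by a default symbol.
    The fibre of the default is cofinite and the other fibres are points, so all fibres are
    Borel.\<close>
  define d where "d t = (if t \<in> range e then inv e t else a0)" for t
  have de: "d (e a) = a" for a using e by (simp add: d_def)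
  have d_borel: "{t. d t = a} \<in> sets borel" for a
  proof -
    have "{t. d t = a} = (if a = a0 then - (range e - {e a0}) else {e a})"
      using e by (auto simp: d_def dest: injD)
    moreover have "- (range e - {e a0}) \<in> sets borel"
      by (intro borel_open open_Compl finite_imp_closed) simp
    ultimately show ?thesis by simp
  qed
  define Q where "Q J = point_measure (patterns J) (\<lambda>\<theta>. ennreal (p J \<theta>))" for J
  define enc where "enc J \<theta> = (\<lambda>j\<in>J. e (\<theta> j))" for J and \<theta> :: "('d, 'a) config"
  define P where "P J = distr (Q J) (PiM J (\<lambda>_. borel)) (enc J)" for J
  have enc_meas: "enc J \<in> measurable (Q J') (PiM J (\<lambda>_. borel))" for J J'
    by (simp add: Q_def measurable_point_measure_eq1 space_PiM enc_def)
  \<comment> \<open>Stated for a base \<open>H\<close> larger than \<open>J\<close>, so that one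
    computation yields the law on \<open>J\<close> and its agreement with the projected law from
    \<open>H\<close>.\<close>
  have emP: "emeasure (distr (Q H) (PiM J (\<lambda>_. borel)) (enc J)) X = ennreal (L (\<lambda>\<sigma>. indicator X (enc J \<sigma>)))"
    if J: "J \<subseteq> H" "finite H" and X: "X \<in> sets (PiM J (\<lambda>_. borel))" for H J X
  proof -
    have loc: "local_on H (\<lambda>\<sigma>. indicator X (enc J \<sigma>) :: real)"
    proof (rule local_onI)
      fix \<sigma> \<tau> :: "('d, 'a) config" assume "\<And>y. y \<in> H \<Longrightarrow> \<sigma> y = \<tau> y"
      then have "enc J \<sigma> = enc J \<tau>" using J unfolding enc_def by (intro restrict_ext) auto
      then show "indicator X (enc J \<sigma>) = (indicator X (enc J \<tau>) :: real)" by simp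
    qed
    have "emeasure (distr (Q H) (PiM J (\<lambda>_. borel)) (enc J)) X = emeasure (Q H) (enc J -` X \<inter> space (Q H))"
      by (rule emeasure_distr[OF enc_meas X])
    also have "\<dots> = (\<Sum>\<theta>\<in>enc J -` X \<inter> patterns H. ennreal (p H \<theta>))"
      unfolding Q_def space_point_measure by (rule emeasure_point_measure_finite) (use J in auto)
    also have "\<dots> = ennreal (\<Sum>\<theta>\<in>enc J -` X \<inter> patterns H. p H \<theta>)"
      using p0[OF J(2)] by (intro sum_ennreal) auto
    also have "(\<Sum>\<theta>\<in>enc J -` X \<inter> patterns H. p H \<theta>) = (\<Sum>\<theta>\<in>patterns H. indicator X (enc J \<theta>) * p H \<theta>)"
      by (rule sum.mono_neutral_cong_left) (use J in \<open>auto simp: indicator_def\<close>)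
    also have "\<dots> = L (\<lambda>\<sigma>. indicator X (enc J \<sigma>))"
      unfolding p_def by (rule expand[OF J(2) loc, symmetric])
    finally show ?thesis .
  qed
  interpret polish_projective UNIV P
    unfolding polish_projective_def
  proof (rule projective_family.intro)
    fix J H :: "(int ^ 'd) set" assume JH: "J \<subseteq> H" "finite H" "H \<subseteq> UNIV"
    have "distr (P H) (PiM J (\<lambda>_. borel)) (\<lambda>f. restrict f J)
        = distr (Q H) (PiM J (\<lambda>_. borel)) ((\<lambda>f. restrict f J) \<circ> enc H)"
      unfolding P_def by (rule distr_distr[OF _ enc_meas]) (rule measurable_restrict_subset[OF JH(1)])
    also have "(\<lambda>f. restrict f J) \<circ> enc H = enc J"
      using JH(1) by (auto simp: enc_def fun_eq_iff)
    also have "distr (Q H) (PiM J (\<lambda>_. borel)) (enc J) = P J"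
    proof (rule measure_eqI)
      fix X assume "X \<in> sets (distr (Q H) (PiM J (\<lambda>_. borel)) (enc J))"
      then have X: "X \<in> sets (PiM J (\<lambda>_. borel))" by simp
      show "emeasure (distr (Q H) (PiM J (\<lambda>_. borel)) (enc J)) X = emeasure (P J) X"
        unfolding P_def using emP[OF JH(1,2) X] emP[OF order_refl finite_subset[OF JH(1,2)] X] by simp
    qed (simp add: P_def)
    finally show "P J = distr (P H) (PiM J (\<lambda>_. borel)) (\<lambda>f. restrict f J)" ..
  next
    fix J :: "(int ^ 'd) set" assume J: "finite J" "J \<subseteq> UNIV"
    show "prob_space (P J)"
    proof (rule prob_spaceI)
      have "space (P J) \<in> sets (PiM J (\<lambda>_. borel))" by (simp add: P_def)
      from emP[OF order_refl J(1) this] have "emeasure (P J) (space (P J)) = ennreal (L (\<lambda>\<sigma>. indicator (space (P J)) (enc J \<sigma>)))"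
        by (simp add: P_def)
      also have "(\<lambda>\<sigma>. indicator (space (P J)) (enc J \<sigma>)) = (\<lambda>_. 1 :: real)"
        by (auto simp: P_def space_PiM enc_def)
      finally show "emeasure (P J) (space (P J)) = 1" by (simp add: one)
    qed
  qed
  define dec where "dec x = (\<lambda>j. d (x j))" for x :: "int ^ 'd \<Rightarrow> real"
  define M where "M = distr lim config_space dec"
  have pre: "dec -` cyl S \<sigma> \<inter> space lim = prod_emb UNIV (\<lambda>_. borel) S (PiE S (\<lambda>y. {t. d t = \<sigma> y}))" for S \<sigma>
    by (auto simp: dec_def cyl_def prod_emb_def space_PiM PiE_iff)
  have X: "PiE S (\<lambda>y. {t. d t = \<sigma> y}) \<in> sets (PiM S (\<lambda>_. borel))" if "finite S" for S \<sigma>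
    using that d_borel by (intro sets_PiM_I_finite) auto
  have dec_meas: "dec \<in> measurable lim config_space"
  proof (rule measurable_sigma_sets[OF sets_config_space])
    fix A :: "('d, 'a) config set" assume "A \<in> {cyl S \<sigma> | S \<sigma>. finite S}"
    then obtain S \<sigma> where A: "A = cyl S \<sigma>" "finite S" by blast
    show "dec -` A \<inter> space lim \<in> sets lim"
      unfolding A(1) pre using X[OF A(2)] by (simp add: sets_lim A(2))
  qed auto
  have "config_prob M"
    unfolding config_prob_def config_prob_axioms_def M_def
    using P.prob_space_distr[OF dec_meas] by simp
  moreover have "measure M (cyl S \<sigma>) = L (indicator (cyl S \<sigma>))" if S: "finite S" for S \<sigma>
  proof -
    have "cyl S \<sigma> \<in> sets config_space" unfolding sets_config_space using S by (intro sigma_sets.Basic) blast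
    then have "measure M (cyl S \<sigma>) = measure lim (dec -` cyl S \<sigma> \<inter> space lim)"
      unfolding M_def by (rule measure_distr[OF dec_meas])
    also have "\<dots> = measure (P S) (PiE S (\<lambda>y. {t. d t = \<sigma> y}))"
      unfolding pre by (rule measure_lim_emb) (use S X in auto)
    also have "\<dots> = L (\<lambda>\<tau>. indicator (PiE S (\<lambda>y. {t. d t = \<sigma> y})) (enc S \<tau>))"
      unfolding measure_def P_def emP[OF order_refl S X[OF S]]
    proof (rule enn2real_ennreal, rule nonneg[OF S])
      show "local_on S (\<lambda>\<tau>. indicator (PiE S (\<lambda>y. {t. d t = \<sigma> y})) (enc S \<tau>) :: real)"
      proof (rule local_onI)
        fix \<rho> \<tau> :: "('d, 'a) config" assume "\<And>y. y \<in> S \<Longrightarrow> \<rho> y = \<tau> y"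
        then have "enc S \<rho> = enc S \<tau>" unfolding enc_def by (intro restrict_ext) auto
        then show "indicator (PiE S (\<lambda>y. {t. d t = \<sigma> y})) (enc S \<rho>)
            = (indicator (PiE S (\<lambda>y. {t. d t = \<sigma> y})) (enc S \<tau>) :: real)" by simp
      qed
    qed simp
    also have "(\<lambda>\<tau>. indicator (PiE S (\<lambda>y. {t. d t = \<sigma> y})) (enc S \<tau>)) = (indicator (cyl S \<sigma>) :: _ \<Rightarrow> real)"
      by (auto simp: fun_eq_iff indicator_def enc_def cyl_def PiE_iff de)
    finally show ?thesis .
  qed
  ultimately show ?thesis by blast
qed

end

section \<open>Finite-volume Gibbs means and their limit\<close>

context finite_range_interaction
begin

text \<open>The free-boundary Gibbs mean on a \<open>norm1\<close> ball. The patterns are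
  extensional, so a test function sees the value \<open>undefined\<close> at every site outside the
  ball.\<close>

definition box_mean :: "real \<Rightarrow> nat \<Rightarrow> (('d, 'a) config \<Rightarrow> real) \<Rightarrow> real" where
  "box_mean \<beta> n f = (\<Sum>\<omega>\<in>patterns {y. norm1 y \<le> int n}. f \<omega> * (exp (- (\<beta> * energy {y. norm1 y \<le> int n} \<omega>))
     / partition_sum \<beta> {y. norm1 y \<le> int n}))"

lemma local_functional_box_mean: "local_functional (box_mean \<beta> n)"
proof
  fix f g :: "('d, 'a) config \<Rightarrow> real" and c
  show "box_mean \<beta> n (\<lambda>\<sigma>. f \<sigma> + g \<sigma>) = box_mean \<beta> n f + box_mean \<beta> n g"
    by (simp add: box_mean_def distrib_right add_divide_distrib sum.distrib)
  show "box_mean \<beta> n (\<lambda>\<sigma>. c * f \<sigma>) = c * box_mean \<beta> n f"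
    by (simp add: box_mean_def sum_distrib_left mult.assoc)
  show "0 \<le> box_mean \<beta> n f" if "\<And>\<sigma>. 0 \<le> f \<sigma>"
    unfolding box_mean_def using that partition_sum_pos[of "{y. norm1 y \<le> int n}" \<beta>]
    by (intro sum_nonneg mult_nonneg_nonneg divide_nonneg_nonneg) auto
  have "box_mean \<beta> n (\<lambda>_. 1) = partition_sum \<beta> {y. norm1 y \<le> int n} / partition_sum \<beta> {y. norm1 y \<le> int n}"
    unfolding box_mean_def sum_divide_distrib[symmetric] mult_1 partition_sum_def ..
  then show "box_mean \<beta> n (\<lambda>_. 1) = 1"
    using partition_sum_pos[of "{y. norm1 y \<le> int n}" \<beta>] by simp
qed

text \<open>The finite-volume weight times \<open>exp (\<beta> * energy)\<close> is constant, so
  detailed balance holds at once wherever the interaction neighbourhood fits into the ball.\<close>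

lemma box_mean_invariant_at:
  assumes "norm1 x + r \<le> int n"
  shows "invariant_at \<beta> x (box_mean \<beta> n)"
  unfolding invariant_at_def box_mean_def
proof (intro allI impI sum_resample_weights)
  show "nbhd r {x} \<subseteq> {y. norm1 y \<le> int n}"
  proof
    fix y assume "y \<in> nbhd r {x}"
    then show "y \<in> {y. norm1 y \<le> int n}"
      using norm1_triangle[of x "y - x"] assms by (simp add: nbhd_def)
  qed
qed (simp_all add: exp_minus)

text \<open>Each level of depth uses up distance \<open>r\<close> to the boundary of the smaller
  ball.\<close>

lemma box_mean_deep:
  "norm1 x + int k * r \<le> int n \<Longrightarrow> n \<le> m \<Longrightarrow> deep \<beta> (box_mean \<beta> n) (box_mean \<beta> m) k x"
proof (induction k arbitrary: x)
  case (Suc k)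
  have "0 \<le> int k * r" using r_nonneg by simp
  then have le: "norm1 x + r \<le> int n" using Suc.prems(1) by (simp add: algebra_simps)
  have "deep \<beta> (box_mean \<beta> n) (box_mean \<beta> m) k y" if "y \<in> nbhd r {x}" for y
  proof (rule Suc.IH[OF _ Suc.prems(2)])
    show "norm1 y + int k * r \<le> int n"
      using norm1_triangle[of x "y - x"] that Suc.prems(1) by (simp add: nbhd_def algebra_simps)
  qed
  then show ?case using le Suc.prems(2) by (simp add: box_mean_invariant_at)
qed simp

lemma box_mean_convergent:
  assumes "high_temperature \<beta>" "finite S" "local_on S f"
  shows "convergent (\<lambda>n. box_mean \<beta> n f)"
proof (rule Cauchy_convergent, rule metric_CauchyI)
  fix \<epsilon> :: real assume \<epsilon>: "0 < \<epsilon>"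
  obtain D where D: "osc_bound f D" by (rule osc_bound_exists[OF assms(2,3)])
  define C where "C = 2 * (\<Sum>x\<in>S. D x)"
  have C0: "0 \<le> C" unfolding C_def using osc_bound_nonneg[OF D] by (simp add: sum_nonneg)
  obtain k where k: "(1 / 2) ^ k < \<epsilon> / (C + 1)"
    using real_arch_pow_inv[of "\<epsilon> / (C + 1)" "1 / 2"] \<epsilon> C0 by auto
  \<comment> \<open>Large enough for every site of \<open>S\<close> to have depth \<open>k\<close>
    in all boxes from \<open>N\<close> on.\<close>
  define N where "N = nat (\<Sum>x\<in>S. norm1 x) + k * nat r"
  have close: "\<bar>box_mean \<beta> n f - box_mean \<beta> m f\<bar> < \<epsilon>" if nm: "N \<le> n" "n \<le> m" for n m
  proof -
    interpret n: local_functional "box_mean \<beta> n" by (rule local_functional_box_mean)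
    interpret m: local_functional "box_mean \<beta> m" by (rule local_functional_box_mean)
    have deep: "deep \<beta> (box_mean \<beta> n) (box_mean \<beta> m) k x" if "x \<in> S" for x
    proof (rule box_mean_deep[OF _ nm(2)])
      have "norm1 x \<le> (\<Sum>x\<in>S. norm1 x)" by (rule member_le_sum[OF that]) (simp_all add: norm1_nonneg assms(2))
      moreover have "int N = (\<Sum>x\<in>S. norm1 x) + int k * r"
        using r_nonneg by (simp add: N_def norm1_nonneg sum_nonneg)
      ultimately show "norm1 x + int k * r \<le> int n" using nm(1) by linarith
    qed
    have "\<bar>box_mean \<beta> n f - box_mean \<beta> m f\<bar> \<le> (\<Sum>x\<in>S. (if x \<in> S then 2 / 2 ^ k else 2) * D x)"
      using comparable_deep[OF assms(1) n.mean_like m.mean_like assms(2) deep] assms(2,3) D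
      unfolding comparable_def by blast
    also have "\<dots> = C * (1 / 2) ^ k"
      by (simp add: C_def sum_distrib_left sum_divide_distrib power_one_over)
    also have "\<dots> \<le> (C + 1) * (1 / 2) ^ k" by (intro mult_right_mono) auto
    also have "\<dots> < (C + 1) * (\<epsilon> / (C + 1))" using k C0 by (intro mult_strict_left_mono) auto
    also have "\<dots> = \<epsilon>" using C0 by simp
    finally show ?thesis .
  qed
  show "\<exists>N. \<forall>m\<ge>N. \<forall>n\<ge>N. dist (box_mean \<beta> m f) (box_mean \<beta> n f) < \<epsilon>"
  proof (intro exI allI impI)
    fix m n assume "N \<le> m" "N \<le> n"
    then show "dist (box_mean \<beta> m f) (box_mean \<beta> n f) < \<epsilon>"
      using close[of m n] close[of n m] by (cases "m \<le> n") (auto simp: dist_real_def abs_minus_commute)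
  qed
qed

text \<open>Invariance under resampling at a given site holds for all large boxes and survives the
  limit. Applied to indicators of cylinders it is the one-site DLR equation.\<close>

lemma dlr_measure_exists:
  assumes "high_temperature \<beta>"
  shows "\<exists>M. config_prob M \<and> dlr \<beta> M"
proof -
  define L where "L f = lim (\<lambda>n. box_mean \<beta> n f)" for f
  have L: "(\<lambda>n. box_mean \<beta> n f) \<longlonglongrightarrow> L f" if "finite S" "local_on S f" for S f
    using box_mean_convergent[OF assms that] by (simp add: L_def convergent_LIMSEQ_iff)
  interpret local_functional L
  proof
    fix S and f g :: "('d, 'a) config \<Rightarrow> real" and c
    assume f: "finite S" "local_on S f"
    interpret b: local_functional "box_mean \<beta> n" for n by (rule local_functional_box_mean)
    show "L (\<lambda>\<sigma>. f \<sigma> + g \<sigma>) = L f + L g" if g: "local_on S g"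
    proof -
      have "(\<lambda>n. box_mean \<beta> n (\<lambda>\<sigma>. f \<sigma> + g \<sigma>)) \<longlonglongrightarrow> L f + L g"
        unfolding b.add[OF f g] using L[OF f] L[OF f(1) g] by (rule tendsto_add)
      then show ?thesis unfolding L_def by (rule limI)
    qed
    show "L (\<lambda>\<sigma>. c * f \<sigma>) = c * L f"
    proof -
      have "(\<lambda>n. box_mean \<beta> n (\<lambda>\<sigma>. c * f \<sigma>)) \<longlonglongrightarrow> c * L f"
        unfolding b.scale[OF f] using L[OF f] by (rule tendsto_mult_left)
      then show ?thesis unfolding L_def by (rule limI)
    qed
    show "0 \<le> L f" if "\<And>\<sigma>. 0 \<le> f \<sigma>"
      using b.nonneg[OF f that] L[OF f] by (intro LIMSEQ_le_const) auto
  next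
    interpret b: local_functional "box_mean \<beta> n" for n by (rule local_functional_box_mean)
    show "L (\<lambda>_. 1) = 1" unfolding L_def b.one by simp
  qed
  obtain M where M: "config_prob M" "\<And>S \<sigma>. finite S \<Longrightarrow> measure M (cyl S \<sigma>) = L (indicator (cyl S \<sigma>))"
    using representing_measure by blast
  have inv: "L (resample \<beta> x f) = L f" if f: "finite S" "local_on S f" for S f x
  proof -
    have "\<forall>\<^sub>F n in sequentially. box_mean \<beta> n (resample \<beta> x f) = box_mean \<beta> n f"
      using eventually_ge_at_top[of "nat (norm1 x + r)"]
    proof eventually_elim
      case (elim n)
      then have "norm1 x + r \<le> int n" by linarith
      then show ?case using box_mean_invariant_at f unfolding invariant_at_def by blast
    qed
    then have "(\<lambda>n. box_mean \<beta> n (resample \<beta> x f)) \<longlonglongrightarrow> L f"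
      using L[OF f] by (subst tendsto_cong) auto
    then show ?thesis unfolding L_def by (rule limI)
  qed
  have "dlr \<beta> M" unfolding dlr_def
  proof (intro allI impI)
    fix S :: "(int ^ 'd) set" and x and \<sigma> :: "('d, 'a) config" and a
    assume S: "finite S" "nbhd r {x} \<subseteq> S"
    have xS: "x \<in> S" using S(2) self_in_nbhd by blast
    let ?I = "indicator (cyl (S - {x}) \<sigma>) :: ('d, 'a) config \<Rightarrow> real"
    \<comment> \<open>Resampling averages out the symbol prescribed at \<open>x\<close>: what
      remains is the probability of drawing \<open>b\<close>, frozen by the cylinder over the other
      sites of \<open>S\<close>.\<close>
    have key: "L (indicator (cyl S (\<sigma>(x := b)))) = site_prob \<beta> x b \<sigma> * L ?I" for b
    proof -
      have "resample \<beta> x (indicator (cyl S (\<sigma>(x := b)))) \<zeta> = site_prob \<beta> x b \<sigma> * ?I \<zeta>" for \<zeta>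
      proof -
        have i: "indicator (cyl S (\<sigma>(x := b))) (\<zeta>(x := c)) = (if c = b then ?I \<zeta> else 0)" for c
          using xS by (auto simp: cyl_def indicator_def)
        have "resample \<beta> x (indicator (cyl S (\<sigma>(x := b)))) \<zeta> = site_prob \<beta> x b \<zeta> * ?I \<zeta>"
          unfolding resample_def i by (simp add: if_distrib cong: if_cong)
        also have "\<dots> = site_prob \<beta> x b \<sigma> * ?I \<zeta>"
        proof (cases "\<zeta> \<in> cyl (S - {x}) \<sigma>")
          case True
          then have "site_prob \<beta> x b \<zeta> = site_prob \<beta> x b \<sigma>"
            using S(2) by (intro site_prob_cong) (auto simp: cyl_def)
          then show ?thesis by simp
        qed simp
        finally show ?thesis .
      qed
      then have "resample \<beta> x (indicator (cyl S (\<sigma>(x := b)))) = (\<lambda>\<zeta>. site_prob \<beta> x b \<sigma> * ?I \<zeta>)" by blast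
      then show ?thesis
        using inv[OF S(1) local_on_indicator_cyl, of x] scale[OF _ local_on_indicator_cyl, of "S - {x}"] S(1)
        by (metis finite_Diff)
    qed
    have en: "energy S (\<sigma>(x := b)) = site_energy x (\<sigma>(x := b)) + energy (S - {x}) \<sigma>" for b
    proof -
      have "energy (S - {x}) (\<sigma>(x := b)) = energy (S - {x}) \<sigma>" using S(1) by (intro energy_cong) auto
      then show ?thesis using site_energy_eq[OF S, of "\<sigma>(x := b)"] by simp
    qed
    have "L (indicator (cyl S (\<sigma>(x := b)))) * exp (\<beta> * energy S (\<sigma>(x := b)))
        = exp (\<beta> * energy (S - {x}) \<sigma>) / (\<Sum>b\<in>UNIV. exp (- (\<beta> * site_energy x (\<sigma>(x := b))))) * L ?I" for b
      unfolding key en site_prob_def by (simp add: distrib_left exp_add exp_minus)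
    from this[of a] this[of "\<sigma> x"]
    show "measure M (cyl S (\<sigma>(x := a))) * exp (\<beta> * energy S (\<sigma>(x := a)))
        = measure M (cyl S \<sigma>) * exp (\<beta> * energy S \<sigma>)"
      using M(2)[OF S(1)] by simp
  qed
  then show ?thesis using M(1) by blast
qed

end

section \<open>Translation invariance\<close>

lemma (in config_prob) shift_measurable: "shift x \<in> measurable M M"
proof (rule measurable_sigma_sets)
  show "sets M = sigma_sets UNIV {cyl S \<sigma> | S \<sigma>. finite S}" by (simp add: sets_M sets_config_space)
  fix A :: "('d, 'a) config set" assume "A \<in> {cyl S \<sigma> | S \<sigma>. finite S}"
  then obtain S \<sigma> where A: "A = cyl S \<sigma>" "finite S" by blast
  have "shift x -` A \<inter> space M = cyl ((+) x ` S) (shift (- x) \<sigma>)"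
    by (auto simp: A cyl_def shift_def)
  then show "shift x -` A \<inter> space M \<in> sets M" using A(2) by simp
qed auto

lemma (in config_prob) measure_distr_shift:
  assumes "finite S"
  shows "measure (distr M M (shift x)) (cyl S \<sigma>) = measure M (cyl ((+) x ` S) (shift (- x) \<sigma>))"
proof -
  have "shift x -` cyl S \<sigma> \<inter> space M = cyl ((+) x ` S) (shift (- x) \<sigma>)"
    by (auto simp: cyl_def shift_def)
  then show ?thesis using assms by (simp add: measure_distr[OF shift_measurable])
qed

text \<open>Prepares for translation invariance, which comes from uniqueness: the boxes used for
  existence are centred at the origin and give no invariance by themselves.\<close>

lemma (in finite_range_interaction) dlr_distr_shift:
  assumes "config_prob M" "dlr \<beta> M"
  shows "config_prob (distr M M (shift z))" "dlr \<beta> (distr M M (shift z))"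
proof -
  interpret config_prob M by fact
  show "config_prob (distr M M (shift z))"
    unfolding config_prob_def config_prob_axioms_def using prob_space_distr[OF shift_measurable] sets_M by simp
  show "dlr \<beta> (distr M M (shift z))"
    unfolding dlr_def
  proof (intro allI impI)
    fix S :: "(int ^ 'd) set" and x and \<sigma> :: "('d, 'a) config" and a
    assume S: "finite S" "nbhd r {x} \<subseteq> S"
    have up: "shift (- z) (\<sigma>(x := a)) = (shift (- z) \<sigma>)(z + x := a)"
      by (auto simp: shift_def fun_eq_iff algebra_simps)
    have "nbhd r {z + x} = (+) z ` nbhd r {x}"
      by (simp add: nbhd_singleton image_image add.assoc)
    then have n: "nbhd r {z + x} \<subseteq> (+) z ` S" using S(2) by auto
    have "measure M (cyl ((+) z ` S) ((shift (- z) \<sigma>)(z + x := a))) * exp (\<beta> * energy ((+) z ` S) ((shift (- z) \<sigma>)(z + x := a)))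
        = measure M (cyl ((+) z ` S) (shift (- z) \<sigma>)) * exp (\<beta> * energy ((+) z ` S) (shift (- z) \<sigma>))"
      using assms(2) n S(1) unfolding dlr_def by blast
    then show "measure (distr M M (shift z)) (cyl S (\<sigma>(x := a))) * exp (\<beta> * energy S (\<sigma>(x := a)))
        = measure (distr M M (shift z)) (cyl S \<sigma>) * exp (\<beta> * energy S \<sigma>)"
      using S(1) by (simp add: measure_distr_shift up[symmetric] energy_translate del: fun_upd_apply)
  qed
qed

theorem (in finite_range_interaction) unique_gibbs_measure:
  assumes "high_temperature \<beta>"
  shows "\<exists>!M. gibbs_measure (scale_interaction \<beta> U) M"
proof -
  obtain M where M: "config_prob M" "dlr \<beta> M" using dlr_measure_exists[OF assms] by blast
  have "distr M M (shift x) = M" for x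
    by (rule dlr_unique[OF assms dlr_distr_shift(1)[OF M] M(1) dlr_distr_shift(2)[OF M] M(2)])
  then have "gibbs_measure (scale_interaction \<beta> U) M" by (rule dlr_imp_gibbs[OF M])
  moreover have "N = M" if "gibbs_measure (scale_interaction \<beta> U) N" for N
    by (rule dlr_unique[OF assms config_prob_gibbs[OF that] M(1) gibbs_imp_dlr[OF that] M(2)])
  ultimately show ?thesis by blast
qed

section \<open>Gibbs probabilities of patterns\<close>

locale gibbs_state = finite_range_interaction U r K + config_prob M
  for U :: "('d::finite, 'a::finite) interaction" and r K and M :: "('d, 'a) config measure" +
  fixes \<beta> :: real
  assumes \<beta>_nonneg: "0 \<le> \<beta>" and dlr: "dlr \<beta> M"
    and shift_invariant: "finite S \<Longrightarrow> measure M (cyl ((+) x ` S) (shift (- x) \<sigma>)) = measure M (cyl S \<sigma>)"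

lemma (in finite_range_interaction) gibbs_state_intro:
  assumes "0 \<le> \<beta>" "gibbs_measure (scale_interaction \<beta> U) M"
  shows "gibbs_state U r K M \<beta>"
proof -
  interpret config_prob M by (rule config_prob_gibbs[OF assms(2)])
  show ?thesis
  proof
    show "dlr \<beta> M" by (rule gibbs_imp_dlr[OF assms(2)])
    fix S x \<sigma> assume "finite (S :: (int ^ 'd) set)"
    moreover have "distr M M (shift x) = M" using assms(2) by (simp add: gibbs_measure_def)
    ultimately show "measure M (cyl ((+) x ` S) (shift (- x) \<sigma>)) = measure M (cyl S \<sigma>)"
      using measure_distr_shift[of S x \<sigma>] by simp
  qed fact
qed

context gibbs_state
begin

text \<open>The factor 2 arises because two patterns are compared and each has its energy split from
  the surroundings at the cost of one boundary term.\<close>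

definition distortion :: "(int ^ 'd) set \<Rightarrow> real" where
  "distortion \<Lambda> = 2 * \<beta> * K * real (card (inner_boundary r \<Lambda>))"

lemma distortion_nonneg: "0 \<le> distortion \<Lambda>"
  using \<beta>_nonneg K_nonneg by (simp add: distortion_def)

lemma distortion_translate: "distortion ((+) x ` \<Lambda>) = distortion \<Lambda>"
  by (simp add: distortion_def inner_boundary_translate card_image)

text \<open>For each fixed surrounding pattern the DLR equation gives the exact ratio of the two
  probabilities in terms of joint energies; splitting off the surroundings costs the distortion. The
  estimate is uniform over all events \<open>B\<close> away from \<Lambda>, which makes it a
  quasi-independence statement.\<close>

lemma compare_patterns:
  assumes "finite \<Lambda>" "finite T" "\<Lambda> \<inter> T = {}" "local_on T (\<lambda>\<sigma>. \<sigma> \<in> B)"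
  shows "measure M (cyl \<Lambda> \<sigma> \<inter> B) * exp (\<beta> * energy \<Lambda> \<sigma>)
    \<le> exp (distortion \<Lambda>) * (measure M (cyl \<Lambda> \<tau> \<inter> B) * exp (\<beta> * energy \<Lambda> \<tau>))"
proof -
  define R where "R = (nbhd r \<Lambda> - \<Lambda>) \<union> T"
  have R: "finite R" "\<Lambda> \<inter> R = {}" "T \<subseteq> R" "nbhd r \<Lambda> \<subseteq> \<Lambda> \<union> R"
    using assms by (auto simp: R_def)
  have B: "local_on R (\<lambda>\<sigma>. \<sigma> \<in> B)" by (rule local_on_mono[OF assms(4) R(3)])
  let ?p = "\<lambda>\<theta> \<sigma>. measure M (cyl (\<Lambda> \<union> R) (override_on \<theta> \<sigma> \<Lambda>))"
  have en: "\<bar>energy (\<Lambda> \<union> R) (override_on \<theta> \<rho> \<Lambda>) - energy \<Lambda> \<rho> - energy R \<theta>\<bar> \<le> K * real (card (inner_boundary r \<Lambda>))" for \<theta> \<rho>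
  proof -
    have "energy \<Lambda> (override_on \<theta> \<rho> \<Lambda>) = energy \<Lambda> \<rho>" "energy R (override_on \<theta> \<rho> \<Lambda>) = energy R \<theta>"
      using assms(1) R(1,2) by (auto intro!: energy_cong simp: override_on_def)
    then show ?thesis using energy_Un[OF assms(1) R(1,2), of "override_on \<theta> \<rho> \<Lambda>"] by simp
  qed
  have weights: "?p \<theta> \<sigma> * exp (\<beta> * energy \<Lambda> \<sigma>) \<le> exp (distortion \<Lambda>) * (?p \<theta> \<tau> * exp (\<beta> * energy \<Lambda> \<tau>))" for \<theta>
  proof -
    let ?H = "\<lambda>\<rho>. energy (\<Lambda> \<union> R) (override_on \<theta> \<rho> \<Lambda>)"
    have "?p \<theta> \<sigma> * exp (\<beta> * ?H \<sigma>) = ?p \<theta> \<tau> * exp (\<beta> * ?H \<tau>)"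
      by (rule dlr_many_sites[OF dlr assms(1) _ R(4)]) (use assms(1) R(1) in auto)
    then have "?p \<theta> \<sigma> = ?p \<theta> \<tau> * exp (\<beta> * ?H \<tau> - \<beta> * ?H \<sigma>)"
      by (simp add: exp_diff field_simps)
    then have "?p \<theta> \<sigma> * exp (\<beta> * energy \<Lambda> \<sigma>) = ?p \<theta> \<tau> * exp (\<beta> * ?H \<tau> - \<beta> * ?H \<sigma> + \<beta> * energy \<Lambda> \<sigma>)"
      by (simp add: exp_add)
    also have "\<dots> \<le> ?p \<theta> \<tau> * exp (distortion \<Lambda> + \<beta> * energy \<Lambda> \<tau>)"
    proof (intro mult_left_mono exp_mono)
      have "?H \<tau> - ?H \<sigma> + energy \<Lambda> \<sigma> \<le> 2 * K * real (card (inner_boundary r \<Lambda>)) + energy \<Lambda> \<tau>"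
        using en[of \<theta> \<sigma>] en[of \<theta> \<tau>] by linarith
      from mult_left_mono[OF this \<beta>_nonneg]
      show "\<beta> * ?H \<tau> - \<beta> * ?H \<sigma> + \<beta> * energy \<Lambda> \<sigma> \<le> distortion \<Lambda> + \<beta> * energy \<Lambda> \<tau>"
        by (simp add: distortion_def algebra_simps)
    qed simp
    finally show ?thesis by (simp add: exp_add mult_ac)
  qed
  have "measure M (cyl \<Lambda> \<sigma> \<inter> B) * exp (\<beta> * energy \<Lambda> \<sigma>)
      = (\<Sum>\<theta>\<in>patterns R. indicator B \<theta> * (?p \<theta> \<sigma> * exp (\<beta> * energy \<Lambda> \<sigma>)))"
    unfolding measure_cyl_Int_local[OF assms(1) R(1,2) B] sum_distrib_right by (simp add: mult.assoc)
  also have "\<dots> \<le> (\<Sum>\<theta>\<in>patterns R. indicator B \<theta> * (exp (distortion \<Lambda>) * (?p \<theta> \<tau> * exp (\<beta> * energy \<Lambda> \<tau>))))"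
    by (intro sum_mono mult_left_mono weights) simp
  also have "\<dots> = exp (distortion \<Lambda>) * (measure M (cyl \<Lambda> \<tau> \<inter> B) * exp (\<beta> * energy \<Lambda> \<tau>))"
    unfolding measure_cyl_Int_local[OF assms(1) R(1,2) B] sum_distrib_right sum_distrib_left
    by (simp add: mult_ac)
  finally show ?thesis .
qed

text \<open>The comparison is summed over all patterns of \<Lambda>, which turns relative weights
  into the free-boundary Gibbs weight.\<close>

lemma pattern_prob_bounds:
  assumes "finite \<Lambda>" "finite T" "\<Lambda> \<inter> T = {}" "local_on T (\<lambda>\<sigma>. \<sigma> \<in> B)"
  shows "measure M (cyl \<Lambda> \<sigma> \<inter> B) * exp (\<beta> * energy \<Lambda> \<sigma>) * partition_sum \<beta> \<Lambda> \<le> exp (distortion \<Lambda>) * measure M B"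
    and "measure M B \<le> exp (distortion \<Lambda>) * (measure M (cyl \<Lambda> \<sigma> \<inter> B) * exp (\<beta> * energy \<Lambda> \<sigma>) * partition_sum \<beta> \<Lambda>)"
proof -
  have BM: "B \<in> sets M" by (rule local_sets[OF assms(2,4)])
  have B: "measure M B = (\<Sum>\<tau>\<in>patterns \<Lambda>. measure M (cyl \<Lambda> \<tau> \<inter> B))"
    by (rule sum_measure_cyl_Int[OF assms(1) BM, symmetric])
  note c = compare_patterns[OF assms]
  have "measure M (cyl \<Lambda> \<sigma> \<inter> B) * exp (\<beta> * energy \<Lambda> \<sigma>) * partition_sum \<beta> \<Lambda>
      = (\<Sum>\<tau>\<in>patterns \<Lambda>. measure M (cyl \<Lambda> \<sigma> \<inter> B) * exp (\<beta> * energy \<Lambda> \<sigma>) * exp (- (\<beta> * energy \<Lambda> \<tau>)))"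
    by (simp add: partition_sum_def sum_distrib_left)
  also have "\<dots> \<le> (\<Sum>\<tau>\<in>patterns \<Lambda>. exp (distortion \<Lambda>) * (measure M (cyl \<Lambda> \<tau> \<inter> B) * exp (\<beta> * energy \<Lambda> \<tau>)) * exp (- (\<beta> * energy \<Lambda> \<tau>)))"
    by (intro sum_mono mult_right_mono c) simp
  also have "\<dots> = exp (distortion \<Lambda>) * measure M B"
    unfolding B sum_distrib_left by (intro sum.cong refl) (simp add: exp_minus)
  finally show "measure M (cyl \<Lambda> \<sigma> \<inter> B) * exp (\<beta> * energy \<Lambda> \<sigma>) * partition_sum \<beta> \<Lambda> \<le> exp (distortion \<Lambda>) * measure M B" .
  have "measure M B = (\<Sum>\<tau>\<in>patterns \<Lambda>. measure M (cyl \<Lambda> \<tau> \<inter> B) * exp (\<beta> * energy \<Lambda> \<tau>) * exp (- (\<beta> * energy \<Lambda> \<tau>)))"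
    unfolding B by (intro sum.cong refl) (simp add: exp_minus)
  also have "\<dots> \<le> (\<Sum>\<tau>\<in>patterns \<Lambda>. exp (distortion \<Lambda>) * (measure M (cyl \<Lambda> \<sigma> \<inter> B) * exp (\<beta> * energy \<Lambda> \<sigma>)) * exp (- (\<beta> * energy \<Lambda> \<tau>)))"
    by (intro sum_mono mult_right_mono c) simp
  also have "\<dots> = exp (distortion \<Lambda>) * (measure M (cyl \<Lambda> \<sigma> \<inter> B) * exp (\<beta> * energy \<Lambda> \<sigma>) * partition_sum \<beta> \<Lambda>)"
    by (simp add: partition_sum_def sum_distrib_left mult.assoc)
  finally show "measure M B \<le> exp (distortion \<Lambda>) * (measure M (cyl \<Lambda> \<sigma> \<inter> B) * exp (\<beta> * energy \<Lambda> \<sigma>) * partition_sum \<beta> \<Lambda>)" .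
qed

lemma cyl_prob_bounds:
  assumes "finite \<Lambda>"
  shows "measure M (cyl \<Lambda> \<sigma>) * exp (\<beta> * energy \<Lambda> \<sigma>) * partition_sum \<beta> \<Lambda> \<le> exp (distortion \<Lambda>)"
    and "1 \<le> exp (distortion \<Lambda>) * (measure M (cyl \<Lambda> \<sigma>) * exp (\<beta> * energy \<Lambda> \<sigma>) * partition_sum \<beta> \<Lambda>)"
  using pattern_prob_bounds[OF assms, of "{}" UNIV \<sigma>] prob_space by (simp_all add: local_on_def)

lemma cyl_prob_pos: "finite \<Lambda> \<Longrightarrow> 0 < measure M (cyl \<Lambda> \<sigma>)"
  using cyl_prob_bounds(2)[of \<Lambda> \<sigma>] by (cases "measure M (cyl \<Lambda> \<sigma>) = 0") (auto simp: zero_less_measure_iff)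

lemma abs_ln_cyl_prob:
  assumes "finite \<Lambda>"
  shows "\<bar>- ln (measure M (cyl \<Lambda> \<sigma>)) - (\<beta> * energy \<Lambda> \<sigma> + ln (partition_sum \<beta> \<Lambda>))\<bar> \<le> distortion \<Lambda>"
proof -
  let ?q = "measure M (cyl \<Lambda> \<sigma>) * exp (\<beta> * energy \<Lambda> \<sigma>) * partition_sum \<beta> \<Lambda>"
  have pos: "0 < measure M (cyl \<Lambda> \<sigma>)" "0 < partition_sum \<beta> \<Lambda>" "0 < ?q"
    using cyl_prob_pos partition_sum_pos assms by auto
  have l: "ln ?q = ln (measure M (cyl \<Lambda> \<sigma>)) + \<beta> * energy \<Lambda> \<sigma> + ln (partition_sum \<beta> \<Lambda>)"
    using pos by (simp add: ln_mult)
  have "ln ?q \<le> ln (exp (distortion \<Lambda>))"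
    using cyl_prob_bounds(1)[OF assms, of \<sigma>] pos by (intro ln_mono) auto
  moreover have "ln 1 \<le> ln (exp (distortion \<Lambda>) * ?q)"
    using cyl_prob_bounds(2)[OF assms, of \<sigma>] by (intro ln_mono) auto
  moreover have "ln (exp (distortion \<Lambda>) * ?q) = distortion \<Lambda> + ln ?q"
    using pos(3) by (subst ln_mult) auto
  ultimately show ?thesis unfolding l by simp
qed

text \<open>Given \<open>B\<close> or not, the probability of the pattern is its free Gibbs weight
  up to one distortion; comparing the two costs the distortion twice.\<close>

lemma conditional_pattern_prob_ge:
  assumes "finite \<Lambda>" "finite T" "\<Lambda> \<inter> T = {}" "local_on T (\<lambda>\<sigma>. \<sigma> \<in> B)"
  shows "exp (- 2 * distortion \<Lambda>) * measure M (cyl \<Lambda> \<sigma>) * measure M B \<le> measure M (cyl \<Lambda> \<sigma> \<inter> B)"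
proof -
  let ?w = "exp (\<beta> * energy \<Lambda> \<sigma>) * partition_sum \<beta> \<Lambda>"
  have w: "0 < ?w" using partition_sum_pos[OF assms(1)] by simp
  have e: "exp (2 * distortion \<Lambda>) = exp (distortion \<Lambda>) * exp (distortion \<Lambda>)"
    by (simp add: exp_add[symmetric])
  have "measure M (cyl \<Lambda> \<sigma>) * measure M B * ?w = (measure M (cyl \<Lambda> \<sigma>) * exp (\<beta> * energy \<Lambda> \<sigma>) * partition_sum \<beta> \<Lambda>) * measure M B"
    by simp
  also have "\<dots> \<le> exp (distortion \<Lambda>) * (exp (distortion \<Lambda>) * (measure M (cyl \<Lambda> \<sigma> \<inter> B) * exp (\<beta> * energy \<Lambda> \<sigma>) * partition_sum \<beta> \<Lambda>))"
    using cyl_prob_bounds(1)[OF assms(1)] pattern_prob_bounds(2)[OF assms] by (intro mult_mono) auto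
  also have "\<dots> = (exp (2 * distortion \<Lambda>) * measure M (cyl \<Lambda> \<sigma> \<inter> B)) * ?w"
    by (simp add: e)
  finally have "measure M (cyl \<Lambda> \<sigma>) * measure M B \<le> exp (2 * distortion \<Lambda>) * measure M (cyl \<Lambda> \<sigma> \<inter> B)"
    using w by (simp only: mult_le_cancel_right_pos)
  then show ?thesis by (simp add: exp_minus field_simps)
qed

text \<open>The disjoint translates are tried in succession: whatever happened on the others, the
  next one succeeds with at least the probability of the pattern reduced by the quasi-independence
  factor.\<close>

lemma measure_avoid_le:
  assumes "finite \<Lambda>" "finite F" "disjoint_family_on (\<lambda>x. (+) x ` \<Lambda>) F"
  shows "measure M {\<sigma>. \<forall>x\<in>F. \<sigma> \<notin> cyl ((+) x ` \<Lambda>) (shift (- x) \<eta>)}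
    \<le> (1 - exp (- 2 * distortion \<Lambda>) * measure M (cyl \<Lambda> \<eta>)) ^ card F"
  using assms(2,3)
proof (induction F rule: finite_induct)
  case empty
  then show ?case using prob_space by simp
next
  case (insert x F)
  let ?c = "exp (- 2 * distortion \<Lambda>) * measure M (cyl \<Lambda> \<eta>)"
  let ?C = "\<lambda>x. cyl ((+) x ` \<Lambda>) (shift (- x) \<eta>)"
  define B where "B = {\<sigma>. \<forall>y\<in>F. \<sigma> \<notin> ?C y}"
  define T where "T = (\<Union>y\<in>F. (+) y ` \<Lambda>)"
  have T: "finite T" using insert assms(1) by (simp add: T_def)
  have disj: "(+) x ` \<Lambda> \<inter> T = {}"
    using insert.prems insert.hyps unfolding disjoint_family_on_def T_def by fastforce
  have loc: "local_on T (\<lambda>\<sigma>. \<sigma> \<in> B)"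
  proof (rule local_onI)
    fix \<sigma> \<tau> :: "('d, 'a) config" assume e: "\<And>z. z \<in> T \<Longrightarrow> \<sigma> z = \<tau> z"
    have "\<sigma> \<in> ?C y \<longleftrightarrow> \<tau> \<in> ?C y" if "y \<in> F" for y
    proof -
      have "\<sigma> z = \<tau> z" if "z \<in> (+) y ` \<Lambda>" for z using e that \<open>y \<in> F\<close> unfolding T_def by blast
      then show ?thesis unfolding cyl_def by simp
    qed
    then show "(\<sigma> \<in> B) = (\<tau> \<in> B)" by (simp add: B_def)
  qed
  have fin: "finite ((+) x ` \<Lambda>)" using assms(1) by simp
  have IH: "measure M B \<le> (1 - ?c) ^ card F"
    unfolding B_def using insert.prems by (intro insert.IH) (auto simp: disjoint_family_on_def)
  have c: "?c * measure M B \<le> measure M (?C x \<inter> B)"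
    using conditional_pattern_prob_ge[OF fin T disj loc, of "shift (- x) \<eta>"]
    by (simp add: distortion_translate shift_invariant assms(1))
  have c1: "?c \<le> 1"
  proof -
    have "?c \<le> 1 * 1" by (rule mult_mono) (use distortion_nonneg prob_le_1 in auto)
    then show ?thesis by simp
  qed
  have "{\<sigma>. \<forall>x\<in>insert x F. \<sigma> \<notin> ?C x} = B - ?C x \<inter> B" by (auto simp: B_def)
  then have "measure M {\<sigma>. \<forall>x\<in>insert x F. \<sigma> \<notin> ?C x} = measure M B - measure M (?C x \<inter> B)"
    using local_sets[OF T loc] fin by (simp add: finite_measure_Diff)
  also have "\<dots> \<le> (1 - ?c) * measure M B" using c by (simp add: algebra_simps)
  also have "\<dots> \<le> (1 - ?c) * (1 - ?c) ^ card F" using IH c1 by (intro mult_left_mono) auto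
  finally show ?case using insert.hyps by simp
qed

end

section \<open>Waiting times\<close>

text \<open>Infima in \<open>enat\<close> are attained, so the event is a finite union of translated
  cylinders. Deleting the origin from the cube expresses \<open>norm1 x > 0\<close>.\<close>

lemma waiting_time_le_iff:
  "waiting_time n \<xi> \<sigma> \<le> enat k \<longleftrightarrow>
    (\<exists>x\<in>cube k - {0}. \<sigma> \<in> cyl ((+) x ` cube n) (shift (- x) \<xi>))"
proof -
  let ?P = "\<lambda>k. \<exists>x. norm1 x > 0 \<and> (\<forall>i. 0 \<le> x $ i \<and> x $ i \<le> int k) \<and>
     restrict (shift x \<sigma>) (cube n) = restrict \<xi> (cube n)"
  have P: "?P k \<longleftrightarrow> (\<exists>x\<in>cube k - {0}. \<sigma> \<in> cyl ((+) x ` cube n) (shift (- x) \<xi>))" for k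
  proof -
    have "restrict (shift x \<sigma>) (cube n) = restrict \<xi> (cube n) \<longleftrightarrow> \<sigma> \<in> cyl ((+) x ` cube n) (shift (- x) \<xi>)" for x
    proof -
      have "restrict (shift x \<sigma>) (cube n) = restrict \<xi> (cube n) \<longleftrightarrow> (\<forall>y\<in>cube n. \<sigma> (x + y) = \<xi> y)"
        by (auto simp: fun_eq_iff restrict_def shift_def)
      then show ?thesis by (simp add: cyl_def shift_def)
    qed
    then show ?thesis by (auto simp: norm1_pos_iff cube_def)
  qed
  have "waiting_time n \<xi> \<sigma> \<le> enat k \<longleftrightarrow> ?P k"
  proof
    assume "?P k"
    then show "waiting_time n \<xi> \<sigma> \<le> enat k" unfolding waiting_time_def by (intro Inf_lower) blast
  next
    assume le: "waiting_time n \<xi> \<sigma> \<le> enat k"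
    define A where "A = {enat k | k. ?P k}"
    have w: "waiting_time n \<xi> \<sigma> = Inf A" by (simp only: waiting_time_def A_def)
    have "A \<noteq> {}" using le by (auto simp: w Inf_enat_def)
    then have "Inf A \<in> A" by (metis all_not_in_conv wellorder_InfI)
    then obtain j where "Inf A = enat j" "?P j" unfolding A_def by blast
    then have j: "waiting_time n \<xi> \<sigma> = enat j" "?P j" by (simp_all only: w)
    then have "j \<le> k" using le by simp
    with j(2) show "?P k" by (meson of_nat_mono order_trans)
  qed
  then show ?thesis by (simp only: P)
qed

lemma waiting_time_restrict: "waiting_time n (restrict \<xi> (cube n)) \<sigma> = waiting_time n \<xi> \<sigma>"
  by (simp add: waiting_time_def)

lemma waiting_time_pos: "waiting_time n \<xi> \<sigma> \<ge> 1"
proof -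
  have "\<not> waiting_time n \<xi> \<sigma> \<le> enat 0"
  proof -
    have "x = 0" if "\<forall>i. 0 \<le> x $ i \<and> x $ i \<le> 0" for x :: "int ^ 'a"
      using that by (auto simp: vec_eq_iff intro: antisym)
    then have "cube 0 - {0} = ({} :: (int ^ 'a) set)" unfolding cube_def by auto
    then show ?thesis by (simp only: waiting_time_le_iff) simp
  qed
  then show ?thesis by (simp add: zero_enat_def[symmetric] ileI1[of 0, unfolded one_eSuc[symmetric]])
qed

context gibbs_state
begin

lemma waiting_time_le_sets [measurable]: "{\<sigma>. waiting_time n \<xi> \<sigma> \<le> enat k} \<in> sets M"
proof -
  have "{\<sigma>. waiting_time n \<xi> \<sigma> \<le> enat k} = (\<Union>x\<in>cube k - {0}. cyl ((+) x ` cube n) (shift (- x) \<xi>))"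
    by (auto simp: waiting_time_le_iff)
  then show ?thesis by simp
qed

lemma waiting_time_measurable [measurable]: "waiting_time n \<xi> \<in> measurable M (count_space UNIV)"
proof -
  have fin: "waiting_time n \<xi> -` {enat k} \<inter> space M \<in> sets M" for k
  proof -
    have "waiting_time n \<xi> -` {enat k} \<inter> space M
        = {\<sigma>. waiting_time n \<xi> \<sigma> \<le> enat k} - (\<Union>j<k. {\<sigma>. waiting_time n \<xi> \<sigma> \<le> enat j})"
    proof -
      have "e = enat k \<longleftrightarrow> e \<le> enat k \<and> (\<forall>j<k. \<not> e \<le> enat j)" for e :: enat
        by (cases e) (auto simp: not_le intro: le_neq_implies_less)
      then show ?thesis by auto
    qed
    then show ?thesis by simp
  qed
  have "waiting_time n \<xi> -` {\<infinity>} \<inter> space M = space M - (\<Union>k. waiting_time n \<xi> -` {enat k} \<inter> space M)"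
  proof -
    have "e = \<infinity> \<longleftrightarrow> (\<forall>k. e \<noteq> enat k)" for e :: enat by (cases e) auto
    then show ?thesis by auto
  qed
  moreover have "\<dots> \<in> sets M" using fin by (intro sets.compl_sets sets.countable_UN) auto
  ultimately have "waiting_time n \<xi> -` {e} \<inter> space M \<in> sets M" for e
    using fin by (cases e) auto
  then show ?thesis by (simp add: measurable_count_space_eq_countable)
qed

lemma waiting_time_le_prob:
  "measure M {\<sigma>. waiting_time n \<eta> \<sigma> \<le> enat k} \<le> real (k + 1) ^ CARD('d) * measure M (cyl (cube n) \<eta>)"
proof -
  have "measure M {\<sigma>. waiting_time n \<eta> \<sigma> \<le> enat k} = measure M (\<Union>x\<in>cube k - {0}. cyl ((+) x ` cube n) (shift (- x) \<eta>))"
    by (rule arg_cong[of _ _ "measure M"]) (auto simp: waiting_time_le_iff)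
  also have "\<dots> \<le> (\<Sum>x\<in>cube k - {0}. measure M (cyl ((+) x ` cube n) (shift (- x) \<eta>)))"
    by (rule finite_measure_subadditive_finite) auto
  also have "\<dots> = real (card (cube k - {0 :: int ^ 'd})) * measure M (cyl (cube n) \<eta>)"
    by (simp add: shift_invariant)
  also have "\<dots> \<le> real (card (cube k :: (int ^ 'd) set)) * measure M (cyl (cube n) \<eta>)"
    by (intro mult_right_mono of_nat_mono card_mono) auto
  finally show ?thesis by (simp add: card_cube add.commute)
qed

end

text \<open>Corners of a grid of \<open>m ^ d\<close> translates of \<open>cube n\<close>. The
  spacing is \<open>n + 1\<close> because the cube has \<open>n + 1\<close> sites in each
  direction.\<close>

definition base_points :: "nat \<Rightarrow> nat \<Rightarrow> (int ^ 'd::finite) set" where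
  "base_points n m = {x. \<forall>i. x $ i \<in> (\<lambda>j. int (n + 1) * int j) ` {..<m}}"

lemma finite_base_points [simp]: "finite (base_points n m)"
  unfolding base_points_def by (rule finite_vec_set) simp

lemma card_base_points: "card (base_points n m :: (int ^ 'd::finite) set) = m ^ CARD('d)"
proof -
  have "inj_on (\<lambda>j. int (n + 1) * int j) {..<m}" by (rule inj_onI) (simp del: of_nat_add)
  then show ?thesis unfolding base_points_def card_vec_set by (simp add: card_image)
qed

lemma base_points_disjoint: "disjoint_family_on (\<lambda>x. (+) x ` cube n) (base_points n m)"
  unfolding disjoint_family_on_def
proof (intro ballI impI)
  fix x y :: "int ^ 'a" assume xy: "x \<in> base_points n m" "y \<in> base_points n m" "x \<noteq> y"
  show "(+) x ` cube n \<inter> (+) y ` cube n = {}"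
  proof (rule ccontr)
    assume "(+) x ` cube n \<inter> (+) y ` cube n \<noteq> {}"
    then obtain u v where uv: "u \<in> cube n" "v \<in> cube n" "x + u = y + v" by auto
    have "x $ i = y $ i" for i
    proof -
      obtain j k where jk: "x $ i = int (n + 1) * int j" "y $ i = int (n + 1) * int k"
        using xy(1,2) unfolding base_points_def by blast
      have u: "0 \<le> u $ i" "u $ i < int (n + 1)" "0 \<le> v $ i" "v $ i < int (n + 1)"
        using uv(1,2) by (auto simp: cube_def dest!: spec[of _ i])
      have "x $ i + u $ i = y $ i + v $ i" using uv(3) by (metis vector_add_component)
      then have "(int (n + 1) * int j + u $ i) div int (n + 1) = (int (n + 1) * int k + v $ i) div int (n + 1)"
        by (simp only: jk)
      then have "j = k" using u by (simp del: of_nat_add)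
      then show ?thesis by (simp add: jk)
    qed
    then show False using xy(3) by (simp add: vec_eq_iff)
  qed
qed

lemma base_points_subset_cube:
  assumes "x \<in> base_points n m" "y \<in> cube n"
  shows "0 \<le> (x + y) $ i \<and> (x + y) $ i < int (n + 1) * int m"
proof -
  obtain j where j: "x $ i = int (n + 1) * int j" "j < m"
    using assms(1) unfolding base_points_def by blast
  have y: "0 \<le> y $ i" "y $ i < int (n + 1)" using assms(2) by (auto simp: cube_def dest!: spec[of _ i])
  have "int (n + 1) * int j + int (n + 1) \<le> int (n + 1) * int m"
    using mult_left_mono[of "int j + 1" "int m" "int (n + 1)"] j(2) by (simp add: algebra_simps)
  then show ?thesis using y j by (simp add: add_nonneg_nonneg del: of_nat_add)
qed

section \<open>The upper tail of the waiting time for a fixed pattern\<close>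

context gibbs_state
begin

lemma waiting_time_gt_prob:
  "measure M {\<sigma>. \<not> waiting_time n \<eta> \<sigma> \<le> enat k}
    \<le> 3 * exp (- (exp (- 2 * distortion (cube n)) / real (n + 1) ^ CARD('d)
        * measure M (cyl (cube n) \<eta>) * real k ^ CARD('d)))"
proof -
  \<comment> \<open>The number of multiples of \<open>n + 1\<close> between 0 and \<open>k\<close>.
    Only the corner of a translate has to lie in \<open>cube k\<close>, not the whole
    translate.\<close>
  define m where "m = k div (n + 1) + 1"
  let ?B = "base_points n m :: (int ^ 'd) set"
  \<comment> \<open>The zero shift is not an admissible occurrence. Losing this one trial costs at
    most a factor \<open>exp 1\<close>, whence the constant 3.\<close>
  let ?F = "?B - {0}"
  define c where "c = exp (- 2 * distortion (cube n)) * measure M (cyl (cube n) \<eta>)"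
  have c: "0 \<le> c" "c \<le> 1"
  proof -
    have "c \<le> 1 * 1" unfolding c_def by (rule mult_mono) (use distortion_nonneg prob_le_1 in auto)
    then show "c \<le> 1" by simp
  qed (simp add: c_def)
  have sub: "?F \<subseteq> cube k - {0}"
  proof
    fix x assume x: "x \<in> ?F"
    have "0 \<le> x $ i \<and> x $ i \<le> int k" for i
    proof -
      obtain j where j: "x $ i = int (n + 1) * int j" "j < m"
        using x unfolding base_points_def by blast
      then have "j * (n + 1) \<le> k" by (simp add: m_def less_Suc_eq_le less_eq_div_iff_mult_less_eq)
      then have "int (j * (n + 1)) \<le> int k" by (simp only: of_nat_le_iff)
      then have "int (n + 1) * int j \<le> int k" by (simp only: of_nat_mult mult.commute)
      then show ?thesis by (simp only: j) (simp del: of_nat_add)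
    qed
    then show "x \<in> cube k - {0}" using x by (simp add: cube_def)
  qed
  have "{\<sigma>. \<not> waiting_time n \<eta> \<sigma> \<le> enat k} \<subseteq> {\<sigma>. \<forall>x\<in>?F. \<sigma> \<notin> cyl ((+) x ` cube n) (shift (- x) \<eta>)}"
    using sub by (auto simp: waiting_time_le_iff)
  then have "measure M {\<sigma>. \<not> waiting_time n \<eta> \<sigma> \<le> enat k}
      \<le> measure M {\<sigma>. \<forall>x\<in>?F. \<sigma> \<notin> cyl ((+) x ` cube n) (shift (- x) \<eta>)}"
  proof (rule finite_measure_mono)
    have "{\<sigma>. \<forall>x\<in>?F. \<sigma> \<notin> cyl ((+) x ` cube n) (shift (- x) \<eta>)}
        = space M - (\<Union>x\<in>?F. cyl ((+) x ` cube n) (shift (- x) \<eta>))" by auto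
    moreover have "\<dots> \<in> sets M" by (intro sets.compl_sets sets.finite_UN) auto
    ultimately show "{\<sigma>. \<forall>x\<in>?F. \<sigma> \<notin> cyl ((+) x ` cube n) (shift (- x) \<eta>)} \<in> sets M" by (simp only:)
  qed
  also have "\<dots> \<le> (1 - c) ^ card ?F"
    unfolding c_def using base_points_disjoint[of n m]
    by (intro measure_avoid_le) (auto simp: disjoint_family_on_def)
  also have "\<dots> \<le> exp (- c) ^ card ?F"
    using c exp_ge_add_one_self[of "- c"] by (intro power_mono) auto
  also have "\<dots> = exp (- (c * real (card ?F)))" by (simp add: exp_of_nat_mult[symmetric] mult.commute)
  also have "\<dots> \<le> exp (1 - c * real (m ^ CARD('d)))"
  proof (rule exp_mono)
    have "card ?B \<le> card (insert 0 ?F)" by (rule card_mono) auto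
    also have "\<dots> = card ?F + 1" by (subst card_insert_disjoint) auto
    finally have "card ?B \<le> card ?F + 1" .
    then have "real (m ^ CARD('d)) \<le> real (card ?F) + 1" unfolding card_base_points[symmetric, of m n]
      by linarith
    then have "c * real (m ^ CARD('d)) \<le> c * (real (card ?F) + 1)" using c by (intro mult_left_mono)
    then show "- (c * real (card ?F)) \<le> 1 - c * real (m ^ CARD('d))" using c by (simp add: algebra_simps)
  qed
  also have "\<dots> = exp 1 * exp (- (c * real (m ^ CARD('d))))" by (simp add: exp_diff exp_minus field_simps)
  also have "\<dots> \<le> 3 * exp (- (c * real (m ^ CARD('d))))" using exp_le by (intro mult_right_mono) auto
  also have "\<dots> \<le> 3 * exp (- (c * (real k / real (n + 1)) ^ CARD('d)))"
  proof -
    have "k < m * (n + 1)" unfolding m_def using dividend_less_div_times[of "n + 1" k] by (simp add: add.commute)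
    then have "real k \<le> real m * real (n + 1)" by (metis less_imp_le of_nat_le_iff of_nat_mult)
    then have "real k / real (n + 1) \<le> real m" by (simp add: field_simps)
    then have "(real k / real (n + 1)) ^ CARD('d) \<le> real (m ^ CARD('d))" by (simp add: power_mono)
    then show ?thesis using c by (simp add: mult_left_mono)
  qed
  finally show ?thesis by (simp add: c_def power_divide mult_ac)
qed

end

text \<open>The waiting time depends on \<xi> only through its pattern on the cube, so Tonelli's
  theorem becomes a finite sum. Finiteness of the set of patterns also gives joint
  measurability.\<close>

lemma (in gibbs_state) nn_integral_waiting_time:
  "(\<integral>\<^sup>+ (\<xi>, \<sigma>). g (waiting_time n \<xi> \<sigma>) \<partial>(M \<Otimes>\<^sub>M M))
    = (\<Sum>\<eta>\<in>patterns (cube n). ennreal (measure M (cyl (cube n) \<eta>)) * (\<integral>\<^sup>+ \<sigma>. g (waiting_time n \<eta> \<sigma>) \<partial>M))"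
proof -
  have res: "(\<lambda>z. restrict (fst z) (cube n)) \<in> measurable (M \<Otimes>\<^sub>M M) (count_space (patterns (cube n)))"
  proof (subst measurable_count_space_eq_countable)
    show "countable (patterns (cube n :: (int ^ 'd) set) :: ('d, 'a) config set)" by (intro countable_finite patterns_finite) simp
    have "(\<lambda>z. restrict (fst z) (cube n)) -` {\<eta>} \<inter> space (M \<Otimes>\<^sub>M M) \<in> sets (M \<Otimes>\<^sub>M M)"
      if \<eta>: "\<eta> \<in> patterns (cube n)" for \<eta>
    proof -
      have "(\<lambda>z. restrict (fst z) (cube n)) -` {\<eta>} \<inter> space (M \<Otimes>\<^sub>M M) = fst -` cyl (cube n) \<eta> \<inter> space (M \<Otimes>\<^sub>M M)"
        using cylinder_eq_cyl[OF \<eta>] by (auto simp: cylinder_def)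
      moreover have "\<dots> \<in> sets (M \<Otimes>\<^sub>M M)" by (rule measurable_sets[OF measurable_fst]) simp
      ultimately show ?thesis by (simp only:)
    qed
    then show "(\<lambda>z. restrict (fst z) (cube n)) \<in> space (M \<Otimes>\<^sub>M M) \<rightarrow> patterns (cube n) \<and>
      (\<forall>\<eta>\<in>patterns (cube n). (\<lambda>z. restrict (fst z) (cube n)) -` {\<eta>} \<inter> space (M \<Otimes>\<^sub>M M) \<in> sets (M \<Otimes>\<^sub>M M))"
      by (auto simp del: vimage_Int)
  qed
  have w: "(\<lambda>z. waiting_time n (restrict (fst z) (cube n)) (snd z)) \<in> measurable (M \<Otimes>\<^sub>M M) (count_space UNIV)"
    by (rule measurable_compose_countable'[OF _ res countable_finite])
      (simp_all add: measurable_compose[OF measurable_snd waiting_time_measurable])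
  have meas: "(\<lambda>(\<xi>, \<sigma>). g (waiting_time n \<xi> \<sigma>)) \<in> borel_measurable (M \<Otimes>\<^sub>M M)"
    using measurable_compose[OF w, of g borel] by (simp add: waiting_time_restrict case_prod_beta')
  let ?G = "\<lambda>\<xi>. \<integral>\<^sup>+ \<sigma>. g (waiting_time n \<xi> \<sigma>) \<partial>M"
  have "(\<integral>\<^sup>+ (\<xi>, \<sigma>). g (waiting_time n \<xi> \<sigma>) \<partial>(M \<Otimes>\<^sub>M M)) = (\<integral>\<^sup>+ \<xi>. ?G \<xi> \<partial>M)"
    using nn_integral_fst[OF meas] by simp
  also have "\<dots> = (\<integral>\<^sup>+ \<xi>. (\<Sum>\<eta>\<in>patterns (cube n). ?G \<eta> * indicator (cyl (cube n) \<eta>) \<xi>) \<partial>M)"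
  proof (rule nn_integral_cong)
    fix \<xi> :: "('d, 'a) config"
    have "(\<Sum>\<eta>\<in>patterns (cube n). ?G \<eta> * indicator (cyl (cube n) \<eta>) \<xi>)
        = (\<Sum>\<eta>\<in>patterns (cube n). if \<eta> = restrict \<xi> (cube n) then ?G \<xi> else 0)"
    proof (rule sum.cong[OF refl])
      fix \<eta> :: "('d, 'a) config" assume \<eta>: "\<eta> \<in> patterns (cube n)"
      have "\<xi> \<in> cyl (cube n) \<eta> \<longleftrightarrow> \<eta> = restrict \<xi> (cube n)"
        using cylinder_eq_cyl[OF \<eta>] by (auto simp: cylinder_def)
      then show "?G \<eta> * indicator (cyl (cube n) \<eta>) \<xi> = (if \<eta> = restrict \<xi> (cube n) then ?G \<xi> else 0)"
        by (auto simp: waiting_time_restrict)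
    qed
    then show "?G \<xi> = (\<Sum>\<eta>\<in>patterns (cube n). ?G \<eta> * indicator (cyl (cube n) \<eta>) \<xi>)" by simp
  qed
  also have "\<dots> = (\<Sum>\<eta>\<in>patterns (cube n). \<integral>\<^sup>+ \<xi>. ?G \<eta> * indicator (cyl (cube n) \<eta>) \<xi> \<partial>M)"
    by (rule nn_integral_sum) simp
  also have "\<dots> = (\<Sum>\<eta>\<in>patterns (cube n). ennreal (measure M (cyl (cube n) \<eta>)) * ?G \<eta>)"
    by (intro sum.cong refl, subst nn_integral_cmult_indicator) (simp_all add: emeasure_eq_measure mult.commute)
  finally show ?thesis .
qed

lemma (in gibbs_state) measure_waiting_time:
  "measure (M \<Otimes>\<^sub>M M) {(\<xi>, \<sigma>). R (waiting_time n \<xi> \<sigma>)}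
    = (\<Sum>\<eta>\<in>patterns (cube n). measure M (cyl (cube n) \<eta>) * measure M {\<sigma>. R (waiting_time n \<eta> \<sigma>)})"
proof -
  have sets: "{\<sigma>. R (waiting_time n \<eta> \<sigma>)} \<in> sets M" for \<eta>
    using measurable_sets[OF waiting_time_measurable, of "Collect R" n \<eta>] by (simp add: vimage_def)
  have e: "emeasure M' A = (\<integral>\<^sup>+ x. indicator A x \<partial>M')" if "A \<in> sets M'" for A and M' :: "'z measure"
    using that by simp
  have sets2: "{(\<xi>, \<sigma>). R (waiting_time n \<xi> \<sigma>)} \<in> sets (M \<Otimes>\<^sub>M M)"
  proof -
    have "{(\<xi> :: ('d, 'a) config, \<sigma>). R (waiting_time n \<xi> \<sigma>)} = (\<Union>\<eta>\<in>patterns (cube n). cyl (cube n) \<eta> \<times> {\<sigma>. R (waiting_time n \<eta> \<sigma>)})"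
    proof safe
      fix \<xi> \<sigma> assume "R (waiting_time n \<xi> \<sigma>)"
      then show "(\<xi>, \<sigma>) \<in> (\<Union>\<eta>\<in>patterns (cube n). cyl (cube n) \<eta> \<times> {\<sigma>. R (waiting_time n \<eta> \<sigma>)})"
        by (intro UN_I[of "restrict \<xi> (cube n)"]) (auto simp: waiting_time_restrict)
    next
      fix \<xi> \<sigma> \<eta> assume "\<eta> \<in> patterns (cube n)" "R (waiting_time n \<eta> \<sigma>)" "\<xi> \<in> cyl (cube n) \<eta>"
      then have "\<eta> = restrict \<xi> (cube n)" using cylinder_eq_cyl[of \<eta> "cube n"] by (auto simp: cylinder_def)
      then show "R (waiting_time n \<xi> \<sigma>)" using \<open>R (waiting_time n \<eta> \<sigma>)\<close> by (simp add: waiting_time_restrict)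
    qed
    moreover have "\<dots> \<in> sets (M \<Otimes>\<^sub>M M)" by (intro sets.finite_UN pair_measureI sets) auto
    ultimately show ?thesis by (simp only:)
  qed
  have "emeasure (M \<Otimes>\<^sub>M M) {(\<xi>, \<sigma>). R (waiting_time n \<xi> \<sigma>)}
      = (\<integral>\<^sup>+ z. indicator {(\<xi>, \<sigma>). R (waiting_time n \<xi> \<sigma>)} z \<partial>(M \<Otimes>\<^sub>M M))"
    using sets2 by simp
  also have "\<dots> = (\<integral>\<^sup>+ (\<xi>, \<sigma>). indicator (Collect R) (waiting_time n \<xi> \<sigma>) \<partial>(M \<Otimes>\<^sub>M M))"
    by (intro nn_integral_cong) (auto simp: indicator_def)
  also have "\<dots> = (\<Sum>\<eta>\<in>patterns (cube n). ennreal (measure M (cyl (cube n) \<eta>)) * (\<integral>\<^sup>+ \<sigma>. indicator (Collect R) (waiting_time n \<eta> \<sigma>) \<partial>M))"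
    by (rule nn_integral_waiting_time)
  also have "\<dots> = (\<Sum>\<eta>\<in>patterns (cube n). ennreal (measure M (cyl (cube n) \<eta>) * measure M {\<sigma>. R (waiting_time n \<eta> \<sigma>)}))"
  proof (intro sum.cong refl)
    fix \<eta> :: "('d, 'a) config"
    have "(\<integral>\<^sup>+ \<sigma>. indicator (Collect R) (waiting_time n \<eta> \<sigma>) \<partial>M) = (\<integral>\<^sup>+ \<sigma>. indicator {\<sigma>. R (waiting_time n \<eta> \<sigma>)} \<sigma> \<partial>M)"
      by (intro nn_integral_cong) (auto simp: indicator_def)
    also have "\<dots> = ennreal (measure M {\<sigma>. R (waiting_time n \<eta> \<sigma>)})"
      using sets by (simp add: emeasure_eq_measure)
    finally show "ennreal (measure M (cyl (cube n) \<eta>)) * (\<integral>\<^sup>+ \<sigma>. indicator (Collect R) (waiting_time n \<eta> \<sigma>) \<partial>M)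
      = ennreal (measure M (cyl (cube n) \<eta>) * measure M {\<sigma>. R (waiting_time n \<eta> \<sigma>)})"
      by (simp add: ennreal_mult)
  qed
  also have "\<dots> = ennreal (\<Sum>\<eta>\<in>patterns (cube n). measure M (cyl (cube n) \<eta>) * measure M {\<sigma>. R (waiting_time n \<eta> \<sigma>)})"
    by (rule sum_ennreal) simp
  finally show ?thesis by (simp add: measure_def sum_nonneg)
qed

section \<open>The pressure\<close>

text \<open>The grid with as many blocks per direction as fit into side \<open>N + 1\<close>; for
  \<open>N < n\<close> there are none and the remainder is everything. What is left over is a
  margin, hence of surface order in \<open>N\<close> for fixed \<open>n\<close>.\<close>

lemma cube_tiling:
  obtains m :: nat and R :: "(int ^ 'd::finite) set" where
    "finite R" "(\<Union>x\<in>base_points n m. (+) x ` cube n) \<inter> R = {}"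
    "cube N = (\<Union>x\<in>base_points n m. (+) x ` cube n) \<union> R"
    "real (card R) \<le> real CARD('d) * real (n + 1) * real (N + 1) ^ (CARD('d) - 1)"
    "real (N + 1) ^ CARD('d) = real m ^ CARD('d) * real (n + 1) ^ CARD('d) + real (card R)"
proof -
  define m where "m = (N + 1) div (n + 1)"
  define B where "B = (\<Union>x\<in>base_points n m. (+) x ` cube n :: (int ^ 'd) set)"
  have mN: "(n + 1) * m \<le> N + 1" unfolding m_def by (rule times_div_less_eq_dividend)
  have sub: "B \<subseteq> cube N"
  proof
    fix z assume "z \<in> B"
    then obtain x y where z: "z = x + y" "x \<in> base_points n m" "y \<in> cube n" by (auto simp: B_def)
    have "int (n + 1) * int m \<le> int (N + 1)" using mN by (simp only: of_nat_mult[symmetric] of_nat_le_iff)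
    then have "0 \<le> z $ i \<and> z $ i \<le> int N" for i
      using base_points_subset_cube[OF z(2,3), of i] unfolding z(1) by (auto simp del: vector_add_component)
    then show "z \<in> cube N" by (simp add: cube_def)
  qed
  have "card B = (\<Sum>x\<in>base_points n m. card ((+) x ` cube n :: (int ^ 'd) set))"
    unfolding B_def using base_points_disjoint[of n m] by (intro card_UN_disjoint) (auto simp: disjoint_family_on_def)
  also have "\<dots> = m ^ CARD('d) * (n + 1) ^ CARD('d)"
    by (simp add: card_image card_base_points card_cube)
  finally have cB: "card B = m ^ CARD('d) * (n + 1) ^ CARD('d)" .
  define R where "R = cube N - B"
  have "card R + card B = (N + 1) ^ CARD('d)"
    unfolding R_def using sub card_mono[OF finite_cube sub] by (simp add: card_Diff_subset finite_subset[OF sub] card_cube)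
  then have "real (card R) + real (card B) = real (N + 1) ^ CARD('d)" by (metis of_nat_add of_nat_power)
  then have sum: "real (N + 1) ^ CARD('d) = real m ^ CARD('d) * real (n + 1) ^ CARD('d) + real (card R)"
    unfolding cB by (simp only: of_nat_mult of_nat_power add.commute)
  \<comment> \<open>The width of the uncovered margin: the tiled part is a cube of side
    \<open>N + 1 - j\<close>, to which Bernoulli's bound applies.\<close>
  define j where "j = real (N + 1) - real (m * (n + 1))"
  have j: "0 \<le> j" "j \<le> real (n + 1)" "j \<le> real (N + 1)"
  proof -
    show "0 \<le> j" unfolding j_def using mN by (simp add: mult.commute del: of_nat_mult of_nat_add)
    have "N + 1 < m * (n + 1) + (n + 1)" unfolding m_def using dividend_less_div_times[of "n + 1" "N + 1"] by linarith
    then have "N + 1 \<le> m * (n + 1) + (n + 1)" by simp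
    then have "real (N + 1) \<le> real (m * (n + 1)) + real (n + 1)" by (metis of_nat_add of_nat_le_iff)
    then show "j \<le> real (n + 1)" unfolding j_def by linarith
    show "j \<le> real (N + 1)" unfolding j_def by (simp del: of_nat_mult of_nat_add)
  qed
  have "real (card R) = real (N + 1) ^ CARD('d) - (real (N + 1) - j) ^ CARD('d)"
  proof -
    have "real (N + 1) - j = real m * real (n + 1)" unfolding j_def of_nat_mult by simp
    then show ?thesis using sum unfolding power_mult_distrib[symmetric] by simp
  qed
  also have "\<dots> \<le> real CARD('d) * j * real (N + 1) ^ (CARD('d) - 1)"
    by (rule power_diff_le_boundary) (use j in auto)
  also have "\<dots> \<le> real CARD('d) * real (n + 1) * real (N + 1) ^ (CARD('d) - 1)"
    using j by (intro mult_right_mono mult_left_mono) auto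
  finally have "real (card R) \<le> real CARD('d) * real (n + 1) * real (N + 1) ^ (CARD('d) - 1)" .
  moreover have "finite R" "B \<inter> R = {}" "cube N = B \<union> R" using sub by (auto simp: R_def)
  ultimately show ?thesis using that sum unfolding B_def by blast
qed

text \<open>For fixed \<open>n\<close> the second error vanishes as \<open>N\<close> grows. Hence
  the sequence is Cauchy, and passing to the limit in \<open>N\<close> leaves a rate of convergence
  in \<open>n\<close>.\<close>

lemma almost_constant_convergent:
  fixes b :: "nat \<Rightarrow> real"
  assumes "\<And>n N. \<bar>b N - b n\<bar> \<le> C / real (n + 1) + E * (real (n + 1) / real (N + 1))"
  obtains L where "b \<longlonglongrightarrow> L" "\<And>n. \<bar>L - b n\<bar> \<le> C / real (n + 1)"
proof -
  have lim: "(\<lambda>N. C / real (n + 1) + E * (real (n + 1) / real (N + 1))) \<longlonglongrightarrow> C / real (n + 1) + E * 0" for n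
  proof (intro tendsto_intros)
    have "(\<lambda>N. real (n + 1) * inverse (real (Suc N))) \<longlonglongrightarrow> real (n + 1) * 0"
      by (intro tendsto_intros LIMSEQ_inverse_real_of_nat)
    then show "(\<lambda>N. real (n + 1) / real (N + 1)) \<longlonglongrightarrow> 0" by (simp add: divide_inverse)
  qed
  have C: "(\<lambda>n. C / real (n + 1)) \<longlonglongrightarrow> 0"
    using tendsto_mult_left[OF LIMSEQ_inverse_real_of_nat, of C] by (simp add: divide_inverse)
  have "Cauchy b"
  proof (rule metric_CauchyI)
    fix e :: real assume e: "0 < e"
    then obtain n where n: "C / real (n + 1) < e / 2"
      using order_tendstoD(2)[OF C, of "e / 2"] by (auto simp: eventually_sequentially)
    then obtain N0 where N0: "\<And>N. N \<ge> N0 \<Longrightarrow> C / real (n + 1) + E * (real (n + 1) / real (N + 1)) < e / 2"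
      using order_tendstoD(2)[OF lim, of n "e / 2"] by (auto simp: eventually_sequentially)
    show "\<exists>M. \<forall>m\<ge>M. \<forall>k\<ge>M. dist (b m) (b k) < e"
    proof (intro exI allI impI)
      fix m k assume "N0 \<le> m" "N0 \<le> k"
      then show "dist (b m) (b k) < e"
        using N0[of m] N0[of k] assms[of m n] assms[of k n] unfolding dist_real_def by linarith
    qed
  qed
  then obtain L where L: "b \<longlonglongrightarrow> L" using Cauchy_convergent convergentD by blast
  moreover have "\<bar>L - b n\<bar> \<le> C / real (n + 1)" for n
  proof -
    have "(\<lambda>N. \<bar>b N - b n\<bar>) \<longlonglongrightarrow> \<bar>L - b n\<bar>" by (intro tendsto_intros L)
    then have "\<bar>L - b n\<bar> \<le> C / real (n + 1) + E * 0"
      by (rule LIMSEQ_le[OF _ lim]) (use assms in auto)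
    then show ?thesis by simp
  qed
  ultimately show ?thesis by (rule that)
qed

text \<open>Reconciles the normalization by \<open>n ^ k\<close> in the definitions with the number
  \<open>(n + 1) ^ k\<close> of sites in the cube.\<close>

lemma Suc_power_over_power: "(\<lambda>n. real (n + 1) ^ k / real n ^ k) \<longlonglongrightarrow> 1"
proof -
  have "(\<lambda>n. (1 + inverse (real n)) ^ k) \<longlonglongrightarrow> (1 + 0) ^ k"
    by (intro tendsto_intros lim_inverse_n)
  moreover have "\<forall>\<^sub>F n in sequentially. (1 + inverse (real n)) ^ k = real (n + 1) ^ k / real n ^ k"
    using eventually_gt_at_top[of 0]
  proof eventually_elim
    case (elim n)
    then have "1 + inverse (real n) = real (n + 1) / real n" by (simp add: field_simps)
    then show ?case by (simp only: power_divide)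
  qed
  ultimately show ?thesis using Lim_transform_eventually by fastforce
qed

context finite_range_interaction
begin

text \<open>Blocks are peeled off one by one; each costs its own boundary, the same for all
  translates.\<close>

lemma ln_partition_sum_tiling:
  assumes "finite S" "finite F" "disjoint_family_on (\<lambda>x. (+) x ` S) F"
    and "finite R" "(\<Union>x\<in>F. (+) x ` S) \<inter> R = {}"
  shows "\<bar>ln (partition_sum t ((\<Union>x\<in>F. (+) x ` S) \<union> R)) - real (card F) * ln (partition_sum t S) - ln (partition_sum t R)\<bar>
    \<le> \<bar>t\<bar> * K * real (card (inner_boundary r S)) * real (card F)"
  using assms(2,3,5)
proof (induction F rule: finite_induct)
  case (insert x F)
  let ?T = "(\<Union>x\<in>F. (+) x ` S) \<union> R"
  have fin: "finite ?T" "finite ((+) x ` S)" using assms insert.hyps by auto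
  have disj: "(+) x ` S \<inter> ?T = {}"
    using insert.prems insert.hyps unfolding disjoint_family_on_def by fastforce
  have IH: "\<bar>ln (partition_sum t ?T) - real (card F) * ln (partition_sum t S) - ln (partition_sum t R)\<bar>
    \<le> \<bar>t\<bar> * K * real (card (inner_boundary r S)) * real (card F)"
    using insert.prems by (intro insert.IH) (auto simp: disjoint_family_on_def)
  have "\<bar>ln (partition_sum t ((+) x ` S \<union> ?T)) - ln (partition_sum t ((+) x ` S)) - ln (partition_sum t ?T)\<bar>
    \<le> \<bar>t\<bar> * K * real (card (inner_boundary r ((+) x ` S)))"
    by (rule ln_partition_sum_Un[OF fin(2,1) disj])
  then have "\<bar>ln (partition_sum t ((+) x ` S \<union> ?T)) - ln (partition_sum t S) - ln (partition_sum t ?T)\<bar>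
    \<le> \<bar>t\<bar> * K * real (card (inner_boundary r S))"
    by (simp add: partition_sum_translate assms(1) inner_boundary_translate card_image)
  moreover have "(\<Union>x\<in>insert x F. (+) x ` S) \<union> R = (+) x ` S \<union> ?T" by auto
  moreover have "real (card (insert x F)) = real (card F) + 1" using insert.hyps by simp
  ultimately show ?case using IH by (simp only: distrib_left distrib_right mult_1_right mult_1_left)
qed simp

text \<open>\<open>K\<close> times the constant in the bound on the inner boundary of a
  cube.\<close>

definition surface_const :: real where
  "surface_const = 2 * real_of_int r * real CARD('d) * K"

lemma surface_const_nonneg: "0 \<le> surface_const"
  using r_nonneg K_nonneg by (simp add: surface_const_def)

lemma card_inner_boundary_cube_le:
  "K * real (card (inner_boundary r (cube n :: (int ^ 'd) set))) \<le> surface_const * real (n + 1) ^ (CARD('d) - 1)"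
  using mult_left_mono[OF card_inner_boundary_cube[OF r_nonneg, of n, where 'd = 'd] K_nonneg]
  by (simp add: surface_const_def mult_ac)

text \<open>The large cube is tiled by copies of the small one. The boundary error per block volume
  is of order \<open>1 / (n + 1)\<close>; the remainder enters twice, through its own partition sum
  and through the volume it takes from the tiling.\<close>

lemma ln_partition_sum_cube_ratio:
  "\<bar>ln (partition_sum t (cube N)) / real (N + 1) ^ CARD('d) - ln (partition_sum t (cube n)) / real (n + 1) ^ CARD('d)\<bar>
    \<le> \<bar>t\<bar> * surface_const / real (n + 1)
      + (2 * (ln (real CARD('a)) + \<bar>t\<bar> * K) * real CARD('d)) * (real (n + 1) / real (N + 1))"
proof -
  let ?a = "\<lambda>n. ln (partition_sum t (cube n))" and ?V = "\<lambda>n. real (n + 1) ^ CARD('d)"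
  let ?V' = "\<lambda>n. real (n + 1) ^ (CARD('d) - 1)"
  define \<kappa> where "\<kappa> = ln (real CARD('a)) + \<bar>t\<bar> * K"
  define b where "b = K * real (card (inner_boundary r (cube n :: (int ^ 'd) set)))"
  have \<kappa>: "0 \<le> \<kappa>" using K_nonneg by (simp add: \<kappa>_def Suc_le_eq)
  have V: "?V n = real (n + 1) * ?V' n" for n
    using power_eq_if[of "real (n + 1)" "CARD('d)"] by simp
  have Vp: "0 < ?V n" "0 < ?V' n" for n by simp_all
  obtain m and R :: "(int ^ 'd) set" where R: "finite R" "(\<Union>x\<in>base_points n m. (+) x ` cube n) \<inter> R = {}"
    "cube N = (\<Union>x\<in>base_points n m. (+) x ` cube n) \<union> R"
    "real (card R) \<le> real CARD('d) * real (n + 1) * ?V' N"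
    "?V N = real m ^ CARD('d) * ?V n + real (card R)" by (rule cube_tiling)
  define c where "c = real m ^ CARD('d)"
  have c: "0 \<le> c" "c * ?V n \<le> ?V N" using R(5) by (auto simp: c_def)
  have cF: "real (card (base_points n m :: (int ^ 'd) set)) = c" by (simp add: card_base_points c_def)
  have 1: "\<bar>?a N - c * ?a n - ln (partition_sum t R)\<bar> \<le> \<bar>t\<bar> * b * c"
    using ln_partition_sum_tiling[OF finite_cube finite_base_points base_points_disjoint R(1,2), of t]
    unfolding R(3)[symmetric] cF b_def by (simp add: mult.assoc)
  have 2: "\<bar>ln (partition_sum t R)\<bar> \<le> \<kappa> * real (card R)"
    unfolding \<kappa>_def by (rule abs_ln_partition_sum_le[OF R(1)])
  have 3: "\<bar>?a n / ?V n\<bar> \<le> \<kappa>"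
  proof -
    have "\<bar>?a n\<bar> \<le> \<kappa> * ?V n"
      using abs_ln_partition_sum_le[OF finite_cube, of t n] by (simp add: \<kappa>_def card_cube)
    then show ?thesis using Vp(1)[of n] \<kappa> by (simp add: abs_divide divide_le_eq)
  qed
  have "\<bar>?a N - (?a n / ?V n) * ?V N\<bar> = \<bar>(?a N - c * ?a n - ln (partition_sum t R)) + ln (partition_sum t R) - (?a n / ?V n) * real (card R)\<bar>"
    unfolding R(5) c_def[symmetric] using Vp(1)[of n] by (simp add: field_simps)
  also have "\<dots> \<le> \<bar>t\<bar> * b * c + \<kappa> * real (card R) + \<kappa> * real (card R)"
  proof -
    have "\<bar>(?a n / ?V n) * real (card R)\<bar> \<le> \<kappa> * real (card R)"
      unfolding abs_mult using 3 \<kappa> by (intro mult_mono) auto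
    then show ?thesis using 1 2 by linarith
  qed
  finally have 4: "\<bar>?a N - (?a n / ?V n) * ?V N\<bar> \<le> \<bar>t\<bar> * b * c + 2 * \<kappa> * real (card R)" by simp
  have "\<bar>?a N / ?V N - ?a n / ?V n\<bar> = \<bar>?a N - (?a n / ?V n) * ?V N\<bar> / ?V N"
  proof -
    have "?a N / ?V N - ?a n / ?V n = (?a N - (?a n / ?V n) * ?V N) / ?V N"
      using Vp(1)[of N] by (simp add: diff_divide_distrib)
    then show ?thesis using Vp(1)[of N] by (simp add: abs_divide)
  qed
  also have "\<dots> \<le> (\<bar>t\<bar> * b * c + 2 * \<kappa> * real (card R)) / ?V N"
    using 4 by (intro divide_right_mono) auto
  also have "\<dots> = \<bar>t\<bar> * b * (c / ?V N) + 2 * \<kappa> * (real (card R) / ?V N)" by (simp add: add_divide_distrib)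
  also have "\<dots> \<le> \<bar>t\<bar> * surface_const / real (n + 1) + 2 * \<kappa> * (real CARD('d) * (real (n + 1) / real (N + 1)))"
  proof (rule add_mono)
    have "c / ?V N \<le> 1 / ?V n" using c Vp by (simp add: field_simps)
    moreover have b: "0 \<le> b" "b \<le> surface_const * ?V' n"
      using K_nonneg card_inner_boundary_cube_le by (auto simp: b_def)
    ultimately have "\<bar>t\<bar> * b * (c / ?V N) \<le> \<bar>t\<bar> * (surface_const * ?V' n) * (1 / ?V n)"
      using c Vp by (intro mult_mono) auto
    also have "\<dots> = \<bar>t\<bar> * surface_const / real (n + 1)" unfolding V using Vp(2)[of n] by simp
    finally show "\<bar>t\<bar> * b * (c / ?V N) \<le> \<bar>t\<bar> * surface_const / real (n + 1)" .
    have "real (card R) / ?V N \<le> (real CARD('d) * real (n + 1) * ?V' N) / ?V N"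
      using R(4) by (intro divide_right_mono) auto
    also have "\<dots> = real CARD('d) * (real (n + 1) / real (N + 1))" unfolding V using Vp(2)[of N] by simp
    finally show "2 * \<kappa> * (real (card R) / ?V N) \<le> 2 * \<kappa> * (real CARD('d) * (real (n + 1) / real (N + 1)))"
      using \<kappa> by (intro mult_left_mono) auto
  qed
  finally show ?thesis by (simp add: \<kappa>_def mult_ac)
qed

text \<open>More than existence of the pressure: an error of surface order valid for every
  \<open>n\<close>, with a constant proportional to the parameter. The extreme level of the upper
  tail requires this precision.\<close>

lemma abs_ln_partition_sum_cube:
  "\<bar>ln (partition_sum t (cube n)) - real (n + 1) ^ CARD('d) * pressure (scale_interaction t U)\<bar>
    \<le> \<bar>t\<bar> * surface_const * real (n + 1) ^ (CARD('d) - 1)"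
proof -
  let ?b = "\<lambda>n. ln (partition_sum t (cube n)) / real (n + 1) ^ CARD('d)"
  obtain L where L: "?b \<longlonglongrightarrow> L" "\<And>n. \<bar>L - ?b n\<bar> \<le> \<bar>t\<bar> * surface_const / real (n + 1)"
    by (rule almost_constant_convergent[of ?b, OF ln_partition_sum_cube_ratio]) blast
  have "(\<lambda>n. ?b n * (real (n + 1) ^ CARD('d) / real n ^ CARD('d))) \<longlonglongrightarrow> L * 1"
    by (intro tendsto_mult L(1) Suc_power_over_power)
  then have "(\<lambda>n. 1 / real n ^ CARD('d) * ln (partition_sum t (cube n))) \<longlonglongrightarrow> L"
    by (simp add: power_eq_0_iff del: power_Suc)
  then have P: "pressure (scale_interaction t U) = L" unfolding pressure_eq by (rule limI)
  have V: "real (n + 1) ^ CARD('d) = real (n + 1) * real (n + 1) ^ (CARD('d) - 1)"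
    using power_eq_if[of "real (n + 1)" "CARD('d)"] by simp
  have "\<bar>ln (partition_sum t (cube n)) - real (n + 1) ^ CARD('d) * L\<bar> = real (n + 1) ^ CARD('d) * \<bar>L - ?b n\<bar>"
  proof -
    have p: "0 < real (n + 1) ^ CARD('d)" by simp
    have "ln (partition_sum t (cube n)) - real (n + 1) ^ CARD('d) * L = - (real (n + 1) ^ CARD('d) * (L - ?b n))"
      using p by (simp add: right_diff_distrib)
    then show ?thesis using p by (simp add: abs_mult)
  qed
  also have "\<dots> \<le> real (n + 1) ^ CARD('d) * (\<bar>t\<bar> * surface_const / real (n + 1))"
    by (intro mult_left_mono L(2)) simp
  also have "\<dots> = \<bar>t\<bar> * surface_const * real (n + 1) ^ (CARD('d) - 1)" unfolding V by (simp del: of_nat_add)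
  finally show ?thesis unfolding P .
qed

end

context gibbs_state
begin

text \<open>The closed form of \<open>\<W>(q)\<close>.\<close>

definition cgf :: "real \<Rightarrow> real" where
  "cgf q = pressure (scale_interaction ((1 - q) * \<beta>) U) + (q - 1) * pressure (scale_interaction \<beta> U)"

definition info :: "nat \<Rightarrow> ('d, 'a) config \<Rightarrow> real" where
  "info n \<eta> = - ln (measure M (cyl (cube n) \<eta>))"

lemma exp_minus_info: "exp (- info n \<eta>) = measure M (cyl (cube n) \<eta>)"
  using cyl_prob_pos[of "cube n" \<eta>] by (simp add: info_def)

lemma distortion_cube_le: "distortion (cube n) \<le> 2 * \<beta> * surface_const * real (n + 1) ^ (CARD('d) - 1)"
  using mult_left_mono[OF card_inner_boundary_cube_le[of n] \<beta>_nonneg] by (simp add: distortion_def mult_ac)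

text \<open>Of the three units of \<open>\<beta> * surface_const\<close>, two come from the
  distortion and one from replacing the partition sum by the pressure.\<close>

lemma abs_info_le:
  "\<bar>info n \<eta> - (\<beta> * energy (cube n) \<eta> + real (n + 1) ^ CARD('d) * pressure (scale_interaction \<beta> U))\<bar>
    \<le> 3 * \<beta> * surface_const * real (n + 1) ^ (CARD('d) - 1)"
  using abs_ln_cyl_prob[OF finite_cube, of n \<eta>] distortion_cube_le[of n] abs_ln_partition_sum_cube[of \<beta> n] \<beta>_nonneg
  unfolding info_def by simp

text \<open>The sum is the moment of order q of the inverse pattern probability, and up to boundary
  terms a partition sum at parameter \<open>(1 - q) * \<beta>\<close>. The 4 consists of 3 for the
  information and 1 for this partition sum.\<close>

lemma abs_ln_moment_le:
  "\<bar>ln (\<Sum>\<eta>\<in>patterns (cube n). exp (- ((1 - q) * info n \<eta>))) - real (n + 1) ^ CARD('d) * cgf q\<bar>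
    \<le> 4 * \<bar>1 - q\<bar> * \<beta> * surface_const * real (n + 1) ^ (CARD('d) - 1)"
proof -
  let ?V = "real (n + 1) ^ CARD('d)" and ?P = "pressure (scale_interaction \<beta> U)"
  define D where "D = \<bar>1 - q\<bar> * (3 * \<beta> * surface_const * real (n + 1) ^ (CARD('d) - 1))"
  define Z where "Z = partition_sum ((1 - q) * \<beta>) (cube n)"
  define S where "S = (\<Sum>\<eta>\<in>patterns (cube n). exp (- ((1 - q) * info n \<eta>)))"
  have Z: "0 < Z" by (simp add: Z_def partition_sum_pos)
  have S: "0 < S" unfolding S_def by (intro sum_pos) auto
  have b: "\<bar>- ((1 - q) * info n \<eta>) - (- ((1 - q) * \<beta> * energy (cube n) \<eta>) - (1 - q) * ?V * ?P)\<bar> \<le> D" for \<eta>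
  proof -
    have "\<bar>- ((1 - q) * info n \<eta>) - (- ((1 - q) * \<beta> * energy (cube n) \<eta>) - (1 - q) * ?V * ?P)\<bar>
      = \<bar>1 - q\<bar> * \<bar>info n \<eta> - (\<beta> * energy (cube n) \<eta> + ?V * ?P)\<bar>"
      unfolding abs_mult[symmetric] abs_minus_cancel[of "(1 - q) * _", symmetric] by (simp add: algebra_simps)
    also have "\<dots> \<le> D" unfolding D_def by (intro mult_left_mono abs_info_le) simp
    finally show ?thesis .
  qed
  have eZ: "exp (c - (1 - q) * ?V * ?P) * Z = (\<Sum>\<eta>\<in>patterns (cube n). exp (c + (- ((1 - q) * \<beta> * energy (cube n) \<eta>) - (1 - q) * ?V * ?P)))" for c
    unfolding Z_def partition_sum_def sum_distrib_left by (intro sum.cong refl) (simp add: exp_add[symmetric] algebra_simps)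
  have "S \<le> exp (D - (1 - q) * ?V * ?P) * Z" unfolding eZ S_def
  proof (rule sum_mono)
    fix \<eta> show "exp (- ((1 - q) * info n \<eta>)) \<le> exp (D + (- ((1 - q) * \<beta> * energy (cube n) \<eta>) - (1 - q) * ?V * ?P))"
      using b[of \<eta>] by (subst exp_le_cancel_iff) linarith
  qed
  then have "ln S \<le> ln (exp (D - (1 - q) * ?V * ?P) * Z)" using S by (intro ln_mono) auto
  moreover have "exp (- D - (1 - q) * ?V * ?P) * Z \<le> S" unfolding eZ S_def
  proof (rule sum_mono)
    fix \<eta> show "exp (- D + (- ((1 - q) * \<beta> * energy (cube n) \<eta>) - (1 - q) * ?V * ?P)) \<le> exp (- ((1 - q) * info n \<eta>))"
      using b[of \<eta>] by (subst exp_le_cancel_iff) linarith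
  qed
  then have "ln (exp (- D - (1 - q) * ?V * ?P) * Z) \<le> ln S" using Z by (intro ln_mono) auto
  moreover have "ln (exp c * Z) = c + ln Z" for c using Z by (simp add: ln_mult)
  ultimately have "\<bar>ln S - (ln Z - (1 - q) * ?V * ?P)\<bar> \<le> D" by simp
  moreover have "\<bar>ln Z - ?V * pressure (scale_interaction ((1 - q) * \<beta>) U)\<bar> \<le> \<bar>1 - q\<bar> * \<beta> * surface_const * real (n + 1) ^ (CARD('d) - 1)"
    using abs_ln_partition_sum_cube[of "(1 - q) * \<beta>" n] \<beta>_nonneg by (simp add: Z_def abs_mult)
  moreover have "?V * cgf q = ?V * pressure (scale_interaction ((1 - q) * \<beta>) U) - (1 - q) * ?V * ?P"
    by (simp add: cgf_def algebra_simps)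
  ultimately show ?thesis unfolding S_def[symmetric] D_def by (simp add: mult_ac)
qed

end

section \<open>Moments of the waiting time\<close>

text \<open>The law of the waiting time for one fixed pattern: \<open>p\<close> is the probability
  of the pattern and \<open>c\<close> the loss from imperfect independence. The moment bounds depend
  on the pattern only through \<open>p\<close>, so they can be summed over patterns.\<close>

locale waiting_law = prob_space M for M :: "'b measure" +
  fixes w :: "'b \<Rightarrow> enat" and d :: nat and p c :: real
  assumes w_measurable [measurable]: "w \<in> measurable M (count_space UNIV)"
    and w_pos: "1 \<le> w x"
    and d_pos: "0 < d" and p_pos: "0 < p" and p_le_1: "p \<le> 1" and c_pos: "0 < c" and c_le_1: "c \<le> 1"
    and le_prob: "measure M {x\<in>space M. w x \<le> enat k} \<le> real (k + 1) ^ d * p"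
    and gt_prob: "measure M {x\<in>space M. \<not> w x \<le> enat k} \<le> 3 * exp (- (c * p * real k ^ d))"
begin

lemma sets_le [measurable]: "{x\<in>space M. w x \<le> enat k} \<in> sets M"
  using measurable_sets[OF w_measurable, of "{..enat k}"] by (simp add: vimage_def Int_def conj_commute)

lemma prob_gt_eq: "measure M {x\<in>space M. \<not> w x \<le> enat k} = 1 - measure M {x\<in>space M. w x \<le> enat k}"
proof -
  have "{x\<in>space M. \<not> w x \<le> enat k} = space M - {x\<in>space M. w x \<le> enat k}" by auto
  then show ?thesis using prob_compl[OF sets_le] by simp
qed

lemma power_powr_inverse: "0 < y \<Longrightarrow> (y powr (a / real d)) ^ d = y powr a"
  using d_pos by (simp add: powr_realpow[symmetric] powr_powr)

lemma AE_finite: "AE x in M. w x \<noteq> \<infinity>"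
proof -
  have "(\<lambda>k. 3 * exp (- (c * p * real k ^ d))) \<longlonglongrightarrow> 0"
    using p_pos c_pos d_pos by real_asymp
  then have "measure M {x\<in>space M. w x = \<infinity>} \<le> 0"
  proof (rule LIMSEQ_le_const)
    have "measure M {x\<in>space M. w x = \<infinity>} \<le> 3 * exp (- (c * p * real k ^ d))" for k
      by (rule order_trans[OF finite_measure_mono gt_prob]) auto
    then show "\<exists>N. \<forall>n\<ge>N. measure M {x\<in>space M. w x = \<infinity>} \<le> 3 * exp (- (c * p * real n ^ d))" by blast
  qed
  then have "measure M {x\<in>space M. w x = \<infinity>} = 0" by (simp add: measure_le_0_iff)
  moreover have "{x\<in>space M. w x = \<infinity>} \<in> sets M"
    using measurable_sets[OF w_measurable, of "{\<infinity>}"] by (simp add: vimage_def Int_def conj_commute)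
  ultimately show ?thesis by (simp add: prob_eq_0)
qed

lemma moment_ge_of_gt:
  assumes "0 \<le> s" "1 / 2 \<le> measure M {x\<in>space M. \<not> w x \<le> enat k}"
  shows "ennreal (1 / 2 * real (k + 1) powr s) \<le> (\<integral>\<^sup>+ x. enat_powr (w x) s \<partial>M)"
proof -
  let ?A = "{x\<in>space M. \<not> w x \<le> enat k}"
  have "ennreal (1 / 2 * real (k + 1) powr s) \<le> ennreal (real (k + 1) powr s * measure M ?A)"
    using mult_left_mono[OF assms(2), of "real (k + 1) powr s"] by (intro ennreal_leI) (simp add: mult.commute)
  also have "\<dots> = (\<integral>\<^sup>+ x. ennreal (real (k + 1) powr s) * indicator ?A x \<partial>M)"
    by (simp add: nn_integral_cmult_indicator emeasure_eq_measure ennreal_mult)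
  also have "\<dots> \<le> (\<integral>\<^sup>+ x. enat_powr (w x) s \<partial>M)"
  proof (rule nn_integral_mono)
    fix x assume "x \<in> space M"
    show "ennreal (real (k + 1) powr s) * indicator ?A x \<le> enat_powr (w x) s"
    proof (cases "w x")
      case (enat j)
      then show ?thesis using assms(1)
        by (auto simp: enat_powr_def indicator_def intro!: ennreal_leI powr_mono2)
    next
      case infinity
      then show ?thesis using assms(1) by (cases "s = 0") (auto simp: enat_powr_def indicator_def)
    qed
  qed
  finally show ?thesis .
qed

text \<open>Below the scale \<open>(2 * p) powr (- 1 / d)\<close> the lower-tail estimate gives
  probability at most 1/2, so half of the mass lies beyond it. For \<open>p > 1 / 2\<close> this
  scale is below 1, and \<open>w \<ge> 1\<close> is used instead.\<close>

lemma moment_nonneg_ge: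
  assumes "0 \<le> q"
  shows "ennreal (1 / 2 * 2 powr (- (q * real d)) * 2 powr (- q) * p powr (- q)) \<le> (\<integral>\<^sup>+ x. enat_powr (w x) (q * real d) \<partial>M)"
proof -
  have pq: "2 powr (- q) * p powr (- q) = (2 * p) powr (- q)" using p_pos by (simp add: powr_mult)
  have s: "0 \<le> q * real d" using assms by simp
  define y where "y = (if p \<le> 1 / 2 then (2 * p) powr (- 1 / real d) else 1)"
  have y1: "1 \<le> y"
  proof -
    have "1 \<le> (2 * p) powr (- 1 / real d)" if "p \<le> 1 / 2"
      using that p_pos d_pos powr_mono2'[of "- 1 / real d" "2 * p" 1] by simp
    then show ?thesis by (simp add: y_def)
  qed
  have yq: "(2 * p) powr (- q) \<le> y powr (q * real d)"
  proof (cases "p \<le> 1 / 2")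
    case True
    then show ?thesis using d_pos by (simp add: y_def powr_powr mult.commute)
  next
    case False
    then have "(2 * p) powr (- q) \<le> (2 * p) powr 0" using assms by (intro powr_mono) auto
    then show ?thesis using False by (simp add: y_def)
  qed
  \<comment> \<open>Then \<open>k + 1\<close> is the integer part of \<open>y\<close>, and as
    \<open>y \<ge> 1\<close> it is at least \<open>y / 2\<close>; being larger than \<open>k\<close>
    means being at least \<open>k + 1\<close>.\<close>
  define k where "k = nat \<lfloor>y\<rfloor> - 1"
  have k: "real (k + 1) \<le> y" "y / 2 \<le> real (k + 1)"
    using y1 unfolding k_def by linarith+
  have half: "1 / 2 \<le> measure M {x\<in>space M. \<not> w x \<le> enat k}"
  proof (cases "p \<le> 1 / 2")
    case True
    have "real (k + 1) ^ d * p \<le> y ^ d * p" using k(1) p_pos by (intro mult_right_mono power_mono) auto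
    also have "y ^ d * p = (2 * p) powr (- 1) * p" using True p_pos power_powr_inverse[of "2 * p" "- 1"] by (simp add: y_def)
    also have "\<dots> = 1 / 2" using p_pos by (simp add: powr_minus)
    finally show ?thesis using le_prob[of k] unfolding prob_gt_eq by linarith
  next
    case False
    then have "k = 0" by (simp add: k_def y_def)
    have empty: "{x\<in>space M. w x \<le> enat 0} = {}"
    proof -
      have "\<not> w x \<le> 0" for x using w_pos[of x] by (metis not_one_le_zero order_trans)
      then show ?thesis by (simp add: zero_enat_def[symmetric])
    qed
    show ?thesis unfolding prob_gt_eq \<open>k = 0\<close> empty by simp
  qed
  have "1 / 2 * 2 powr (- (q * real d)) * 2 powr (- q) * p powr (- q) = 1 / 2 * (2 powr (- (q * real d)) * (2 * p) powr (- q))"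
    by (simp add: pq[symmetric])
  also have "\<dots> \<le> 1 / 2 * (2 powr (- (q * real d)) * y powr (q * real d))"
    using yq by (intro mult_left_mono) auto
  also have "\<dots> = 1 / 2 * (y / 2) powr (q * real d)"
  proof -
    have "(y / 2) powr (q * real d) = y powr (q * real d) / 2 powr (q * real d)"
      using y1 by (intro powr_divide)
    then show ?thesis by (simp add: powr_minus_divide)
  qed
  also have "1 / 2 * (y / 2) powr (q * real d) \<le> 1 / 2 * real (k + 1) powr (q * real d)"
    using k y1 s by (intro mult_left_mono powr_mono2) auto
  finally show ?thesis
    using moment_ge_of_gt[OF s half] by (meson ennreal_leI order_trans)
qed

text \<open>At the scale \<open>z\<close> with \<open>c * p * z ^ d = 2\<close> the upper tail is at
  most \<open>3 * exp (- 2)\<close>, hence at most 1/2. On the other half of the mass the waiting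
  time is small, so its negative power is large.\<close>

lemma moment_neg_ge:
  assumes "q < 0"
  shows "ennreal (1 / 2 * 2 powr (q * real d) * 2 powr q * (c * p) powr (- q)) \<le> (\<integral>\<^sup>+ x. enat_powr (w x) (q * real d) \<partial>M)"
proof -
  have cp: "0 < c * p" "c * p \<le> 1" using c_pos p_pos mult_mono[OF c_le_1 p_le_1] by auto
  define z where "z = (2 / (c * p)) powr (1 / real d)"
  have z1: "1 \<le> z" unfolding z_def using cp by (intro ge_one_powr_ge_zero) (auto simp: field_simps)
  define m where "m = nat \<lceil>z\<rceil>"
  have m: "z \<le> real m" "real m \<le> 2 * z" using z1 unfolding m_def by linarith+
  have s: "q * real d < 0" using assms d_pos by (simp add: mult_neg_pos)
  have "2 = c * p * z ^ d" using cp power_powr_inverse[of "2 / (c * p)" 1] c_pos p_pos by (simp add: z_def)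
  also have "\<dots> \<le> c * p * real m ^ d" using m z1 cp by (intro mult_left_mono power_mono) auto
  finally have "3 * exp (- (c * p * real m ^ d)) \<le> 3 * exp (- 2)" by simp
  moreover have "(6 :: real) \<le> exp 2"
  proof -
    have "(5 / 2 :: real) \<le> exp 1" using exp_lower_Taylor_quadratic[of 1] by simp
    then have "(5 / 2 :: real) * (5 / 2) \<le> exp 1 * exp 1" by (intro mult_mono) auto
    then show ?thesis by (simp add: exp_add[symmetric])
  qed
  then have "3 * exp (- 2) \<le> (1 / 2 :: real)" by (simp add: exp_minus field_simps)
  ultimately have half: "1 / 2 \<le> measure M {x\<in>space M. w x \<le> enat m}"
    using gt_prob[of m] unfolding prob_gt_eq by linarith
  let ?A = "{x\<in>space M. w x \<le> enat m}"
  have "1 / 2 * 2 powr (q * real d) * 2 powr q * (c * p) powr (- q) = 1 / 2 * (2 * z) powr (q * real d)"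
  proof -
    have "z powr (q * real d) = (2 / (c * p)) powr q" using d_pos by (simp add: z_def powr_powr)
    also have "\<dots> = 2 powr q / (c * p) powr q" using cp by (intro powr_divide)
    finally have "z powr (q * real d) = 2 powr q * (c * p) powr (- q)" by (simp add: powr_minus_divide)
    moreover have "(2 * z) powr (q * real d) = 2 powr (q * real d) * z powr (q * real d)" by (rule powr_mult)
    ultimately show ?thesis by (simp only: mult.assoc)
  qed
  also have "\<dots> \<le> real m powr (q * real d) * measure M ?A"
  proof -
    have "(2 * z) powr (q * real d) \<le> real m powr (q * real d)"
      using m z1 s by (intro powr_mono2') auto
    then have "(1 / 2) * (2 * z) powr (q * real d) \<le> measure M ?A * real m powr (q * real d)"
      using half by (intro mult_mono) auto
    then show ?thesis by (simp add: mult.commute)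
  qed
  finally have "ennreal (1 / 2 * 2 powr (q * real d) * 2 powr q * (c * p) powr (- q)) \<le> ennreal (real m powr (q * real d) * measure M ?A)"
    by (rule ennreal_leI)
  also have "\<dots> = (\<integral>\<^sup>+ x. ennreal (real m powr (q * real d)) * indicator ?A x \<partial>M)"
    by (simp add: nn_integral_cmult_indicator emeasure_eq_measure ennreal_mult)
  also have "\<dots> \<le> (\<integral>\<^sup>+ x. enat_powr (w x) (q * real d) \<partial>M)"
  proof (rule nn_integral_mono)
    fix x assume "x \<in> space M"
    show "ennreal (real m powr (q * real d)) * indicator ?A x \<le> enat_powr (w x) (q * real d)"
    proof (cases "w x")
      case (enat j)
      then have "1 \<le> j" using w_pos[of x] by (simp add: one_enat_def)
      then show ?thesis using s enat
        by (auto simp: enat_powr_def indicator_def intro!: ennreal_leI powr_mono2')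
    qed (auto simp: indicator_def)
  qed
  finally show ?thesis .
qed

lemma summable_moment_series: "summable (\<lambda>j. (real j + 1) powr s * exp (- real j))"
proof (rule summable_comparison_test_bigo)
  show "(\<lambda>j. (real j + 1) powr s * exp (- real j)) \<in> O(\<lambda>j. exp (- (1 / 2)) ^ j)"
    by real_asymp
  show "summable (\<lambda>j. norm (exp (- (1 / 2)) ^ j :: real))"
    unfolding norm_power by (rule summable_geometric) simp
qed

text \<open>The scale \<open>L\<close> with \<open>c p L^d \<ge> 1\<close> splits the range of the waiting time into blocks, the
  \<open>j\<close>-th of which has probability at most \<open>3 exp (- j)\<close>.\<close>

lemma moment_nonneg_le:
  assumes "0 \<le> q"
  shows "(\<integral>\<^sup>+ x. enat_powr (w x) (q * real d) \<partial>M)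
    \<le> ennreal (3 * 2 powr (q * real d) * (\<Sum>j. (real j + 1) powr (q * real d) * exp (- real j)) * (c * p) powr (- q))"
proof -
  let ?s = "q * real d"
  have s: "0 \<le> ?s" using assms by simp
  have cp: "0 < c * p" "c * p \<le> 1" using c_pos p_pos mult_mono[OF c_le_1 p_le_1] by auto
  define z where "z = (c * p) powr (- 1 / real d)"
  have z1: "1 \<le> z" unfolding z_def using cp d_pos powr_mono2'[of "- 1 / real d" "c * p" 1] by simp
  \<comment> \<open>The number \<open>z\<close> solves \<open>c * p * z ^ d = 1\<close>. Rounding up
    preserves the inequality and, since \<open>z \<ge> 1\<close>, costs at most a factor 2.\<close>
  define L where "L = nat \<lceil>z\<rceil>"
  have L: "z \<le> real L" "real L \<le> 2 * z" "1 \<le> L" using z1 unfolding L_def by linarith+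
  have "1 = c * p * z ^ d" using cp power_powr_inverse[of "c * p" "- 1"] c_pos p_pos by (simp add: z_def powr_minus field_simps)
  also have "\<dots> \<le> c * p * real L ^ d" using L z1 cp by (intro mult_left_mono power_mono) auto
  finally have cpL: "1 \<le> c * p * real L ^ d" .
  let ?A = "\<lambda>j. {x\<in>space M. \<not> w x \<le> enat (j * L)}"
  let ?b = "\<lambda>j. (real (j + 1) * real L) powr ?s"
  have prob: "measure M (?A j) \<le> 3 * exp (- real j)" for j
  proof -
    have "real j \<le> real j ^ d" using d_pos by (cases j) (auto intro: self_le_power)
    also have "\<dots> \<le> (c * p * real L ^ d) * real j ^ d" using cpL by (intro mult_le_cancel_right1[THEN iffD2]) auto
    also have "\<dots> = c * p * real (j * L) ^ d" by (simp add: power_mult_distrib)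
    finally have "3 * exp (- (c * p * real (j * L) ^ d)) \<le> 3 * exp (- real j)" by simp
    then show ?thesis using gt_prob[of "j * L"] by linarith
  qed
  have "(\<integral>\<^sup>+ x. enat_powr (w x) ?s \<partial>M) \<le> (\<integral>\<^sup>+ x. (\<Sum>j. ennreal (?b j) * indicator (?A j) x) \<partial>M)"
  proof (rule nn_integral_mono_AE)
    show "AE x in M. enat_powr (w x) ?s \<le> (\<Sum>j. ennreal (?b j) * indicator (?A j) x)"
      using AE_finite AE_space
    proof eventually_elim
      case (elim x)
      then obtain k where k: "w x = enat k" by (cases "w x") auto
      have k1: "1 \<le> k" using w_pos[of x] by (simp add: k one_enat_def)
      \<comment> \<open>Subtracting 1 places \<open>k\<close> in the half-open block from
        \<open>j * L\<close> exclusive to \<open>(j + 1) * L\<close> inclusive, matching the strict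
        inequality in \<open>?A j\<close>.\<close>
      define j where "j = (k - 1) div L"
      have "j * L \<le> k - 1" unfolding j_def by simp
      then have x: "x \<in> ?A j" using elim k k1 by auto
      have "k - 1 < j * L + L" unfolding j_def using dividend_less_div_times[of L "k - 1"] L(3) by linarith
      then have "k \<le> (j + 1) * L" using k1 by simp
      then have "real k \<le> real (j + 1) * real L" by (metis of_nat_le_iff of_nat_mult)
      then have "enat_powr (w x) ?s \<le> ennreal (?b j) * indicator (?A j) x"
        using x s by (simp add: k enat_powr_def ennreal_leI powr_mono2)
      also have "\<dots> \<le> (\<Sum>j. ennreal (?b j) * indicator (?A j) x)"
      proof -
        have "f j \<le> suminf f" for f :: "nat \<Rightarrow> ennreal" using sum_le_suminf[of f "{j}"] by simp
        then show ?thesis .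
      qed
      finally show ?case .
    qed
  qed
  also have "\<dots> = (\<Sum>j. \<integral>\<^sup>+ x. ennreal (?b j) * indicator (?A j) x \<partial>M)"
    by (rule nn_integral_suminf) simp
  also have "\<dots> = (\<Sum>j. ennreal (?b j * measure M (?A j)))"
    by (simp add: nn_integral_cmult_indicator emeasure_eq_measure ennreal_mult)
  also have "\<dots> \<le> (\<Sum>j. ennreal (3 * real L powr ?s * ((real j + 1) powr ?s * exp (- real j))))"
  proof (intro suminf_le ennreal_leI)
    fix j
    have "?b j * measure M (?A j) \<le> ?b j * (3 * exp (- real j))" by (intro mult_left_mono prob) simp
    also have "\<dots> = 3 * real L powr ?s * ((real j + 1) powr ?s * exp (- real j))"
      by (simp add: powr_mult add.commute mult_ac)
    finally show "?b j * measure M (?A j) \<le> 3 * real L powr ?s * ((real j + 1) powr ?s * exp (- real j))" .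
  qed auto
  also have "\<dots> = ennreal (3 * real L powr ?s * (\<Sum>j. (real j + 1) powr ?s * exp (- real j)))"
    unfolding suminf_mult[OF summable_moment_series, symmetric]
    by (rule suminf_ennreal_eq) (auto intro!: summable_sums summable_mult summable_moment_series)
  also have "\<dots> \<le> ennreal (3 * 2 powr ?s * (\<Sum>j. (real j + 1) powr ?s * exp (- real j)) * (c * p) powr (- q))"
  proof (rule ennreal_leI)
    have S: "0 \<le> (\<Sum>j. (real j + 1) powr ?s * exp (- real j))"
      by (rule suminf_nonneg[OF summable_moment_series]) simp
    have "real L powr ?s \<le> (2 * z) powr ?s" using L z1 s by (intro powr_mono2) auto
    also have "\<dots> = 2 powr ?s * (c * p) powr (- q)"
    proof -
      have "z powr ?s = (c * p) powr (- q)" using d_pos by (simp add: z_def powr_powr)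
      then show ?thesis by (simp only: powr_mult)
    qed
    finally have "3 * real L powr ?s * (\<Sum>j. (real j + 1) powr ?s * exp (- real j))
        \<le> 3 * (2 powr ?s * (c * p) powr (- q)) * (\<Sum>j. (real j + 1) powr ?s * exp (- real j))"
      using S by (intro mult_right_mono mult_left_mono) auto
    then show "3 * real L powr ?s * (\<Sum>j. (real j + 1) powr ?s * exp (- real j))
        \<le> 3 * 2 powr ?s * (\<Sum>j. (real j + 1) powr ?s * exp (- real j)) * (c * p) powr (- q)"
      by (simp add: mult_ac)
  qed
  finally show ?thesis .
qed

text \<open>Dyadic decomposition, with \<open>min 1 y \<le> y powr (- q)\<close> applied to each dyadic probability.\<close>

lemma moment_neg_le:
  assumes "-1 \<le> q" "q < 0"
  shows "(\<integral>\<^sup>+ x. enat_powr (w x) (q * real d) \<partial>M) \<le> ennreal (4 ^ d * (3 - log 2 p) * p powr (- q))"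
proof -
  define \<theta> where "\<theta> = - q"
  have \<theta>: "0 < \<theta>" "\<theta> \<le> 1" using assms by (auto simp: \<theta>_def)
  define J where "J = nat \<lceil>- log 2 p\<rceil>"
  have lp: "0 \<le> - log 2 p" using p_pos p_le_1 by simp
  have J: "- log 2 p \<le> real J" "real J \<le> 1 - log 2 p" using lp unfolding J_def by linarith+
  let ?A = "\<lambda>j. {x\<in>space M. w x \<le> enat (2 ^ (j + 1))}"
  let ?b = "\<lambda>j. (2 ^ j :: real) powr (q * real d)"
  have dyadic: "?b j * measure M (?A j) \<le> 4 ^ d * p powr \<theta>" for j
  proof -
    \<comment> \<open>The block is bounded by the event \<open>w \<le> 2 ^ (j + 1)\<close>; the 4
      absorbs the successor in \<open>k + 1\<close>.\<close>
    have y: "measure M (?A j) \<le> (4 * 2 ^ j) ^ d * p"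
    proof -
      have "(1 :: real) \<le> 2 ^ j" by simp
      then have "2 * 2 ^ j + 1 \<le> (4 * 2 ^ j :: real)" by linarith
      then have "real (2 ^ (j + 1) + 1) \<le> 4 * 2 ^ j" by simp
      then have "real (2 ^ (j + 1) + 1) ^ d * p \<le> (4 * 2 ^ j) ^ d * p"
        using p_pos by (intro mult_right_mono power_mono) auto
      then show ?thesis using le_prob[of "2 ^ (j + 1)"] by linarith
    qed
    \<comment> \<open>A number in the unit interval is at most its power with exponent at most 1;
      this is where \<open>-1 \<le> q\<close> is used.\<close>
    have "measure M (?A j) \<le> measure M (?A j) powr \<theta>"
    proof (cases "measure M (?A j) = 0")
      case False
      then have "0 < measure M (?A j)" using zero_less_measure_iff by blast
      then have "measure M (?A j) powr 1 \<le> measure M (?A j) powr \<theta>"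
        using \<theta> prob_le_1 by (intro powr_mono') auto
      then show ?thesis by simp
    qed simp
    also have "\<dots> \<le> ((4 * 2 ^ j) ^ d * p) powr \<theta>" using y \<theta> by (intro powr_mono2) auto
    also have "\<dots> = (4 ^ d) powr \<theta> * (2 ^ j) powr (\<theta> * real d) * p powr \<theta>"
    proof -
      have "((2 ^ j) ^ d :: real) powr \<theta> = (2 ^ j) powr (\<theta> * real d)"
        by (simp add: powr_realpow[symmetric] powr_powr mult.commute mult.left_commute)
      then show ?thesis by (simp only: powr_mult power_mult_distrib)
    qed
    finally have "?b j * measure M (?A j) \<le> ?b j * ((4 ^ d) powr \<theta> * (2 ^ j) powr (\<theta> * real d) * p powr \<theta>)"
      by (intro mult_left_mono) auto
    also have "\<dots> = (?b j * (2 ^ j) powr (\<theta> * real d)) * ((4 ^ d) powr \<theta> * p powr \<theta>)" by simp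
    also have "?b j * (2 ^ j) powr (\<theta> * real d) = 1" by (simp add: \<theta>_def powr_add[symmetric])
    also have "1 * ((4 ^ d) powr \<theta> * p powr \<theta>) \<le> 4 ^ d * p powr \<theta>"
    proof -
      have "(4 ^ d :: real) powr \<theta> \<le> (4 ^ d) powr 1" using \<theta> by (intro powr_mono) auto
      then show ?thesis by (simp add: mult_right_mono)
    qed
    finally show ?thesis .
  qed
  have last: "?b J \<le> p powr \<theta>"
  proof -
    have "1 / p = 2 powr (- log 2 p)" using p_pos by (simp add: powr_minus divide_inverse)
    also have "\<dots> \<le> 2 powr (real J)" using J by (intro powr_mono) auto
    also have "\<dots> = 2 ^ J" by (simp add: powr_realpow)
    finally have "1 / p \<le> 2 ^ J" .
    also have "\<dots> \<le> (2 ^ J) ^ d" using d_pos by (intro self_le_power) auto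
    finally have "((2 ^ J) ^ d :: real) powr (- \<theta>) \<le> (1 / p) powr (- \<theta>)" using p_pos \<theta> by (intro powr_mono2') auto
    also have "(1 / p) powr (- \<theta>) = p powr \<theta>" using p_pos by (simp add: powr_divide powr_minus)
    finally show ?thesis by (simp add: \<theta>_def powr_realpow[symmetric] powr_powr mult.commute mult.left_commute)
  qed
  have "(\<integral>\<^sup>+ x. enat_powr (w x) (q * real d) \<partial>M) \<le> (\<integral>\<^sup>+ x. (\<Sum>j<J. ennreal (?b j) * indicator (?A j) x) + ennreal (?b J) \<partial>M)"
  proof (rule nn_integral_mono)
    fix x assume x: "x \<in> space M"
    show "enat_powr (w x) (q * real d) \<le> (\<Sum>j<J. ennreal (?b j) * indicator (?A j) x) + ennreal (?b J)"
    proof (cases "w x")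
      case (enat k)
      have k1: "1 \<le> k" using w_pos[of x] by (simp add: enat one_enat_def)
      have s: "q * real d \<le> 0" using assms(2) by (simp add: mult_nonpos_nonneg)
      obtain j where j: "2 ^ j \<le> k" "k < 2 ^ (j + 1)" using ex_power_ivl1[of 2 k] k1 by auto
      show ?thesis
      proof (cases "j < J")
        case True
        have "real (2 ^ j) powr (q * real d) \<ge> real k powr (q * real d)"
          using j(1) s by (intro powr_mono2') (simp_all only: of_nat_le_iff, simp_all)
        then have "enat_powr (w x) (q * real d) \<le> ennreal (?b j) * indicator (?A j) x"
          using j x by (simp add: enat enat_powr_def ennreal_leI)
        also have "\<dots> \<le> (\<Sum>j<J. ennreal (?b j) * indicator (?A j) x)"
          by (rule member_le_sum) (use True in auto)
        finally show ?thesis by (simp add: add_increasing2)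
      next
        case False
        then have "2 ^ J \<le> (2 :: nat) ^ j" by (intro power_increasing) auto
        then have "2 ^ J \<le> k" using j(1) by linarith
        then have "real (2 ^ J) powr (q * real d) \<ge> real k powr (q * real d)"
          using s by (intro powr_mono2') (simp_all only: of_nat_le_iff, simp_all)
        then have "enat_powr (w x) (q * real d) \<le> ennreal (?b J)" by (simp add: enat enat_powr_def ennreal_leI)
        then show ?thesis by (simp add: add_increasing)
      qed
    next
      case infinity
      have "\<not> q * real d > 0" "q * real d \<noteq> 0" using assms(2) d_pos by (auto simp: zero_less_mult_iff)
      then show ?thesis by (simp add: infinity enat_powr_def)
    qed
  qed
  also have "\<dots> = (\<Sum>j<J. \<integral>\<^sup>+ x. ennreal (?b j) * indicator (?A j) x \<partial>M) + ennreal (?b J)"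
  proof -
    have "(\<integral>\<^sup>+ x. (\<Sum>j<J. f j x) + a \<partial>M) = (\<Sum>j<J. \<integral>\<^sup>+ x. f j x \<partial>M) + a"
      if "\<And>j. f j \<in> borel_measurable M" for f :: "nat \<Rightarrow> 'b \<Rightarrow> ennreal" and a
      using that by (simp add: nn_integral_add nn_integral_sum emeasure_space_1)
    from this[of "\<lambda>j x. ennreal (?b j) * indicator (?A j) x"] show ?thesis by measurable
  qed
  also have "\<dots> = ennreal ((\<Sum>j<J. ?b j * measure M (?A j)) + ?b J)"
  proof -
    have "(\<integral>\<^sup>+ x. ennreal (?b j) * indicator (?A j) x \<partial>M) = ennreal (?b j * measure M (?A j))" for j
      by (simp add: nn_integral_cmult_indicator emeasure_eq_measure ennreal_mult)
    then show ?thesis by (simp add: sum_ennreal sum_nonneg del: ennreal_plus add: ennreal_plus[symmetric])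
  qed
  also have "\<dots> \<le> ennreal (4 ^ d * (3 - log 2 p) * p powr (- q))"
  proof (rule ennreal_leI)
    have "(\<Sum>j<J. ?b j * measure M (?A j)) \<le> (\<Sum>j<J. 4 ^ d * p powr \<theta>)" by (intro sum_mono dyadic)
    then have "(\<Sum>j<J. ?b j * measure M (?A j)) + ?b J \<le> real J * (4 ^ d * p powr \<theta>) + p powr \<theta>"
      using last by simp
    also have "\<dots> \<le> real J * (4 ^ d * p powr \<theta>) + 4 ^ d * p powr \<theta>"
      using mult_right_mono[of 1 "4 ^ d" "p powr \<theta>"] by simp
    also have "\<dots> = (real J + 1) * (4 ^ d * p powr \<theta>)" by (simp add: algebra_simps)
    also have "\<dots> \<le> (3 - log 2 p) * (4 ^ d * p powr \<theta>)" using J by (intro mult_right_mono) auto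
    finally show "(\<Sum>j<J. ?b j * measure M (?A j)) + ?b J \<le> 4 ^ d * (3 - log 2 p) * p powr (- q)"
      by (simp add: \<theta>_def mult_ac)
  qed
  finally show ?thesis .
qed

end

section \<open>Asymptotics on the volume scale\<close>

text \<open>The strict inequality between the rates leaves an exponential factor, which eventually
  absorbs the fixed constant \<kappa>.\<close>

lemma exp_scale_eventually_le:
  fixes S S' A :: "nat \<Rightarrow> real"
  assumes "(\<lambda>n. ln (S n) / A n) \<longlonglongrightarrow> l" "(\<lambda>n. ln (S' n) / A n) \<longlonglongrightarrow> l'" "l < l' + t"
    and "\<And>n. 0 < S n" "\<And>n. 0 < S' n" "filterlim A at_top sequentially" "0 < \<kappa>"
  shows "\<forall>\<^sub>F n in sequentially. S n \<le> \<kappa> * (S' n * exp (t * A n))"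
proof -
  define a where "a = (l' + t - l) / 2"
  have a: "0 < a" using assms(3) by (simp add: a_def)
  have "(\<lambda>n. ln (S n) / A n - ln (S' n) / A n - t) \<longlonglongrightarrow> l - l' - t"
    by (intro tendsto_intros assms)
  moreover have "l - l' - t < - a" using assms(3) by (simp add: a_def field_simps)
  ultimately have "\<forall>\<^sub>F n in sequentially. ln (S n) / A n - ln (S' n) / A n - t < - a"
    by (rule order_tendstoD(2))
  moreover have "\<forall>\<^sub>F n in sequentially. 0 < A n"
    using assms(6) by (simp add: filterlim_at_top_dense)
  moreover have "\<forall>\<^sub>F n in sequentially. - ln \<kappa> / a \<le> A n"
    using assms(6) unfolding filterlim_at_top by blast
  ultimately show ?thesis
  proof eventually_elim
    case (elim n)
    then have "(ln (S n) - ln (S' n) - t * A n) / A n < - a" by (simp add: diff_divide_distrib)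
    then have "ln (S n) - ln (S' n) - t * A n < - a * A n" using elim by (simp add: divide_less_eq)
    moreover have "- ln \<kappa> \<le> a * A n" using elim(3) a by (simp add: field_simps)
    ultimately have "ln (S n) \<le> ln \<kappa> + ln (S' n) + t * A n" by linarith
    also have "\<dots> = ln (\<kappa> * (S' n * exp (t * A n)))" using assms(5,7) by (simp add: ln_mult less_imp_neq[symmetric])
    finally show ?case using assms(4,5,7) by (subst (asm) ln_le_cancel_iff) auto
  qed
qed

text \<open>\<open>vol\<close> is the number of sites of the cube, \<open>surf\<close> the order of
  boundary errors and \<open>scl\<close> the normalization in the theorem. The difference between
  \<open>vol\<close> and \<open>scl\<close> is itself of order \<open>surf\<close>.\<close>

abbreviation vol :: "nat \<Rightarrow> nat \<Rightarrow> real" where "vol d n \<equiv> real (n + 1) ^ d"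
abbreviation surf :: "nat \<Rightarrow> nat \<Rightarrow> real" where "surf d n \<equiv> real (n + 1) ^ (d - 1)"
abbreviation scl :: "nat \<Rightarrow> nat \<Rightarrow> real" where "scl d n \<equiv> real n ^ d"

locale multidim_gibbs_state = gibbs_state U r K M \<beta>
  for U :: "('d::finite, 'a::finite) interaction" and r K and M :: "('d, 'a) config measure" and \<beta> +
  assumes dim_ge_2: "2 \<le> CARD('d)"
begin

text \<open>The place where dimension at least 2 enters: constants and logarithms of the side length
  are then at most of surface order.\<close>

lemma surf_ge: "real (n + 1) \<le> surf CARD('d) n" "1 \<le> surf CARD('d) n"
proof -
  show "real (n + 1) \<le> surf CARD('d) n" using dim_ge_2 by (intro self_le_power) auto
  show "1 \<le> surf CARD('d) n" by (intro one_le_power) simp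
qed

lemma vol_eq: "vol CARD('d) n = real (n + 1) * surf CARD('d) n"
  using power_eq_if[of "real (n + 1)" "CARD('d)"] by simp

lemma scl_at_top: "filterlim (scl CARD('d)) at_top sequentially"
  by (rule filterlim_pow_at_top[OF _ filterlim_real_sequentially]) simp

lemma vol_scl: "(\<lambda>n. vol CARD('d) n / scl CARD('d) n) \<longlonglongrightarrow> 1"
  by (rule Suc_power_over_power)

lemma surf_scl: "(\<lambda>n. surf CARD('d) n / scl CARD('d) n) \<longlonglongrightarrow> 0"
proof -
  have "(\<lambda>n. vol CARD('d) n / scl CARD('d) n * inverse (real (Suc n))) \<longlonglongrightarrow> 1 * 0"
    by (intro tendsto_mult vol_scl LIMSEQ_inverse_real_of_nat)
  moreover have "vol CARD('d) n / scl CARD('d) n * inverse (real (Suc n)) = surf CARD('d) n / scl CARD('d) n" for n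
  proof -
    have "a * b / c * inverse a = b / c" if "a \<noteq> 0" for a b c :: real using that by simp
    from this[of "real (n + 1)"] show ?thesis unfolding vol_eq Suc_eq_plus1 by simp
  qed
  ultimately show ?thesis by (simp only: mult_zero_right)
qed

lemma surface_order_tendsto:
  assumes "\<And>n. \<bar>x n - vol CARD('d) n * l\<bar> \<le> C * surf CARD('d) n"
  shows "(\<lambda>n. x n / scl CARD('d) n) \<longlonglongrightarrow> l"
proof -
  have "(\<lambda>n. (x n - vol CARD('d) n * l) / scl CARD('d) n) \<longlonglongrightarrow> 0"
  proof (rule Lim_null_comparison)
    show "\<forall>\<^sub>F n in sequentially. norm ((x n - vol CARD('d) n * l) / scl CARD('d) n) \<le> C * (surf CARD('d) n / scl CARD('d) n)"
      using assms by (intro always_eventually allI) (simp add: abs_divide divide_right_mono)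
    show "(\<lambda>n. C * (surf CARD('d) n / scl CARD('d) n)) \<longlonglongrightarrow> 0" using tendsto_mult_left[OF surf_scl, of C] by simp
  qed
  then have "(\<lambda>n. (x n - vol CARD('d) n * l) / scl CARD('d) n + l * (vol CARD('d) n / scl CARD('d) n)) \<longlonglongrightarrow> 0 + l * 1"
    by (intro tendsto_intros vol_scl)
  moreover have "(x n - vol CARD('d) n * l) / scl CARD('d) n + l * (vol CARD('d) n / scl CARD('d) n) = x n / scl CARD('d) n" for n
    by (simp add: diff_divide_distrib mult.commute)
  ultimately show ?thesis by simp
qed

definition moment :: "real \<Rightarrow> nat \<Rightarrow> real" where
  "moment q n = (\<Sum>\<eta>\<in>patterns (cube n). exp (- ((1 - q) * info n \<eta>)))"

lemma moment_pos: "0 < moment q n"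
  unfolding moment_def by (intro sum_pos) auto

lemma ln_moment_bound: "\<bar>ln (moment q n) - vol CARD('d) n * cgf q\<bar> \<le> 4 * \<bar>1 - q\<bar> * \<beta> * surface_const * surf CARD('d) n"
  unfolding moment_def by (rule abs_ln_moment_le)

lemma ln_moment_tendsto: "(\<lambda>n. ln (moment q n) / scl CARD('d) n) \<longlonglongrightarrow> cgf q"
  by (rule surface_order_tendsto[OF ln_moment_bound])

lemma moment_0: "moment 0 n = 1"
proof -
  have "moment 0 n = (\<Sum>\<eta>\<in>patterns (cube n). measure M (cyl (cube n) \<eta> \<inter> UNIV))"
    by (simp add: moment_def exp_minus_info)
  also have "\<dots> = measure M UNIV" 
    using sets.top[of M] unfolding space_M by (intro sum_measure_cyl_Int finite_cube)
  finally show ?thesis using prob_space by simp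
qed

lemma cgf_0 [simp]: "cgf 0 = 0"
  using LIMSEQ_unique[OF ln_moment_tendsto[of 0]] by (simp add: moment_0)

lemma info_nonneg: "0 \<le> info n \<eta>"
  using cyl_prob_pos[of "cube n" \<eta>] by (simp add: info_def prob_le_1)

text \<open>Linear growth in the volume makes the factor \<open>3 - log 2 p\<close> of the negative
  moments polynomial in \<open>n\<close>, hence negligible on the exponential scale.\<close>

lemma info_le: obtains C where "0 \<le> C" "\<And>n \<eta>. info n \<eta> \<le> C * vol CARD('d) n"
proof
  let ?C = "\<beta> * K + \<bar>pressure (scale_interaction \<beta> U)\<bar> + 3 * \<beta> * surface_const"
  show "0 \<le> ?C" using \<beta>_nonneg K_nonneg surface_const_nonneg by simp
  fix n \<eta>
  have "\<beta> * energy (cube n) \<eta> \<le> \<beta> * (K * vol CARD('d) n)"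
    using abs_energy_le[OF finite_cube, of n \<eta>] \<beta>_nonneg by (intro mult_left_mono) (simp_all add: card_cube abs_le_iff add.commute)
  moreover have "vol CARD('d) n * pressure (scale_interaction \<beta> U) \<le> vol CARD('d) n * \<bar>pressure (scale_interaction \<beta> U)\<bar>"
    by (intro mult_left_mono) auto
  moreover have "3 * \<beta> * surface_const * surf CARD('d) n \<le> 3 * \<beta> * surface_const * vol CARD('d) n"
  proof (intro mult_left_mono)
    show "surf CARD('d) n \<le> vol CARD('d) n" unfolding vol_eq using surf_ge(2)[of n] by (simp add: mult_le_cancel_right1)
  qed (use \<beta>_nonneg surface_const_nonneg in simp)
  ultimately have "info n \<eta> \<le> \<beta> * (K * vol CARD('d) n) + vol CARD('d) n * \<bar>pressure (scale_interaction \<beta> U)\<bar> + 3 * \<beta> * surface_const * vol CARD('d) n"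
    using abs_info_le[of n \<eta>] by linarith
  also have "\<dots> = ?C * vol CARD('d) n" by (simp only: distrib_right) (simp only: mult_ac)
  finally show "info n \<eta> \<le> ?C * vol CARD('d) n" .
qed

text \<open>Jensen's inequality under the weights tilted by \<open>exp (q * info)\<close>: the
  logarithmic moment lies above its tangent at q, whose slope is the tilted mean of the
  information.\<close>

lemma ln_moment_tangent:
  "ln (moment q n) + (a - q) * ((\<Sum>\<eta>\<in>patterns (cube n). exp (- ((1 - q) * info n \<eta>)) * info n \<eta>) / moment q n)
    \<le> ln (moment a n)"
proof -
  let ?w = "\<lambda>\<eta>. exp (- ((1 - q) * info n \<eta>))"
  define m where "m = (\<Sum>\<eta>\<in>patterns (cube n). ?w \<eta> * info n \<eta>) / moment q n"
  have m: "(\<Sum>\<eta>\<in>patterns (cube n). ?w \<eta> * info n \<eta>) = m * moment q n"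
    using moment_pos[of q n] by (simp add: m_def)
  \<comment> \<open>The linear term has tilted mean zero because \<open>m\<close> is the tilted
    mean, so inserting it changes nothing; it prepares for \<open>1 + x \<le> exp x\<close>.\<close>
  have "moment q n * exp ((a - q) * m)
      = (\<Sum>\<eta>\<in>patterns (cube n). ?w \<eta> * (exp ((a - q) * m) * (1 + (a - q) * (info n \<eta> - m))))"
  proof -
    have "(\<Sum>\<eta>\<in>patterns (cube n). ?w \<eta> * (exp ((a - q) * m) * (1 + (a - q) * (info n \<eta> - m))))
      = exp ((a - q) * m) * (moment q n + (a - q) * (\<Sum>\<eta>\<in>patterns (cube n). ?w \<eta> * info n \<eta>) - (a - q) * m * moment q n)"
      unfolding moment_def sum_distrib_left sum.distrib[symmetric] sum_subtractf[symmetric]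
      by (intro sum.cong refl) (simp only: algebra_simps)
    then show ?thesis unfolding m by simp
  qed
  also have "\<dots> \<le> (\<Sum>\<eta>\<in>patterns (cube n). ?w \<eta> * exp ((a - q) * info n \<eta>))"
  proof (intro sum_mono mult_left_mono)
    fix \<eta>
    have "exp ((a - q) * m) * (1 + (a - q) * (info n \<eta> - m)) \<le> exp ((a - q) * m) * exp ((a - q) * (info n \<eta> - m))"
      by (intro mult_left_mono exp_ge_add_one_self) simp
    also have "\<dots> = exp ((a - q) * info n \<eta>)" unfolding exp_add[symmetric] by (simp add: algebra_simps)
    finally show "exp ((a - q) * m) * (1 + (a - q) * (info n \<eta> - m)) \<le> exp ((a - q) * info n \<eta>)" .
  qed simp
  also have "\<dots> = moment a n"
    unfolding moment_def exp_add[symmetric] by (intro sum.cong refl arg_cong[of _ _ exp]) (simp add: algebra_simps)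
  finally have "ln (moment q n * exp ((a - q) * m)) \<le> ln (moment a n)"
    using moment_pos[of q n] by (intro ln_mono) auto
  moreover have "ln (moment q n * exp ((a - q) * m)) = ln (moment q n) + (a - q) * m"
    using moment_pos[of q n] by (subst ln_mult) auto
  ultimately show ?thesis by (simp add: m_def)
qed

text \<open>The tangent at an intermediate point is used at both ends; in the convex combination the
  slope cancels, and the inequality passes to the limit.\<close>

lemma convex_cgf: "convex_on UNIV cgf"
proof (rule convex_onI)
  fix u a b :: real assume u: "0 < u" "u < 1"
  define q where "q = (1 - u) * a + u * b"
  have "ln (moment q n) \<le> (1 - u) * ln (moment a n) + u * ln (moment b n)" for n
  proof -
    define m where "m = (\<Sum>\<eta>\<in>patterns (cube n). exp (- ((1 - q) * info n \<eta>)) * info n \<eta>) / moment q n"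
    have "(1 - u) * (ln (moment q n) + (a - q) * m) \<le> (1 - u) * ln (moment a n)"
      "u * (ln (moment q n) + (b - q) * m) \<le> u * ln (moment b n)"
      unfolding m_def by (rule mult_left_mono[OF ln_moment_tangent], use u in simp)+
    moreover have "(1 - u) * (ln (moment q n) + (a - q) * m) + u * (ln (moment q n) + (b - q) * m) = ln (moment q n)"
      by (simp add: q_def algebra_simps)
    ultimately show ?thesis by linarith
  qed
  note le = this
  have "ln (moment q n) / scl CARD('d) n \<le> (1 - u) * (ln (moment a n) / scl CARD('d) n) + u * (ln (moment b n) / scl CARD('d) n)" for n
    using divide_right_mono[OF le, of "scl CARD('d) n" n] by (simp add: add_divide_distrib)
  then have "cgf q \<le> (1 - u) * cgf a + u * cgf b"
    by (intro LIMSEQ_le[OF ln_moment_tendsto, of "\<lambda>n. (1 - u) * (ln (moment a n) / scl CARD('d) n) + u * (ln (moment b n) / scl CARD('d) n)"]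
      tendsto_intros ln_moment_tendsto) auto
  then show "cgf ((1 - u) *\<^sub>R a + u *\<^sub>R b) \<le> (1 - u) * cgf a + u * cgf b" by (simp add: q_def)
qed simp

section \<open>Specific entropy as the derivative of the cumulant generating function at 0\<close>

definition mean_info :: "nat \<Rightarrow> real" where
  "mean_info n = (\<Sum>\<eta>\<in>patterns (cube n). measure M (cyl (cube n) \<eta>) * info n \<eta>)"

lemma mean_info_tangent: "q * mean_info n \<le> ln (moment q n)"
  using ln_moment_tangent[of 0 n q] by (simp add: moment_0 mean_info_def exp_minus_info)

text \<open>The tangent at 0 has slope \<open>mean_info n\<close>. Positive and negative q bound it
  from above and below by difference quotients at 0, which differentiability makes arbitrarily
  close.\<close>

lemma mean_info_tendsto:
  assumes "(cgf has_real_derivative s) (at 0)"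
  shows "(\<lambda>n. mean_info n / scl CARD('d) n) \<longlonglongrightarrow> s"
proof -
  have lim: "((\<lambda>q. cgf q / q) \<longlongrightarrow> s) (at 0)"
    using assms unfolding has_field_derivative_iff by simp
  show ?thesis
  proof (rule order_tendstoI)
    fix a assume "a < s"
    then have 1: "\<forall>\<^sub>F q in at_left 0. a < cgf q / q"
      using order_tendstoD(1)[OF lim] by (simp add: eventually_at_split)
    have 2: "\<forall>\<^sub>F q in at_left (0::real). q < 0" by (simp add: eventually_at_filter)
    obtain q where q: "q < 0" "a < cgf q / q"
      using eventually_happens'[OF trivial_limit_at_left_real eventually_conj[OF 2 1]] by blast
    have "(\<lambda>n. (ln (moment q n) / scl CARD('d) n) / q) \<longlonglongrightarrow> cgf q / q"
      by (intro tendsto_divide ln_moment_tendsto tendsto_const) (use q in simp)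
    from order_tendstoD(1)[OF this q(2)] show "\<forall>\<^sub>F n in sequentially. a < mean_info n / scl CARD('d) n"
    proof eventually_elim
      case (elim n)
      have "ln (moment q n) / q \<le> mean_info n"
        using mean_info_tangent[of q n] q(1) by (simp add: neg_divide_le_eq mult.commute)
      from divide_right_mono[OF this, of "scl CARD('d) n"]
      have "(ln (moment q n) / scl CARD('d) n) / q \<le> mean_info n / scl CARD('d) n" by (simp add: mult.commute)
      then show ?case using elim by linarith
    qed
  next
    fix a assume "s < a"
    then have 1: "\<forall>\<^sub>F q in at_right 0. cgf q / q < a"
      using order_tendstoD(2)[OF lim] by (simp add: eventually_at_split)
    have 2: "\<forall>\<^sub>F q in at_right (0::real). 0 < q" by (rule eventually_at_right_less)
    obtain q where q: "0 < q" "cgf q / q < a"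
      using eventually_happens'[OF trivial_limit_at_right_real eventually_conj[OF 2 1]] by blast
    have "(\<lambda>n. (ln (moment q n) / scl CARD('d) n) / q) \<longlonglongrightarrow> cgf q / q"
      by (intro tendsto_divide ln_moment_tendsto tendsto_const) (use q in simp)
    from order_tendstoD(2)[OF this q(2)] show "\<forall>\<^sub>F n in sequentially. mean_info n / scl CARD('d) n < a"
    proof eventually_elim
      case (elim n)
      have "mean_info n \<le> ln (moment q n) / q"
        using mean_info_tangent[of q n] q(1) by (simp add: pos_le_divide_eq mult.commute)
      from divide_right_mono[OF this, of "scl CARD('d) n"]
      have "mean_info n / scl CARD('d) n \<le> (ln (moment q n) / scl CARD('d) n) / q" by (simp add: mult.commute)
      then show ?case using elim by linarith
    qed
  qed
qed

lemma specific_entropy_eq: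
  assumes "(cgf has_real_derivative s) (at 0)"
  shows "specific_entropy M = s"
proof -
  have "- (1 / real n ^ CARD('d)) * (\<Sum>\<eta>\<in>patterns (cube n). measure M (cylinder (cube n) \<eta>) * ln (measure M (cylinder (cube n) \<eta>)))
      = mean_info n / scl CARD('d) n" for n
    unfolding mean_info_def info_def by (simp add: cylinder_eq_cyl sum_negf cong: sum.cong)
  then show ?thesis unfolding specific_entropy_def using mean_info_tendsto[OF assms] by (simp add: limI)
qed

lemma entropy_nonneg:
  assumes "(cgf has_real_derivative s) (at 0)"
  shows "0 \<le> s"
  by (rule LIMSEQ_le_const[OF mean_info_tendsto[OF assms]])
    (intro exI[of _ 0] allI impI, simp add: mean_info_def sum_nonneg info_nonneg)

lemma cgf_ge_entropy_line:
  assumes "(cgf has_real_derivative s) (at 0)"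
  shows "q * s \<le> cgf q"
proof -
  have "q * (mean_info n / scl CARD('d) n) \<le> ln (moment q n) / scl CARD('d) n" for n
    using divide_right_mono[OF mean_info_tangent, of "scl CARD('d) n" q n] by simp
  then show ?thesis
    by (intro LIMSEQ_le[OF tendsto_mult_left[OF mean_info_tendsto[OF assms]] ln_moment_tendsto]) auto
qed

text \<open>Exponential tilting: under the weights \<open>exp (q info)\<close> the information density concentrates at
  the derivative of the cumulant generating function.\<close>

lemma tilted_lower_bound:
  assumes der: "(cgf has_real_derivative v) (at q)" and \<epsilon>: "0 < \<epsilon>"
  shows "\<forall>\<^sub>F n in sequentially. exp (scl CARD('d) n * (cgf q - q * v - \<bar>q\<bar> * \<epsilon> - \<epsilon>))
    \<le> (\<Sum>\<eta>\<in>{\<eta>\<in>patterns (cube n). \<bar>info n \<eta> - scl CARD('d) n * v\<bar> \<le> \<epsilon> * scl CARD('d) n}. measure M (cyl (cube n) \<eta>))"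
proof -
  have lim: "((\<lambda>y. (cgf y - cgf q) / (y - q)) \<longlongrightarrow> v) (at q)"
    using der unfolding has_field_derivative_iff .
  have "\<forall>\<^sub>F y in at q. \<bar>(cgf y - cgf q) / (y - q) - v\<bar> < \<epsilon>"
    using tendstoD[OF lim \<epsilon>] by (simp add: dist_real_def)
  then obtain \<delta>0 where \<delta>0: "0 < \<delta>0" "\<And>y. y \<noteq> q \<Longrightarrow> \<bar>y - q\<bar> < \<delta>0 \<Longrightarrow> \<bar>(cgf y - cgf q) / (y - q) - v\<bar> < \<epsilon>"
    unfolding eventually_at dist_real_def by auto
  \<comment> \<open>Halving keeps both \<open>q + \<delta>\<close> and \<open>q - \<delta>\<close>
    strictly inside the range where difference quotients are within \<epsilon> of the derivative;
    these two points serve as Chernoff parameters for the two tails.\<close>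
  define \<delta> where "\<delta> = \<delta>0 / 2"
  have \<delta>: "0 < \<delta>" "\<delta> < \<delta>0" using \<delta>0 by (auto simp: \<delta>_def)
  have hi: "cgf (q + \<delta>) < cgf q + \<delta> * (v + \<epsilon>)"
  proof -
    have "(cgf (q + \<delta>) - cgf q) / \<delta> < v + \<epsilon>" using \<delta>0(2)[of "q + \<delta>"] \<delta> by simp
    then show ?thesis using \<delta> by (simp add: pos_divide_less_eq mult.commute)
  qed
  have lo: "cgf (q - \<delta>) < cgf q + - (\<delta> * (v - \<epsilon>))"
  proof -
    have "v - \<epsilon> < (cgf (q - \<delta>) - cgf q) / (- \<delta>)" using \<delta>0(2)[of "q - \<delta>"] \<delta> by simp
    then have "v - \<epsilon> < (cgf q - cgf (q - \<delta>)) / \<delta>" by (simp add: minus_divide_right[symmetric] minus_divide_left)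
    then show ?thesis using \<delta> by (simp add: pos_less_divide_eq mult.commute)
  qed
  have "\<forall>\<^sub>F n in sequentially. moment (q + \<delta>) n \<le> 1 / 4 * (moment q n * exp (\<delta> * (v + \<epsilon>) * scl CARD('d) n))"
    by (rule exp_scale_eventually_le[OF ln_moment_tendsto ln_moment_tendsto hi])
      (simp_all add: moment_pos scl_at_top)
  moreover have "\<forall>\<^sub>F n in sequentially. moment (q - \<delta>) n \<le> 1 / 4 * (moment q n * exp (- (\<delta> * (v - \<epsilon>)) * scl CARD('d) n))"
    by (rule exp_scale_eventually_le[OF ln_moment_tendsto ln_moment_tendsto lo])
      (simp_all add: moment_pos scl_at_top)
  \<comment> \<open>The last \<epsilon> in the exponent of the claim pays for the factor 1/2 left
    after removing both tails and for the convergence error of the moment.\<close>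
  moreover have "\<forall>\<^sub>F n in sequentially. (1::real) \<le> 1 / 2 * (moment q n * exp ((\<epsilon> - cgf q) * scl CARD('d) n))"
    by (rule exp_scale_eventually_le[of "\<lambda>_. 1" "scl CARD('d)" 0, OF _ ln_moment_tendsto])
      (use \<epsilon> in \<open>simp_all add: moment_pos scl_at_top\<close>)
  ultimately show ?thesis
  proof eventually_elim
    case (elim n)
    let ?P = "patterns (cube n) :: ('d, 'a) config set" and ?X = "info n"
    let ?w = "\<lambda>\<eta>. exp (- ((1 - q) * ?X \<eta>))"
    define G where "G = {\<eta>\<in>?P. \<bar>?X \<eta> - scl CARD('d) n * v\<bar> \<le> \<epsilon> * scl CARD('d) n}"
    define H where "H = {\<eta>\<in>?P. scl CARD('d) n * (v + \<epsilon>) < ?X \<eta>}"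
    define L where "L = {\<eta>\<in>?P. ?X \<eta> < scl CARD('d) n * (v - \<epsilon>)}"
    have fin: "finite ?P" by simp
    have sub: "?P \<subseteq> G \<union> (H \<union> L)"
      unfolding G_def H_def L_def by (auto simp: abs_le_iff algebra_simps)
    have finGHL: "finite G" "finite H" "finite L" using fin by (auto simp: G_def H_def L_def)
    have "moment q n \<le> (\<Sum>\<eta>\<in>G \<union> (H \<union> L). ?w \<eta>)"
      unfolding moment_def by (rule sum_mono2) (use sub finGHL in auto)
    also have "\<dots> \<le> (\<Sum>\<eta>\<in>G. ?w \<eta>) + ((\<Sum>\<eta>\<in>H. ?w \<eta>) + (\<Sum>\<eta>\<in>L. ?w \<eta>))"
    proof -
      have "(\<Sum>\<eta>\<in>A \<union> B. ?w \<eta>) \<le> (\<Sum>\<eta>\<in>A. ?w \<eta>) + (\<Sum>\<eta>\<in>B. ?w \<eta>)" if "finite A" "finite B" for A B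
        using sum_Un[OF that, of ?w] sum_nonneg[of "A \<inter> B" ?w] by simp
      then show ?thesis using finGHL by (meson add_left_mono finite_Un order_trans)
    qed
    finally have tot: "moment q n \<le> (\<Sum>\<eta>\<in>G. ?w \<eta>) + ((\<Sum>\<eta>\<in>H. ?w \<eta>) + (\<Sum>\<eta>\<in>L. ?w \<eta>))" .
    \<comment> \<open>Exponential Markov inequality for the tilted weights: shifting the tilt by
      \<open>a\<close> costs at least \<open>exp b\<close> on every pattern of
      \<open>A\<close>.\<close>
    have tail: "(\<Sum>\<eta>\<in>A. ?w \<eta>) \<le> moment (q + a) n * exp (- b)"
      if "A \<subseteq> ?P" "\<And>\<eta>. \<eta> \<in> A \<Longrightarrow> b \<le> a * ?X \<eta>" for A a b
    proof -
      have "(\<Sum>\<eta>\<in>A. ?w \<eta>) \<le> (\<Sum>\<eta>\<in>A. exp (- ((1 - (q + a)) * ?X \<eta>)) * exp (- b))"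
      proof (rule sum_mono)
        fix \<eta> assume "\<eta> \<in> A"
        then show "?w \<eta> \<le> exp (- ((1 - (q + a)) * ?X \<eta>)) * exp (- b)"
          unfolding exp_add[symmetric] using that(2)[of \<eta>] by (subst exp_le_cancel_iff) (simp add: algebra_simps)
      qed
      also have "\<dots> \<le> (\<Sum>\<eta>\<in>?P. exp (- ((1 - (q + a)) * ?X \<eta>)) * exp (- b))"
        using that(1) fin by (intro sum_mono2) auto
      finally show ?thesis by (simp add: moment_def sum_distrib_right)
    qed
    have "(\<Sum>\<eta>\<in>H. ?w \<eta>) \<le> moment (q + \<delta>) n * exp (- (\<delta> * (v + \<epsilon>) * scl CARD('d) n))"
      by (rule tail) (use \<delta> in \<open>auto simp: H_def mult.assoc mult.commute[of "v + \<epsilon>"]\<close>)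
    also have "\<dots> \<le> (1 / 4 * (moment q n * exp (\<delta> * (v + \<epsilon>) * scl CARD('d) n))) * exp (- (\<delta> * (v + \<epsilon>) * scl CARD('d) n))"
      using elim(1) by (rule mult_right_mono) simp
    also have "\<dots> = moment q n / 4" by (simp add: exp_minus)
    finally have H: "(\<Sum>\<eta>\<in>H. ?w \<eta>) \<le> moment q n / 4" .
    have "(\<Sum>\<eta>\<in>L. ?w \<eta>) \<le> moment (q + (- \<delta>)) n * exp (- (- (\<delta> * (v - \<epsilon>)) * scl CARD('d) n))"
      by (rule tail) (use \<delta> in \<open>auto simp: L_def mult.assoc mult.commute[of "v - \<epsilon>"]\<close>)
    also have "\<dots> = moment (q - \<delta>) n * exp (- (- (\<delta> * (v - \<epsilon>)) * scl CARD('d) n))" by simp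
    also have "\<dots> \<le> (1 / 4 * (moment q n * exp (- (\<delta> * (v - \<epsilon>)) * scl CARD('d) n))) * exp (- (- (\<delta> * (v - \<epsilon>)) * scl CARD('d) n))"
      using elim(2) by (rule mult_right_mono) simp
    also have "\<dots> = moment q n / 4" by (simp add: exp_minus)
    finally have L: "(\<Sum>\<eta>\<in>L. ?w \<eta>) \<le> moment q n / 4" .
    have G: "1 / 2 * moment q n \<le> (\<Sum>\<eta>\<in>G. ?w \<eta>)" using tot H L by linarith
    have "exp (scl CARD('d) n * (cgf q - q * v - \<bar>q\<bar> * \<epsilon> - \<epsilon>))
        = exp (- (scl CARD('d) n * (q * v + \<bar>q\<bar> * \<epsilon>))) * exp (- ((\<epsilon> - cgf q) * scl CARD('d) n))"
      unfolding exp_add[symmetric] by (simp add: algebra_simps)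
    also have "\<dots> \<le> exp (- (scl CARD('d) n * (q * v + \<bar>q\<bar> * \<epsilon>))) * (1 / 2 * moment q n)"
    proof (rule mult_left_mono)
      have "1 * exp (- ((\<epsilon> - cgf q) * scl CARD('d) n)) \<le> (1 / 2 * (moment q n * exp ((\<epsilon> - cgf q) * scl CARD('d) n))) * exp (- ((\<epsilon> - cgf q) * scl CARD('d) n))"
        using elim(3) by (rule mult_right_mono) simp
      also have "\<dots> = 1 / 2 * moment q n" by (simp add: exp_minus)
      finally show "exp (- ((\<epsilon> - cgf q) * scl CARD('d) n)) \<le> 1 / 2 * moment q n" by simp
    qed simp
    also have "\<dots> \<le> exp (- (scl CARD('d) n * (q * v + \<bar>q\<bar> * \<epsilon>))) * (\<Sum>\<eta>\<in>G. ?w \<eta>)"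
      using G by (rule mult_left_mono) simp
    \<comment> \<open>The tilt is undone: on \<open>G\<close> the factor
      \<open>exp (q * info)\<close> differs from its central value by at most
      \<open>exp (\<bar>q\<bar> * \<epsilon> * n ^ d)\<close>.\<close>
    also have "\<dots> \<le> (\<Sum>\<eta>\<in>G. measure M (cyl (cube n) \<eta>))"
      unfolding sum_distrib_left
    proof (rule sum_mono)
      fix \<eta> assume "\<eta> \<in> G"
      then have "\<bar>?X \<eta> - scl CARD('d) n * v\<bar> \<le> \<epsilon> * scl CARD('d) n" by (simp add: G_def)
      then have "\<bar>q\<bar> * \<bar>?X \<eta> - scl CARD('d) n * v\<bar> \<le> \<bar>q\<bar> * (\<epsilon> * scl CARD('d) n)" by (rule mult_left_mono) simp
      then have "q * (?X \<eta> - scl CARD('d) n * v) \<le> \<bar>q\<bar> * (\<epsilon> * scl CARD('d) n)" unfolding abs_mult[symmetric] by linarith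
      then have "exp (- (scl CARD('d) n * (q * v + \<bar>q\<bar> * \<epsilon>))) * ?w \<eta> \<le> exp (- ?X \<eta>)"
        unfolding exp_add[symmetric] by (subst exp_le_cancel_iff) (simp add: algebra_simps)
      then show "exp (- (scl CARD('d) n * (q * v + \<bar>q\<bar> * \<epsilon>))) * ?w \<eta> \<le> measure M (cyl (cube n) \<eta>)"
        by (simp add: exp_minus_info)
    qed
    finally show ?case unfolding G_def .
  qed
qed

end

section \<open>The waiting-time pressure and the tail estimates\<close>

lemma exp_neg_2_le: "3 * exp (- 2) \<le> (1 / 2 :: real)"
proof -
  have "(5 / 2 :: real) \<le> exp 1" using exp_lower_Taylor_quadratic[of 1] by simp
  then have "(5 / 2 :: real) * (5 / 2) \<le> exp 1 * exp 1" by (intro mult_mono) auto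
  then have "(6 :: real) \<le> exp 2" by (simp add: exp_add[symmetric])
  then show ?thesis by (simp add: exp_minus field_simps)
qed

text \<open>The tail events as predicates of the waiting time alone, with the logarithm removed; the
  parameter will be \<open>n ^ d * v\<close>. An infinite waiting time belongs to the upper tail
  only.\<close>

definition rate_ge :: "nat \<Rightarrow> real \<Rightarrow> enat \<Rightarrow> bool" where
  "rate_ge d y e \<longleftrightarrow> (case e of enat k \<Rightarrow> exp y \<le> real k ^ d | \<infinity> \<Rightarrow> True)"

definition rate_le :: "nat \<Rightarrow> real \<Rightarrow> enat \<Rightarrow> bool" where
  "rate_le d y e \<longleftrightarrow> (case e of enat k \<Rightarrow> real k ^ d \<le> exp y | \<infinity> \<Rightarrow> False)"

lemma log_waiting_rate_iff:
  fixes \<xi> \<sigma> :: "('d::finite, 'a::finite) config"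
  assumes "0 < n"
  shows "ereal v \<le> log_waiting_rate n \<xi> \<sigma> \<longleftrightarrow> rate_ge CARD('d) (scl CARD('d) n * v) (waiting_time n \<xi> \<sigma>)"
    and "log_waiting_rate n \<xi> \<sigma> \<le> ereal v \<longleftrightarrow> rate_le CARD('d) (scl CARD('d) n * v) (waiting_time n \<xi> \<sigma>)"
proof -
  have s: "0 < scl CARD('d) n" using assms by simp
  have "(ereal v \<le> log_waiting_rate n \<xi> \<sigma> \<longleftrightarrow> rate_ge CARD('d) (scl CARD('d) n * v) (waiting_time n \<xi> \<sigma>))
      \<and> (log_waiting_rate n \<xi> \<sigma> \<le> ereal v \<longleftrightarrow> rate_le CARD('d) (scl CARD('d) n * v) (waiting_time n \<xi> \<sigma>))"
  proof (cases "waiting_time n \<xi> \<sigma>")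
    case (enat k)
    then have k: "1 \<le> k" using waiting_time_pos[of n \<xi> \<sigma>] by (simp add: one_enat_def)
    then have kd: "0 < real k ^ CARD('d)" by simp
    have "ereal_of_enat (waiting_time n \<xi> \<sigma>) ^ CARD('d) = ereal (real k ^ CARD('d))"
      by (simp add: enat)
    then have r: "log_waiting_rate n \<xi> \<sigma> = ereal (ln (real k ^ CARD('d)) / scl CARD('d) n)"
      using kd s unfolding log_waiting_rate_def by (simp add: elog_def not_le)
    have "v \<le> ln (real k ^ CARD('d)) / scl CARD('d) n \<longleftrightarrow> exp (scl CARD('d) n * v) \<le> real k ^ CARD('d)"
      using kd s by (simp add: pos_le_divide_eq ln_ge_iff mult.commute)
    moreover have "ln (real k ^ CARD('d)) / scl CARD('d) n \<le> v \<longleftrightarrow> real k ^ CARD('d) \<le> exp (scl CARD('d) n * v)"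
    proof -
      have "ln (real k ^ CARD('d)) / scl CARD('d) n \<le> v \<longleftrightarrow> ln (real k ^ CARD('d)) \<le> ln (exp (scl CARD('d) n * v))"
        using s by (simp add: pos_divide_le_eq mult.commute)
      also have "\<dots> \<longleftrightarrow> real k ^ CARD('d) \<le> exp (scl CARD('d) n * v)" using kd by (intro ln_le_cancel_iff) auto
      finally show ?thesis .
    qed
    ultimately show ?thesis unfolding r by (simp add: rate_ge_def rate_le_def enat)
  next
    case infinity
    have "log_waiting_rate n \<xi> \<sigma> = \<infinity>"
      using s unfolding log_waiting_rate_def by (simp add: infinity elog_def)
    then show ?thesis by (simp add: infinity rate_ge_def rate_le_def)
  qed
  then show "ereal v \<le> log_waiting_rate n \<xi> \<sigma> \<longleftrightarrow> rate_ge CARD('d) (scl CARD('d) n * v) (waiting_time n \<xi> \<sigma>)"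
    "log_waiting_rate n \<xi> \<sigma> \<le> ereal v \<longleftrightarrow> rate_le CARD('d) (scl CARD('d) n * v) (waiting_time n \<xi> \<sigma>)" by blast+
qed

text \<open>The pointwise inequality behind Markov's inequality. Positive exponents serve the upper
  tail and negative ones the lower tail.\<close>

lemma enat_powr_ge_of_rate:
  assumes "0 < d" "1 \<le> e"
  shows "0 \<le> q \<Longrightarrow> rate_ge d y e \<Longrightarrow> ennreal (exp (y * q)) \<le> enat_powr e (q * real d)"
    and "q \<le> 0 \<Longrightarrow> rate_le d y e \<Longrightarrow> ennreal (exp (y * q)) \<le> enat_powr e (q * real d)"
proof -
  have e: "exp (y * q) = exp y powr q" by (simp add: powr_def mult.commute)
  have p: "real k powr (q * real d) = (real k ^ d) powr q" if "e = enat k" for k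
  proof -
    have "0 < real k" using assms(2) that by (simp add: one_enat_def)
    then show ?thesis by (simp add: powr_realpow[symmetric] powr_powr mult.commute)
  qed
  show "ennreal (exp (y * q)) \<le> enat_powr e (q * real d)" if "0 \<le> q" "rate_ge d y e"
  proof (cases e)
    case (enat k)
    then show ?thesis using that by (simp add: enat_powr_def p e rate_ge_def ennreal_leI powr_mono2)
  next
    case infinity
    then show ?thesis using that(1) assms(1) by (cases "q = 0") (auto simp: enat_powr_def)
  qed
  show "ennreal (exp (y * q)) \<le> enat_powr e (q * real d)" if "q \<le> 0" "rate_le d y e"
  proof (cases e)
    case (enat k)
    then have "0 < real k ^ d" using assms(2) by (simp add: one_enat_def)
    then show ?thesis using that enat by (simp add: enat_powr_def p e rate_le_def ennreal_leI powr_mono2')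
  qed (use that in \<open>simp add: rate_le_def\<close>)
qed

context multidim_gibbs_state
begin

text \<open>The factor \<open>c\<close> of \<open>waiting_law\<close>: twice the distortion comes
  from quasi-independence, and the volume from trying only one shift per block. Minus its logarithm
  is of surface order.\<close>

definition inv_loss :: "nat \<Rightarrow> real" where
  "inv_loss n = exp (- 2 * distortion (cube n)) / vol CARD('d) n"

lemma inv_loss_pos: "0 < inv_loss n"
  by (simp add: inv_loss_def)

lemma ln_inv_loss: "0 \<le> - ln (inv_loss n)" "- ln (inv_loss n) \<le> (4 * \<beta> * surface_const + real CARD('d)) * surf CARD('d) n"
proof -
  have l: "- ln (inv_loss n) = 2 * distortion (cube n) + real CARD('d) * ln (real (n + 1))"
    by (simp add: inv_loss_def ln_div ln_realpow)
  then show "0 \<le> - ln (inv_loss n)" using distortion_nonneg[of "cube n"] by simp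
  have "ln (real (n + 1)) \<le> surf CARD('d) n" using ln_le_minus_one[of "real (n + 1)"] surf_ge(1)[of n] by simp
  then have "real CARD('d) * ln (real (n + 1)) \<le> real CARD('d) * surf CARD('d) n" by (rule mult_left_mono) simp
  then show "- ln (inv_loss n) \<le> (4 * \<beta> * surface_const + real CARD('d)) * surf CARD('d) n"
    unfolding l distrib_right using distortion_cube_le[of n] by linarith
qed

lemma inv_loss_le_1: "inv_loss n \<le> 1"
  using ln_inv_loss(1)[of n] inv_loss_pos[of n] by (simp add: ln_le_zero_iff)

lemma waiting_law_cube:
  "waiting_law M (waiting_time n \<eta>) CARD('d) (measure M (cyl (cube n) \<eta>)) (inv_loss n)"
proof
  show "measure M {\<sigma>\<in>space M. waiting_time n \<eta> \<sigma> \<le> enat k} \<le> real (k + 1) ^ CARD('d) * measure M (cyl (cube n) \<eta>)" for k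
    using waiting_time_le_prob[of n \<eta> k] by simp
  show "measure M {\<sigma>\<in>space M. \<not> waiting_time n \<eta> \<sigma> \<le> enat k}
      \<le> 3 * exp (- (inv_loss n * measure M (cyl (cube n) \<eta>) * real k ^ CARD('d)))" for k
    using waiting_time_gt_prob[of n \<eta> k] by (simp add: inv_loss_def)
qed (simp_all add: waiting_time_measurable waiting_time_pos cyl_prob_pos inv_loss_pos inv_loss_le_1)

definition waiting_moment :: "real \<Rightarrow> nat \<Rightarrow> ennreal" where
  "waiting_moment q n = (\<integral>\<^sup>+ (\<xi>, \<sigma>). enat_powr (waiting_time n \<xi> \<sigma>) (q * real CARD('d)) \<partial>(M \<Otimes>\<^sub>M M))"

lemma prob_powr_eq: "measure M (cyl (cube n) \<eta>) powr (- q) = exp (q * info n \<eta>)"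
  using cyl_prob_pos[of "cube n" \<eta>] by (simp add: powr_def info_def)

text \<open>Weighting the bound \<open>P powr (- q)\<close> by the probability of the pattern
  produces exactly \<open>moment q n\<close>.\<close>

lemma waiting_moment_bracket:
  assumes "0 < lo" "0 < hi"
    and "\<And>\<eta>. ennreal (lo * measure M (cyl (cube n) \<eta>) powr (- q)) \<le> (\<integral>\<^sup>+ \<sigma>. enat_powr (waiting_time n \<eta> \<sigma>) (q * real CARD('d)) \<partial>M)"
    and "\<And>\<eta>. (\<integral>\<^sup>+ \<sigma>. enat_powr (waiting_time n \<eta> \<sigma>) (q * real CARD('d)) \<partial>M) \<le> ennreal (hi * measure M (cyl (cube n) \<eta>) powr (- q))"
  obtains e where "waiting_moment q n = ennreal e" "lo * moment q n \<le> e" "e \<le> hi * moment q n"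
proof -
  let ?p = "\<lambda>\<eta>. measure M (cyl (cube n) \<eta>)"
  have W: "waiting_moment q n = (\<Sum>\<eta>\<in>patterns (cube n). ennreal (?p \<eta>) * (\<integral>\<^sup>+ \<sigma>. enat_powr (waiting_time n \<eta> \<sigma>) (q * real CARD('d)) \<partial>M))"
    unfolding waiting_moment_def by (rule nn_integral_waiting_time)
  have m: "ennreal (a * moment q n) = (\<Sum>\<eta>\<in>patterns (cube n). ennreal (?p \<eta>) * ennreal (a * ?p \<eta> powr (- q)))" if "0 < a" for a
  proof -
    have "a * moment q n = (\<Sum>\<eta>\<in>patterns (cube n). ?p \<eta> * (a * ?p \<eta> powr (- q)))"
      unfolding moment_def sum_distrib_left prob_powr_eq unfolding exp_minus_info[symmetric]
      by (intro sum.cong refl) (simp add: exp_add[symmetric] algebra_simps)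
    also have "ennreal \<dots> = (\<Sum>\<eta>\<in>patterns (cube n). ennreal (?p \<eta> * (a * ?p \<eta> powr (- q))))"
      using that by (intro sum_ennreal[symmetric]) simp
    also have "\<dots> = (\<Sum>\<eta>\<in>patterns (cube n). ennreal (?p \<eta>) * ennreal (a * ?p \<eta> powr (- q)))"
      using that by (intro sum.cong refl ennreal_mult) auto
    finally show ?thesis .
  qed
  have lo: "ennreal (lo * moment q n) \<le> waiting_moment q n"
    unfolding m[OF assms(1)] W by (intro sum_mono mult_left_mono assms(3)) simp
  have hi: "waiting_moment q n \<le> ennreal (hi * moment q n)"
    unfolding m[OF assms(2)] W by (intro sum_mono mult_left_mono assms(4)) simp
  have "waiting_moment q n < top" using hi by (rule le_less_trans) simp
  then have e: "waiting_moment q n = ennreal (enn2real (waiting_moment q n))" by simp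
  show ?thesis
  proof (rule that[OF e])
    show "lo * moment q n \<le> enn2real (waiting_moment q n)"
      using lo by (subst (asm) e) (simp add: ennreal_le_iff)
    show "enn2real (waiting_moment q n) \<le> hi * moment q n"
      using hi assms(2) moment_pos[of q n] by (subst (asm) e) (simp add: ennreal_le_iff)
  qed
qed

text \<open>For each pattern the moment of the waiting time is \<open>P powr (- q)\<close> up to
  factors whose logarithms are of surface order, uniformly in the pattern. For q at least 0 the loss
  factor enters the upper bound, for negative q the lower one, where in addition the upper bound
  carries a factor logarithmic in the probability.\<close>

lemma waiting_moment_asymptotics:
  assumes "-1 < q"
  obtains e where "\<And>n. 0 < e n" "\<And>n. waiting_moment q n = ennreal (e n)"
    "(\<lambda>n. ln (e n) / scl CARD('d) n) \<longlonglongrightarrow> cgf q"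
proof -
  define L where "L = 4 * \<beta> * surface_const + real CARD('d)"
  have L0: "0 \<le> L" using \<beta>_nonneg surface_const_nonneg by (simp add: L_def)
  have const: "\<bar>x\<bar> \<le> \<bar>x\<bar> * surf CARD('d) n" for x n using surf_ge(2)[of n] by (simp add: mult_le_cancel_left1)
  have "\<exists>C. \<forall>n. \<exists>lo hi. 0 < lo \<and> 0 < hi \<and> - (C * surf CARD('d) n) \<le> ln lo \<and> ln hi \<le> C * surf CARD('d) n
    \<and> (\<forall>\<eta>. ennreal (lo * measure M (cyl (cube n) \<eta>) powr (- q)) \<le> (\<integral>\<^sup>+ \<sigma>. enat_powr (waiting_time n \<eta> \<sigma>) (q * real CARD('d)) \<partial>M))
    \<and> (\<forall>\<eta>. (\<integral>\<^sup>+ \<sigma>. enat_powr (waiting_time n \<eta> \<sigma>) (q * real CARD('d)) \<partial>M) \<le> ennreal (hi * measure M (cyl (cube n) \<eta>) powr (- q)))"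
  proof (cases "0 \<le> q")
    case True
    define lo where "lo = (1 / 2 * 2 powr (- (q * real CARD('d))) * 2 powr (- q) :: real)"
    define A where "A = 3 * 2 powr (q * real CARD('d)) * (\<Sum>j. (real j + 1) powr (q * real CARD('d)) * exp (- real j))"
    \<comment> \<open>Taking the maximum guarantees positivity of the constant, as required for
      splitting the logarithm of the product.\<close>
    define B where "B = max A 1"
    define C where "C = \<bar>ln lo\<bar> + \<bar>ln B\<bar> + q * L"
    have lo: "0 < lo" by (simp add: lo_def)
    show ?thesis
    proof (rule exI[of _ C], rule allI)
      fix n
      let ?hi = "B * inv_loss n powr (- q)"
      have qL: "q * (- ln (inv_loss n)) \<le> (q * L) * surf CARD('d) n"
        using mult_left_mono[OF ln_inv_loss(2)[of n] True] by (simp add: L_def mult.assoc)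
      have C: "C * surf CARD('d) n = \<bar>ln lo\<bar> * surf CARD('d) n + \<bar>ln B\<bar> * surf CARD('d) n + q * L * surf CARD('d) n" by (simp add: C_def distrib_right)
      have pos: "0 \<le> q * L * surf CARD('d) n" using True L0 by simp
      have "ln ?hi = ln B + q * (- ln (inv_loss n))" using inv_loss_pos[of n] by (simp add: B_def ln_mult ln_powr)
      then have hi: "ln ?hi \<le> C * surf CARD('d) n" using const[of "ln B" n] const[of "ln lo" n] qL C by linarith
      have lo': "- (C * surf CARD('d) n) \<le> ln lo" using const[of "ln B" n] const[of "ln lo" n] pos C by linarith
      have up: "(\<integral>\<^sup>+ \<sigma>. enat_powr (waiting_time n \<eta> \<sigma>) (q * real CARD('d)) \<partial>M) \<le> ennreal (?hi * measure M (cyl (cube n) \<eta>) powr (- q))" for \<eta>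
      proof -
        interpret w: waiting_law M "waiting_time n \<eta>" "CARD('d)" "measure M (cyl (cube n) \<eta>)" "inv_loss n" by (rule waiting_law_cube)
        have "A * (inv_loss n * measure M (cyl (cube n) \<eta>)) powr (- q) \<le> B * (inv_loss n * measure M (cyl (cube n) \<eta>)) powr (- q)"
          by (intro mult_right_mono) (auto simp: B_def)
        also have "\<dots> = ?hi * measure M (cyl (cube n) \<eta>) powr (- q)" by (simp add: powr_mult)
        finally show ?thesis using w.moment_nonneg_le[OF True] unfolding A_def[symmetric] by (meson ennreal_leI order_trans)
      qed
      have dn: "ennreal (lo * measure M (cyl (cube n) \<eta>) powr (- q)) \<le> (\<integral>\<^sup>+ \<sigma>. enat_powr (waiting_time n \<eta> \<sigma>) (q * real CARD('d)) \<partial>M)" for \<eta>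
      proof -
        interpret w: waiting_law M "waiting_time n \<eta>" "CARD('d)" "measure M (cyl (cube n) \<eta>)" "inv_loss n" by (rule waiting_law_cube)
        show ?thesis using w.moment_nonneg_ge[OF True] by (simp add: lo_def)
      qed
      have "0 < ?hi" using inv_loss_pos[of n] by (simp add: B_def)
      with lo lo' hi up dn show "\<exists>lo hi. 0 < lo \<and> 0 < hi \<and> - (C * surf CARD('d) n) \<le> ln lo \<and> ln hi \<le> C * surf CARD('d) n
        \<and> (\<forall>\<eta>. ennreal (lo * measure M (cyl (cube n) \<eta>) powr (- q)) \<le> (\<integral>\<^sup>+ \<sigma>. enat_powr (waiting_time n \<eta> \<sigma>) (q * real CARD('d)) \<partial>M))
        \<and> (\<forall>\<eta>. (\<integral>\<^sup>+ \<sigma>. enat_powr (waiting_time n \<eta> \<sigma>) (q * real CARD('d)) \<partial>M) \<le> ennreal (hi * measure M (cyl (cube n) \<eta>) powr (- q)))"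
        by blast
    qed
  next
    case False
    then have q: "-1 \<le> q" "q < 0" using assms by auto
    define A where "A = (1 / 2 * 2 powr (q * real CARD('d)) * 2 powr q :: real)"
    obtain I where I: "0 \<le> I" "\<And>n \<eta>. info n \<eta> \<le> I * vol CARD('d) n" using info_le by blast
    \<comment> \<open>Since the information is at most \<open>I * vol\<close>, the factor
      \<open>3 - log 2 p\<close> is at most \<open>3 + I / ln 2\<close> times the volume, which
      contributes only a logarithm to the exponent.\<close>
    define B where "B = 4 ^ CARD('d) * (3 + I / ln 2)"
    have B: "1 \<le> B"
    proof -
      have "1 * 1 \<le> B" unfolding B_def using I(1) by (intro mult_mono) auto
      then show ?thesis by simp
    qed
    define C where "C = \<bar>ln A\<bar> + \<bar>ln B\<bar> + - q * L + real CARD('d)"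
    have A: "0 < A" by (simp add: A_def)
    show ?thesis
    proof (rule exI[of _ C], rule allI)
      fix n
      let ?lo = "A * inv_loss n powr (- q)" and ?hi = "B * vol CARD('d) n"
      have qL: "(- q) * (- ln (inv_loss n)) \<le> (- q * L) * surf CARD('d) n"
        using mult_left_mono[OF ln_inv_loss(2)[of n], of "- q"] q by (simp add: L_def mult.assoc)
      have C: "C * surf CARD('d) n = \<bar>ln A\<bar> * surf CARD('d) n + \<bar>ln B\<bar> * surf CARD('d) n + (- q * L) * surf CARD('d) n + real CARD('d) * surf CARD('d) n"
        by (simp only: C_def distrib_right)
      have pos: "0 \<le> (- q * L) * surf CARD('d) n" "0 \<le> real CARD('d) * surf CARD('d) n" using q L0 by (auto intro!: mult_nonneg_nonneg simp: mult_nonpos_nonneg)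
      have lnlo: "ln ?lo = ln A - (- q) * (- ln (inv_loss n))" using inv_loss_pos[of n] A by (simp add: ln_mult ln_powr)
      have lo: "- (C * surf CARD('d) n) \<le> ln ?lo"
        unfolding lnlo using const[of "ln A" n] const[of "ln B" n] qL pos C by linarith
      have "ln (real (n + 1)) \<le> surf CARD('d) n" using ln_le_minus_one[of "real (n + 1)"] surf_ge(1)[of n] by simp
      then have dl: "real CARD('d) * ln (real (n + 1)) \<le> real CARD('d) * surf CARD('d) n" by (rule mult_left_mono) simp
      have lnhi: "ln ?hi = ln B + real CARD('d) * ln (real (n + 1))" using B by (simp add: ln_mult ln_realpow)
      have hi: "ln ?hi \<le> C * surf CARD('d) n"
        unfolding lnhi using const[of "ln A" n] const[of "ln B" n] dl pos C by linarith
      have up: "(\<integral>\<^sup>+ \<sigma>. enat_powr (waiting_time n \<eta> \<sigma>) (q * real CARD('d)) \<partial>M) \<le> ennreal (?hi * measure M (cyl (cube n) \<eta>) powr (- q))" for \<eta>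
      proof -
        interpret w: waiting_law M "waiting_time n \<eta>" "CARD('d)" "measure M (cyl (cube n) \<eta>)" "inv_loss n" by (rule waiting_law_cube)
        have "3 - log 2 (measure M (cyl (cube n) \<eta>)) = 3 + info n \<eta> / ln 2"
          by (simp add: log_def info_def)
        also have "\<dots> \<le> 3 * vol CARD('d) n + I / ln 2 * vol CARD('d) n"
        proof (rule add_mono)
          show "info n \<eta> / ln 2 \<le> I / ln 2 * vol CARD('d) n" using divide_right_mono[OF I(2), of "ln 2"] by simp
          show "3 \<le> 3 * vol CARD('d) n" by simp
        qed
        finally have "4 ^ CARD('d) * (3 - log 2 (measure M (cyl (cube n) \<eta>))) * measure M (cyl (cube n) \<eta>) powr (- q)
          \<le> 4 ^ CARD('d) * (3 * vol CARD('d) n + I / ln 2 * vol CARD('d) n) * measure M (cyl (cube n) \<eta>) powr (- q)"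
          by (intro mult_right_mono mult_left_mono) auto
        also have "\<dots> = ?hi * measure M (cyl (cube n) \<eta>) powr (- q)" by (simp add: B_def algebra_simps)
        finally show ?thesis using w.moment_neg_le[OF q] by (meson ennreal_leI order_trans)
      qed
      have dn: "ennreal (?lo * measure M (cyl (cube n) \<eta>) powr (- q)) \<le> (\<integral>\<^sup>+ \<sigma>. enat_powr (waiting_time n \<eta> \<sigma>) (q * real CARD('d)) \<partial>M)" for \<eta>
      proof -
        interpret w: waiting_law M "waiting_time n \<eta>" "CARD('d)" "measure M (cyl (cube n) \<eta>)" "inv_loss n" by (rule waiting_law_cube)
        have "?lo * measure M (cyl (cube n) \<eta>) powr (- q) = A * (inv_loss n * measure M (cyl (cube n) \<eta>)) powr (- q)"
          by (simp add: powr_mult)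
        then show ?thesis using w.moment_neg_ge[OF q(2)] unfolding A_def[symmetric] by (simp only:)
      qed
      have "0 < ?lo" "0 < ?hi" using inv_loss_pos[of n] A B by auto
      with lo hi up dn show "\<exists>lo hi. 0 < lo \<and> 0 < hi \<and> - (C * surf CARD('d) n) \<le> ln lo \<and> ln hi \<le> C * surf CARD('d) n
        \<and> (\<forall>\<eta>. ennreal (lo * measure M (cyl (cube n) \<eta>) powr (- q)) \<le> (\<integral>\<^sup>+ \<sigma>. enat_powr (waiting_time n \<eta> \<sigma>) (q * real CARD('d)) \<partial>M))
        \<and> (\<forall>\<eta>. (\<integral>\<^sup>+ \<sigma>. enat_powr (waiting_time n \<eta> \<sigma>) (q * real CARD('d)) \<partial>M) \<le> ennreal (hi * measure M (cyl (cube n) \<eta>) powr (- q)))"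
        by blast
    qed
  qed
  then obtain C where C: "\<And>n. \<exists>lo hi. 0 < lo \<and> 0 < hi \<and> - (C * surf CARD('d) n) \<le> ln lo \<and> ln hi \<le> C * surf CARD('d) n
    \<and> (\<forall>\<eta>. ennreal (lo * measure M (cyl (cube n) \<eta>) powr (- q)) \<le> (\<integral>\<^sup>+ \<sigma>. enat_powr (waiting_time n \<eta> \<sigma>) (q * real CARD('d)) \<partial>M))
    \<and> (\<forall>\<eta>. (\<integral>\<^sup>+ \<sigma>. enat_powr (waiting_time n \<eta> \<sigma>) (q * real CARD('d)) \<partial>M) \<le> ennreal (hi * measure M (cyl (cube n) \<eta>) powr (- q)))"
    by blast
  have "\<exists>e>0. waiting_moment q n = ennreal e \<and> \<bar>ln e - vol CARD('d) n * cgf q\<bar> \<le> (C + 4 * \<bar>1 - q\<bar> * \<beta> * surface_const) * surf CARD('d) n" for n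
  proof -
    obtain lo hi where *: "0 < lo" "0 < hi" "- (C * surf CARD('d) n) \<le> ln lo" "ln hi \<le> C * surf CARD('d) n"
      "\<And>\<eta>. ennreal (lo * measure M (cyl (cube n) \<eta>) powr (- q)) \<le> (\<integral>\<^sup>+ \<sigma>. enat_powr (waiting_time n \<eta> \<sigma>) (q * real CARD('d)) \<partial>M)"
      "\<And>\<eta>. (\<integral>\<^sup>+ \<sigma>. enat_powr (waiting_time n \<eta> \<sigma>) (q * real CARD('d)) \<partial>M) \<le> ennreal (hi * measure M (cyl (cube n) \<eta>) powr (- q))"
      using C[of n] by blast
    obtain e where e: "waiting_moment q n = ennreal e" "lo * moment q n \<le> e" "e \<le> hi * moment q n"
      by (rule waiting_moment_bracket[OF *(1,2,5,6)])
    have m: "0 < moment q n" by (rule moment_pos)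
    then have e0: "0 < e" using e(2) *(1) by (meson less_le_trans mult_pos_pos)
    have "ln (lo * moment q n) \<le> ln e" using e(2) * m by (intro ln_mono) auto
    moreover have "ln e \<le> ln (hi * moment q n)" using e(3) e0 by (intro ln_mono) auto
    moreover have "ln (lo * moment q n) = ln lo + ln (moment q n)" "ln (hi * moment q n) = ln hi + ln (moment q n)"
      using * m by (simp_all add: ln_mult)
    ultimately have "\<bar>ln e - vol CARD('d) n * cgf q\<bar> \<le> C * surf CARD('d) n + 4 * \<bar>1 - q\<bar> * \<beta> * surface_const * surf CARD('d) n"
      using ln_moment_bound[of q n] *(3,4) by linarith
    then show ?thesis using e(1) e0 unfolding distrib_right by blast
  qed
  then obtain e where e: "\<And>n. 0 < e n" "\<And>n. waiting_moment q n = ennreal (e n)"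
    "\<And>n. \<bar>ln (e n) - vol CARD('d) n * cgf q\<bar> \<le> (C + 4 * \<bar>1 - q\<bar> * \<beta> * surface_const) * surf CARD('d) n" by metis
  show ?thesis by (rule that[OF e(1,2) surface_order_tendsto[OF e(3)]])
qed

lemma waiting_pressure_eq:
  assumes "-1 < q"
  shows "waiting_pressure M q = ereal (cgf q)"
proof -
  obtain e where e: "\<And>n. 0 < e n" "\<And>n. waiting_moment q n = ennreal (e n)"
    "(\<lambda>n. ln (e n) / scl CARD('d) n) \<longlonglongrightarrow> cgf q" using waiting_moment_asymptotics[OF assms] by blast
  have "ereal (1 / real n ^ CARD('d)) * elog (enn2ereal (\<integral>\<^sup>+ (\<xi>, \<sigma>). enat_powr (waiting_time n \<xi> \<sigma>) (q * real CARD('d)) \<partial>(M \<Otimes>\<^sub>M M)))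
      = ereal (ln (e n) / scl CARD('d) n)" for n
    unfolding waiting_moment_def[symmetric] e(2) using e(1)[of n] by (simp add: elog_def)
  moreover have "(\<lambda>n. ereal (ln (e n) / scl CARD('d) n)) \<longlonglongrightarrow> ereal (cgf q)" using e(3) by simp
  ultimately show ?thesis unfolding waiting_pressure_def by (simp add: limI)
qed

section \<open>From moments and pattern probabilities to tail probabilities\<close>

lemma markov_waiting:
  assumes "\<And>e. 1 \<le> e \<Longrightarrow> R e \<Longrightarrow> ennreal t \<le> enat_powr e (q * real CARD('d))" "0 \<le> t"
    and "waiting_moment q n = ennreal x" "0 \<le> x"
  shows "t * measure (M \<Otimes>\<^sub>M M) {(\<xi>, \<sigma>). R (waiting_time n \<xi> \<sigma>)} \<le> x"
proof -
  have sets: "{\<sigma>. R (waiting_time n \<eta> \<sigma>)} \<in> sets M" for \<eta>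
    using measurable_sets[OF waiting_time_measurable, of "Collect R" n \<eta>] by (simp add: vimage_def)
  let ?p = "\<lambda>\<eta>. measure M (cyl (cube n) \<eta>)"
  have I: "ennreal (t * measure M {\<sigma>. R (waiting_time n \<eta> \<sigma>)}) \<le> (\<integral>\<^sup>+ \<sigma>. enat_powr (waiting_time n \<eta> \<sigma>) (q * real CARD('d)) \<partial>M)" for \<eta>
  proof -
    have "ennreal (t * measure M {\<sigma>. R (waiting_time n \<eta> \<sigma>)}) = (\<integral>\<^sup>+ \<sigma>. ennreal t * indicator {\<sigma>. R (waiting_time n \<eta> \<sigma>)} \<sigma> \<partial>M)"
      using sets assms(2) by (simp add: nn_integral_cmult_indicator emeasure_eq_measure ennreal_mult)
    also have "\<dots> \<le> (\<integral>\<^sup>+ \<sigma>. enat_powr (waiting_time n \<eta> \<sigma>) (q * real CARD('d)) \<partial>M)"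
      by (intro nn_integral_mono) (auto simp: indicator_def assms(1) waiting_time_pos)
    finally show ?thesis .
  qed
  have "t * measure (M \<Otimes>\<^sub>M M) {(\<xi>, \<sigma>). R (waiting_time n \<xi> \<sigma>)}
      = (\<Sum>\<eta>\<in>patterns (cube n). ?p \<eta> * (t * measure M {\<sigma>. R (waiting_time n \<eta> \<sigma>)}))"
    unfolding measure_waiting_time sum_distrib_left by (simp only: mult.left_commute)
  also have "ennreal \<dots> = (\<Sum>\<eta>\<in>patterns (cube n). ennreal (?p \<eta>) * ennreal (t * measure M {\<sigma>. R (waiting_time n \<eta> \<sigma>)}))"
    using assms(2) by (subst sum_ennreal[symmetric]) (simp_all add: ennreal_mult)
  also have "\<dots> \<le> waiting_moment q n"
    unfolding waiting_moment_def nn_integral_waiting_time[of "\<lambda>e. enat_powr e (q * real CARD('d))"]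
    by (intro sum_mono mult_left_mono I) simp
  finally show ?thesis using assms(3,4) by (simp add: ennreal_le_iff)
qed

text \<open>Markov's inequality with exponent q; the strict inequality in the second hypothesis
  absorbs the subexponential error of the moment.\<close>

lemma tail_upper_bound:
  assumes "-1 < q" "cgf q - v * q < c"
    and "\<And>n e. 1 \<le> e \<Longrightarrow> R n e \<Longrightarrow> ennreal (exp (scl CARD('d) n * v * q)) \<le> enat_powr e (q * real CARD('d))"
  shows "\<forall>\<^sub>F n in sequentially. measure (M \<Otimes>\<^sub>M M) {(\<xi>, \<sigma>). R n (waiting_time n \<xi> \<sigma>)} \<le> exp (scl CARD('d) n * c)"
proof -
  obtain e where e: "\<And>n. 0 < e n" "\<And>n. waiting_moment q n = ennreal (e n)"
    "(\<lambda>n. ln (e n) / scl CARD('d) n) \<longlonglongrightarrow> cgf q" using waiting_moment_asymptotics[OF assms(1)] by blast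
  have "\<forall>\<^sub>F n in sequentially. e n \<le> 1 * (1 * exp ((c + v * q) * scl CARD('d) n))"
    by (rule exp_scale_eventually_le[OF e(3), of "\<lambda>_. 1" 0]) (use assms(2) e(1) scl_at_top in auto)
  then show ?thesis
  proof eventually_elim
    case (elim n)
    have "exp (scl CARD('d) n * v * q) * measure (M \<Otimes>\<^sub>M M) {(\<xi>, \<sigma>). R n (waiting_time n \<xi> \<sigma>)} \<le> e n"
      by (rule markov_waiting[OF assms(3) _ e(2)]) (use e(1)[of n] in auto)
    also have "\<dots> \<le> exp (scl CARD('d) n * v * q) * exp (scl CARD('d) n * c)"
      using elim unfolding exp_add[symmetric] by (simp add: algebra_simps)
    finally show ?case by simp
  qed
qed

lemma measure_waiting_ge:
  assumes "G \<subseteq> patterns (cube n)" "\<And>\<eta>. \<eta> \<in> G \<Longrightarrow> 1 / 2 \<le> measure M {\<sigma>. R (waiting_time n \<eta> \<sigma>)}"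
  shows "1 / 2 * (\<Sum>\<eta>\<in>G. measure M (cyl (cube n) \<eta>)) \<le> measure (M \<Otimes>\<^sub>M M) {(\<xi>, \<sigma>). R (waiting_time n \<xi> \<sigma>)}"
proof -
  have "1 / 2 * (\<Sum>\<eta>\<in>G. measure M (cyl (cube n) \<eta>))
      \<le> (\<Sum>\<eta>\<in>G. measure M (cyl (cube n) \<eta>) * measure M {\<sigma>. R (waiting_time n \<eta> \<sigma>)})"
    unfolding sum_distrib_left
  proof (rule sum_mono)
    fix \<eta> assume "\<eta> \<in> G"
    from mult_left_mono[OF assms(2)[OF this], of "measure M (cyl (cube n) \<eta>)"]
    show "1 / 2 * measure M (cyl (cube n) \<eta>) \<le> measure M (cyl (cube n) \<eta>) * measure M {\<sigma>. R (waiting_time n \<eta> \<sigma>)}"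
      by (simp add: mult.commute)
  qed
  also have "\<dots> \<le> (\<Sum>\<eta>\<in>patterns (cube n). measure M (cyl (cube n) \<eta>) * measure M {\<sigma>. R (waiting_time n \<eta> \<sigma>)})"
    using assms(1) by (intro sum_mono2) auto
  finally show ?thesis by (simp add: measure_waiting_time)
qed

text \<open>The union bound up to time \<open>k\<close> must not exceed 1/2. Rounding in the scale
  costs \<open>d * ln 2\<close>, and the probability 1/2 costs another \<open>ln 2\<close>.\<close>

lemma rate_ge_prob:
  assumes "0 \<le> y" "y + (real CARD('d) + 1) * ln 2 \<le> info n \<eta>"
  shows "1 / 2 \<le> measure M {\<sigma>. rate_ge CARD('d) y (waiting_time n \<eta> \<sigma>)}"
proof -
  define T where "T = exp (y / real CARD('d))"
  have T: "1 \<le> T" "T ^ CARD('d) = exp y" using assms(1) by (simp_all add: T_def exp_of_nat_mult[symmetric])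
  \<comment> \<open>The largest integer below \<open>T\<close>, so that failing to reach
    \<open>T\<close> means being at most \<open>k\<close>; as \<open>T \<ge> 1\<close>, the
    successor of \<open>k\<close> is at most \<open>2 * T\<close>.\<close>
  define k where "k = nat \<lceil>T\<rceil> - 1"
  have k: "real (k + 1) \<le> 2 * T" using T(1) unfolding k_def by linarith
  have sub: "- {\<sigma>. rate_ge CARD('d) y (waiting_time n \<eta> \<sigma>)} \<subseteq> {\<sigma>. waiting_time n \<eta> \<sigma> \<le> enat k}"
  proof clarsimp
    fix \<sigma> assume "\<not> rate_ge CARD('d) y (waiting_time n \<eta> \<sigma>)"
    then obtain j where j: "waiting_time n \<eta> \<sigma> = enat j" "real j ^ CARD('d) < T ^ CARD('d)"
      unfolding T(2) by (cases "waiting_time n \<eta> \<sigma>") (auto simp: rate_ge_def)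
    then have "real j < T" using T(1) by (intro power_less_imp_less_base[of "real j" "CARD('d)"]) auto
    then have "j \<le> k" unfolding k_def by linarith
    then show "waiting_time n \<eta> \<sigma> \<le> enat k" by (simp add: j)
  qed
  have sets: "{\<sigma>. rate_ge CARD('d) y (waiting_time n \<eta> \<sigma>)} \<in> sets M"
    using measurable_sets[OF waiting_time_measurable, of "Collect (rate_ge CARD('d) y)" n \<eta>] by (simp add: vimage_def)
  have "measure M (- {\<sigma>. rate_ge CARD('d) y (waiting_time n \<eta> \<sigma>)}) \<le> measure M {\<sigma>. waiting_time n \<eta> \<sigma> \<le> enat k}"
    by (rule finite_measure_mono[OF sub]) simp
  also have "\<dots> \<le> real (k + 1) ^ CARD('d) * measure M (cyl (cube n) \<eta>)" by (rule waiting_time_le_prob)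
  also have "\<dots> \<le> (2 * T) ^ CARD('d) * exp (- info n \<eta>)"
    unfolding exp_minus_info using k by (intro mult_right_mono power_mono) auto
  also have "\<dots> = exp (real CARD('d) * ln 2 + y - info n \<eta>)"
  proof -
    have "(2 :: real) ^ CARD('d) = exp (real CARD('d) * ln 2)" by (simp add: exp_of_nat_mult)
    then show ?thesis by (simp add: power_mult_distrib T(2) exp_add exp_diff exp_minus divide_inverse)
  qed
  also have "\<dots> \<le> exp (- ln 2)" using assms(2) by (simp add: algebra_simps)
  also have "\<dots> = 1 / 2" by (simp add: exp_minus)
  finally show ?thesis
    using prob_compl[OF sets] by (simp add: Compl_eq_Diff_UNIV)
qed

text \<open>The exponent in the upper-tail estimate must be at least 2, because
  \<open>3 * exp (- 2)\<close> is at most 1/2. This 2 costs \<open>ln 2\<close>, and rounding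
  \<open>T\<close> down costs \<open>d * ln 2\<close>.\<close>

lemma rate_le_prob:
  assumes "info n \<eta> - ln (inv_loss n) + (real CARD('d) + 1) * ln 2 \<le> y"
  shows "1 / 2 \<le> measure M {\<sigma>. rate_le CARD('d) y (waiting_time n \<eta> \<sigma>)}"
proof -
  define T where "T = exp (y / real CARD('d))"
  have "0 \<le> (real CARD('d) + 1) * ln 2" by simp
  then have y0: "0 \<le> y" using assms info_nonneg[of n \<eta>] ln_inv_loss(1)[of n] by linarith
  have T: "1 \<le> T" "T ^ CARD('d) = exp y" using y0 by (simp_all add: T_def exp_of_nat_mult[symmetric])
  define k where "k = nat \<lfloor>T\<rfloor>"
  have "1 \<le> \<lfloor>T\<rfloor>" using T(1) by (simp add: le_floor_iff)
  then have k: "real k \<le> T" "T / 2 \<le> real k" unfolding k_def by linarith+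
  have sub: "- {\<sigma>. \<not> waiting_time n \<eta> \<sigma> \<le> enat k} \<subseteq> {\<sigma>. rate_le CARD('d) y (waiting_time n \<eta> \<sigma>)}"
  proof
    fix \<sigma> assume "\<sigma> \<in> - {\<sigma>. \<not> waiting_time n \<eta> \<sigma> \<le> enat k}"
    then have "waiting_time n \<eta> \<sigma> \<le> enat k" by simp
    then obtain j where j: "waiting_time n \<eta> \<sigma> = enat j" "j \<le> k" by (cases "waiting_time n \<eta> \<sigma>") auto
    then have "real j ^ CARD('d) \<le> T ^ CARD('d)" using k by (intro power_mono) auto
    then show "\<sigma> \<in> {\<sigma>. rate_le CARD('d) y (waiting_time n \<eta> \<sigma>)}" by (simp add: rate_le_def j T(2))
  qed
  have sets: "{\<sigma>. rate_le CARD('d) y (waiting_time n \<eta> \<sigma>)} \<in> sets M"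
    using measurable_sets[OF waiting_time_measurable, of "Collect (rate_le CARD('d) y)" n \<eta>] by (simp add: vimage_def)
  have gt_sets: "{\<sigma>. \<not> waiting_time n \<eta> \<sigma> \<le> enat k} \<in> sets M"
    using sets.compl_sets[OF waiting_time_le_sets[of n \<eta> k]] by (simp add: Compl_eq_Diff_UNIV[symmetric] Collect_neg_eq)
  have "2 = exp (ln (2 :: real))" by simp
  also have "\<dots> \<le> exp (ln (inv_loss n) - info n \<eta> + y - real CARD('d) * ln 2)"
    using assms by (intro exp_mono) (simp add: algebra_simps)
  also have "\<dots> = inv_loss n * exp (- info n \<eta>) * (T / 2) ^ CARD('d)"
  proof -
    have "(2 :: real) ^ CARD('d) = exp (real CARD('d) * ln 2)" by (simp add: exp_of_nat_mult)
    moreover have "exp (ln (inv_loss n)) = inv_loss n" using inv_loss_pos[of n] by simp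
    moreover have "exp (a - i + y - b) = exp a * exp (- i) * (exp y / exp b)" for a i b :: real
      by (simp add: exp_diff exp_add exp_minus field_simps)
    ultimately show ?thesis by (simp only: power_divide T(2))
  qed
  also have "\<dots> \<le> inv_loss n * exp (- info n \<eta>) * real k ^ CARD('d)"
    using k T(1) inv_loss_pos[of n] by (intro mult_left_mono power_mono) auto
  finally have "3 * exp (- (inv_loss n * measure M (cyl (cube n) \<eta>) * real k ^ CARD('d))) \<le> 3 * exp (- 2)"
    unfolding exp_minus_info by simp
  then have "measure M {\<sigma>. \<not> waiting_time n \<eta> \<sigma> \<le> enat k} \<le> 1 / 2"
    using waiting_time_gt_prob[of n \<eta> k] exp_neg_2_le unfolding inv_loss_def[symmetric] by linarith
  moreover have "measure M (- {\<sigma>. \<not> waiting_time n \<eta> \<sigma> \<le> enat k}) = 1 - measure M {\<sigma>. \<not> waiting_time n \<eta> \<sigma> \<le> enat k}"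
    using prob_compl[OF gt_sets] by (simp add: Compl_eq_Diff_UNIV)
  moreover have "measure M (- {\<sigma>. \<not> waiting_time n \<eta> \<sigma> \<le> enat k}) \<le> measure M {\<sigma>. rate_le CARD('d) y (waiting_time n \<eta> \<sigma>)}"
    by (rule finite_measure_mono[OF sub sets])
  ultimately show ?thesis by linarith
qed

text \<open>Patterns with information close to \<open>n ^ d * w\<close> have total probability about
  \<open>exp (n ^ d * (cgf q - q * w))\<close>, and given such a pattern the event has probability
  at least 1/2.\<close>

lemma tilted_tail_lower_bound:
  assumes der: "(cgf has_real_derivative w) (at q)" and c: "c < cgf q - q * w" and \<epsilon>: "0 < \<epsilon>"
    and R: "\<forall>\<^sub>F n in sequentially. \<forall>\<eta>. \<bar>info n \<eta> - scl CARD('d) n * w\<bar> \<le> \<epsilon> * scl CARD('d) n \<longrightarrow>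
      1 / 2 \<le> measure M {\<sigma>. R n (waiting_time n \<eta> \<sigma>)}"
  shows "\<forall>\<^sub>F n in sequentially. exp (scl CARD('d) n * c) \<le> measure (M \<Otimes>\<^sub>M M) {(\<xi>, \<sigma>). R n (waiting_time n \<xi> \<sigma>)}"
proof -
  define g where "g = cgf q - q * w - c"
  have g: "0 < g" using c by (simp add: g_def)
  \<comment> \<open>Half of the available gap is reserved for the error
    \<open>(\<bar>q\<bar> + 1) * \<delta>\<close> of the tilting, the other half for the factor
    1/2.\<close>
  define \<delta> where "\<delta> = min \<epsilon> (g / (2 * (\<bar>q\<bar> + 1)))"
  have \<delta>: "0 < \<delta>" "\<delta> \<le> \<epsilon>" using \<epsilon> g by (auto simp: \<delta>_def)
  have "(\<bar>q\<bar> + 1) * \<delta> \<le> (\<bar>q\<bar> + 1) * (g / (2 * (\<bar>q\<bar> + 1)))" by (intro mult_left_mono) (auto simp: \<delta>_def)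
  also have "\<dots> = g / 2"
  proof -
    have "x * (g / (2 * x)) = g / 2" if "x \<noteq> 0" for x :: real using that by simp
    from this[of "\<bar>q\<bar> + 1"] show ?thesis by linarith
  qed
  finally have "\<bar>q\<bar> * \<delta> + \<delta> \<le> g / 2" unfolding distrib_right by simp
  then have gap: "c + g / 2 \<le> cgf q - q * w - \<bar>q\<bar> * \<delta> - \<delta>" using g_def by linarith
  have "\<forall>\<^sub>F n in sequentially. (1::real) \<le> 1 / 2 * (1 * exp (g / 2 * scl CARD('d) n))"
    by (rule exp_scale_eventually_le[of "\<lambda>_. 1" "scl CARD('d)" 0 "\<lambda>_. 1" 0]) (use g scl_at_top in auto)
  then show ?thesis using R tilted_lower_bound[OF der \<delta>(1)]
  proof eventually_elim
    case (elim n)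
    define G where "G = {\<eta>\<in>patterns (cube n). \<bar>info n \<eta> - scl CARD('d) n * w\<bar> \<le> \<delta> * scl CARD('d) n}"
    have "\<delta> * scl CARD('d) n \<le> \<epsilon> * scl CARD('d) n" using \<delta>(2) by (rule mult_right_mono) simp
    then have half: "1 / 2 \<le> measure M {\<sigma>. R n (waiting_time n \<eta> \<sigma>)}" if "\<eta> \<in> G" for \<eta>
      using elim(2) that unfolding G_def by (auto dest!: spec[of _ \<eta>])
    have "exp (scl CARD('d) n * c) * 1 \<le> exp (scl CARD('d) n * c) * (1 / 2 * (1 * exp (g / 2 * scl CARD('d) n)))"
      using elim(1) by (rule mult_left_mono) simp
    also have "\<dots> = 1 / 2 * exp (scl CARD('d) n * (c + g / 2))" by (simp add: exp_add[symmetric] algebra_simps)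
    also have "\<dots> \<le> 1 / 2 * exp (scl CARD('d) n * (cgf q - q * w - \<bar>q\<bar> * \<delta> - \<delta>))"
      by (intro mult_left_mono exp_mono gap) simp_all
    also have "\<dots> \<le> 1 / 2 * (\<Sum>\<eta>\<in>G. measure M (cyl (cube n) \<eta>))"
      using elim(3) unfolding G_def by (rule mult_left_mono) simp
    also have "\<dots> \<le> measure (M \<Otimes>\<^sub>M M) {(\<xi>, \<sigma>). R n (waiting_time n \<xi> \<sigma>)}"
      by (rule measure_waiting_ge[OF _ half]) (auto simp: G_def)
    finally show ?case by simp
  qed
qed

text \<open>Tilting to a level strictly above \<open>v\<close> leaves a margin proportional to
  \<open>n ^ d\<close>, which absorbs the additive constant of \<open>rate_ge_prob\<close>.\<close>

lemma upper_tail_lower_bound: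
  assumes "(cgf has_real_derivative w) (at q)" "c < cgf q - q * w" "0 \<le> v" "v < w"
  shows "\<forall>\<^sub>F n in sequentially. exp (scl CARD('d) n * c)
    \<le> measure (M \<Otimes>\<^sub>M M) {(\<xi>, \<sigma>). rate_ge CARD('d) (scl CARD('d) n * v) (waiting_time n \<xi> \<sigma>)}"
proof (rule tilted_tail_lower_bound[OF assms(1,2)])
  define \<epsilon> where "\<epsilon> = (w - v) / 2"
  show \<epsilon>: "0 < \<epsilon>" using assms(4) by (simp add: \<epsilon>_def)
  have "\<forall>\<^sub>F n in sequentially. (real CARD('d) + 1) * ln 2 / \<epsilon> \<le> scl CARD('d) n"
    using scl_at_top unfolding filterlim_at_top by blast
  then show "\<forall>\<^sub>F n in sequentially. \<forall>\<eta>. \<bar>info n \<eta> - scl CARD('d) n * w\<bar> \<le> \<epsilon> * scl CARD('d) n \<longrightarrow>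
      1 / 2 \<le> measure M {\<sigma>. rate_ge CARD('d) (scl CARD('d) n * v) (waiting_time n \<eta> \<sigma>)}"
  proof eventually_elim
    case (elim n)
    show ?case
    proof (intro allI impI rate_ge_prob)
      fix \<eta> assume b: "\<bar>info n \<eta> - scl CARD('d) n * w\<bar> \<le> \<epsilon> * scl CARD('d) n"
      show "0 \<le> scl CARD('d) n * v" using assms(3) by simp
      have "(real CARD('d) + 1) * ln 2 \<le> \<epsilon> * scl CARD('d) n" using elim \<epsilon> by (simp add: pos_divide_le_eq mult.commute)
      moreover have "w = v + 2 * \<epsilon>" using \<epsilon>_def by (simp add: field_simps)
      then have "scl CARD('d) n * w = scl CARD('d) n * v + 2 * (\<epsilon> * scl CARD('d) n)" by (simp add: algebra_simps)
      ultimately show "scl CARD('d) n * v + (real CARD('d) + 1) * ln 2 \<le> info n \<eta>" using b by linarith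
    qed
  qed
qed

text \<open>Here the margin must also absorb the loss from imperfect independence, which is of
  surface order.\<close>

lemma lower_tail_lower_bound:
  assumes "(cgf has_real_derivative w) (at q)" "c < cgf q - q * w" "w < v"
  shows "\<forall>\<^sub>F n in sequentially. exp (scl CARD('d) n * c)
    \<le> measure (M \<Otimes>\<^sub>M M) {(\<xi>, \<sigma>). rate_le CARD('d) (scl CARD('d) n * v) (waiting_time n \<xi> \<sigma>)}"
proof (rule tilted_tail_lower_bound[OF assms(1,2)])
  define \<epsilon> where "\<epsilon> = (v - w) / 2"
  show \<epsilon>: "0 < \<epsilon>" using assms(3) by (simp add: \<epsilon>_def)
  define C where "C = 4 * \<beta> * surface_const + real CARD('d) + (real CARD('d) + 1) * ln 2"
  have "(\<lambda>n. C * (surf CARD('d) n / scl CARD('d) n)) \<longlonglongrightarrow> C * 0" by (intro tendsto_intros surf_scl)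
  then have "\<forall>\<^sub>F n in sequentially. C * (surf CARD('d) n / scl CARD('d) n) < \<epsilon>" using \<epsilon> by (intro order_tendstoD(2)) auto
  moreover have "\<forall>\<^sub>F n in sequentially. (0::nat) < n" by (rule eventually_gt_at_top)
  ultimately show "\<forall>\<^sub>F n in sequentially. \<forall>\<eta>. \<bar>info n \<eta> - scl CARD('d) n * w\<bar> \<le> \<epsilon> * scl CARD('d) n \<longrightarrow>
      1 / 2 \<le> measure M {\<sigma>. rate_le CARD('d) (scl CARD('d) n * v) (waiting_time n \<eta> \<sigma>)}"
  proof eventually_elim
    case (elim n)
    have s: "0 < scl CARD('d) n" using elim(2) by simp
    then have C: "C * surf CARD('d) n \<le> \<epsilon> * scl CARD('d) n" using elim(1) by (simp add: pos_divide_less_eq)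
    show ?case
    proof (intro allI impI rate_le_prob)
      fix \<eta> assume b: "\<bar>info n \<eta> - scl CARD('d) n * w\<bar> \<le> \<epsilon> * scl CARD('d) n"
      have "(real CARD('d) + 1) * ln 2 * 1 \<le> (real CARD('d) + 1) * ln 2 * surf CARD('d) n"
        using surf_ge(2)[of n] by (intro mult_left_mono) auto
      then have "- ln (inv_loss n) + (real CARD('d) + 1) * ln 2 \<le> C * surf CARD('d) n"
        using ln_inv_loss(2)[of n] unfolding C_def distrib_right by linarith
      moreover have "v = w + 2 * \<epsilon>" using \<epsilon>_def by (simp add: field_simps)
      then have "scl CARD('d) n * v = scl CARD('d) n * w + 2 * (\<epsilon> * scl CARD('d) n)" by (simp add: algebra_simps)
      ultimately show "info n \<eta> - ln (inv_loss n) + (real CARD('d) + 1) * ln 2 \<le> scl CARD('d) n * v" using b C by linarith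
    qed
  qed
qed

end

section \<open>Patterns of almost maximal energy\<close>

context finite_range_interaction
begin

definition max_energy :: "nat \<Rightarrow> real" where
  "max_energy n = Max (energy (cube n) ` patterns (cube n))"

lemma energy_le_max_energy: "energy (cube n) \<sigma> \<le> max_energy n"
proof -
  have "energy (cube n) (restrict \<sigma> (cube n)) \<le> max_energy n"
    unfolding max_energy_def by (intro Max_ge) auto
  then show ?thesis by (simp add: energy_restrict)
qed

lemma max_energy_attained: obtains \<eta> where "\<eta> \<in> patterns (cube n)" "energy (cube n) \<eta> = max_energy n"
proof -
  have "max_energy n \<in> energy (cube n) ` patterns (cube n)"
    unfolding max_energy_def by (intro Max_in) auto
  then show ?thesis using that by auto
qed

text \<open>The threshold refers to the maximum over the untranslated cube; by translation
  invariance it is the maximum for every block.\<close>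

definition excited :: "real \<Rightarrow> nat \<Rightarrow> int ^ 'd \<Rightarrow> ('d, 'a) config \<Rightarrow> bool" where
  "excited \<tau> n x \<sigma> \<longleftrightarrow> max_energy n - \<tau> \<le> energy ((+) x ` cube n) \<sigma>"

definition num_excited :: "real \<Rightarrow> nat \<Rightarrow> real" where
  "num_excited \<tau> n = real (card {\<eta>\<in>patterns (cube n). max_energy n - \<tau> \<le> energy (cube n) \<eta>})"

lemma sum_excited: "(\<Sum>\<eta>\<in>patterns ((+) x ` cube n). of_bool (excited \<tau> n x \<eta>)) = num_excited \<tau> n"
proof -
  have "(\<Sum>\<eta>\<in>patterns ((+) x ` cube n). of_bool (excited \<tau> n x \<eta>) :: real)
      = (\<Sum>\<eta>\<in>patterns (cube n). of_bool (excited \<tau> n x (shift (- x) \<eta>)))"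
    by (rule sum.reindex_bij_betw[OF patterns_translate_bij, symmetric])
  also have "\<dots> = (\<Sum>\<eta>\<in>patterns (cube n). of_bool (max_energy n - \<tau> \<le> energy (cube n) \<eta>))"
    by (simp add: excited_def energy_translate)
  also have "\<dots> = num_excited \<tau> n"
    by (simp add: num_excited_def Int_def conj_commute)
  finally show ?thesis .
qed

text \<open>Whether a block is excited depends only on its own sites, so for disjoint blocks the
  count factorizes; the remainder is unrestricted.\<close>

lemma count_excited:
  assumes "finite F" "finite R" "disjoint_family_on (\<lambda>x. (+) x ` cube n) F" "(\<Union>x\<in>F. (+) x ` cube n) \<inter> R = {}"
  shows "(\<Sum>\<omega>\<in>patterns ((\<Union>x\<in>F. (+) x ` cube n) \<union> R). of_bool (\<forall>x\<in>F. excited \<tau> n x \<omega>))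
    = num_excited \<tau> n ^ card F * real CARD('a) ^ card R"
  using assms(1,3,4)
proof (induction F rule: finite_induct)
  case empty
  then show ?case using assms(2) by (simp add: card_patterns)
next
  case (insert x F)
  let ?B = "(+) x ` cube n" and ?T = "(\<Union>x\<in>F. (+) x ` cube n) \<union> R"
  have fin: "finite ?B" "finite ?T" using assms(2) insert.hyps by auto
  have disj: "?B \<inter> ?T = {}" using insert.prems insert.hyps unfolding disjoint_family_on_def by fastforce
  have e: "excited \<tau> n y (override_on \<theta> \<eta> ?B) \<longleftrightarrow> excited \<tau> n y \<theta>" if "y \<in> F" for y \<theta> \<eta>
  proof -
    have "energy ((+) y ` cube n) (override_on \<theta> \<eta> ?B) = energy ((+) y ` cube n) \<theta>"
      using disj that by (intro energy_cong) (auto simp: override_on_def)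
    then show ?thesis by (simp add: excited_def)
  qed
  have ex: "excited \<tau> n x (override_on \<theta> \<eta> ?B) \<longleftrightarrow> excited \<tau> n x \<eta>" for \<theta> \<eta>
  proof -
    have "energy ?B (override_on \<theta> \<eta> ?B) = energy ?B \<eta>" by (intro energy_cong) auto
    then show ?thesis by (simp add: excited_def)
  qed
  have "(\<Union>x\<in>insert x F. (+) x ` cube n) \<union> R = ?B \<union> ?T" by auto
  then have "(\<Sum>\<omega>\<in>patterns ((\<Union>x\<in>insert x F. (+) x ` cube n) \<union> R). of_bool (\<forall>y\<in>insert x F. excited \<tau> n y \<omega>) :: real)
      = (\<Sum>\<theta>\<in>patterns ?T. \<Sum>\<eta>\<in>patterns ?B. of_bool (\<forall>y\<in>insert x F. excited \<tau> n y (override_on \<theta> \<eta> ?B)))"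
    using sum_patterns_Un[OF fin disj] by (simp only:)
  also have "\<dots> = (\<Sum>\<theta>\<in>patterns ?T. \<Sum>\<eta>\<in>patterns ?B. of_bool (excited \<tau> n x \<eta>) * of_bool (\<forall>y\<in>F. excited \<tau> n y \<theta>))"
    using e ex by (intro sum.cong refl) (auto simp: of_bool_def)
  also have "\<dots> = num_excited \<tau> n * (\<Sum>\<theta>\<in>patterns ?T. of_bool (\<forall>y\<in>F. excited \<tau> n y \<theta>))"
    unfolding sum_distrib_right[symmetric] sum_distrib_left[symmetric] sum_excited ..
  also have "(\<Sum>\<theta>\<in>patterns ?T. of_bool (\<forall>y\<in>F. excited \<tau> n y \<theta>)) = num_excited \<tau> n ^ card F * real CARD('a) ^ card R"
    using insert.prems by (intro insert.IH) (auto simp: disjoint_family_on_def)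
  finally show ?case using insert.hyps by simp
qed

text \<open>A block that is not excited may be replaced by a maximizer; this gains so much energy that it
  outweighs the number of patterns of the block.\<close>

lemma partition_sum_le_excited:
  fixes t \<tau> :: real
  assumes "finite S" "finite F" "disjoint_family_on (\<lambda>x. (+) x ` cube n) F" "(\<Union>x\<in>F. (+) x ` cube n) \<subseteq> S" "0 \<le> t"
    and gain: "real (card (cube n :: (int ^ 'd) set)) * ln (real CARD('a))
      \<le> t * (\<tau> - 2 * K * real (card (inner_boundary r (cube n :: (int ^ 'd) set))))"
    and "0 \<le> \<tau>"
  shows "(\<Sum>\<omega>\<in>patterns S. exp (t * energy S \<omega>))
    \<le> 2 ^ card F * (\<Sum>\<omega>\<in>patterns S. of_bool (\<forall>x\<in>F. excited \<tau> n x \<omega>) * exp (t * energy S \<omega>))"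
  using assms(2-4)
proof (induction F rule: finite_induct)
  case (insert x F)
  let ?B = "(+) x ` cube n"
  define T where "T = S - ?B"
  have fin: "finite ?B" "finite T" using assms(1) by (auto simp: T_def)
  have disj: "?B \<inter> T = {}" and S: "S = ?B \<union> T" using insert.prems by (auto simp: T_def)
  let ?k = "K * real (card (inner_boundary r (cube n :: (int ^ 'd) set)))"
  let ?w = "\<lambda>\<theta> \<eta>. exp (t * energy S (override_on \<theta> \<eta> ?B))"
  have e: "excited \<tau> n y (override_on \<theta> \<eta> ?B) \<longleftrightarrow> excited \<tau> n y \<theta>" if "y \<in> F" for y \<theta> \<eta>
  proof -
    have "(+) y ` cube n \<inter> ?B = {}"
    proof (rule disjoint_family_onD[OF insert.prems(1)])
      show "y \<noteq> x" using that insert.hyps by auto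
    qed (use that in simp_all)
    then have "energy ((+) y ` cube n) (override_on \<theta> \<eta> ?B) = energy ((+) y ` cube n) \<theta>"
      by (intro energy_cong) (auto simp: override_on_def)
    then show ?thesis by (simp add: excited_def)
  qed
  have ex: "excited \<tau> n x (override_on \<theta> \<eta> ?B) \<longleftrightarrow> excited \<tau> n x \<eta>" for \<theta> \<eta>
  proof -
    have "energy ?B (override_on \<theta> \<eta> ?B) = energy ?B \<eta>" by (intro energy_cong) auto
    then show ?thesis by (simp add: excited_def)
  qed
  have block: "(\<Sum>\<eta>\<in>patterns ?B. ?w \<theta> \<eta>) \<le> 2 * (\<Sum>\<eta>\<in>patterns ?B. of_bool (excited \<tau> n x \<eta>) * ?w \<theta> \<eta>)" for \<theta>
  proof -
    obtain \<eta>0 where \<eta>0: "\<eta>0 \<in> patterns (cube n)" "energy (cube n) \<eta>0 = max_energy n" by (rule max_energy_attained)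
    define \<eta>m where "\<eta>m = shift (- x) \<eta>0"
    have \<eta>m: "\<eta>m \<in> patterns ?B" "energy ?B \<eta>m = max_energy n"
      using bij_betwE[OF patterns_translate_bij] \<eta>0 by (auto simp: \<eta>m_def energy_translate)
    have en: "\<bar>energy S (override_on \<theta> \<eta> ?B) - energy ?B \<eta> - energy T \<theta>\<bar> \<le> ?k" for \<eta>
    proof -
      have "energy ?B (override_on \<theta> \<eta> ?B) = energy ?B \<eta>" "energy T (override_on \<theta> \<eta> ?B) = energy T \<theta>"
      proof -
        show "energy ?B (override_on \<theta> \<eta> ?B) = energy ?B \<eta>" by (rule energy_cong[OF fin(1)]) simp
        show "energy T (override_on \<theta> \<eta> ?B) = energy T \<theta>"
        proof (rule energy_cong[OF fin(2)])
          fix z assume "z \<in> T"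
          then have "z \<notin> ?B" using disj by blast
          then show "override_on \<theta> \<eta> ?B z = \<theta> z" by (rule override_on_apply_notin)
        qed
      qed
      then show ?thesis using energy_Un[OF fin disj, of "override_on \<theta> \<eta> ?B"]
        unfolding S[symmetric] by (simp add: inner_boundary_translate card_image)
    qed
    \<comment> \<open>Passing to a maximizer gains \<tau> in the block and loses at most two
      boundary terms; \<open>gain\<close> makes the resulting factor at least the number of block
      patterns.\<close>
    have bad: "?w \<theta> \<eta> \<le> ?w \<theta> \<eta>m / real CARD('a) ^ card (cube n :: (int ^ 'd) set)" if "\<not> excited \<tau> n x \<eta>" for \<eta>
    proof -
      have "energy S (override_on \<theta> \<eta> ?B) \<le> energy S (override_on \<theta> \<eta>m ?B) - (\<tau> - 2 * ?k)"
        using en[of \<eta>] en[of \<eta>m] that \<eta>m(2) unfolding excited_def by linarith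
      from mult_left_mono[OF this assms(5)]
      have "t * energy S (override_on \<theta> \<eta> ?B) \<le> t * energy S (override_on \<theta> \<eta>m ?B) - t * (\<tau> - 2 * ?k)"
        by (simp add: right_diff_distrib)
      also have "\<dots> \<le> t * energy S (override_on \<theta> \<eta>m ?B) - real (card (cube n :: (int ^ 'd) set)) * ln (real CARD('a))"
        using gain by (simp add: mult.assoc)
      finally have "?w \<theta> \<eta> \<le> exp (t * energy S (override_on \<theta> \<eta>m ?B) - real (card (cube n :: (int ^ 'd) set)) * ln (real CARD('a)))"
        by simp
      then show ?thesis by (simp add: exp_diff exp_of_nat_mult)
    qed
    have m: "excited \<tau> n x \<eta>m" using \<eta>m(2) assms(7) by (simp add: excited_def)
    \<comment> \<open>There are at most as many unexcited patterns as patterns in all, so together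
      they weigh no more than the maximizer, which is itself excited. Hence one factor 2 per
      block.\<close>
    have "(\<Sum>\<eta>\<in>patterns ?B. of_bool (\<not> excited \<tau> n x \<eta>) * ?w \<theta> \<eta>)
        \<le> (\<Sum>\<eta>\<in>(patterns ?B :: ('d, 'a) config set). ?w \<theta> \<eta>m / real CARD('a) ^ card (cube n :: (int ^ 'd) set))"
      using bad by (intro sum_mono) (simp add: of_bool_def)
    also have "\<dots> = ?w \<theta> \<eta>m" using fin by (simp add: card_patterns card_image)
    also have "\<dots> = of_bool (excited \<tau> n x \<eta>m) * ?w \<theta> \<eta>m" using m by simp
    also have "\<dots> \<le> (\<Sum>\<eta>\<in>patterns ?B. of_bool (excited \<tau> n x \<eta>) * ?w \<theta> \<eta>)"
      by (rule member_le_sum) (use \<eta>m fin in auto)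
    finally have "(\<Sum>\<eta>\<in>patterns ?B. of_bool (\<not> excited \<tau> n x \<eta>) * ?w \<theta> \<eta>) \<le> (\<Sum>\<eta>\<in>patterns ?B. of_bool (excited \<tau> n x \<eta>) * ?w \<theta> \<eta>)" .
    moreover have "(\<Sum>\<eta>\<in>patterns ?B. ?w \<theta> \<eta>) = (\<Sum>\<eta>\<in>patterns ?B. of_bool (excited \<tau> n x \<eta>) * ?w \<theta> \<eta>)
        + (\<Sum>\<eta>\<in>patterns ?B. of_bool (\<not> excited \<tau> n x \<eta>) * ?w \<theta> \<eta>)"
      unfolding sum.distrib[symmetric] by (intro sum.cong refl) (simp add: of_bool_def)
    ultimately show ?thesis by linarith
  qed
  have "(\<Sum>\<omega>\<in>patterns S. exp (t * energy S \<omega>))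
      \<le> 2 ^ card F * (\<Sum>\<omega>\<in>patterns S. of_bool (\<forall>x\<in>F. excited \<tau> n x \<omega>) * exp (t * energy S \<omega>))"
    using insert.prems by (intro insert.IH) (auto simp: disjoint_family_on_def)
  also have "(\<Sum>\<omega>\<in>patterns S. of_bool (\<forall>x\<in>F. excited \<tau> n x \<omega>) * exp (t * energy S \<omega>))
      = (\<Sum>\<theta>\<in>patterns T. of_bool (\<forall>x\<in>F. excited \<tau> n x \<theta>) * (\<Sum>\<eta>\<in>patterns ?B. ?w \<theta> \<eta>))"
  proof -
    have "(\<Sum>\<omega>\<in>patterns S. of_bool (\<forall>x\<in>F. excited \<tau> n x \<omega>) * exp (t * energy S \<omega>))
      = (\<Sum>\<theta>\<in>patterns T. \<Sum>\<eta>\<in>patterns ?B. of_bool (\<forall>x\<in>F. excited \<tau> n x (override_on \<theta> \<eta> ?B)) * ?w \<theta> \<eta>)"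
      using sum_patterns_Un[OF fin disj, of "\<lambda>\<omega>. of_bool (\<forall>x\<in>F. excited \<tau> n x \<omega>) * exp (t * energy S \<omega>)"]
      unfolding S[symmetric] .
    then show ?thesis by (simp add: e sum_distrib_left)
  qed
  also have "\<dots> \<le> (\<Sum>\<theta>\<in>patterns T. of_bool (\<forall>x\<in>F. excited \<tau> n x \<theta>) * (2 * (\<Sum>\<eta>\<in>patterns ?B. of_bool (excited \<tau> n x \<eta>) * ?w \<theta> \<eta>)))"
    by (intro sum_mono mult_left_mono block) simp
  also have "\<dots> = 2 * (\<Sum>\<omega>\<in>patterns S. of_bool (\<forall>x\<in>insert x F. excited \<tau> n x \<omega>) * exp (t * energy S \<omega>))"
  proof -
    have "(\<Sum>\<omega>\<in>patterns S. of_bool (\<forall>x\<in>insert x F. excited \<tau> n x \<omega>) * exp (t * energy S \<omega>))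
      = (\<Sum>\<theta>\<in>patterns T. \<Sum>\<eta>\<in>patterns ?B. of_bool (\<forall>x\<in>insert x F. excited \<tau> n x (override_on \<theta> \<eta> ?B)) * ?w \<theta> \<eta>)"
      using sum_patterns_Un[OF fin disj, of "\<lambda>\<omega>. of_bool (\<forall>x\<in>insert x F. excited \<tau> n x \<omega>) * exp (t * energy S \<omega>)"]
      unfolding S[symmetric] .
    also have "\<dots> = (\<Sum>\<theta>\<in>patterns T. \<Sum>\<eta>\<in>patterns ?B. of_bool (\<forall>x\<in>F. excited \<tau> n x \<theta>) * (of_bool (excited \<tau> n x \<eta>) * ?w \<theta> \<eta>))"
      using e ex by (intro sum.cong refl) (auto simp: of_bool_def)
    finally show ?thesis by (simp only: sum_distrib_left mult.left_commute[of _ 2])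
  qed
  finally have "(\<Sum>\<omega>\<in>patterns S. exp (t * energy S \<omega>))
      \<le> 2 ^ card F * (2 * (\<Sum>\<omega>\<in>patterns S. of_bool (\<forall>x\<in>insert x F. excited \<tau> n x \<omega>) * exp (t * energy S \<omega>)))"
    by simp
  then show ?case using insert.hyps by (simp add: mult.assoc mult.left_commute)
qed simp

text \<open>After reduction to excited blocks, the energy is bounded by its maximum and the
  remaining patterns are counted. \<open>c\<close> and \<open>R\<close> are the number of blocks and
  the size of the untiled remainder.\<close>

lemma partition_sum_cube_le_excited:
  fixes t \<tau> :: real
  assumes "0 \<le> t" "0 \<le> \<tau>"
    and gain: "real (card (cube n :: (int ^ 'd) set)) * ln (real CARD('a))
      \<le> t * (\<tau> - 2 * K * real (card (inner_boundary r (cube n :: (int ^ 'd) set))))"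
  obtains c R :: real where "0 \<le> c" "c * vol CARD('d) n \<le> vol CARD('d) N" "0 \<le> R" "R \<le> real CARD('d) * real (n + 1) * surf CARD('d) N"
    "ln (partition_sum (- t) (cube N)) \<le> c * ln (2 * num_excited \<tau> n) + R * ln (real CARD('a)) + t * max_energy N"
proof -
  obtain m and R :: "(int ^ 'd) set" where R: "finite R" "(\<Union>x\<in>base_points n m. (+) x ` cube n) \<inter> R = {}"
    "cube N = (\<Union>x\<in>base_points n m. (+) x ` cube n) \<union> R"
    "real (card R) \<le> real CARD('d) * real (n + 1) * surf CARD('d) N"
    "vol CARD('d) N = real m ^ CARD('d) * vol CARD('d) n + real (card R)" by (rule cube_tiling)
  let ?F = "base_points n m :: (int ^ 'd) set"
  have cF: "real (card ?F) = real m ^ CARD('d)" by (simp add: card_base_points)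
  have ne: "1 \<le> num_excited \<tau> n"
  proof -
    obtain \<eta>0 where "\<eta>0 \<in> patterns (cube n)" "energy (cube n) \<eta>0 = max_energy n" by (rule max_energy_attained)
    then have "\<eta>0 \<in> {\<eta>\<in>patterns (cube n). max_energy n - \<tau> \<le> energy (cube n) \<eta>}" using assms(2) by simp
    then have "0 < card {\<eta>\<in>patterns (cube n :: (int ^ 'd) set). max_energy n - \<tau> \<le> energy (cube n) \<eta>}"
      by (subst card_gt_0_iff) auto
    then show ?thesis unfolding num_excited_def by linarith
  qed
  have "partition_sum (- t) (cube N) = (\<Sum>\<omega>\<in>patterns (cube N). exp (t * energy (cube N) \<omega>))"
    by (simp add: partition_sum_def)
  also have "\<dots> \<le> 2 ^ card ?F * (\<Sum>\<omega>\<in>patterns (cube N). of_bool (\<forall>x\<in>?F. excited \<tau> n x \<omega>) * exp (t * energy (cube N) \<omega>))"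
    by (rule partition_sum_le_excited[OF finite_cube finite_base_points base_points_disjoint _ assms(1) gain assms(2)])
      (use R(3) in blast)
  also have "\<dots> \<le> 2 ^ card ?F * (\<Sum>\<omega>\<in>patterns (cube N). of_bool (\<forall>x\<in>?F. excited \<tau> n x \<omega>) * exp (t * max_energy N))"
    using assms(1) by (intro mult_left_mono sum_mono exp_mono energy_le_max_energy) auto
  also have "\<dots> = 2 ^ card ?F * (num_excited \<tau> n ^ card ?F * real CARD('a) ^ card R) * exp (t * max_energy N)"
    using count_excited[OF finite_base_points R(1) base_points_disjoint R(2), of \<tau>]
    unfolding R(3)[symmetric] sum_distrib_right[symmetric] by simp
  finally have "ln (partition_sum (- t) (cube N)) \<le> ln (2 ^ card ?F * (num_excited \<tau> n ^ card ?F * real CARD('a) ^ card R) * exp (t * max_energy N))"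
    by (intro ln_mono partition_sum_pos) auto
  also have "\<dots> = real (card ?F) * ln (2 * num_excited \<tau> n) + real (card R) * ln (real CARD('a)) + t * max_energy N"
    using ne by (simp add: ln_mult ln_realpow algebra_simps)
  finally show ?thesis
    using that[of "real (card ?F)" "real (card R)"] R(4,5) cF by simp
qed

end

text \<open>A larger slope would win for large q, whatever the constants; used to read off extreme
  information contents from growth as q tends to infinity.\<close>

lemma slope_le_of_linear_domination:
  fixes a b c e :: real
  assumes "\<And>q. 1 \<le> q \<Longrightarrow> a + b * q \<le> c + (q - 1) * e"
  shows "b \<le> e"
proof (rule ccontr)
  assume "\<not> b \<le> e"
  then have be: "0 < b - e" by simp
  \<comment> \<open>At \<open>q = 1 + x\<close> the excess slope has just compensated the constants,
    and a further \<open>b - e\<close> is left over.\<close>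
  define x where "x = \<bar>c - a - e\<bar> / (b - e)"
  have x: "0 \<le> x" "(b - e) * x = \<bar>c - a - e\<bar>" using be by (simp_all add: x_def)
  have "a + b * (1 + x) \<le> c + (1 + x - 1) * e" using x(1) by (intro assms) simp
  then have "(b - e) + (b - e) * x \<le> c - a - e" by (simp add: algebra_simps)
  then show False using x(2) be by linarith
qed

section \<open>Maximal information content and the extreme level of the upper tail\<close>

context multidim_gibbs_state
begin

text \<open>The largest information content on the cube up to a term of surface order.\<close>

definition max_info :: "nat \<Rightarrow> real" where
  "max_info n = \<beta> * max_energy n + vol CARD('d) n * pressure (scale_interaction \<beta> U)"

lemma info_le_max_info: "info n \<eta> \<le> max_info n + 3 * \<beta> * surface_const * surf CARD('d) n"
  using abs_info_le[of n \<eta>] mult_left_mono[OF energy_le_max_energy[of n \<eta>] \<beta>_nonneg]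
  unfolding max_info_def by linarith

lemma card_patterns_cube: "real (card (patterns (cube n) :: ('d, 'a) config set)) = exp (vol CARD('d) n * ln (real CARD('a)))"
proof -
  have "real (card (patterns (cube n) :: ('d, 'a) config set)) = real CARD('a) ^ ((n + 1) ^ CARD('d))"
    by (simp add: card_patterns card_cube add.commute)
  also have "\<dots> = exp (ln (real CARD('a))) ^ ((n + 1) ^ CARD('d))" by simp
  also have "\<dots> = exp (real ((n + 1) ^ CARD('d)) * ln (real CARD('a)))" by (rule exp_of_nat_mult[symmetric])
  finally show ?thesis by (simp only: of_nat_power)
qed

text \<open>At q = 1 the moment counts patterns, and the error term vanishes with
  \<open>\<bar>1 - q\<bar>\<close>, so the cube with a single site already gives the exact
  value.\<close>

lemma cgf_1: "cgf 1 = ln (real CARD('a))"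
proof -
  have "ln (moment 1 0) = ln (real CARD('a))"
    by (simp add: moment_def card_patterns_cube)
  then show ?thesis using ln_moment_bound[of 1 0] by simp
qed

text \<open>For large q no moment exceeds the number of patterns times
  \<open>exp ((q - 1) * max_info)\<close> up to boundary terms, so linear growth of
  \<open>cgf\<close> with slope \<open>v\<close> forces a large maximum. The 7 is 3 from the
  information plus 4 from the moment.\<close>

lemma max_info_ge:
  assumes "\<And>q. 0 \<le> q \<Longrightarrow> I + v * q \<le> cgf q"
  shows "vol CARD('d) n * v \<le> max_info n + 7 * \<beta> * surface_const * surf CARD('d) n"
proof (rule slope_le_of_linear_domination)
  fix q :: real assume q: "1 \<le> q"
  let ?m = "max_info n + 3 * \<beta> * surface_const * surf CARD('d) n"
  have "moment q n \<le> (\<Sum>\<eta>\<in>(patterns (cube n) :: ('d, 'a) config set). exp ((q - 1) * ?m))"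
    unfolding moment_def
  proof (rule sum_mono)
    fix \<eta> :: "('d, 'a) config"
    have "(q - 1) * info n \<eta> \<le> (q - 1) * ?m" using q by (intro mult_left_mono info_le_max_info) simp
    then show "exp (- ((1 - q) * info n \<eta>)) \<le> exp ((q - 1) * ?m)" by (simp add: algebra_simps)
  qed
  also have "\<dots> = exp (vol CARD('d) n * ln (real CARD('a)) + (q - 1) * ?m)" by (simp add: card_patterns_cube exp_add)
  finally have "ln (moment q n) \<le> ln (exp (vol CARD('d) n * ln (real CARD('a)) + (q - 1) * ?m))"
    using moment_pos by (intro ln_mono)
  then have l: "ln (moment q n) \<le> vol CARD('d) n * ln (real CARD('a)) + (q - 1) * ?m" by simp
  have ab: "\<bar>1 - q\<bar> = q - 1" using q by simp
  have "vol CARD('d) n * cgf q \<le> ln (moment q n) + 4 * (q - 1) * \<beta> * surface_const * surf CARD('d) n"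
    using ln_moment_bound[of q n] unfolding ab by linarith
  moreover have "vol CARD('d) n * (I + v * q) \<le> vol CARD('d) n * cgf q" using q by (intro mult_left_mono assms) auto
  moreover have "(q - 1) * (max_info n + 7 * \<beta> * surface_const * surf CARD('d) n) = (q - 1) * ?m + 4 * (q - 1) * \<beta> * surface_const * surf CARD('d) n"
    by (simp add: algebra_simps)
  moreover have "vol CARD('d) n * (I + v * q) = vol CARD('d) n * I + vol CARD('d) n * v * q" by (simp add: algebra_simps)
  ultimately show "vol CARD('d) n * I + vol CARD('d) n * v * q \<le> vol CARD('d) n * ln (real CARD('a)) + (q - 1) * (max_info n + 7 * \<beta> * surface_const * surf CARD('d) n)"
    using l by linarith
qed

text \<open>Conversely a single maximizing pattern bounds the moment from below, and its growth in q
  cannot exceed that of \<open>cgf\<close>.\<close>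

lemma max_info_le:
  assumes "\<And>q. 0 \<le> q \<Longrightarrow> cgf q \<le> v * q"
  shows "max_info n \<le> vol CARD('d) n * v + 7 * \<beta> * surface_const * surf CARD('d) n"
proof -
  let ?e = "max_info n - 7 * \<beta> * surface_const * surf CARD('d) n"
  obtain \<eta> where \<eta>: "\<eta> \<in> patterns (cube n)" "energy (cube n) \<eta> = max_energy n" by (rule max_energy_attained)
  have i: "max_info n - 3 * \<beta> * surface_const * surf CARD('d) n \<le> info n \<eta>"
    using abs_info_le[of n \<eta>] unfolding \<eta>(2) max_info_def by linarith
  have "?e \<le> vol CARD('d) n * v"
  proof (rule slope_le_of_linear_domination)
    fix q :: real assume q: "1 \<le> q"
    have ab: "\<bar>1 - q\<bar> = q - 1" using q by simp
    have "exp ((q - 1) * info n \<eta>) = exp (- ((1 - q) * info n \<eta>))" by (simp add: algebra_simps)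
    also have "\<dots> \<le> moment q n"
      unfolding moment_def using \<eta>(1) by (intro member_le_sum) auto
    finally have "ln (exp ((q - 1) * info n \<eta>)) \<le> ln (moment q n)" by (intro ln_mono) auto
    then have "(q - 1) * info n \<eta> \<le> ln (moment q n)" by simp
    moreover have "(q - 1) * (max_info n - 3 * \<beta> * surface_const * surf CARD('d) n) \<le> (q - 1) * info n \<eta>"
      using q i by (intro mult_left_mono) auto
    moreover have "ln (moment q n) \<le> vol CARD('d) n * cgf q + 4 * (q - 1) * \<beta> * surface_const * surf CARD('d) n"
      using ln_moment_bound[of q n] unfolding ab by linarith
    moreover have "vol CARD('d) n * cgf q \<le> vol CARD('d) n * (v * q)" using q by (intro mult_left_mono assms) auto
    moreover have "(q - 1) * (max_info n - 3 * \<beta> * surface_const * surf CARD('d) n) - 4 * (q - 1) * \<beta> * surface_const * surf CARD('d) n = - ?e + ?e * q"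
      by (simp add: algebra_simps)
    moreover have "vol CARD('d) n * (v * q) = vol CARD('d) n * v + (q - 1) * (vol CARD('d) n * v)" by (simp add: algebra_simps)
    ultimately show "- ?e + ?e * q \<le> vol CARD('d) n * v + (q - 1) * (vol CARD('d) n * v)" by linarith
  qed
  then show ?thesis by linarith
qed

text \<open>For a large cube the linear lower bound on \<open>cgf\<close> makes the partition sum at
  parameter \<open>- t\<close> large, while reduction to excited blocks bounds it by their number
  and the maximal energy. The latter accounts for slope \<open>v\<close> only, so
  \<open>I + v\<close> per site is left for the logarithm of the number of excited patterns.\<close>

lemma num_excited_ge:
  assumes low: "\<And>q. 0 \<le> q \<Longrightarrow> I + v * q \<le> cgf q" and up: "\<And>q. 0 \<le> q \<Longrightarrow> cgf q \<le> v * q"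
    and \<beta>: "0 < \<beta>" and t: "0 \<le> t" and \<tau>: "0 \<le> \<tau>"
    and gain: "real (card (cube n :: (int ^ 'd) set)) * ln (real CARD('a))
      \<le> t * (\<tau> - 2 * K * real (card (inner_boundary r (cube n :: (int ^ 'd) set))))"
  shows "vol CARD('d) n * (I + v) \<le> ln (2 * num_excited \<tau> n)"
proof -
  define a where "a = ln (2 * num_excited \<tau> n)"
  have ne: "0 \<le> a"
  proof -
    obtain \<eta>0 where "\<eta>0 \<in> patterns (cube n)" "energy (cube n) \<eta>0 = max_energy n" by (rule max_energy_attained)
    then have "\<eta>0 \<in> {\<eta>\<in>patterns (cube n). max_energy n - \<tau> \<le> energy (cube n) \<eta>}" using \<tau> by simp
    then have "0 < card {\<eta>\<in>patterns (cube n :: (int ^ 'd) set). max_energy n - \<tau> \<le> energy (cube n) \<eta>}"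
      by (subst card_gt_0_iff) auto
    then have "1 \<le> num_excited \<tau> n" unfolding num_excited_def by linarith
    then show ?thesis by (simp add: a_def)
  qed
  \<comment> \<open>Chosen so that the partition sum inside \<open>cgf q\<close> has parameter
    \<open>- t\<close>.\<close>
  define q where "q = 1 + t / \<beta>"
  have q: "1 \<le> q" "(q - 1) * \<beta> = t" "(1 - q) * \<beta> = - t" using \<beta> t by (auto simp: q_def field_simps)
  \<comment> \<open>Collects the errors of surface order in \<open>N\<close>: the untiled remainder,
    and 8 boundary units, 1 from the pressure at \<open>- t\<close> and 7 from
    \<open>max_info_le\<close>.\<close>
  define C where "C = real CARD('d) * real (n + 1) * ln (real CARD('a)) + 8 * t * surface_const"
  have A: "0 \<le> ln (real CARD('a))" by (simp add: Suc_le_eq)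
  have bound: "I + v \<le> a / vol CARD('d) n + C * (1 / real (N + 1))" for N
  proof -
    obtain c R where cR: "0 \<le> c" "c * vol CARD('d) n \<le> vol CARD('d) N" "0 \<le> R" "R \<le> real CARD('d) * real (n + 1) * surf CARD('d) N"
      "ln (partition_sum (- t) (cube N)) \<le> c * a + R * ln (real CARD('a)) + t * max_energy N"
      unfolding a_def by (rule partition_sum_cube_le_excited[OF t \<tau> gain, of N])
    have P: "vol CARD('d) N * pressure (scale_interaction (- t) U) - t * surface_const * surf CARD('d) N \<le> ln (partition_sum (- t) (cube N))"
      using abs_ln_partition_sum_cube[of "- t" N] t by simp
    have cg: "vol CARD('d) N * cgf q = vol CARD('d) N * pressure (scale_interaction (- t) U) + (q - 1) * (vol CARD('d) N * pressure (scale_interaction \<beta> U))"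
      unfolding cgf_def q(3) distrib_left by (simp only: mult.left_commute)
    have mi: "(q - 1) * max_info N = t * max_energy N + (q - 1) * (vol CARD('d) N * pressure (scale_interaction \<beta> U))"
      unfolding max_info_def distrib_left mult.assoc[symmetric] q(2) ..
    have "(q - 1) * max_info N \<le> (q - 1) * (vol CARD('d) N * v + 7 * \<beta> * surface_const * surf CARD('d) N)"
      using q(1) by (intro mult_left_mono max_info_le up) auto
    also have "\<dots> = (q - 1) * (vol CARD('d) N * v) + 7 * ((q - 1) * \<beta>) * surface_const * surf CARD('d) N" by (simp add: algebra_simps)
    finally have m2: "(q - 1) * max_info N \<le> (q - 1) * (vol CARD('d) N * v) + 7 * t * surface_const * surf CARD('d) N" unfolding q(2) .
    have l: "vol CARD('d) N * (I + v * q) \<le> vol CARD('d) N * cgf q" using q(1) by (intro mult_left_mono low) auto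
    have l2: "vol CARD('d) N * (I + v * q) = vol CARD('d) N * (I + v) + (q - 1) * (vol CARD('d) N * v)" by (simp add: algebra_simps)
    have Rl: "R * ln (real CARD('a)) \<le> (real CARD('d) * real (n + 1) * surf CARD('d) N) * ln (real CARD('a))"
      using cR(4) A by (rule mult_right_mono)
    have "vol CARD('d) N * (I + v) \<le> c * a + (real CARD('d) * real (n + 1) * surf CARD('d) N) * ln (real CARD('a)) + 8 * t * surface_const * surf CARD('d) N"
      using P cg mi m2 l l2 Rl cR(5) by linarith
    also have "\<dots> = c * a + C * surf CARD('d) N" by (simp add: C_def algebra_simps)
    also have "\<dots> \<le> (vol CARD('d) N / vol CARD('d) n) * a + C * surf CARD('d) N"
    proof -
      have "c \<le> vol CARD('d) N / vol CARD('d) n" using cR(2) by (simp add: pos_le_divide_eq)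
      then show ?thesis by (rule add_right_mono[OF mult_right_mono[OF _ ne]])
    qed
    finally have F: "vol CARD('d) N * (I + v) \<le> vol CARD('d) N / vol CARD('d) n * a + C * surf CARD('d) N" .
    have "C * (1 / real (N + 1)) * vol CARD('d) N = C * surf CARD('d) N" unfolding vol_eq[of N] by simp
    moreover have "a / vol CARD('d) n * vol CARD('d) N = vol CARD('d) N / vol CARD('d) n * a" by simp
    ultimately have "(a / vol CARD('d) n + C * (1 / real (N + 1))) * vol CARD('d) N = vol CARD('d) N / vol CARD('d) n * a + C * surf CARD('d) N"
      by (simp only: distrib_right)
    with F have "(I + v) * vol CARD('d) N \<le> (a / vol CARD('d) n + C * (1 / real (N + 1))) * vol CARD('d) N"
      by (simp only: mult.commute[of "I + v"])
    then show ?thesis by (rule mult_right_le_imp_le) simp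
  qed
  \<comment> \<open>With \<open>n\<close> fixed the large cube grows, so the conclusion contains no
    error of surface order in \<open>n\<close>.\<close>
  have "(\<lambda>N. a / vol CARD('d) n + C * (1 / real (N + 1))) \<longlonglongrightarrow> a / vol CARD('d) n + C * 0"
  proof (intro tendsto_intros)
    show "(\<lambda>N. 1 / real (N + 1)) \<longlonglongrightarrow> 0" using LIMSEQ_inverse_real_of_nat by (simp add: divide_inverse)
  qed
  then have "I + v \<le> a / vol CARD('d) n + C * 0" by (rule LIMSEQ_le_const) (use bound in blast)
  then show ?thesis unfolding a_def[symmetric] by (simp add: pos_le_divide_eq mult.commute)
qed

text \<open>The extreme level \<open>v = sup \<W>'\<close> is not accessible by tilting. Here the \<open>(n+1)^d - n^d\<close> extra
  sites of the cube raise the information content by more than the boundary effects lower it.\<close>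

lemma extreme_tail_lower_bound:
  assumes low: "\<And>q. 0 \<le> q \<Longrightarrow> I + v * q \<le> cgf q" and up: "\<And>q. 0 \<le> q \<Longrightarrow> cgf q \<le> v * q"
    and \<beta>: "0 < \<beta>" "24 * \<beta> * surface_const \<le> ln 2" and A: "2 \<le> CARD('a)" and c: "c < I"
  shows "\<forall>\<^sub>F n in sequentially. exp (scl CARD('d) n * c)
    \<le> measure (M \<Otimes>\<^sub>M M) {(\<xi>, \<sigma>). rate_ge CARD('d) (scl CARD('d) n * v) (waiting_time n \<xi> \<sigma>)}"
proof -
  \<comment> \<open>Since \<open>cgf 1\<close> is the logarithm of the alphabet size, the level is
    at least ln 2; this is the information gained from each surplus site.\<close>
  have "ln 2 \<le> ln (real CARD('a))" using A by (intro ln_mono) auto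
  moreover have "ln (real CARD('a)) \<le> v" using up[of 1] unfolding cgf_1 by simp
  ultimately have v: "ln 2 \<le> v" by linarith
  have v0: "0 \<le> v" by (rule order_trans[OF _ v]) simp
  \<comment> \<open>The information exceeds \<open>vol * v\<close> by at most this much surface: 3
    units from \<open>info_le_max_info\<close> and 7 from \<open>max_info_le\<close>.\<close>
  define D where "D = 10 * \<beta> * surface_const"
  have D0: "0 \<le> D" using \<beta>(1) surface_const_nonneg by (simp add: D_def)
  have "(\<lambda>n. (vol CARD('d) n * I - D * surf CARD('d) n - ln 4) / scl CARD('d) n) \<longlonglongrightarrow> I"
  proof (rule surface_order_tendsto[of _ _ "D + ln 4"])
    fix n
    have "ln 4 * 1 \<le> ln (4 :: real) * surf CARD('d) n" by (intro mult_left_mono surf_ge) simp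
    moreover have "0 \<le> D * surf CARD('d) n" using D0 by simp
    moreover have "0 \<le> ln (4 :: real)" by simp
    ultimately show "\<bar>vol CARD('d) n * I - D * surf CARD('d) n - ln 4 - vol CARD('d) n * I\<bar> \<le> (D + ln 4) * surf CARD('d) n"
      unfolding distrib_right by linarith
  qed
  then have "\<forall>\<^sub>F n in sequentially. c < (vol CARD('d) n * I - D * surf CARD('d) n - ln 4) / scl CARD('d) n"
    using c by (rule order_tendstoD(1))
  moreover have "\<forall>\<^sub>F n in sequentially. 2 * (1 + (real CARD('d) + 1) * ln 2) / ln 2 \<le> real n"
    using filterlim_real_sequentially unfolding filterlim_at_top by blast
  moreover have "\<forall>\<^sub>F n in sequentially. (0::nat) < n" by (rule eventually_gt_at_top)
  ultimately show ?thesis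
  proof eventually_elim
    case (elim n)
    let ?bd = "real (card (inner_boundary r (cube n :: (int ^ 'd) set)))"
    \<comment> \<open>The summand \<open>1 / \<beta>\<close> keeps the information deficit of
      excited patterns at surface order plus 1, and with the next choice of \<open>t\<close> the
      hypothesis \<open>gain\<close> holds with equality.\<close>
    define \<tau> where "\<tau> = 2 * K * ?bd + 1 / \<beta>"
    define t where "t = \<beta> * (real (card (cube n :: (int ^ 'd) set)) * ln (real CARD('a)))"
    have \<tau>: "0 \<le> \<tau>" using K_nonneg \<beta>(1) by (simp add: \<tau>_def)
    have t: "0 \<le> t" using \<beta>(1) by (simp add: t_def Suc_le_eq)
    have gain: "real (card (cube n :: (int ^ 'd) set)) * ln (real CARD('a)) \<le> t * (\<tau> - 2 * K * ?bd)"
      using \<beta>(1) by (simp add: t_def \<tau>_def)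
    define G where "G = {\<eta>\<in>patterns (cube n). max_energy n - \<tau> \<le> energy (cube n) \<eta>}"
    have count: "exp (vol CARD('d) n * (I + v)) \<le> 2 * real (card G)"
    proof -
      have "vol CARD('d) n * (I + v) \<le> ln (2 * num_excited \<tau> n)" by (rule num_excited_ge[OF low up \<beta>(1) t \<tau> gain])
      moreover have "0 < 2 * num_excited \<tau> n"
      proof -
        obtain \<eta>0 where "\<eta>0 \<in> patterns (cube n)" "energy (cube n) \<eta>0 = max_energy n" by (rule max_energy_attained)
        then have "\<eta>0 \<in> {\<eta>\<in>patterns (cube n). max_energy n - \<tau> \<le> energy (cube n) \<eta>}" using \<tau> by simp
        then have "0 < card {\<eta>\<in>patterns (cube n :: (int ^ 'd) set). max_energy n - \<tau> \<le> energy (cube n) \<eta>}"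
          by (subst card_gt_0_iff) auto
        then show ?thesis by (simp add: num_excited_def)
      qed
      ultimately have "exp (vol CARD('d) n * (I + v)) \<le> 2 * num_excited \<tau> n" by (simp add: ln_ge_iff)
      then show ?thesis by (simp add: num_excited_def G_def)
    qed
    have half: "1 / 2 \<le> measure M {\<sigma>. rate_ge CARD('d) (scl CARD('d) n * v) (waiting_time n \<eta> \<sigma>)}" if "\<eta> \<in> G" for \<eta>
    proof (rule rate_ge_prob)
      show "0 \<le> scl CARD('d) n * v" using v0 by simp
      have "\<beta> * (max_energy n - \<tau>) \<le> \<beta> * energy (cube n) \<eta>"
        using that \<beta>(1) by (intro mult_left_mono) (auto simp: G_def)
      moreover have "\<beta> * (max_energy n - \<tau>) = \<beta> * max_energy n - 2 * (\<beta> * (K * ?bd)) - 1"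
        using \<beta>(1) by (simp add: \<tau>_def algebra_simps)
      moreover have "\<beta> * (K * ?bd) \<le> \<beta> * (surface_const * surf CARD('d) n)"
        using \<beta>(1) by (intro mult_left_mono card_inner_boundary_cube_le) simp
      ultimately have "max_info n - 5 * \<beta> * surface_const * surf CARD('d) n - 1 \<le> info n \<eta>"
        using abs_info_le[of n \<eta>] unfolding max_info_def by (simp add: mult.assoc)
      \<comment> \<open>The 12 is made up of 3 from \<open>abs_info_le\<close>, 2 from \<tau> and 7
        from \<open>max_info_ge\<close>.\<close>
      then have i: "vol CARD('d) n * v - 12 * \<beta> * surface_const * surf CARD('d) n - 1 \<le> info n \<eta>"
        using max_info_ge[OF low, of n] by linarith
      have "scl CARD('d) n = real n * real n ^ (CARD('d) - 1)" using power_eq_if[of "real n" "CARD('d)"] by simp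
      also have "\<dots> \<le> real n * surf CARD('d) n" by (intro mult_left_mono power_mono) auto
      \<comment> \<open>Since \<open>vol = n * surf + surf\<close>, the cube exceeds the
        normalization by at least one full layer of sites.\<close>
      finally have "scl CARD('d) n + surf CARD('d) n \<le> vol CARD('d) n" unfolding vol_eq by (simp add: algebra_simps)
      then have "(scl CARD('d) n + surf CARD('d) n) * v \<le> vol CARD('d) n * v" using v0 by (rule mult_right_mono)
      then have vv: "scl CARD('d) n * v + surf CARD('d) n * v \<le> vol CARD('d) n * v" unfolding distrib_right .
      have 1: "surf CARD('d) n * ln 2 \<le> surf CARD('d) n * v" using v by (rule mult_left_mono) simp
      have "2 * (12 * \<beta> * surface_const * surf CARD('d) n) = 24 * \<beta> * surface_const * surf CARD('d) n" by simp
      also have "\<dots> \<le> ln 2 * surf CARD('d) n" using \<beta>(2) by (rule mult_right_mono) simp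
      also have "\<dots> = surf CARD('d) n * ln 2" by (rule mult.commute)
      finally have 2: "2 * (12 * \<beta> * surface_const * surf CARD('d) n) \<le> surf CARD('d) n * ln 2" .
      have "2 * (1 + (real CARD('d) + 1) * ln 2) / ln 2 \<le> surf CARD('d) n" using elim(2) surf_ge(1)[of n] by simp
      then have 3: "2 * (1 + (real CARD('d) + 1) * ln 2) \<le> surf CARD('d) n * ln 2" by (simp add: pos_divide_le_eq)
      \<comment> \<open>The surplus \<open>L = surf * ln 2\<close> is halved: one half covers the
        boundary error \<open>B\<close>, whence 24 as twice 12, the other the constants
        \<open>1 + X\<close>.\<close>
      have "S + X \<le> j" if "L \<le> A" "2 * B \<le> L" "2 * (1 + X) \<le> L" "V - B - 1 \<le> j" "S + A \<le> V"
        for S X j L A B V :: real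
      proof -
        have "1 + X \<le> L - B" using that(2,3) by (simp add: algebra_simps)
        then show ?thesis using that by simp
      qed
      from this[OF 1 2 3 i vv] show "scl CARD('d) n * v + (real CARD('d) + 1) * ln 2 \<le> info n \<eta>" .
    qed
    have s: "0 < scl CARD('d) n" using elim(3) by simp
    have "c * scl CARD('d) n < vol CARD('d) n * I - D * surf CARD('d) n - ln 4" using elim(1) s by (simp add: pos_less_divide_eq)
    then have "exp (scl CARD('d) n * c) \<le> exp (vol CARD('d) n * I - D * surf CARD('d) n - ln 4)" by (simp add: mult.commute)
    also have "\<dots> = 1 / 4 * (exp (vol CARD('d) n * (I + v)) * exp (- (vol CARD('d) n * v + D * surf CARD('d) n)))"
    proof -
      have "exp (a - b - ln 4) = 1 / 4 * (exp (a + d) * exp (- (d + b)))" for a b d :: real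
        by (simp add: exp_diff exp_add exp_minus field_simps)
      from this[of "vol CARD('d) n * I" "D * surf CARD('d) n" "vol CARD('d) n * v"] show ?thesis by (simp only: distrib_left)
    qed
    also have "\<dots> \<le> 1 / 4 * (2 * real (card G) * exp (- (vol CARD('d) n * v + D * surf CARD('d) n)))"
      using count by (intro mult_left_mono mult_right_mono) auto
    also have "\<dots> = 1 / 2 * (\<Sum>\<eta>\<in>G. exp (- (vol CARD('d) n * v + D * surf CARD('d) n)))" by simp
    also have "\<dots> \<le> 1 / 2 * (\<Sum>\<eta>\<in>G. measure M (cyl (cube n) \<eta>))"
    proof (intro mult_left_mono sum_mono)
      fix \<eta>
      have "info n \<eta> \<le> vol CARD('d) n * v + D * surf CARD('d) n"
        using info_le_max_info[of n \<eta>] max_info_le[OF up, of n] by (simp add: D_def)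
      then have "exp (- (vol CARD('d) n * v + D * surf CARD('d) n)) \<le> exp (- info n \<eta>)" by simp
      then show "exp (- (vol CARD('d) n * v + D * surf CARD('d) n)) \<le> measure M (cyl (cube n) \<eta>)" by (simp only: exp_minus_info)
    qed simp
    also have "\<dots> \<le> measure (M \<Otimes>\<^sub>M M) {(\<xi>, \<sigma>). rate_ge CARD('d) (scl CARD('d) n * v) (waiting_time n \<xi> \<sigma>)}"
      by (rule measure_waiting_ge[OF _ half]) (auto simp: G_def)
    finally show ?case .
  qed
qed

end

section \<open>The large deviation principle\<close>

text \<open>Reduces a limit in the extended reals to exponential bounds with real exponents. If
  \<open>J\<close> is minus infinity the lower hypothesis is vacuous, and probabilities equal to 0
  are covered by \<open>elog\<close>.\<close>

lemma rate_tendsto: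
  fixes P :: "nat \<Rightarrow> real" and J :: ereal
  assumes up: "\<And>c. J < ereal c \<Longrightarrow> \<forall>\<^sub>F n in sequentially. P n \<le> exp (real n ^ d * c)"
    and lo: "\<And>c. ereal c < J \<Longrightarrow> \<forall>\<^sub>F n in sequentially. exp (real n ^ d * c) \<le> P n"
  shows "(\<lambda>n. ereal (1 / real n ^ d) * elog (ereal (P n))) \<longlonglongrightarrow> J"
proof (rule order_tendstoI)
  fix a assume "a < J"
  then obtain c where c: "a < ereal c" "ereal c < J" using ereal_dense2 by blast
  show "\<forall>\<^sub>F n in sequentially. a < ereal (1 / real n ^ d) * elog (ereal (P n))"
    using lo[OF c(2)] eventually_gt_at_top[of 0]
  proof eventually_elim
    case (elim n)
    have pos: "0 < P n" by (rule less_le_trans[OF _ elim(1)]) simp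
    have "real n ^ d * c \<le> ln (P n)" using elim(1) pos by (simp add: ln_ge_iff)
    then have "c \<le> 1 / real n ^ d * ln (P n)" using elim(2) by (simp add: pos_le_divide_eq mult.commute)
    then have "ereal c \<le> ereal (1 / real n ^ d) * elog (ereal (P n))" using pos by (simp add: elog_def)
    with c(1) show ?case by (rule less_le_trans)
  qed
next
  fix a assume "J < a"
  then obtain c where c: "J < ereal c" "ereal c < a" using ereal_dense2 by blast
  show "\<forall>\<^sub>F n in sequentially. ereal (1 / real n ^ d) * elog (ereal (P n)) < a"
    using up[OF c(1)] eventually_gt_at_top[of 0]
  proof eventually_elim
    case (elim n)
    have "ereal (1 / real n ^ d) * elog (ereal (P n)) \<le> ereal c"
    proof (cases "P n \<le> 0")
      case True
      then show ?thesis using elim(2) by (simp add: elog_def)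
    next
      case False
      then have "ln (P n) \<le> ln (exp (real n ^ d * c))" using elim(1) by (intro ln_mono) auto
      then have "1 / real n ^ d * ln (P n) \<le> c" using elim(2) by (simp add: pos_divide_le_eq mult.commute)
      then show ?thesis using False by (simp add: elog_def)
    qed
    then show ?case using c(2) by (rule le_less_trans)
  qed
qed

text \<open>The largest point at which the value is at most \<open>v\<close>. Just to the right of
  it the function exceeds \<open>v\<close> strictly, which a point with value \<open>v\<close> alone
  would not give where the function is locally constant.\<close>

lemma last_crossing:
  fixes g :: "real \<Rightarrow> real"
  assumes cont: "continuous_on {a..b} g" and ab: "a \<le> b" and ga: "g a \<le> v" and gb: "v < g b"
  obtains x where "a \<le> x" "x < b" "g x = v" "\<And>y. x < y \<Longrightarrow> y \<le> b \<Longrightarrow> v < g y"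
proof -
  let ?S = "{a..b} \<inter> g -` {..v}"
  have "closed ?S" by (rule continuous_closed_preimage[OF cont]) auto
  then have "compact ({a..b} \<inter> ?S)" by (intro compact_Int_closed compact_Icc)
  then have "compact ?S" by (simp add: Int_assoc[symmetric])
  moreover have "?S \<noteq> {}" using ab ga by auto
  ultimately obtain x where x: "x \<in> ?S" "\<And>y. y \<in> ?S \<Longrightarrow> y \<le> x" using compact_attains_sup[of ?S] by blast
  have "\<exists>y\<ge>x. y \<le> b \<and> g y = v"
    using x(1) gb by (intro IVT') (auto intro: continuous_on_subset[OF cont])
  then obtain y where y: "x \<le> y" "y \<le> b" "g y = v" by blast
  then have "y \<le> x" using x(1) by (intro x(2)) auto
  then have "g x = v" using y by simp
  show ?thesis
  proof
    show "a \<le> x" "g x = v" using x(1) \<open>g x = v\<close> by auto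
    show "x < b" using x(1) gb by (cases "x = b") auto
    fix z assume z: "x < z" "z \<le> b"
    then have "z \<notin> ?S" using x(2)[of z] by linarith
    then show "v < g z" using z x(1) by auto
  qed
qed

text \<open>\<open>g\<close> stands for W'. The smoothness hypothesis concerns the pressure, from
  which \<open>cgf\<close> differs by an affine function.\<close>

locale smooth_gibbs_state = multidim_gibbs_state U r K M \<beta>
  for U :: "('d::finite, 'a::finite) interaction" and r K and M :: "('d, 'a) config measure" and \<beta> +
  fixes g :: "real \<Rightarrow> real"
  assumes cgf_deriv_within: "-1 \<le> x \<Longrightarrow> (cgf has_real_derivative g x) (at x within {-1..})"
    and continuous_g: "continuous_on {-1..} g"

lemma (in multidim_gibbs_state) smooth_gibbs_state_exists:
  assumes "C1_within (\<lambda>q. pressure (scale_interaction ((1 - q) * \<beta>) U)) {-1..}"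
  shows "\<exists>g. smooth_gibbs_state U r K M \<beta> g"
proof -
  obtain f' where f': "\<And>x. x \<in> {-1..} \<Longrightarrow>
      ((\<lambda>q. pressure (scale_interaction ((1 - q) * \<beta>) U)) has_real_derivative f' x) (at x within {-1..})"
    "continuous_on {-1..} f'"
    using assms unfolding C1_within_def by blast
  have "smooth_gibbs_state U r K M \<beta> (\<lambda>x. f' x + pressure (scale_interaction \<beta> U))"
  proof unfold_locales
    fix x :: real assume "-1 \<le> x"
    then have "x \<in> {-1..}" by simp
    note der = f'(1)[OF this]
    have "((\<lambda>q. (q - 1) * pressure (scale_interaction \<beta> U)) has_real_derivative pressure (scale_interaction \<beta> U)) (at x within {-1..})"
      by (auto intro!: derivative_eq_intros)
    from DERIV_add[OF der this]
    show "(cgf has_real_derivative f' x + pressure (scale_interaction \<beta> U)) (at x within {-1..})"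
      unfolding cgf_def[abs_def] .
  next
    show "continuous_on {-1..} (\<lambda>x. f' x + pressure (scale_interaction \<beta> U))"
      by (intro continuous_intros f'(2))
  qed
  then show ?thesis by blast
qed

context smooth_gibbs_state
begin

lemma cgf_deriv:
  assumes "-1 < x"
  shows "(cgf has_real_derivative g x) (at x)"
proof -
  have "at x within {-1..} = at x" by (rule at_within_interior) (use assms in simp)
  then show ?thesis using cgf_deriv_within[OF less_imp_le[OF assms]] by (simp only:)
qed

lemma isCont_g:
  assumes "-1 < x"
  shows "isCont g x"
  by (rule continuous_on_interior[OF continuous_g]) (use assms in simp)

lemma specific_entropy_g: "specific_entropy M = g 0"
  by (rule specific_entropy_eq[OF cgf_deriv]) simp

lemma g_0_nonneg: "0 \<le> g 0"
  by (rule entropy_nonneg[OF cgf_deriv]) simp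

lemma cgf_ge_line: "q * g 0 \<le> cgf q"
  by (rule cgf_ge_entropy_line[OF cgf_deriv]) simp

text \<open>Convexity, with the tangent at \<open>x\<close> evaluated at 0, where \<open>cgf\<close>
  vanishes.\<close>

lemma cgf_le_tangent:
  assumes "-1 < x"
  shows "cgf x \<le> x * g x"
  using convex_on_imp_above_tangent[OF convex_cgf connected_UNIV, of x 0 "g x"] cgf_deriv[OF assms]
  by (simp add: algebra_simps)

text \<open>Continuity of \<open>g\<close> identifies the right limit at -1. For negative x the
  inequalities \<open>x * g 0 \<le> cgf x \<le> x * g x\<close> give \<open>g x \<le> g 0\<close>,
  which resolves the absolute value.\<close>

lemma u_zero_eq: "u_zero M = g 0 - g (-1)"
proof -
  have d: "deriv (\<lambda>q. real_of_ereal (waiting_pressure M q)) x = g x" if "-1 < x" for x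
  proof (rule DERIV_imp_deriv)
    show "((\<lambda>q. real_of_ereal (waiting_pressure M q)) has_real_derivative g x) (at x)"
      by (rule has_field_derivative_transform_within_open[OF cgf_deriv[OF that], of "{-1<..}"])
        (use that in \<open>auto simp: waiting_pressure_eq\<close>)
  qed
  have "(g \<longlongrightarrow> g (-1)) (at (-1) within {-1..})"
    using continuous_g by (simp add: continuous_on_def)
  then have l: "(g \<longlongrightarrow> g (-1)) (at_right (-1))" by (rule tendsto_within_subset) auto
  have "\<forall>\<^sub>F x in at_right (-1). x \<in> {-1<..<(0::real)}" by (rule eventually_at_right_real) simp
  then have "\<forall>\<^sub>F x in at_right (-1). g x \<le> g 0"
  proof eventually_elim
    case (elim x)
    have "x * g 0 \<le> x * g x" by (rule order_trans[OF cgf_ge_line cgf_le_tangent]) (use elim in simp)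
    moreover have "x < 0" using elim by simp
    ultimately show ?case by (simp only: mult_le_cancel_left_neg)
  qed
  then have le: "g (-1) \<le> g 0" by (rule tendsto_upperbound[OF l]) simp
  have "\<forall>\<^sub>F x in at_right (-1). deriv (\<lambda>q. real_of_ereal (waiting_pressure M q)) x = g x"
    using d by (simp add: eventually_at_filter)
  then have "(deriv (\<lambda>q. real_of_ereal (waiting_pressure M q)) \<longlongrightarrow> g (-1)) (at_right (-1))"
    using l by (simp cong: tendsto_cong)
  then have "Lim (at_right (-1)) (deriv (\<lambda>q. real_of_ereal (waiting_pressure M q))) = g (-1)"
    by (intro tendsto_Lim) simp
  then show ?thesis using le by (simp add: u_zero_def specific_entropy_g)
qed

text \<open>\<open>cgf q - q * g q\<close> is the exponent attained by tilting at q; by continuity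
  the tilt may be moved slightly beyond the level without dropping below \<open>c\<close>.\<close>

lemma tilt_near:
  assumes "-1 < x" "c < cgf x - x * g x"
  shows "\<forall>\<^sub>F q in at x. c < cgf q - q * g q"
proof (rule order_tendstoD(1)[OF _ assms(2)])
  have "isCont (\<lambda>q. cgf q - q * g q) x"
    by (intro continuous_intros isCont_g[OF assms(1)] DERIV_isCont[OF cgf_deriv[OF assms(1)]])
  then show "((\<lambda>q. cgf q - q * g q) \<longlongrightarrow> cgf x - x * g x) (at x)" by (simp add: isCont_def)
qed

lemma rate_INF_eq:
  "(INF q\<in>{-1<..}. ereal (- v * q) + waiting_pressure M q) = (INF q\<in>{-1<..}. ereal (cgf q - v * q))"
  by (intro INF_cong refl) (simp add: waiting_pressure_eq)

lemma measure_pair_le_1: "measure (M \<Otimes>\<^sub>M M) A \<le> 1"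
proof -
  interpret P: pair_prob_space M M by unfold_locales
  show ?thesis by (rule P.prob_le_1)
qed

text \<open>The extreme-level argument needs \<open>v \<ge> ln 2\<close> and thus two symbols; a
  one-letter alphabet is treated separately.\<close>

lemma cgf_eq_0_of_trivial_alphabet:
  assumes "CARD('a) = 1"
  shows "cgf q = 0"
proof -
  have "moment q n = 1" for n
  proof -
    have "card (patterns (cube n) :: ('d, 'a) config set) = 1" using assms by (simp add: card_patterns)
    then obtain \<eta> where \<eta>: "(patterns (cube n) :: ('d, 'a) config set) = {\<eta>}" by (rule card_1_singletonE)
    have "info n \<eta> = 0" using moment_0[of n] by (simp add: moment_def \<eta>)
    then show ?thesis by (simp add: moment_def \<eta>)
  qed
  then show ?thesis using LIMSEQ_unique[OF ln_moment_tendsto[of q]] by simp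
qed

lemma upper_tail_rate:
  assumes v: "g 0 \<le> v" and \<beta>: "0 < \<beta>" "24 * \<beta> * surface_const \<le> ln 2"
  shows "(\<lambda>n. ereal (1 / real n ^ CARD('d)) * elog (ereal (measure (M \<Otimes>\<^sub>M M) {(\<xi>, \<sigma>). ereal v \<le> log_waiting_rate n \<xi> \<sigma>})))
    \<longlonglongrightarrow> (INF q\<in>{-1<..}. ereal (- v * q) + waiting_pressure M q)"
proof (rule rate_tendsto)
  fix c assume "(INF q\<in>{-1<..}. ereal (- v * q) + waiting_pressure M q) < ereal c"
  then obtain q where q: "-1 < q" "cgf q - v * q < c" unfolding rate_INF_eq by (auto simp: INF_less_iff)
  show "\<forall>\<^sub>F n in sequentially. measure (M \<Otimes>\<^sub>M M) {(\<xi>, \<sigma>). ereal v \<le> log_waiting_rate n \<xi> \<sigma>} \<le> exp (scl CARD('d) n * c)"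
  proof (cases "0 \<le> q")
    case True
    have "\<forall>\<^sub>F n in sequentially. measure (M \<Otimes>\<^sub>M M) {(\<xi>, \<sigma>). rate_ge CARD('d) (scl CARD('d) n * v) (waiting_time n \<xi> \<sigma>)} \<le> exp (scl CARD('d) n * c)"
      by (rule tail_upper_bound[OF q]) (use True in \<open>auto intro: enat_powr_ge_of_rate(1)\<close>)
    with eventually_gt_at_top[of 0] show ?thesis
      by eventually_elim (simp add: log_waiting_rate_iff)
  next
    \<comment> \<open>For negative q and a level at or above the entropy, the exponent is at least
      \<open>q * (g 0 - v) \<ge> 0\<close>, so the bound is trivial.\<close>
    case False
    have "q * (g 0 - v) \<le> c" using cgf_ge_line[of q] q(2) by (simp add: algebra_simps)
    moreover have "0 \<le> q * (g 0 - v)" using False v by (intro mult_nonpos_nonpos) auto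
    ultimately have "1 \<le> exp (scl CARD('d) n * c)" for n by simp
    then show ?thesis using order_trans[OF measure_pair_le_1] by (intro always_eventually) blast
  qed
next
  fix c assume "ereal c < (INF q\<in>{-1<..}. ereal (- v * q) + waiting_pressure M q)"
  \<comment> \<open>An intermediate exponent turns the infimum into an inequality for every q while
    leaving strict room above \<open>c\<close>.\<close>
  then obtain c' where c': "ereal c < ereal c'" "ereal c' < (INF q\<in>{-1<..}. ereal (cgf q - v * q))"
    using ereal_dense2 unfolding rate_INF_eq by blast
  have lower: "c' + v * q \<le> cgf q" if "-1 < q" for q
  proof -
    have "(INF q\<in>{-1<..}. ereal (cgf q - v * q)) \<le> ereal (cgf q - v * q)" using that by (intro INF_lower) simp
    then have "ereal c' < ereal (cgf q - v * q)" by (rule less_le_trans[OF c'(2)])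
    then show ?thesis by simp
  qed
  have v0: "0 \<le> v" using g_0_nonneg v by linarith
  have "\<forall>\<^sub>F n in sequentially. exp (scl CARD('d) n * c) \<le> measure (M \<Otimes>\<^sub>M M) {(\<xi>, \<sigma>). rate_ge CARD('d) (scl CARD('d) n * v) (waiting_time n \<xi> \<sigma>)}"
  proof (cases "\<exists>b\<ge>0. v < g b")
    case True
    then obtain b where b: "0 \<le> b" "v < g b" by blast
    \<comment> \<open>The tilt is taken just to the right of \<open>x\<close>, where the tilted
      level exceeds \<open>v\<close> strictly and the exponent is still close to its value at
      \<open>x\<close>.\<close>
    obtain x where x: "0 \<le> x" "x < b" "g x = v" "\<And>y. x < y \<Longrightarrow> y \<le> b \<Longrightarrow> v < g y"
      by (rule last_crossing[OF continuous_on_subset[OF continuous_g] b(1) v b(2)]) auto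
    have "c < cgf x - x * g x" using lower[of x] c'(1) x(1,3) by (simp add: mult.commute)
    then have "\<forall>\<^sub>F q in at_right x. c < cgf q - q * g q"
      using tilt_near[of x c] x(1) by (simp add: eventually_at_split)
    moreover have "\<forall>\<^sub>F q in at_right x. q \<in> {x<..<b}" using x(2) by (rule eventually_at_right_real)
    ultimately have "\<forall>\<^sub>F q in at_right x. c < cgf q - q * g q \<and> q \<in> {x<..<b}" by eventually_elim simp
    then have "\<exists>q. c < cgf q - q * g q \<and> q \<in> {x<..<b}" by (rule eventually_happens'[rotated]) simp
    then obtain q where q: "c < cgf q - q * g q" "x < q" "q < b" by auto
    show ?thesis by (rule upper_tail_lower_bound[OF cgf_deriv q(1) v0 x(4)]) (use q x(1) in auto)
  next
    \<comment> \<open>Here \<open>g \<le> v\<close> on the whole half-line. A level above the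
      supremum would make the infimum minus infinity, contradicting the existence of
      \<open>c'\<close>; what remains is handled by sandwiching \<open>cgf q\<close> between
      \<open>c' + v * q\<close> and \<open>v * q\<close>.\<close>
    case False
    have low: "c' + v * q \<le> cgf q" if "0 \<le> q" for q using that by (intro lower) simp
    have upp: "cgf q \<le> v * q" if "0 \<le> q" for q
    proof -
      have "q * g q \<le> q * v" using False that by (intro mult_left_mono) (auto simp: not_less)
      then show ?thesis using cgf_le_tangent[of q] that by (simp add: mult.commute)
    qed
    show ?thesis
    proof (cases "2 \<le> CARD('a)")
      case True
      from low upp \<beta> True c'(1) show ?thesis by (intro extreme_tail_lower_bound) auto
    next
      \<comment> \<open>With a single symbol \<open>cgf\<close> vanishes, which forces
        \<open>v = 0\<close>, and the event is the whole space because the waiting time is at least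
        1.\<close>
      case A: False
      moreover have "0 < CARD('a)" by simp
      ultimately have "CARD('a) = 1" by linarith
      note z = cgf_eq_0_of_trivial_alphabet[OF this]
      have "v \<le> 0"
      proof (rule slope_le_of_linear_domination)
        fix q :: real assume "1 \<le> q"
        then show "c' + v * q \<le> 0 + (q - 1) * 0" using low[of q] z by simp
      qed
      then have v: "v = 0" using v0 by simp
      have "rate_ge CARD('d) 0 e" if "1 \<le> e" for e
        using that by (cases e) (auto simp: rate_ge_def one_enat_def)
      then have "{(\<xi>, \<sigma>). rate_ge CARD('d) (scl CARD('d) n * v) (waiting_time n \<xi> \<sigma>)} = space (M \<Otimes>\<^sub>M M)" for n
        by (auto simp: v waiting_time_pos space_pair_measure space_M)
      moreover have "measure (M \<Otimes>\<^sub>M M) (space (M \<Otimes>\<^sub>M M)) = 1"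
      proof -
        interpret P: pair_prob_space M M by unfold_locales
        show ?thesis by (rule P.prob_space)
      qed
      moreover have "scl CARD('d) n * c \<le> 0" for n using low[of 0] c'(1) by (simp add: mult_nonneg_nonpos)
      ultimately show ?thesis by simp
    qed
  qed
  with eventually_gt_at_top[of 0]
  show "\<forall>\<^sub>F n in sequentially. exp (scl CARD('d) n * c) \<le> measure (M \<Otimes>\<^sub>M M) {(\<xi>, \<sigma>). ereal v \<le> log_waiting_rate n \<xi> \<sigma>}"
    by eventually_elim (simp add: log_waiting_rate_iff)
qed

lemma lower_tail_rate:
  assumes v: "g (-1) < v" "v < g 0"
  shows "(\<lambda>n. ereal (1 / real n ^ CARD('d)) * elog (ereal (measure (M \<Otimes>\<^sub>M M) {(\<xi>, \<sigma>). log_waiting_rate n \<xi> \<sigma> \<le> ereal v})))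
    \<longlonglongrightarrow> (INF q\<in>{-1<..}. ereal (- v * q) + waiting_pressure M q)"
proof (rule rate_tendsto)
  fix c assume "(INF q\<in>{-1<..}. ereal (- v * q) + waiting_pressure M q) < ereal c"
  then obtain q where q: "-1 < q" "cgf q - v * q < c" unfolding rate_INF_eq by (auto simp: INF_less_iff)
  show "\<forall>\<^sub>F n in sequentially. measure (M \<Otimes>\<^sub>M M) {(\<xi>, \<sigma>). log_waiting_rate n \<xi> \<sigma> \<le> ereal v} \<le> exp (scl CARD('d) n * c)"
  proof (cases "q \<le> 0")
    case True
    have "\<forall>\<^sub>F n in sequentially. measure (M \<Otimes>\<^sub>M M) {(\<xi>, \<sigma>). rate_le CARD('d) (scl CARD('d) n * v) (waiting_time n \<xi> \<sigma>)} \<le> exp (scl CARD('d) n * c)"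
      by (rule tail_upper_bound[OF q]) (use True in \<open>auto intro: enat_powr_ge_of_rate(2)\<close>)
    with eventually_gt_at_top[of 0] show ?thesis
      by eventually_elim (simp add: log_waiting_rate_iff)
  next
    case False
    have "q * (g 0 - v) \<le> c" using cgf_ge_line[of q] q(2) by (simp add: algebra_simps)
    moreover have "0 \<le> q * (g 0 - v)" using False v by (intro mult_nonneg_nonneg) auto
    ultimately have "1 \<le> exp (scl CARD('d) n * c)" for n by simp
    then show ?thesis using order_trans[OF measure_pair_le_1] by (intro always_eventually) blast
  qed
next
  fix c assume c: "ereal c < (INF q\<in>{-1<..}. ereal (- v * q) + waiting_pressure M q)"
  \<comment> \<open>Reflection turns the last crossing into the first one: with
    \<open>x = - y\<close>, the function \<open>g\<close> equals \<open>v\<close> at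
    \<open>x\<close> and stays strictly below it between -1 and \<open>x\<close>, so tilts to the
    left of \<open>x\<close> reach beyond the level.\<close>
  obtain y where y: "0 \<le> y" "y < 1" "- g (- y) = - v" "\<And>z. y < z \<Longrightarrow> z \<le> 1 \<Longrightarrow> - v < - g (- z)"
  proof (rule last_crossing[of 0 1 "\<lambda>x. - g (- x)" "- v"])
    show "continuous_on {0..1} (\<lambda>x. - g (- x))"
      by (intro continuous_intros continuous_on_compose2[OF continuous_g]) auto
  qed (use v in auto)
  define x where "x = - y"
  have x: "-1 < x" "g x = v" "\<And>q. -1 < q \<Longrightarrow> q < x \<Longrightarrow> g q < v"
    using y(2,3) y(4)[of "- q" for q] by (auto simp: x_def)
  have "(INF q\<in>{-1<..}. ereal (cgf q - v * q)) \<le> ereal (cgf x - v * x)" using x(1) by (intro INF_lower) simp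
  with c have "ereal c < ereal (cgf x - v * x)" unfolding rate_INF_eq by (rule less_le_trans)
  then have "c < cgf x - x * g x" using x(2) by (simp add: mult.commute)
  then have "\<forall>\<^sub>F q in at_left x. c < cgf q - q * g q"
    using tilt_near[of x c] x(1) by (simp add: eventually_at_split)
  moreover have "\<forall>\<^sub>F q in at_left x. q \<in> {-1<..<x}" using x(1) by (rule eventually_at_left_real)
  ultimately have "\<forall>\<^sub>F q in at_left x. c < cgf q - q * g q \<and> q \<in> {-1<..<x}" by eventually_elim simp
  then have "\<exists>q. c < cgf q - q * g q \<and> q \<in> {-1<..<x}" by (rule eventually_happens'[rotated]) simp
  then obtain q where q: "c < cgf q - q * g q" "-1 < q" "q < x" by auto
  have "\<forall>\<^sub>F n in sequentially. exp (scl CARD('d) n * c) \<le> measure (M \<Otimes>\<^sub>M M) {(\<xi>, \<sigma>). rate_le CARD('d) (scl CARD('d) n * v) (waiting_time n \<xi> \<sigma>)}"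
    by (rule lower_tail_lower_bound[OF cgf_deriv[OF q(2)] q(1) x(3)[OF q(2,3)]])
  with eventually_gt_at_top[of 0]
  show "\<forall>\<^sub>F n in sequentially. exp (scl CARD('d) n * c) \<le> measure (M \<Otimes>\<^sub>M M) {(\<xi>, \<sigma>). log_waiting_rate n \<xi> \<sigma> \<le> ereal v}"
    by eventually_elim (simp add: log_waiting_rate_iff)
qed

end

theorem theorem8:
  fixes U :: "('d::finite, 'a::finite) interaction"
  assumes "CARD('d) \<ge> 2"
    and "interaction U"
    and "finite_range U"
  shows "\<exists>\<beta>\<^sub>1>0. \<forall>\<beta>. 0 < \<beta> \<and> \<beta> \<le> \<beta>\<^sub>1 \<longrightarrow>
    (\<exists>!M. gibbs_measure (scale_interaction \<beta> U) M) \<and>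
    (\<forall>M. gibbs_measure (scale_interaction \<beta> U) M \<and>
         C1_within (\<lambda>q. pressure (scale_interaction ((1 - q) * \<beta>) U)) {- 1..} \<longrightarrow>
      (\<forall>u\<ge>0.
        (\<lambda>n. ereal (1 / real n ^ CARD('d)) *
           elog (ereal (measure (M \<Otimes>\<^sub>M M)
             {(\<xi>, \<sigma>). log_waiting_rate n \<xi> \<sigma> \<ge> ereal (specific_entropy M + u)})))
        \<longlonglongrightarrow>
        (INF q\<in>{- 1<..}. ereal (- (specific_entropy M + u) * q) + waiting_pressure M q)) \<and>
      (\<forall>u. 0 < u \<and> u < u_zero M \<longrightarrow>
        (\<lambda>n. ereal (1 / real n ^ CARD('d)) *
           elog (ereal (measure (M \<Otimes>\<^sub>M M)
             {(\<xi>, \<sigma>). log_waiting_rate n \<xi> \<sigma> \<le> ereal (specific_entropy M - u)})))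
        \<longlonglongrightarrow>
        (INF q\<in>{- 1<..}. ereal (- (specific_entropy M - u) * q) + waiting_pressure M q)))"
proof -
  obtain r K where "finite_range_interaction U r K"
    using finite_range_interaction_exists[OF assms(2,3)] by blast
  then interpret finite_range_interaction U r K .
  define N where "N = real (card {y :: int ^ 'd. norm1 y \<le> r})"
  have N: "0 \<le> N" by (simp add: N_def)
  \<comment> \<open>The first term makes \<open>(exp (4 * \<beta> * K) - 1) * N\<close> at most 1/2,
    which is Dobrushin's condition; the second is the smallness required at the extreme level. The
    added ones keep the denominators positive if \<open>K\<close> or \<open>surface_const\<close>
    vanishes.\<close>
  define \<beta>1 where "\<beta>1 = min (ln (1 + 1 / (2 * (N + 1))) / (4 * K + 1)) (ln 2 / (24 * surface_const + 1))"
  have high: "high_temperature \<beta>" "24 * \<beta> * surface_const \<le> ln 2" if "0 < \<beta>" "\<beta> \<le> \<beta>1" for \<beta>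
  proof -
    have "\<beta> * (4 * K + 1) \<le> ln (1 + 1 / (2 * (N + 1)))"
      using that K_nonneg by (simp add: \<beta>1_def pos_le_divide_eq)
    then have "4 * \<beta> * K \<le> ln (1 + 1 / (2 * (N + 1)))" using that(1) by (simp add: algebra_simps)
    moreover have "0 < 1 + 1 / (2 * (N + 1))" using N by (simp add: add_pos_pos)
    ultimately have "exp (4 * \<beta> * K) \<le> 1 + 1 / (2 * (N + 1))" using ln_ge_iff by blast
    then have "(exp (4 * \<beta> * K) - 1) * N \<le> 1 / (2 * (N + 1)) * N" using N by (intro mult_right_mono) auto
    also have "\<dots> \<le> 1 / 2" using N by (simp add: field_simps)
    finally show "high_temperature \<beta>" using that(1) by (simp add: high_temperature_def N_def)
    have "\<beta> * (24 * surface_const + 1) \<le> ln 2"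
      using that surface_const_nonneg by (simp add: \<beta>1_def pos_le_divide_eq)
    then show "24 * \<beta> * surface_const \<le> ln 2" using that(1) by (simp add: algebra_simps)
  qed
  have smooth: "\<exists>g. smooth_gibbs_state U r K M \<beta> g"
    if "0 < \<beta>" "gibbs_measure (scale_interaction \<beta> U) M"
      "C1_within (\<lambda>q. pressure (scale_interaction ((1 - q) * \<beta>) U)) {- 1..}" for \<beta> M
  proof -
    interpret gibbs_state U r K M \<beta> using that by (intro gibbs_state_intro) auto
    interpret multidim_gibbs_state U r K M \<beta> using assms(1) by unfold_locales
    show ?thesis by (rule smooth_gibbs_state_exists[OF that(3)])
  qed
  show ?thesis
  proof (intro exI[of _ \<beta>1] conjI allI impI; (elim conjE)?)
    have "0 < ln (1 + 1 / (2 * (N + 1)))" using N by (intro ln_gt_zero) simp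
    then have "0 < ln (1 + 1 / (2 * (N + 1))) / (4 * K + 1)" using K_nonneg by (intro divide_pos_pos) auto
    moreover have "0 < ln 2 / (24 * surface_const + 1)" using surface_const_nonneg by (intro divide_pos_pos) auto
    ultimately show "0 < \<beta>1" by (simp only: \<beta>1_def min_less_iff_conj)
  next
    fix \<beta> assume "0 < \<beta>" "\<beta> \<le> \<beta>1"
    then show "\<exists>!M. gibbs_measure (scale_interaction \<beta> U) M" by (intro unique_gibbs_measure high)
  next
    fix \<beta> M and u :: real
    assume \<beta>: "0 < \<beta>" "\<beta> \<le> \<beta>1" and M: "gibbs_measure (scale_interaction \<beta> U) M"
      "C1_within (\<lambda>q. pressure (scale_interaction ((1 - q) * \<beta>) U)) {- 1..}" and u: "0 \<le> u"
    obtain g where "smooth_gibbs_state U r K M \<beta> g" using smooth[OF \<beta>(1) M] by blast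
    then interpret smooth_gibbs_state U r K M \<beta> g .
    show "(\<lambda>n. ereal (1 / real n ^ CARD('d)) * elog (ereal (measure (M \<Otimes>\<^sub>M M)
          {(\<xi>, \<sigma>). log_waiting_rate n \<xi> \<sigma> \<ge> ereal (specific_entropy M + u)})))
        \<longlonglongrightarrow> (INF q\<in>{- 1<..}. ereal (- (specific_entropy M + u) * q) + waiting_pressure M q)"
      by (rule upper_tail_rate[OF _ \<beta>(1) high(2)[OF \<beta>]]) (use u in \<open>simp add: specific_entropy_g\<close>)
  next
    fix \<beta> M and u :: real
    assume \<beta>: "0 < \<beta>" "\<beta> \<le> \<beta>1" and M: "gibbs_measure (scale_interaction \<beta> U) M"
      "C1_within (\<lambda>q. pressure (scale_interaction ((1 - q) * \<beta>) U)) {- 1..}" and u: "0 < u" "u < u_zero M"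
    obtain g where "smooth_gibbs_state U r K M \<beta> g" using smooth[OF \<beta>(1) M] by blast
    then interpret smooth_gibbs_state U r K M \<beta> g .
    show "(\<lambda>n. ereal (1 / real n ^ CARD('d)) * elog (ereal (measure (M \<Otimes>\<^sub>M M)
          {(\<xi>, \<sigma>). log_waiting_rate n \<xi> \<sigma> \<le> ereal (specific_entropy M - u)})))
        \<longlonglongrightarrow> (INF q\<in>{- 1<..}. ereal (- (specific_entropy M - u) * q) + waiting_pressure M q)"
      by (rule lower_tail_rate) (use u in \<open>simp_all add: specific_entropy_g u_zero_eq\<close>)
  qed
qed

end
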